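(* Let $\mathcal{S}$ be a set of rational primes. Let $\Lambda=\{q \text{ prime} : q-1 \text{ is squarefree}\}$ and, for each $n$, let $C_n$ denote the cyclic group of order $n$. Let $G=\prod_{q\in\Lambda}C_{q-1}$. Then $G$ admits two realisations over $\mathbb{Q}$: one with unbounded local degrees at every rational prime (in particular at all primes in $\mathcal{S}$), and one with bounded local degrees at all primes in $\mathcal{S}$.
   Context: A realisation of $G$ over $\mathbb{Q}$ is a Galois extension $L/\mathbb{Q}$ with $\mathrm{Gal}(L/\mathbb{Q})\cong G$. A field $L\subseteq\overline{\mathbb{Q}}$ has bounded local degrees at a prime $p$ if $L$ can be embedded in some finite extension of $\mathbb{Q}_p$, and unbounded (infinite) local degrees at $p$ otherwise. *)

theory Defs
  imports
    "HOL-Analysis.Analysis"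
    "HOL-Algebra.Algebra"
    "HOL-Algebra.Bij"
    "HOL-Algebra.Product_Groups"
    "HOL-Algebra.Elementary_Groups"
    "HOL-Algebra.Algebraic_Closure_Type"
    "HOL-Computational_Algebra.Computational_Algebra"
begin

hide_const (open) Divisibility.prime Divisibility.irreducible

section \<open>The field of p-adic numbers\<close>

definition padic_val :: "nat \<Rightarrow> rat \<Rightarrow> int" where
  "padic_val p x =
     int (multiplicity (int p) (fst (quotient_of x))) - int (multiplicity (int p) (snd (quotient_of x)))"

definition padic_abs :: "nat \<Rightarrow> rat \<Rightarrow> real" where
  "padic_abs p x = (if x = 0 then 0 else real p powi (- padic_val p x))"

definition padic_Cauchy :: "nat \<Rightarrow> (nat \<Rightarrow> rat) \<Rightarrow> bool" where
  "padic_Cauchy p s \<longleftrightarrow> (\<forall>e>0. \<exists>N. \<forall>m\<ge>N. \<forall>n\<ge>N. padic_abs p (s m - s n) < e)"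

definition padic_Cauchy_ring :: "nat \<Rightarrow> (nat \<Rightarrow> rat) ring" where
  "padic_Cauchy_ring p =
     \<lparr>carrier = {s. padic_Cauchy p s},
      monoid.mult = (\<lambda>s t n. s n * t n), one = (\<lambda>_. 1),
      ring.zero = (\<lambda>_. 0), add = (\<lambda>s t n. s n + t n)\<rparr>"

definition padic_null :: "nat \<Rightarrow> (nat \<Rightarrow> rat) set" where
  "padic_null p = {s. (\<lambda>n. padic_abs p (s n)) \<longlonglongrightarrow> 0}"

text \<open>The completion of the rationals with respect to the p-adic absolute value.\<close>

definition Qp :: "nat \<Rightarrow> (nat \<Rightarrow> rat) set ring" where
  "Qp p = padic_Cauchy_ring p Quot padic_null p"

definition Qp_bar :: "nat \<Rightarrow> (((nat \<Rightarrow> rat) set list \<times> nat) multiset \<Rightarrow> (nat \<Rightarrow> rat) set) ring" where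
  "Qp_bar p = field.alg_closure (Qp p)"

definition Qp_in_Qp_bar :: "nat \<Rightarrow> (((nat \<Rightarrow> rat) set list \<times> nat) multiset \<Rightarrow> (nat \<Rightarrow> rat) set) set" where
  "Qp_in_Qp_bar p = ring.indexed_const (Qp p) ` carrier (Qp p)"

text \<open>Finite extensions of the p-adic numbers are taken inside the algebraic closure; every finite
  extension is isomorphic to one of these.\<close>

definition finite_extension_of_Qp ::
  "nat \<Rightarrow> (((nat \<Rightarrow> rat) set list \<times> nat) multiset \<Rightarrow> (nat \<Rightarrow> rat) set) set \<Rightarrow> bool" where
  "finite_extension_of_Qp p E \<longleftrightarrow>
     subfield E (Qp_bar p) \<and> Qp_in_Qp_bar p \<subseteq> E \<and>
     ring.finite_dimension (Qp_bar p) (Qp_in_Qp_bar p) E"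


section \<open>Galois extensions of the rationals\<close>

abbreviation complex_ring :: "complex ring" where
  "complex_ring \<equiv> ring_of_type_algebra"

abbreviation field_of :: "complex set \<Rightarrow> complex ring" where
  "field_of L \<equiv> complex_ring\<lparr>carrier := L\<rparr>"

text \<open>Algebraic extensions of the rationals are subfields of the algebraic closure of the
  rationals in the complex numbers. The second condition is normality: a rational polynomial splits
  over \<open>L\<close> iff all its complex roots lie in \<open>L\<close>. Separability is automatic in characteristic 0.\<close>

definition galois_over_Q :: "complex set \<Rightarrow> bool" where
  "galois_over_Q L \<longleftrightarrow>
     subfield L complex_ring \<and> (\<forall>x\<in>L. algebraic x) \<and>
     (\<forall>P :: rat poly. irreducible P \<and> (\<exists>x\<in>L. poly (map_poly of_rat P) x = 0)
        \<longrightarrow> (\<forall>z. poly (map_poly of_rat P) z = 0 \<longrightarrow> z \<in> L))"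

definition Gal :: "complex set \<Rightarrow> complex set \<Rightarrow> (complex \<Rightarrow> complex) monoid" where
  "Gal L F =
     BijGroup L\<lparr>carrier := {\<sigma> \<in> Bij L. \<sigma> \<in> ring_hom (field_of L) (field_of L) \<and> (\<forall>x\<in>F. \<sigma> x = x)}\<rparr>"

definition krull_topology :: "complex set \<Rightarrow> (complex \<Rightarrow> complex) topology" where
  "krull_topology L =
     topology_generated_by
       {\<sigma> <#\<^bsub>Gal L \<rat>\<^esub> carrier (Gal L F) |\<sigma> F.
          \<sigma> \<in> carrier (Gal L \<rat>) \<and> subfield F complex_ring \<and> F \<subseteq> L \<and>
          ring.finite_dimension complex_ring \<rat> F}"

text \<open>\<open>T\<close> is the topology of the profinite group \<open>G\<close>.\<close>

definition realisation_over_Q :: "complex set \<Rightarrow> ('a, 'b) monoid_scheme \<Rightarrow> 'a topology \<Rightarrow> bool" where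
  "realisation_over_Q L G T \<longleftrightarrow>
     galois_over_Q L \<and> (\<exists>f \<in> iso (Gal L \<rat>) G. homeomorphic_map (krull_topology L) T f)"

definition bounded_local_degrees :: "complex set \<Rightarrow> nat \<Rightarrow> bool" where
  "bounded_local_degrees L p \<longleftrightarrow>
     (\<exists>E \<phi>. finite_extension_of_Qp p E \<and> \<phi> \<in> ring_hom (field_of L) (Qp_bar p\<lparr>carrier := E\<rparr>))"

abbreviation unbounded_local_degrees :: "complex set \<Rightarrow> nat \<Rightarrow> bool" where
  "unbounded_local_degrees L p \<equiv> \<not> bounded_local_degrees L p"


section \<open>The group\<close>

definition Lambda :: "nat set" where
  "Lambda = {q. prime q \<and> squarefree (q - 1)}"

definition G_Lambda :: "(nat \<Rightarrow> int) monoid" where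
  "G_Lambda = product_group Lambda (\<lambda>q. integer_mod_group (q - 1))"

definition G_Lambda_topology :: "(nat \<Rightarrow> int) topology" where
  "G_Lambda_topology =
     product_topology (\<lambda>q. discrete_topology (carrier (integer_mod_group (q - 1)))) Lambda"

end

(* Both realisations are composita of fields L_q, q in Lambda, where L_q is the subfield of the N_q-th
   cyclotomic field fixed by the kernel of a surjective character psi_q from the units modulo N_q onto
   Z/(q-1). If the conductors N_q are pairwise coprime, the Galois group of the compositum is the
   product of the groups Z/(q-1).

   For N_q = q the compositum contains all q-th roots of unity, q in Lambda. A field of degree d over
   Q_p contains no primitive q-th root of unity for a prime q > p^d different from p, so the local
   degrees are unbounded as soon as Lambda is infinite.

   For the second realisation let N_q = u v with primes u, v = 1 mod q - 1 whose discrete logarithms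
   modulo q - 1 agree at all primes up to q, and let psi_q be the difference of the two logarithms. Then
   a prime p splits completely in L_q for every q >= p, so that p has bounded local degrees.

   Lambda is infinite: a prime q = 3 mod 4 outside Lambda is 1 modulo the square of an odd prime r. A
   Chebyshev bound in each progression modulo 4 r^2 shows that theta of these primes would be at most
   0.47 x + O(1), which contradicts the Mertens estimate for the primes that are 3 modulo 4. *)
theory Submission
  imports Defs "HOL-Number_Theory.Number_Theory" "HOL-Real_Asymp.Real_Asymp"
begin

hide_const (open) Polynomials.degree Polynomials.lead_coeff up_ring.coeff up_ring.monom module.smult

section \<open>Rational and integral polynomials at roots of unity\<close>

text \<open>No prime ideals of number fields are used. Elements of cyclotomic fields are values of
  polynomials at \<open>zeta N\<close>. Conjugation is the substitution of
  \<open>zeta N ^ a\<close>, which respects all rational relations because cyclotomic polynomials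
  are irreducible. A homomorphism into another field is given by an image of \<open>zeta N\<close>
  that satisfies the same relations, so one extension theorem yields both the automorphisms of the
  compositum and its embeddings into an algebraic closure of the p-adic numbers. Complete splitting
  at \<open>p\<close> is used in the form of a p-adic root of the generating polynomial, found digit
  by digit.

  The constant 0.47 may be any number strictly between 0.463, a bound for the sum of the Chebyshev
  constants over the odd r, and 1/2, the Mertens weight of the primes that are 3 modulo 4. For these
  primes q - 1 is 2 modulo 4, so that only squares of odd primes can divide it. The Chebyshev bounds
  lose a factor log r against the true density, but the sum of log r / r^2 converges and is small
  enough.\<close>

definition ev :: "rat poly \<Rightarrow> complex \<Rightarrow> complex" where
  "ev f z = poly (map_poly of_rat f) z"

definition evi :: "int poly \<Rightarrow> complex \<Rightarrow> complex" where
  "evi f z = poly (map_poly of_int f) z"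

abbreviation ratp :: "int poly \<Rightarrow> rat poly" where "ratp \<equiv> map_poly of_int"

lemma map_poly_add_hom:
  assumes "h 0 = 0" "\<And>x y. h (x + y) = h x + h y"
  shows "map_poly h (f + g) = map_poly h f + map_poly h g"
  by (intro poly_eqI) (simp add: coeff_map_poly assms)

lemma map_poly_mult_hom:
  fixes h :: "'a::comm_ring_1 \<Rightarrow> 'b::comm_ring_1"
  assumes "h 0 = 0" "\<And>x y. h (x + y) = h x + h y" "\<And>x y. h (x * y) = h x * h y"
  shows "map_poly h (f * g) = map_poly h f * map_poly h g"
proof (induction f)
  case (pCons a f)
  have "map_poly h (pCons a f * g) = map_poly h (smult a g + pCons 0 (f * g))" by simp
  also have "\<dots> = smult (h a) (map_poly h g) + pCons 0 (map_poly h (f * g))"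
    by (simp add: map_poly_add_hom assms map_poly_smult map_poly_pCons)
  finally show ?case by (simp add: pCons.IH map_poly_pCons assms)
qed simp

lemma ev_simps [simp]:
  "ev 0 z = 0" "ev 1 z = 1" "ev (f + g) z = ev f z + ev g z" "ev (f * g) z = ev f z * ev g z"
  "ev [:c:] z = of_rat c" "ev (monom c n) z = of_rat c * z ^ n" "ev (pCons c f) z = of_rat c + z * ev f z"
  by (simp_all add: ev_def map_poly_add_hom map_poly_mult_hom of_rat_add of_rat_mult
      map_poly_monom poly_monom map_poly_pCons)

lemma ev_minus [simp]: "ev (- f) z = - ev f z"
  using ev_simps(3)[of "-f" f z] by (simp add: eq_neg_iff_add_eq_0 del: ev_simps(3))

lemma ev_diff [simp]: "ev (f - g) z = ev f z - ev g z"
  using ev_simps(3)[of f "-g" z] by (simp del: ev_simps(3))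

lemma ev_smult [simp]: "ev (smult c f) z = of_rat c * ev f z"
  using ev_simps(4)[of "[:c:]" f z] by (simp del: ev_simps(4))

lemma ev_pcompose [simp]: "ev (pcompose f g) z = ev f (ev g z)"
  by (induction f) (simp_all add: pcompose_pCons)

lemma evi_simps [simp]:
  "evi 0 z = 0" "evi 1 z = 1" "evi (f + g) z = evi f z + evi g z" "evi (f * g) z = evi f z * evi g z"
  "evi [:c:] z = of_int c" "evi (monom c n) z = of_int c * z ^ n" "evi (pCons c f) z = of_int c + z * evi f z"
  by (simp_all add: evi_def map_poly_add_hom map_poly_mult_hom
      map_poly_monom poly_monom map_poly_pCons)

lemma evi_minus [simp]: "evi (- f) z = - evi f z"
  using evi_simps(3)[of "-f" f z] by (simp add: eq_neg_iff_add_eq_0 del: evi_simps(3))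

lemma evi_diff [simp]: "evi (f - g) z = evi f z - evi g z"
  using evi_simps(3)[of f "-g" z] by (simp del: evi_simps(3))

lemma evi_smult [simp]: "evi (smult c f) z = of_int c * evi f z"
  using evi_simps(4)[of "[:c:]" f z] by (simp del: evi_simps(4))

lemma evi_pow [simp]: "evi (f ^ n) z = evi f z ^ n"
  by (induction n) simp_all

lemma evi_sum: "evi (\<Sum>x\<in>XX. f x) z = (\<Sum>x\<in>XX. evi (f x) z)"
  by (induction XX rule: infinite_finite_induct) simp_all

lemma evi_prod: "evi (\<Prod>x\<in>XX. f x) z = (\<Prod>x\<in>XX. evi (f x) z)"
  by (induction XX rule: infinite_finite_induct) simp_all

lemma evi_pcompose [simp]: "evi (pcompose f g) z = evi f (evi g z)"
  by (induction f) (simp_all add: pcompose_pCons)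

lemma ev_ratp [simp]: "ev (ratp f) z = evi f z"
  by (simp add: ev_def evi_def map_poly_map_poly comp_def)

lemma degree_ratp [simp]: "degree (ratp f) = degree f"
  by (simp add: degree_map_poly)

lemma ratp_mult: "ratp (f * g) = ratp f * ratp g"
  by (rule map_poly_mult_hom) auto

lemma ratp_inject: "ratp f = ratp g \<Longrightarrow> f = g"
  by (metis (no_types, lifting) coeff_map_poly of_int_0 of_int_eq_iff poly_eqI)

section \<open>Gauss's lemma and minimal polynomials of roots of unity\<close>

lemma rat_poly_clear_denominators:
  fixes g :: "rat poly"
  shows "\<exists>d g'. d > 0 \<and> smult (of_int d) g = ratp g'"
proof (induction g)
  case 0
  show ?case by (intro exI[of _ 1] exI[of _ 0]) simp
next
  case (pCons a g)
  then obtain d g' where d: "d > 0" "smult (of_int d) g = ratp g'" by blast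
  obtain n m where a: "a = of_int n / of_int m" "m > 0"
    by (metis quotient_of_denom_pos quotient_of_div surj_pair)
  have "smult (of_int (m * d)) (pCons a g) = pCons (of_int (d * n)) (smult (of_int m) (smult (of_int d) g))"
    using a by simp
  also have "\<dots> = ratp (pCons (d * n) (smult m g'))"
    by (simp only: d) (simp add: map_poly_pCons map_poly_smult)
  finally show ?case using a d by (intro exI[of _ "m * d"] exI conjI) auto
qed

lemma rat_poly_primitive:
  fixes g :: "rat poly"
  assumes "g \<noteq> 0"
  obtains c g' where "c \<noteq> 0" "g = smult c (ratp g')" "content g' = 1"
proof -
  obtain d g0 where d: "d > 0" "smult (of_int d) g = ratp g0"
    using rat_poly_clear_denominators by blast
  have "g0 \<noteq> 0" using d assms by auto
  define c where "c = content g0"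
  have c: "c \<noteq> 0" using \<open>g0 \<noteq> 0\<close> by (simp add: c_def)
  have g0: "g0 = smult c (primitive_part g0)" by (simp add: c_def)
  have "ratp g0 = smult (of_int c) (ratp (primitive_part g0))"
    by (subst g0) (simp add: map_poly_smult)
  then have "smult (of_int d) g = smult (of_int c) (ratp (primitive_part g0))" using d by simp
  then have "smult (1 / of_int d) (smult (of_int d) g) = smult (1 / of_int d) (smult (of_int c) (ratp (primitive_part g0)))"
    by (rule arg_cong)
  then have "g = smult (of_int c / of_int d) (ratp (primitive_part g0))" using d(1) by (simp del: d(2))
  then show thesis using that[of "of_int c / of_int d" "primitive_part g0"] c d \<open>g0 \<noteq> 0\<close> by simp
qed

text \<open>Gauss's lemma. Primitive multiples of the two factors have a primitive product, which is
  therefore \<open>F\<close> up to sign; comparing leading coefficients then makes the scalar in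
  \<open>g\<close> equal to 1 or -1.\<close>

lemma monic_factor_integral:
  fixes g k :: "rat poly" and F :: "int poly"
  assumes gk: "g * k = ratp F" and F: "lead_coeff F = 1" and g: "lead_coeff g = 1"
  shows "\<exists>g'. g = ratp g' \<and> lead_coeff g' = 1"
proof -
  have "F \<noteq> 0" using F by auto
  then have "ratp F \<noteq> 0" using ratp_inject[of F 0] by auto
  then have "g \<noteq> 0" "k \<noteq> 0" using gk by auto
  obtain c g' where g': "c \<noteq> 0" "g = smult c (ratp g')" "content g' = 1"
    using rat_poly_primitive[OF \<open>g \<noteq> 0\<close>] .
  obtain d k' where k': "d \<noteq> 0" "k = smult d (ratp k')" "content k' = 1"
    using rat_poly_primitive[OF \<open>k \<noteq> 0\<close>] .
  have eq: "smult (c * d) (ratp (g' * k')) = ratp F"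
    unfolding gk[symmetric] g'(2) k'(2) ratp_mult by (simp add: mult.commute)
  have "content F dvd 1"
    using content_dvd_coeff[of F "degree F"] F by simp
  then have cF: "content F = 1" using normalize_content[of F] by simp
  obtain n m where nm: "c * d = of_int n / of_int m" "m > 0"
    by (metis quotient_of_denom_pos quotient_of_div surj_pair)
  have "smult (of_int m) (smult (c * d) (ratp (g' * k'))) = smult (of_int m) (ratp F)"
    unfolding eq ..
  moreover have "of_int m * (c * d) = of_int n" using nm by simp
  ultimately have "smult (of_int n) (ratp (g' * k')) = smult (of_int m) (ratp F)" unfolding smult_smult by simp
  then have "ratp (smult n (g' * k')) = ratp (smult m F)"
    by (simp only: map_poly_smult of_int_0 of_int_mult)
  then have e: "smult n (g' * k') = smult m F" by (rule ratp_inject)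
  then have "content (smult n (g' * k')) = content (smult m F)" by simp
  then have "\<bar>n\<bar> = m" using g'(3) k'(3) cF nm(2) by (simp add: content_mult)
  then have "g' * k' = F \<or> g' * k' = - F" using e nm
  proof (cases "n \<ge> 0")
    case True
    then have "n = m" using \<open>\<bar>n\<bar> = m\<close> by simp
    then show ?thesis using e nm(2) smult_cancel[of m "g' * k'" F] by simp
  next
    case False
    then have "n = - m" using \<open>\<bar>n\<bar> = m\<close> by simp
    have "smult m (g' * k' + F) = 0" unfolding smult_add_right e[symmetric] \<open>n = - m\<close> by simp
    then show ?thesis using nm by (simp add: eq_neg_iff_add_eq_0)
  qed
  then have "lead_coeff g' * lead_coeff k' = 1 \<or> lead_coeff g' * lead_coeff k' = -1"
    using F unfolding lead_coeff_mult[symmetric] by (elim disjE) simp_all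
  then have "lead_coeff g' * lead_coeff k' dvd 1" by (elim disjE) simp_all
  then have "lead_coeff g' dvd 1" by (rule dvd_mult_left)
  then have "lead_coeff g' = 1 \<or> lead_coeff g' = -1" by (simp add: zdvd1_eq abs_if split: if_splits)
  moreover have "c * of_int (lead_coeff g') = 1"
    using g unfolding g'(2) by (simp add: coeff_map_poly g'(1))
  ultimately have "(lead_coeff g' = 1 \<and> c = 1) \<or> (lead_coeff g' = -1 \<and> c = -1)"
    by (metis mult.right_neutral mult_minus_right of_int_1 of_int_minus minus_minus)
  then consider "lead_coeff g' = 1" "c = 1" | "lead_coeff g' = -1" "c = -1" by blast
  then show ?thesis
  proof cases
    assume "lead_coeff g' = 1" "c = 1" then show ?thesis using g' by (intro exI[of _ g']) simp
  next
    assume "lead_coeff g' = -1" "c = -1"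
    then have "g = ratp (- g')" unfolding g'(2) by (intro poly_eqI) (simp add: coeff_map_poly)
    then show ?thesis using \<open>lead_coeff g' = -1\<close> by (intro exI[of _ "-g'"]) simp
  qed
qed

definition unity_poly :: "nat \<Rightarrow> int poly" where "unity_poly N = monom 1 N - 1"

lemma evi_unity_poly [simp]: "evi (unity_poly N) z = z ^ N - 1"
  by (simp add: unity_poly_def)

lemma degree_unity_poly: "N > 0 \<Longrightarrow> degree (unity_poly N) = N"
proof -
  assume "N > 0"
  then have "degree (monom 1 N + (- 1) :: int poly) = N"
    by (subst degree_add_eq_left) (simp_all add: degree_monom_eq)
  then show ?thesis by (simp add: unity_poly_def)
qed

lemma lead_coeff_unity_poly: "N > 0 \<Longrightarrow> lead_coeff (unity_poly N) = 1"
proof -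
  assume "N > 0"
  then have "lead_coeff (unity_poly N) = coeff (unity_poly N) N" by (simp only: degree_unity_poly)
  then show ?thesis using \<open>N > 0\<close> by (simp add: unity_poly_def)
qed

lemma unity_poly_nonzero: "N > 0 \<Longrightarrow> unity_poly N \<noteq> 0"
  using lead_coeff_unity_poly[of N] by auto

text \<open>Divisibility of all annihilating polynomials is put in place of irreducibility, because
  minimality is applied in this form.\<close>

definition is_min_poly :: "rat poly \<Rightarrow> complex \<Rightarrow> bool" where
  "is_min_poly m z \<longleftrightarrow> lead_coeff m = 1 \<and> ev m z = 0 \<and> (\<forall>f. ev f z = 0 \<longrightarrow> m dvd f)"

lemma is_min_poly_exists:
  assumes "f0 \<noteq> 0" "ev f0 z = 0"
  shows "\<exists>m. is_min_poly m z"
proof -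
  define P where "P = (\<lambda>n. \<exists>f. f \<noteq> 0 \<and> ev f z = 0 \<and> degree f = n)"
  have "P (degree f0)" using assms unfolding P_def by blast
  then have "P (LEAST n. P n)" by (rule LeastI)
  then obtain f where f: "f \<noteq> 0" "ev f z = 0" "degree f = (LEAST n. P n)" unfolding P_def by blast
  define m where "m = smult (inverse (lead_coeff f)) f"
  have "lead_coeff f \<noteq> 0" using f(1) by simp
  then have m: "lead_coeff m = 1" "ev m z = 0" "degree m = degree f" "m \<noteq> 0" using f(1,2) by (auto simp: m_def)
  have "m dvd g" if g: "ev g z = 0" for g
  proof (rule ccontr)
    assume "\<not> m dvd g"
    then have ne: "g mod m \<noteq> 0" by (simp add: dvd_eq_mod_eq_0)
    have "ev g z = ev (g div m * m + g mod m) z" by simp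
    then have "ev (g mod m) z = 0" using g m(2) unfolding ev_simps by simp
    then have "P (degree (g mod m))" unfolding P_def using ne by blast
    then have "degree f \<le> degree (g mod m)" unfolding f(3) by (rule Least_le)
    moreover have "degree (g mod m) < degree m" using ne m(4) degree_mod_less by blast
    ultimately show False using m by simp
  qed
  then show ?thesis using m unfolding is_min_poly_def by blast
qed

lemma is_min_poly_degree_pos: "is_min_poly m z \<Longrightarrow> degree m > 0"
  unfolding is_min_poly_def
  by (metis degree_eq_zeroE ev_simps(5) lead_coeff_pCons(2) gr0I of_rat_1 zero_neq_one)

text \<open>Irreducibility of \<open>m\<close> in disguise. The gcd of \<open>m\<close> and
  \<open>f\<close> vanishes at \<open>w\<close>, so it is not constant. If it did not vanish at
  \<open>z\<close>, its cofactor in \<open>m\<close> would, and would be a multiple of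
  \<open>m\<close>, which forces the gcd to be constant.\<close>

lemma is_min_poly_share:
  assumes m: "is_min_poly m z" and "ev m w = 0" "ev f w = 0"
  shows "m dvd f"
proof -
  define g where "g = gcd m f"
  define s where "s = fst (bezout_coefficients m f)"
  define t where "t = snd (bezout_coefficients m f)"
  have "g = s * m + t * f" unfolding g_def s_def t_def by (rule bezout_coefficients_fst_snd[symmetric])
  then have "ev g w = ev s w * ev m w + ev t w * ev f w" by simp
  then have gw: "ev g w = 0" using assms by simp
  obtain k where k: "m = g * k" unfolding g_def using gcd_dvd1[of m f] by (elim dvdE)
  have m0: "m \<noteq> 0" using m unfolding is_min_poly_def by auto
  have "ev g z * ev k z = ev m z" unfolding k by simp
  then have "ev g z * ev k z = 0" using m unfolding is_min_poly_def by simp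
  moreover have "ev k z \<noteq> 0"
  proof
    assume "ev k z = 0"
    then have "m dvd k" using m unfolding is_min_poly_def by blast
    then have "degree m \<le> degree k" using m0 k by (intro dvd_imp_degree_le) auto
    then have "degree g = 0" using k m0 by (auto simp: degree_mult_eq)
    then obtain c where "g = [:c:]" by (rule degree_eq_zeroE)
    then show False using gw k m0 by auto
  qed
  ultimately have "m dvd g" using m unfolding is_min_poly_def by simp
  moreover have "g dvd f" unfolding g_def by simp
  ultimately show ?thesis by (rule dvd_trans)
qed

text \<open>Bezout: the gcd of \<open>m\<close> and \<open>h\<close> is a nonzero constant, and at
  \<open>z\<close> only the term with \<open>h\<close> survives. This makes the values at a root of
  unity a field.\<close>

lemma is_min_poly_inverse:
  assumes m: "is_min_poly m z" and "ev h z \<noteq> 0"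
  shows "\<exists>g. ev g z = inverse (ev h z)"
proof -
  define g where "g = gcd m h"
  define s where "s = fst (bezout_coefficients m h)"
  define t where "t = snd (bezout_coefficients m h)"
  have "g = s * m + t * h" unfolding g_def s_def t_def by (rule bezout_coefficients_fst_snd[symmetric])
  then have gz: "ev g z = ev s z * ev m z + ev t z * ev h z" by simp
  obtain k' where k': "h = g * k'" unfolding g_def using gcd_dvd2[of m h] by (elim dvdE)
  then have "ev g z \<noteq> 0" using assms(2) by auto
  obtain k where k: "m = g * k" unfolding g_def using gcd_dvd1[of m h] by (elim dvdE)
  have m0: "m \<noteq> 0" using m unfolding is_min_poly_def by auto
  have "ev g z * ev k z = ev m z" unfolding k by simp
  then have "ev k z = 0" using m \<open>ev g z \<noteq> 0\<close> unfolding is_min_poly_def by simp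
  then have "m dvd k" using m unfolding is_min_poly_def by blast
  then have "degree m \<le> degree k" using m0 k by (intro dvd_imp_degree_le) auto
  then have "degree g = 0" using k m0 by (auto simp: degree_mult_eq)
  then obtain c where c: "g = [:c:]" by (rule degree_eq_zeroE)
  then have "c \<noteq> 0" using k m0 by auto
  have "of_rat c = ev t z * ev h z" using gz c m unfolding is_min_poly_def by simp
  then have "ev t z = of_rat c * inverse (ev h z)" using assms(2) by (simp add: field_simps)
  then have "ev (smult (inverse c) t) z = inverse (ev h z)"
    using \<open>c \<noteq> 0\<close> by (simp add: of_rat_inverse)
  then show ?thesis by blast
qed

lemma root_of_unity_min_poly:
  assumes z: "z ^ N = 1" and N: "N > 0"
  obtains g h where "is_min_poly (ratp g) z" "lead_coeff g = 1" "unity_poly N = g * h"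
proof -
  have "ratp (unity_poly N) \<noteq> 0" using unity_poly_nonzero[OF N] ratp_inject[of _ 0] by auto
  moreover have "ev (ratp (unity_poly N)) z = 0" using z by simp
  ultimately obtain m where m: "is_min_poly m z" using is_min_poly_exists by blast
  then have "m dvd ratp (unity_poly N)"
    using \<open>ev (ratp (unity_poly N)) z = 0\<close> unfolding is_min_poly_def by simp
  then obtain k where k: "ratp (unity_poly N) = m * k" by (elim dvdE)
  have "lead_coeff (ratp (unity_poly N)) = 1" using lead_coeff_unity_poly[OF N] by (simp add: coeff_map_poly)
  then have "lead_coeff k = 1" using m lead_coeff_mult[of m k] unfolding is_min_poly_def k by simp
  obtain g where g: "m = ratp g" "lead_coeff g = 1"
    using monic_factor_integral[OF k[symmetric] lead_coeff_unity_poly[OF N]] m unfolding is_min_poly_def by blast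
  obtain h where h: "k = ratp h"
    using monic_factor_integral[of k m "unity_poly N"] k lead_coeff_unity_poly[OF N] \<open>lead_coeff k = 1\<close> by (auto simp: mult.commute)
  have "unity_poly N = g * h" using k g h by (intro ratp_inject) (simp add: ratp_mult)
  then show thesis using that g m by blast
qed

text \<open>Z[z] meets Q in Z. Modulo the monic integral minimal polynomial \<open>f\<close> becomes
  an integral remainder of smaller degree; minus its rational value it vanishes at \<open>z\<close>,
  hence is the zero polynomial, and the value is its constant coefficient.\<close>

lemma evi_rational_integral:
  assumes z: "z ^ N = 1" and N: "N > 0" and r: "evi f z \<in> \<rat>"
  shows "evi f z \<in> \<int>"
proof -
  obtain g h where g: "is_min_poly (ratp g) z" "lead_coeff g = 1" "unity_poly N = g * h"
    using root_of_unity_min_poly[OF z N] .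
  \<comment> \<open>Pseudo-division is ordinary division with remainder here, since \<open>g\<close>
    is monic.\<close>
  define q where "q = fst (pseudo_divmod f g)"
  define s where "s = snd (pseudo_divmod f g)"
  have "g \<noteq> 0" using g by auto
  then have fq: "f = g * q + s" and s: "s = 0 \<or> degree s < degree g"
    using pseudo_divmod[of g f q s] g(2) by (auto simp: q_def s_def)
  have gz: "evi g z = 0" using g unfolding is_min_poly_def by simp
  then have fs: "evi f z = evi s z" using fq by simp
  obtain x where x: "evi f z = of_rat x" using r by (rule Rats_cases)
  have "ev (ratp s - [:x:]) z = 0" using fs x by simp
  then have d: "ratp g dvd ratp s - [:x:]" using g unfolding is_min_poly_def by blast
  have dg: "degree g > 0" using is_min_poly_degree_pos[OF g(1)] by simp
  have "degree (ratp s - [:x:]) < degree (ratp g)"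
    using s dg by (intro degree_diff_less) auto
  then have "ratp s - [:x:] = 0" using d dvd_imp_degree_le[OF d] by linarith
  then have "coeff (ratp s) 0 = coeff [:x:] 0" by simp
  then have "x = of_int (coeff s 0)" by (simp add: coeff_map_poly)
  then show ?thesis using x by simp
qed

section \<open>Frobenius congruences and the irreducibility of the cyclotomic polynomials\<close>

lemma freshman_dvd:
  fixes x y :: "'a :: comm_ring_1"
  assumes "prime p"
  shows "of_nat p dvd (x + y) ^ p - (x ^ p + y ^ p)"
proof -
  have p: "p > 0" using assms prime_gt_0_nat by blast
  have "(x + y) ^ p = (\<Sum>k\<le>p. of_nat (p choose k) * x ^ k * y ^ (p - k))" by (rule binomial_ring)
  also have "{..p} = insert 0 (insert p {1..<p})" using p by auto
  also have "(\<Sum>k\<in>insert 0 (insert p {1..<p}). of_nat (p choose k) * x ^ k * y ^ (p - k))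
      = y ^ p + (x ^ p + (\<Sum>k\<in>{1..<p}. of_nat (p choose k) * x ^ k * y ^ (p - k)))"
    using p by (subst sum.insert) auto
  finally have "(x + y) ^ p - (x ^ p + y ^ p) = (\<Sum>k\<in>{1..<p}. of_nat (p choose k) * x ^ k * y ^ (p - k))"
    by simp
  moreover have "of_nat p dvd (of_nat (p choose k) :: 'a)" if "k \<in> {1..<p}" for k
  proof -
    have "p dvd (p choose k)" using dvd_choose_prime[of k p] that assms p by auto
    then obtain b where "p choose k = p * b" by (elim dvdE)
    then show ?thesis by simp
  qed
  ultimately show ?thesis by (auto intro!: dvd_sum dvd_mult2)
qed

lemma fermat_dvd_int:
  assumes "prime p"
  shows "int p dvd a ^ p - a"
proof (induction a rule: int_induct[where k = 0])
  case base
  then show ?case using assms prime_gt_0_nat by (simp add: zero_power)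
next
  case (step1 i)
  have "(i + 1) ^ p - (i + 1) = ((i + 1) ^ p - (i ^ p + 1 ^ p)) + (i ^ p - i)" by simp
  then show ?case using dvd_add[OF freshman_dvd[OF assms, of i 1] step1(2)] by (simp only:)
next
  case (step2 i)
  have "(i - 1) ^ p - (i - 1) = (i ^ p - i) - ((i - 1 + 1) ^ p - ((i - 1) ^ p + 1 ^ p))" by simp
  then show ?case using dvd_diff[OF step2(2) freshman_dvd[OF assms, of "i - 1" 1]] by (simp only:)
qed

lemma frobenius_poly:
  fixes g :: "int poly"
  assumes "prime p"
  shows "of_nat p dvd g ^ p - pcompose g (monom 1 p)"
proof (induction g)
  case 0
  then show ?case using assms prime_gt_0_nat by (simp add: zero_power)
next
  case (pCons a g)
  define XX where "XX = (monom 1 1 :: int poly)"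
  have XX: "XX ^ p = monom 1 p" "pCons 0 g = XX * g" by (simp_all add: XX_def monom_power monom_altdef)
  have e: "pCons a g = [:a:] + XX * g" using XX by (simp add: flip: XX(2))
  have 1: "of_nat p dvd (pCons a g) ^ p - ([:a:] ^ p + (XX * g) ^ p)" unfolding e by (rule freshman_dvd[OF assms])
  have 2: "of_nat p dvd ([:a:] ^ p - [:a:] :: int poly)"
  proof -
    obtain b where "a ^ p - a = int p * b" using fermat_dvd_int[OF assms, of a] by (elim dvdE)
    then have "[:a:] ^ p - [:a:] = of_nat p * [:b:]" by (simp add: poly_const_pow of_nat_poly)
    then show ?thesis by (metis dvd_triv_left)
  qed
  have 3: "of_nat p dvd XX ^ p * (g ^ p - pcompose g (monom 1 p))" using pCons.IH by (rule dvd_mult)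
  have "(pCons a g) ^ p - pcompose (pCons a g) (monom 1 p) =
    ((pCons a g) ^ p - ([:a:] ^ p + (XX * g) ^ p)) + ([:a:] ^ p - [:a:]) + XX ^ p * (g ^ p - pcompose g (monom 1 p))"
    by (simp add: pcompose_pCons XX power_mult_distrib algebra_simps)
  then show ?case using dvd_add[OF dvd_add[OF 1 2] 3] by (simp only:)
qed

lemma evi_frobenius:
  assumes "prime p"
  obtains w where "\<And>z. evi g z ^ p = evi g (z ^ p) + of_nat p * evi w z"
proof -
  obtain w where "g ^ p - pcompose g (monom 1 p) = of_nat p * w" using frobenius_poly[OF assms, of g] by (elim dvdE)
  then have "g ^ p = pcompose g (monom 1 p) + smult (of_nat p) w" by (simp add: of_nat_poly algebra_simps)
  then have "evi (g ^ p) z = evi (pcompose g (monom 1 p) + smult (of_nat p) w) z" for z by simp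
  then show thesis using that[of w] by simp
qed

text \<open>The quotient n / p would be a rational element of Z[z], hence an integer. With n = 1
  this says that \<open>p\<close> is not a unit of Z[z].\<close>

lemma not_inverse_prime_in_Zzeta:
  assumes "z ^ N = 1" "N > 0" "prime (p::nat)" "\<not> p dvd n"
  shows "of_nat n \<noteq> of_nat p * evi f z"
proof
  assume e: "of_nat n = of_nat p * evi f z"
  have p: "of_nat p \<noteq> (0::complex)" using assms(3) by auto
  then have fz: "evi f z = of_nat n / of_nat p" using e by simp
  then have "evi f z \<in> \<rat>" by simp
  then have "evi f z \<in> \<int>" using assms evi_rational_integral by blast
  then obtain k where "evi f z = of_int k" by (auto elim: Ints_cases)
  then have "(of_int (int n) :: complex) = of_int (int p * k)" using e by simp
  then have "int n = int p * k" by (simp only: of_int_eq_iff)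
  then show False using assms(4) by (metis dvd_triv_left int_dvd_int_iff)
qed

text \<open>Dedekind's argument. If g(z^p) were nonzero, the cofactor \<open>h\<close> would vanish
  at z^p, and the derivative of X^N - 1 = g h at that point would equal g(z^p) times h'(z^p).
  Frobenius puts g(z^p) into p Z[z], so \<open>N\<close> would be divisible by \<open>p\<close>
  there.\<close>

lemma conjugate_root_prime:
  assumes z: "z ^ N = 1" and N: "N > 0" and p: "prime p" "\<not> p dvd N" and f: "ev f z = 0"
  shows "ev f (z ^ p) = 0"
proof -
  obtain g h where g: "is_min_poly (ratp g) z" "lead_coeff g = 1" "unity_poly N = g * h"
    using root_of_unity_min_poly[OF z N] .
  have gz: "evi g z = 0" using g unfolding is_min_poly_def by simp
  obtain w where w: "\<And>z. evi g z ^ p = evi g (z ^ p) + of_nat p * evi w z"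
    using evi_frobenius[OF p(1)] by blast
  have "evi g (z ^ p) = 0"
  proof (rule ccontr)
    assume ne: "evi g (z ^ p) \<noteq> 0"
    have "(z ^ p) ^ N = 1" using z by (metis mult.commute power_mult power_one)
    then have "evi (g * h) (z ^ p) = 0" by (simp only: g(3)[symmetric] evi_unity_poly) simp
    then have hz: "evi h (z ^ p) = 0" using ne by simp
    have "pderiv (unity_poly N) = g * pderiv h + h * pderiv g" using g(3) by (simp add: pderiv_mult)
    moreover have "pderiv (unity_poly N) = monom (int N) (N - 1)"
      using N by (cases N) (auto simp: unity_poly_def pderiv_diff pderiv_monom)
    ultimately have "evi (monom (int N) (N - 1)) (z ^ p) = evi (g * pderiv h + h * pderiv g) (z ^ p)" by simp
    then have "of_nat N * (z ^ p) ^ (N - 1) = evi g (z ^ p) * evi (pderiv h) (z ^ p)" using hz by simp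
    also have "evi g (z ^ p) = - of_nat p * evi w z"
    proof -
      have "0 = evi g (z ^ p) + of_nat p * evi w z"
        using w[of z] gz prime_gt_0_nat[OF p(1)] by (simp add: zero_power)
      then show ?thesis by (simp add: eq_neg_iff_add_eq_0)
    qed
    finally have 1: "of_nat N * (z ^ p) ^ (N - 1) = - of_nat p * evi w z * evi (pderiv h) (z ^ p)" .
    \<comment> \<open>The root of unity next to \<open>N\<close> is invertible and is removed, which
      leaves \<open>N\<close> alone on the left.\<close>
    have 2: "(z ^ p) ^ (N - 1) * z ^ p = 1"
      using \<open>(z ^ p) ^ N = 1\<close> power_minus_mult[OF N, of "z ^ p"] by simp
    have "of_nat N = of_nat N * ((z ^ p) ^ (N - 1) * z ^ p)" unfolding 2 by simp
    also have "\<dots> = - of_nat p * evi w z * evi (pderiv h) (z ^ p) * z ^ p"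
      unfolding mult.assoc[symmetric] 1 ..
    also have "\<dots> = of_nat p * evi (- w * pcompose (pderiv h) (monom 1 p) * monom 1 p) z"
      by (simp only: evi_simps evi_minus evi_pcompose of_int_1 mult_1 mult_minus_left mult_minus_right mult.assoc)
    finally have "of_nat N = of_nat p * evi (- w * pcompose (pderiv h) (monom 1 p) * monom 1 p) z" .
    then show False using not_inverse_prime_in_Zzeta[OF z N p] by blast
  qed
  moreover have "ratp g dvd f" using g(1) f unfolding is_min_poly_def by simp
  ultimately show ?thesis unfolding dvd_def by auto
qed

text \<open>Climbs through the prime factors of \<open>a\<close>. The prime case holds for every
  N-th root of unity, so each step restarts from the power already reached.\<close>

lemma conjugate_root:
  assumes z: "z ^ N = 1" and N: "N > 0" and a: "coprime a N" and f: "ev f z = 0"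
  shows "ev f (z ^ a) = 0"
proof (cases "a = 0")
  case True
  then have "N = 1" using a by simp
  then show ?thesis using z f True by simp
next
  case False
  from False a show ?thesis
  proof (induction a rule: prime_divisors_induct)
    case zero then show ?case by simp
  next
    case (unit x) then show ?case using f by simp
  next
    case (factor p x)
    have x: "ev f (z ^ x) = 0" using factor(2,3,4) by simp
    have p: "coprime p N" "prime p" using factor by simp_all
    have "\<not> p dvd N"
    proof
      assume "p dvd N"
      then have "p dvd 1" using p(1) coprime_common_divisor[of p N p] by simp
      then show False using p(2) by simp
    qed
    moreover have "(z ^ x) ^ N = (z ^ N) ^ x" by (simp only: power_mult[symmetric] mult.commute)
    then have "(z ^ x) ^ N = 1" using z by simp
    ultimately have "ev f ((z ^ x) ^ p) = 0" by (intro conjugate_root_prime[OF _ N p(2) _ x])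
    moreover have "z ^ (p * x) = (z ^ x) ^ p" by (simp only: power_mult[symmetric] mult.commute)
    ultimately show ?case by simp
  qed
qed

section \<open>Cyclic subfields of cyclotomic fields\<close>

definition zeta :: "nat \<Rightarrow> complex" where "zeta N = cis (2 * pi / real N)"

lemma zeta_power: "zeta N ^ k = cis (2 * pi * real k / real N)"
  by (simp add: zeta_def Complex.DeMoivre mult_ac)

lemma zeta_power_self: "N > 0 \<Longrightarrow> zeta N ^ N = 1"
  by (simp add: zeta_power)

lemma zeta_mult_power: "M > 0 \<Longrightarrow> zeta (N * M) ^ M = zeta N"
  by (simp add: zeta_power) (simp add: zeta_def)

lemma zeta_power_unity: "N > 0 \<Longrightarrow> (zeta N ^ k) ^ N = 1"
  by (metis zeta_power_self mult.commute power_mult power_one)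

lemma zeta_power_mod: "N > 0 \<Longrightarrow> zeta N ^ (k mod N) = zeta N ^ k"
proof -
  assume N: "N > 0"
  have "zeta N ^ k = zeta N ^ (N * (k div N) + k mod N)" by simp
  also have "\<dots> = zeta N ^ (k mod N)" unfolding power_add power_mult zeta_power_self[OF N] by simp
  finally show ?thesis by simp
qed

lemma unity_eq_zeta_power:
  assumes "N > 0" "z ^ N = 1"
  obtains j where "j < N" "z = zeta N ^ j"
proof -
  have "z \<in> (\<lambda>k. cis (2 * pi * real k / real N)) ` {..<N}"
    using Complex.bij_betw_roots_unity[OF assms(1)] assms(2) by (auto simp: bij_betw_def)
  then show thesis using that by (auto simp: zeta_power)
qed

lemma zeta_power_inj:
  assumes "N > 0" "zeta N ^ i = zeta N ^ j"
  shows "[i = j] (mod N)"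
proof -
  have "cis (2 * pi * real (i mod N) / real N) = cis (2 * pi * real (j mod N) / real N)"
    using assms zeta_power_mod[OF assms(1)] by (metis zeta_power)
  moreover have "i mod N \<in> {..<N}" "j mod N \<in> {..<N}" using assms(1) by auto
  ultimately have "i mod N = j mod N"
    using Complex.bij_betw_roots_unity[OF assms(1)] unfolding bij_betw_def inj_on_def by blast
  then show ?thesis by (simp add: cong_def)
qed

lemma zeta_power_cong: "N > 0 \<Longrightarrow> [i = j] (mod N) \<Longrightarrow> zeta N ^ i = zeta N ^ j"
  by (metis cong_def zeta_power_mod)

lemma zeta_power_eq_1_iff: "N > 0 \<Longrightarrow> zeta N ^ k = 1 \<longleftrightarrow> N dvd k"
  using zeta_power_inj[of N k 0] zeta_power_cong[of N k 0] by (auto simp: cong_0_iff)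

lemma zeta_conjugate:
  assumes "N > 0" "coprime a N" "ev f (zeta N) = 0"
  shows "ev f (zeta N ^ a) = 0"
  using conjugate_root[OF zeta_power_self] assms by blast

text \<open>The fixed field of the Galois group is found by counting. The minimal polynomial has as
  many distinct roots as its degree, all of the form \<open>zeta N ^ b\<close> with \<open>b\<close>
  coprime to \<open>N\<close>. The remainder of \<open>f\<close> modulo it takes one value at all of
  them and has smaller degree, so it is constant.\<close>

lemma galois_invariant_rational:
  assumes N: "N > 0" and inv: "\<And>a. coprime a N \<Longrightarrow> ev f (zeta N ^ a) = ev f (zeta N)"
  shows "ev f (zeta N) \<in> \<rat>"
proof -
  define z where "z = zeta N"
  have z: "z ^ N = 1" using zeta_power_self[OF N] by (simp add: z_def)
  obtain g h where g: "is_min_poly (ratp g) z" "lead_coeff g = 1" "unity_poly N = g * h"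
    using root_of_unity_min_poly[OF z N] .
  define R where "R = {w. evi g w = 0}"
  have "g * h \<noteq> 0" unfolding g(3)[symmetric] by (rule unity_poly_nonzero[OF N])
  then have gh: "g \<noteq> 0" "h \<noteq> 0" by auto
  have nz: "(map_poly of_int p :: complex poly) \<noteq> 0" if "p \<noteq> 0" for p
    using that by (simp add: map_poly_eq_0_iff)
  have fin: "finite R" unfolding R_def evi_def using poly_roots_finite[OF nz[OF gh(1)]] .
  have finh: "finite {w. evi h w = 0}" unfolding evi_def using poly_roots_finite[OF nz[OF gh(2)]] .
  \<comment> \<open>X^N - 1 has N distinct roots and \<open>h\<close> accounts for at most
    \<open>degree h\<close> of them, which leaves at least \<open>degree g\<close> for
    \<open>g\<close>.\<close>
  have "{w. w ^ N = 1} \<subseteq> R \<union> {w. evi h w = 0}"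
  proof
    fix w :: complex assume "w \<in> {w. w ^ N = 1}"
    then have "evi (g * h) w = 0" unfolding g(3)[symmetric] by simp
    then show "w \<in> R \<union> {w. evi h w = 0}" by (auto simp: R_def)
  qed
  then have "card {w::complex. w ^ N = 1} \<le> card (R \<union> {w. evi h w = 0})"
    using fin finh by (intro card_mono) auto
  then have "N \<le> card R + card {w. evi h w = 0}"
    using card_Un_le[of R "{w. evi h w = 0}"] N by (simp add: card_roots_unity_eq)
  moreover have "card {w. evi h w = 0} \<le> degree h"
    unfolding evi_def using card_poly_roots_bound[OF nz[OF gh(2)]] by (simp add: degree_map_poly)
  moreover have "N = degree g + degree h"
    using degree_unity_poly[OF N] gh unfolding g(3) by (simp add: degree_mult_eq)
  ultimately have cR: "degree g \<le> card R" by simp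
  have dg: "degree g > 0" using is_min_poly_degree_pos[OF g(1)] by simp
  define x where "x = ev f z"
  define r where "r = f mod ratp g"
  have gz: "ev (ratp g) z = 0" using g(1) unfolding is_min_poly_def by simp
  have fr: "ev f w = ev (f div ratp g) w * ev (ratp g) w + ev r w" for w
  proof -
    have "f div ratp g * ratp g + r = f" unfolding r_def by (rule div_mult_mod_eq)
    then have "ev (f div ratp g * ratp g + r) w = ev f w" by (rule arg_cong)
    then show ?thesis unfolding ev_simps by (rule sym)
  qed
  have Rx: "ev r w = x" if w: "w \<in> R" for w
  proof -
    have gw: "ev (ratp g) w = 0" using w by (simp add: R_def)
    have "evi (g * h) w = 0" using gw by simp
    then have "w ^ N = 1" unfolding g(3)[symmetric] by simp
    then obtain b where b: "b < N" "w = z ^ b" by (rule unity_eq_zeta_power[OF N, folded z_def])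
    \<comment> \<open>A common divisor d > 1 would make \<open>w\<close> a root of X^(N/d) - 1. The
      minimal polynomial, which \<open>w\<close> shares with \<open>z\<close>, would divide this,
      and \<open>z\<close> would have order below N.\<close>
    have "coprime b N"
    proof (rule ccontr)
      assume "\<not> coprime b N"
      define d where "d = gcd b N"
      have "d \<noteq> 1" unfolding d_def using \<open>\<not> coprime b N\<close> coprime_iff_gcd_eq_1 by blast
      moreover have "d > 0" using N by (simp add: d_def)
      ultimately have d: "d > 1" by linarith
      have dN: "d dvd N" "d dvd b" by (simp_all add: d_def)
      obtain e where e: "N = d * e" using dN(1) by (elim dvdE)
      obtain c where c: "b = d * c" using dN(2) by (elim dvdE)
      have "w ^ e = (z ^ N) ^ c" unfolding b(2) e c power_mult[symmetric] by (simp add: mult_ac)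
      then have "ev (ratp (unity_poly e)) w = 0" using z by simp
      then have "ratp g dvd ratp (unity_poly e)" by (rule is_min_poly_share[OF g(1) gw])
      then obtain k where "ratp (unity_poly e) = ratp g * k" by (elim dvdE)
      then have "ev (ratp (unity_poly e)) z = ev (ratp g * k) z" by (rule arg_cong)
      then have "z ^ e = 1" using gz by simp
      then have "N dvd e" using zeta_power_eq_1_iff[OF N] z_def by simp
      moreover have "e > 0" using e N by (cases e) auto
      ultimately have "N \<le> e" by (rule dvd_imp_le)
      then show False using e d \<open>e > 0\<close> by simp
    qed
    then have "ev f w = x" using inv[of b] b(2) by (simp add: x_def z_def)
    then show ?thesis using fr[of w] gw by simp
  qed
  define P where "P = map_poly of_rat r - [:x:]"
  have Pw: "poly P w = 0" if "w \<in> R" for w using Rx[OF that] by (simp add: P_def ev_def)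
  have "P = 0"
  proof (rule ccontr)
    assume P: "P \<noteq> 0"
    have "ratp g \<noteq> 0" using gh by (simp add: map_poly_eq_0_iff)
    then have "r = 0 \<or> degree r < degree (ratp g)" unfolding r_def by (rule degree_mod_less)
    then have "degree r < degree g" using dg by auto
    then have "degree P < degree g" unfolding P_def
      by (intro degree_diff_less) (auto simp: degree_map_poly dg)
    moreover have "card R \<le> card {w. poly P w = 0}"
      using poly_roots_finite[OF P] Pw by (intro card_mono) auto
    moreover have "card {w. poly P w = 0} \<le> degree P" by (rule card_poly_roots_bound[OF P])
    ultimately show False using cR by simp
  qed
  then have "coeff P 0 = 0" by simp
  then have "x = of_rat (coeff r 0)" by (simp add: P_def coeff_map_poly)
  then show ?thesis unfolding x_def z_def by simp
qed

lemma galois_invariant_integral: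
  assumes N: "N > 0" and inv: "\<And>a. coprime a N \<Longrightarrow> evi f (zeta N ^ a) = evi f (zeta N)"
  shows "evi f (zeta N) \<in> \<int>"
proof -
  have "ev (ratp f) (zeta N) \<in> \<rat>" using inv by (intro galois_invariant_rational[OF N]) simp
  then have "evi f (zeta N) \<in> \<rat>" by simp
  then show ?thesis by (rule evi_rational_integral[OF zeta_power_self[OF N] N])
qed

text \<open>The same \<open>h k\<close> serves for every \<open>z\<close>. The coefficients can
  therefore be conjugated by replacing \<open>zeta N\<close> with one of its powers.\<close>

lemma coeff_prod_evi:
  assumes "finite C"
  shows "\<exists>h :: nat \<Rightarrow> int poly. \<forall>z k. evi (h k) z = coeff (\<Prod>c\<in>C. [:- evi (f c) z, 1:]) k"
  using assms
proof (induction C)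
  case empty
  show ?case by (intro exI[of _ "\<lambda>k. if k = 0 then 1 else 0"]) auto
next
  case (insert c C)
  then obtain h where h: "\<And>z k. evi (h k) z = coeff (\<Prod>c\<in>C. [:- evi (f c) z, 1:]) k" by blast
  define h' where "h' = (\<lambda>k. (case k of 0 \<Rightarrow> 0 | Suc j \<Rightarrow> h j) - f c * h k)"
  have "evi (h' k) z = coeff (\<Prod>c\<in>insert c C. [:- evi (f c) z, 1:]) k" for z k
  proof -
    have "(\<Prod>c\<in>insert c C. [:- evi (f c) z, 1:]) = [:- evi (f c) z, 1:] * (\<Prod>c\<in>C. [:- evi (f c) z, 1:])"
      using insert by simp
    then show ?thesis by (cases k) (simp_all add: h'_def h)
  qed
  then show ?case by blast
qed

lemma integral_poly:
  assumes "\<And>k. coeff P k \<in> \<int>"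
  shows "\<exists>F :: int poly. map_poly of_int F = (P :: complex poly)"
proof -
  define F where "F = map_poly (\<lambda>x::complex. \<lfloor>Re x\<rfloor>) P"
  have "of_int \<lfloor>Re (coeff P k)\<rfloor> = coeff P k" for k
    using assms[of k] by (auto elim!: Ints_cases)
  then have "map_poly of_int F = P"
    by (intro poly_eqI) (simp add: F_def coeff_map_poly)
  then show ?thesis by blast
qed

text \<open>\<open>\<psi>\<close> identifies the Galois group of the subfield of the \<open>N\<close>-th cyclotomic field fixed by the
  kernel of \<open>\<psi>\<close> with \<open>\<int> / n\<close>; the value of \<open>f\<close> at \<open>zeta N\<close> generates this subfield.\<close>

locale block =
  fixes N n :: nat and \<psi> :: "nat \<Rightarrow> nat" and f :: "int poly"
  assumes N: "N > 0"
    and psi_less: "\<And>a. \<psi> a < n"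
    and psi_mult: "\<And>a b. coprime a N \<Longrightarrow> coprime b N \<Longrightarrow> \<psi> (a * b) = (\<psi> a + \<psi> b) mod n"
    and psi_surj: "\<And>c. c < n \<Longrightarrow> \<exists>a. coprime a N \<and> \<psi> a = c"
    and psi_cong: "\<And>a b. [a = b] (mod N) \<Longrightarrow> \<psi> a = \<psi> b"
    and gen: "\<And>a b. coprime a N \<Longrightarrow> coprime b N \<Longrightarrow>
      evi f (zeta N ^ a) = evi f (zeta N ^ b) \<longleftrightarrow> \<psi> a = \<psi> b"
begin

lemma n_pos: "n > 0" using psi_less[of 0] by simp

definition rep :: "nat \<Rightarrow> nat" where "rep c = (SOME a. coprime a N \<and> \<psi> a = c)"

lemma rep: "c < n \<Longrightarrow> coprime (rep c) N" "c < n \<Longrightarrow> \<psi> (rep c) = c"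
  using someI_ex[OF psi_surj, of c] by (auto simp: rep_def)

text \<open>Conjugates of the generator are labelled by Z/n; label 0 belongs to the generator
  itself.\<close>

definition conj :: "nat \<Rightarrow> complex" where "conj c = evi f (zeta N ^ rep c)"

lemma conj_psi: "coprime a N \<Longrightarrow> evi f (zeta N ^ a) = conj (\<psi> a)"
  unfolding conj_def by (subst gen) (auto simp: rep psi_less)

lemma conj_inj: "inj_on conj {..<n}"
  by (rule inj_onI) (metis conj_def gen lessThan_iff rep)

lemma psi_1: "\<psi> 1 = 0"
proof -
  have "\<psi> (1 * 1) = (\<psi> 1 + \<psi> 1) mod n" by (rule psi_mult) auto
  then have "(\<psi> 1 + \<psi> 1) mod n = (\<psi> 1 + 0) mod n" using psi_less[of 1] by simp
  then have "[\<psi> 1 + \<psi> 1 = \<psi> 1 + 0] (mod n)" by (simp add: cong_def)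
  then have "[\<psi> 1 = 0] (mod n)" by (simp only: cong_add_lcancel_nat)
  then show ?thesis using psi_less[of 1] by (simp add: cong_def)
qed

definition fc :: "nat \<Rightarrow> int poly" where "fc c = pcompose f (monom 1 (rep c))"

text \<open>Conjugation by \<open>a\<close> translates the label by \<open>\<psi> a\<close>. The
  whole Galois action on the conjugates is reduced to this translation.\<close>

lemma evi_fc: "c < n \<Longrightarrow> coprime a N \<Longrightarrow> evi (fc c) (zeta N ^ a) = conj ((\<psi> a + c) mod n)"
  using conj_psi[of "a * rep c"] rep[of c] psi_mult[of a "rep c"]
  by (simp add: fc_def power_mult)

lemma evi_fc_zeta: "c < n \<Longrightarrow> evi (fc c) (zeta N) = conj c"
  using evi_fc[of c 1] psi_1 by simp

lemma bij_shift: "bij_betw (\<lambda>c. (s + c) mod n) {..<n} {..<n}"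
proof -
  have "inj_on (\<lambda>c. (s + c) mod n) {..<n}"
  proof (rule inj_onI)
    fix x y assume xy: "x \<in> {..<n}" "y \<in> {..<n}" "(s + x) mod n = (s + y) mod n"
    then have "[s + x = s + y] (mod n)" by (simp add: cong_def)
    then have "[x = y] (mod n)" by (simp only: cong_add_lcancel_nat)
    then show "x = y" using xy by (simp add: cong_def)
  qed
  moreover have "(\<lambda>c. (s + c) mod n) ` {..<n} \<subseteq> {..<n}" using n_pos by auto
  ultimately show ?thesis by (simp add: bij_betw_def endo_inj_surj)
qed

definition charpoly :: "complex poly" where "charpoly = (\<Prod>c<n. [:- conj c, 1:])"

text \<open>Numerator of the Lagrange interpolation that sends each conjugate to the one with label
  advanced by \<open>s\<close>. The common denominator, the derivative of \<open>charpoly\<close>,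
  is left out so that the coefficients are integers.\<close>

definition lagr :: "nat \<Rightarrow> complex poly" where
  "lagr s = (\<Sum>j<n. smult (conj ((s + j) mod n)) (\<Prod>i\<in>{..<n} - {j}. [:- conj i, 1:]))"

lemma charpoly_integral: "\<exists>F :: int poly. map_poly of_int F = charpoly"
proof (rule integral_poly)
  fix k
  obtain h where h: "\<And>z k. evi (h k) z = coeff (\<Prod>c<n. [:- evi (fc c) z, 1:]) k"
    using coeff_prod_evi[of "{..<n}" fc] by auto
  have "(\<Prod>c<n. [:- evi (fc c) (zeta N ^ a), 1:]) = charpoly" if "coprime a N" for a
  proof -
    have "(\<Prod>c<n. [:- evi (fc c) (zeta N ^ a), 1:]) = (\<Prod>c<n. [:- conj ((\<psi> a + c) mod n), 1:])"
      using evi_fc[OF _ that] by (intro prod.cong) auto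
    also have "\<dots> = charpoly" unfolding charpoly_def
      by (rule prod.reindex_bij_betw[OF bij_shift])
    finally show ?thesis .
  qed
  then have *: "evi (h k) (zeta N ^ a) = coeff charpoly k" if "coprime a N" for a
    using h[of k "zeta N ^ a"] that by simp
  have "evi (h k) (zeta N) \<in> \<int>"
    using * *[of 1] by (intro galois_invariant_integral[OF N]) simp
  then show "coeff charpoly k \<in> \<int>" using *[of 1] by simp
qed

text \<open>Conjugation translates nodes and values by the same amount, so it only permutes the
  summands.\<close>

lemma lagr_integral: "\<exists>F :: int poly. map_poly of_int F = lagr s"
proof (rule integral_poly)
  fix k
  have "\<forall>j. \<exists>h. \<forall>z k. evi (h k) z = coeff (\<Prod>i\<in>{..<n}-{j}. [:- evi (fc i) z, 1:]) k"
    using coeff_prod_evi[of "{..<n}-{j}" fc for j] by auto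
  then obtain h where h: "\<And>j z k. evi (h j k) z = coeff (\<Prod>i\<in>{..<n}-{j}. [:- evi (fc i) z, 1:]) k"
    using choice[of "\<lambda>j h. \<forall>z k. evi (h k) z = coeff (\<Prod>i\<in>{..<n}-{j}. [:- evi (fc i) z, 1:]) k"] by auto
  define H where "H = (\<Sum>j<n. fc ((s + j) mod n) * h j k)"
  have *: "evi H (zeta N ^ a) = coeff (lagr s) k" if a: "coprime a N" for a
  proof -
    define u where "u = (\<lambda>j. (\<psi> a + j) mod n)"
    have u: "bij_betw u {..<n} {..<n}" unfolding u_def by (rule bij_shift)
    have ul: "u j < n" for j using n_pos by (simp add: u_def)
    have "evi H (zeta N ^ a) = (\<Sum>j<n. conj (u ((s + j) mod n)) * coeff (\<Prod>i\<in>{..<n}-{j}. [:- conj (u i), 1:]) k)"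
      unfolding H_def evi_sum evi_simps h
      using evi_fc[OF _ a] n_pos by (intro sum.cong refl arg_cong2[of _ _ _ _ "(*)"] arg_cong2[of _ _ _ _ coeff] prod.cong) (auto simp: u_def)
    also have "\<dots> = (\<Sum>j<n. conj ((s + u j) mod n) * coeff (\<Prod>i\<in>{..<n}-{u j}. [:- conj i, 1:]) k)"
    proof (intro sum.cong refl arg_cong2[of _ _ _ _ "(*)"] arg_cong2[of _ _ _ _ coeff])
      fix j assume j: "j \<in> {..<n}"
      show "conj (u ((s + j) mod n)) = conj ((s + u j) mod n)"
        by (simp add: u_def mod_add_right_eq add_ac)
      have "bij_betw u ({..<n}-{j}) ({..<n}-{u j})"
        using u j by (intro bij_betw_DiffI) (auto simp: bij_betw_def)
      then show "(\<Prod>i\<in>{..<n}-{j}. [:- conj (u i), 1:]) = (\<Prod>i\<in>{..<n}-{u j}. [:- conj i, 1:])"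
        by (rule prod.reindex_bij_betw)
    qed
    also have "\<dots> = (\<Sum>j<n. conj ((s + j) mod n) * coeff (\<Prod>i\<in>{..<n}-{j}. [:- conj i, 1:]) k)"
      by (rule sum.reindex_bij_betw[OF u])
    also have "\<dots> = coeff (lagr s) k" unfolding lagr_def by (simp add: coeff_sum)
    finally show ?thesis .
  qed
  have "evi H (zeta N) \<in> \<int>"
    using * *[of 1] by (intro galois_invariant_integral[OF N]) simp
  then show "coeff (lagr s) k \<in> \<int>" using *[of 1] by simp
qed

definition F :: "int poly" where "F = (SOME F. map_poly of_int F = charpoly)"
definition G :: "nat \<Rightarrow> int poly" where "G s = (SOME F. map_poly of_int F = lagr s)"

lemma F: "map_poly of_int F = charpoly" unfolding F_def by (rule someI_ex[OF charpoly_integral])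
lemma G: "map_poly of_int (G s) = lagr s" unfolding G_def by (rule someI_ex[OF lagr_integral])

lemma F_root: "evi F z = 0 \<longleftrightarrow> (\<exists>c<n. z = conj c)"
  unfolding evi_def F charpoly_def by (auto simp: poly_prod)

lemma lead_coeff_F: "lead_coeff F = 1"
proof -
  have "(of_int (lead_coeff F) :: complex) = lead_coeff (map_poly of_int F)"
    by (simp add: degree_map_poly coeff_map_poly)
  also have "\<dots> = 1" unfolding F charpoly_def by (simp add: lead_coeff_prod)
  finally show ?thesis by simp
qed

lemma degree_F: "degree F = n"
proof -
  have "degree F = degree (map_poly of_int F :: complex poly)" by (simp add: degree_map_poly)
  also have "\<dots> = n" unfolding F charpoly_def by (simp add: degree_prod_eq_sum_degree)
  finally show ?thesis .
qed

lemma pderiv_F: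
  assumes "j < n"
  shows "evi (pderiv F) (conj j) = (\<Prod>i\<in>{..<n}-{j}. conj j - conj i)"
proof -
  have "map_poly of_int (pderiv F) = pderiv (map_poly of_int F :: complex poly)"
    by (intro poly_eqI) (simp add: coeff_map_poly coeff_pderiv)
  then have "evi (pderiv F) (conj j) = poly (pderiv charpoly) (conj j)"
    unfolding evi_def F by simp
  also have "\<dots> = (\<Sum>a<n. \<Prod>i\<in>{..<n}-{a}. conj j - conj i)"
    unfolding charpoly_def pderiv_prod by (simp add: poly_sum poly_prod pderiv_pCons)
  also have "\<dots> = (\<Sum>a<n. if a = j then \<Prod>i\<in>{..<n}-{j}. conj j - conj i else 0)"
    using assms by (intro sum.cong refl) (auto simp: prod_zero_iff)
  also have "\<dots> = (\<Prod>i\<in>{..<n}-{j}. conj j - conj i)" using assms by simp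
  finally show ?thesis .
qed

lemma pderiv_F_nonzero: "j < n \<Longrightarrow> evi (pderiv F) (conj j) \<noteq> 0"
  using conj_inj by (auto simp: pderiv_F inj_on_def)

text \<open>Only one Lagrange term survives at a node. The quotient of \<open>G s\<close> by the
  derivative of \<open>F\<close> thus advances every label by \<open>s\<close>, by one formula for
  all \<open>j\<close>; this is why homomorphisms act on the labels as translations.\<close>

lemma G_eval:
  assumes "j < n"
  shows "evi (G s) (conj j) = conj ((s + j) mod n) * evi (pderiv F) (conj j)"
proof -
  have "evi (G s) (conj j) = (\<Sum>a<n. conj ((s + a) mod n) * (\<Prod>i\<in>{..<n}-{a}. conj j - conj i))"
    unfolding evi_def G lagr_def by (simp add: poly_sum poly_prod)
  also have "\<dots> = (\<Sum>a<n. if a = j then conj ((s + j) mod n) * (\<Prod>i\<in>{..<n}-{j}. conj j - conj i) else 0)"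
    using assms by (intro sum.cong refl) (auto simp: prod_zero_iff)
  also have "\<dots> = conj ((s + j) mod n) * (\<Prod>i\<in>{..<n}-{j}. conj j - conj i)" using assms by simp
  finally show ?thesis using pderiv_F[OF assms] by simp
qed

end

text \<open>A norm of t - zeta, taken over the kernel of \<open>\<psi>\<close>, generates the fixed
  field for a suitable integer \<open>t\<close>. The polynomials whose roots are the cosets of the
  kernel are distinct, and \<open>t\<close> avoids the finitely many points where two of them
  agree.\<close>

lemma block_generator_exists:
  fixes N n :: nat and \<psi> :: "nat \<Rightarrow> nat"
  assumes N: "N > 0"
    and psi_less: "\<And>a. \<psi> a < n"
    and psi_mult: "\<And>a b. coprime a N \<Longrightarrow> coprime b N \<Longrightarrow> \<psi> (a * b) = (\<psi> a + \<psi> b) mod n"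
    and psi_surj: "\<And>c. c < n \<Longrightarrow> \<exists>a. coprime a N \<and> \<psi> a = c"
    and psi_cong: "\<And>a b. [a = b] (mod N) \<Longrightarrow> \<psi> a = \<psi> b"
  shows "\<exists>f. block N n \<psi> f"
proof -
  define R where "R = (\<lambda>c. {zeta N ^ a |a. coprime a N \<and> \<psi> a = c})"
  define P where "P = (\<lambda>c. \<Prod>w\<in>R c. [:- w, 1:])"
  define H where "H = {h. h < N \<and> coprime h N \<and> \<psi> h = 0}"
  have finR: "finite (R c)" for c
  proof (rule finite_subset)
    show "R c \<subseteq> {w. w ^ N = 1}" unfolding R_def using zeta_power_unity[OF N] by auto
    show "finite {w::complex. w ^ N = 1}" using N finite_roots_unity[of N] by simp
  qed
  have finH: "finite H" unfolding H_def by simp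
  have rootP: "poly (P c) w = 0 \<longleftrightarrow> w \<in> R c" for c w
    unfolding P_def using finR by (auto simp: poly_prod)
  have PP: "P c \<noteq> P d" if "c < n" "d < n" "c \<noteq> d" for c d
  proof
    assume e: "P c = P d"
    obtain a where a: "coprime a N" "\<psi> a = c" using psi_surj[OF \<open>c < n\<close>] by blast
    then have "zeta N ^ a \<in> R c" unfolding R_def by blast
    then have "zeta N ^ a \<in> R d" using e rootP by metis
    then obtain b where b: "zeta N ^ a = zeta N ^ b" "\<psi> b = d" unfolding R_def by blast
    then have "\<psi> a = \<psi> b" using zeta_power_inj[OF N] psi_cong by blast
    then show False using a b that by simp
  qed
  define Bad where "Bad = (\<Union>c<n. \<Union>d\<in>{..<n}-{c}. {t. poly (P c - P d) t = 0})"
  have "finite {t. poly (P c - P d) t = 0}" if "c \<in> {..<n}" "d \<in> {..<n} - {c}" for c d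
    using PP[of c d] that by (intro poly_roots_finite) auto
  then have "finite Bad" unfolding Bad_def by (intro finite_UN_I) blast+
  then have "finite ((of_int :: int \<Rightarrow> complex) -` Bad)" by (intro finite_vimageI) (auto simp: inj_def)
  then obtain t :: int where t: "of_int t \<notin> Bad"
    using infinite_UNIV_int ex_new_if_finite by (metis vimageI)
  \<comment> \<open>At \<open>zeta N ^ a\<close> the factors run through the coset of
    \<open>a\<close>, so this integral polynomial takes the value of the coset polynomial at
    \<open>t\<close>.\<close>
  define f where "f = (\<Prod>h\<in>H. [:t:] - monom 1 h)"
  have evf: "evi f (zeta N ^ a) = poly (P (\<psi> a)) (of_int t)" if a: "coprime a N" for a
  proof -
    have bij: "bij_betw (\<lambda>h. zeta N ^ (a * h)) H (R (\<psi> a))"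
      unfolding bij_betw_def
    proof
      show "inj_on (\<lambda>h. zeta N ^ (a * h)) H"
      proof (rule inj_onI)
        fix h k assume hk: "h \<in> H" "k \<in> H" "zeta N ^ (a * h) = zeta N ^ (a * k)"
        then have "[a * h = a * k] (mod N)" using zeta_power_inj[OF N] by blast
        then have "[h = k] (mod N)" using a cong_mult_lcancel_nat by blast
        then show "h = k" using hk by (simp add: H_def cong_def)
      qed
      show "(\<lambda>h. zeta N ^ (a * h)) ` H = R (\<psi> a)"
      proof
        show "(\<lambda>h. zeta N ^ (a * h)) ` H \<subseteq> R (\<psi> a)"
        proof
          fix w assume "w \<in> (\<lambda>h. zeta N ^ (a * h)) ` H"
          then obtain h where h: "h \<in> H" "w = zeta N ^ (a * h)" by blast
          then have "\<psi> (a * h) = \<psi> a" using psi_mult[OF a, of h] psi_less[of a] by (simp add: H_def)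
          moreover have "coprime (a * h) N" using a h by (simp add: H_def)
          ultimately show "w \<in> R (\<psi> a)" using h unfolding R_def by blast
        qed
        show "R (\<psi> a) \<subseteq> (\<lambda>h. zeta N ^ (a * h)) ` H"
        proof
          fix w assume "w \<in> R (\<psi> a)"
          then obtain b where b: "coprime b N" "\<psi> b = \<psi> a" "w = zeta N ^ b" unfolding R_def by blast
          \<comment> \<open>The quotient of \<open>b\<close> by \<open>a\<close> modulo
            \<open>N\<close> lies in the kernel and carries \<open>a\<close> to
            \<open>b\<close>.\<close>
          obtain x where x: "[a * x = 1] (mod N)" using cong_solve_coprime_nat[OF a] by auto
          define h where "h = (x * b) mod N"
          have "[a * h = a * (x * b)] (mod N)" unfolding h_def by (simp add: cong_def mod_mult_right_eq)
          also have "a * (x * b) = a * x * b" by simp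
          also have "[a * x * b = 1 * b] (mod N)" using x by (rule cong_scalar_right)
          finally have hb: "[a * h = b] (mod N)" by simp
          have "coprime (a * h) N" using b(1) hb by (metis cong_imp_coprime cong_sym)
          then have ch: "coprime h N" by simp
          have "(\<psi> a + \<psi> h) mod n = \<psi> a" using psi_mult[OF a ch] psi_cong[OF hb] b by simp
          then have "[\<psi> a + \<psi> h = \<psi> a + 0] (mod n)" using psi_less[of a] by (simp add: cong_def)
          then have "[\<psi> h = 0] (mod n)" by (simp only: cong_add_lcancel_nat)
          then have "\<psi> h = 0" using psi_less[of h] by (simp add: cong_def)
          then have "h \<in> H" using ch N by (simp add: H_def h_def)
          moreover have "w = zeta N ^ (a * h)" using b(3) zeta_power_cong[OF N hb] by simp
          ultimately show "w \<in> (\<lambda>h. zeta N ^ (a * h)) ` H" by blast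
        qed
      qed
    qed
    have "evi f (zeta N ^ a) = (\<Prod>h\<in>H. of_int t - zeta N ^ (a * h))"
      unfolding f_def evi_prod by (simp add: power_mult)
    also have "\<dots> = (\<Prod>w\<in>R (\<psi> a). of_int t - w)"
      by (rule prod.reindex_bij_betw[OF bij])
    also have "\<dots> = poly (P (\<psi> a)) (of_int t)" unfolding P_def by (simp add: poly_prod)
    finally show ?thesis .
  qed
  have "evi f (zeta N ^ a) = evi f (zeta N ^ b) \<longleftrightarrow> \<psi> a = \<psi> b" if "coprime a N" "coprime b N" for a b
  proof
    assume e: "evi f (zeta N ^ a) = evi f (zeta N ^ b)"
    show "\<psi> a = \<psi> b"
    proof (rule ccontr)
      assume "\<psi> a \<noteq> \<psi> b"
      moreover have "poly (P (\<psi> a) - P (\<psi> b)) (of_int t) = 0" using e evf that by simp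
      ultimately have "of_int t \<in> Bad" unfolding Bad_def using psi_less by force
      then show False using t by blast
    qed
  qed (use evf that in simp)
  then have "block N n \<psi> f" using assms by unfold_locales auto
  then show ?thesis ..
qed

section \<open>Roots of the generating polynomials modulo prime powers\<close>

lemma monic_linear_quotient:
  fixes g :: "int poly"
  assumes "lead_coeff g = 1" "degree g > 0"
  shows "\<exists>g' c. g = [:- b, 1:] * g' + [:c:] \<and> lead_coeff g' = 1 \<and> Suc (degree g') = degree g"
proof -
  define g' where "g' = synthetic_div g b"
  have eq: "g = [:- b, 1:] * g' + [:poly g b:]"
    using synthetic_div_correct'[of b g] by (simp add: g'_def)
  have "g' \<noteq> 0"
  proof
    assume "g' = 0"
    then have "degree g = degree [:poly g b:]" using eq by simp
    then show False using assms by simp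
  qed
  have d: "Suc (degree g') = degree g" using assms(2) by (simp add: g'_def degree_synthetic_div)
  have "lead_coeff g = coeff ([:- b, 1:] * g') (degree g)"
    using assms(2) by (subst eq, subst coeff_add) (cases "degree g"; simp)
  also have "\<dots> = lead_coeff ([:- b, 1:] * g')"
    using \<open>g' \<noteq> 0\<close> d by (subst degree_mult_eq) auto
  also have "\<dots> = lead_coeff g'" by (subst lead_coeff_mult) simp
  finally have "lead_coeff g' = 1" using assms by simp
  then show ?thesis using eq d by blast
qed

text \<open>The factorisation modulo \<open>p\<close> is kept over the integers with an explicit
  multiple of \<open>p\<close>. At each new root the earlier factors are prime to \<open>p\<close>,
  so the constant remainder of the next division is divisible by \<open>p\<close>.\<close>

lemma roots_mod_prime:
  fixes f :: "int poly"
  assumes p: "prime p" and f: "lead_coeff f = 1" and fin: "finite C" and card: "card C \<le> degree f"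
    and inj: "\<And>a b. a \<in> C \<Longrightarrow> b \<in> C \<Longrightarrow> int p dvd a - b \<Longrightarrow> a = b"
    and root: "\<And>a. a \<in> C \<Longrightarrow> int p dvd poly f a"
  shows "\<exists>g h. f = (\<Prod>a\<in>C. [:- a, 1:]) * g + smult (int p) h \<and> lead_coeff g = 1 \<and> card C + degree g = degree f"
  using fin card inj root
proof (induction C)
  case empty
  show ?case using f by (intro exI[of _ f] exI[of _ 0]) simp
next
  case (insert b C)
  then obtain g h where gh: "f = (\<Prod>a\<in>C. [:- a, 1:]) * g + smult (int p) h" "lead_coeff g = 1"
      "card C + degree g = degree f"
    by (metis card_insert_disjoint Suc_leD insertCI)
  have "degree g > 0" using gh(3) insert by simp
  then obtain g' c where g': "g = [:- b, 1:] * g' + [:c:]" "lead_coeff g' = 1" "Suc (degree g') = degree g"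
    using monic_linear_quotient gh(2) by blast
  have "poly f b = (\<Prod>a\<in>C. b - a) * c + int p * poly h b"
    unfolding gh(1) g'(1) by (simp add: poly_prod)
  moreover have "int p dvd poly f b" using insert by blast
  ultimately have "int p dvd (\<Prod>a\<in>C. b - a) * c"
    by (metis dvd_add_left_iff dvd_triv_left)
  moreover have "\<not> int p dvd (\<Prod>a\<in>C. b - a)"
  proof
    assume "int p dvd (\<Prod>a\<in>C. b - a)"
    then obtain a where "a \<in> C" "int p dvd b - a"
      using prime_dvd_prod_iff[of C "int p" "\<lambda>a. b - a"] insert p by auto
    then show False using insert by blast
  qed
  ultimately have "int p dvd c" using p prime_dvd_mult_iff[of "int p"] by simp
  then obtain c' where c': "c = int p * c'" by (elim dvdE)
  have "f = (\<Prod>a\<in>insert b C. [:- a, 1:]) * g' + smult (int p) (smult c' (\<Prod>a\<in>C. [:- a, 1:]) + h)"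
    using insert(1,2) unfolding gh(1) g'(1) c' by (simp add: algebra_simps smult_add_right)
  then show ?case using g' gh(3) insert(1,2)
    by (intro exI[of _ g'] exI[of _ "smult c' (\<Prod>a\<in>C. [:- a, 1:]) + h"]) simp
qed

text \<open>Fermat's theorem makes all residues roots of X^p - X, and the degree leaves room for no
  further factor.\<close>

lemma fermat_poly:
  assumes p: "prime p"
  shows "\<exists>h. monom 1 p - monom 1 1 = (\<Prod>a<p. [:- int a, 1:]) + smult (int p) h"
proof -
  have p1: "p > 1" using p prime_gt_1_nat by blast
  define f where "f = (monom 1 p - monom 1 1 :: int poly)"
  have "degree (monom 1 p + - monom 1 1 :: int poly) = p"
    using p1 by (subst degree_add_eq_left) (simp_all add: degree_monom_eq)
  then have d: "degree f = p" by (simp add: f_def)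
  have l: "lead_coeff f = 1" unfolding d using p1 by (simp add: f_def)
  define C where "C = int ` {..<p}"
  have "\<exists>g h. f = (\<Prod>a\<in>C. [:- a, 1:]) * g + smult (int p) h \<and> lead_coeff g = 1 \<and> card C + degree g = degree f"
  proof (rule roots_mod_prime[OF p l])
    show "finite C" by (simp add: C_def)
    show "card C \<le> degree f" unfolding C_def d by (simp add: card_image)
    show "a = b" if "a \<in> C" "b \<in> C" "int p dvd a - b" for a b
    proof -
      have "a mod int p = b mod int p" using that(3) by (simp add: mod_eq_dvd_iff)
      then show ?thesis using that(1,2) by (auto simp: C_def simp flip: of_nat_mod)
    qed
    show "int p dvd poly f a" for a using fermat_dvd_int[OF p] by (simp add: f_def poly_monom)
  qed
  then obtain g h where gh: "f = (\<Prod>a\<in>C. [:- a, 1:]) * g + smult (int p) h" "lead_coeff g = 1"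
      "card C + degree g = degree f" by blast
  have "card C = p" unfolding C_def by (simp add: card_image)
  then have "degree g = 0" using gh(3) d by simp
  then obtain c where "g = [:c:]" by (rule degree_eq_zeroE)
  then have "g = 1" using gh(2) by simp
  moreover have "(\<Prod>a\<in>C. [:- a, 1:]) = (\<Prod>a<p. [:- int a, 1:])"
    unfolding C_def by (subst prod.reindex) auto
  ultimately show ?thesis using gh(1) unfolding f_def by auto
qed

section \<open>The Frobenius-fixed subring of Z[zeta] and p-adic approximation in it\<close>

context block
begin

text \<open>Elements of Z[zeta] fixed by the Frobenius substitution; for a prime \<open>p\<close>
  not dividing \<open>N\<close> this is the ring of integers of the decomposition field, whose
  residue fields above \<open>p\<close> have \<open>p\<close> elements.\<close>

definition inR :: "nat \<Rightarrow> complex \<Rightarrow> bool" where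
  "inR p x \<longleftrightarrow> (\<exists>g. x = evi g (zeta N) \<and> evi g (zeta N ^ p) = x)"

definition pdiv :: "nat \<Rightarrow> nat \<Rightarrow> complex \<Rightarrow> bool" where
  "pdiv p k x \<longleftrightarrow> (\<exists>y. inR p y \<and> x = of_nat (p ^ k) * y)"

lemma inR_add: "inR p x \<Longrightarrow> inR p y \<Longrightarrow> inR p (x + y)"
  unfolding inR_def by (metis evi_simps(3))

lemma inR_mult: "inR p x \<Longrightarrow> inR p y \<Longrightarrow> inR p (x * y)"
  unfolding inR_def by (metis evi_simps(4))

lemma inR_of_int: "inR p (of_int c)"
  unfolding inR_def by (rule exI[of _ "[:c:]"]) simp

lemma inR_of_nat: "inR p (of_nat c)"
  using inR_of_int[of p "int c"] by simp

lemma inR_diff: "inR p x \<Longrightarrow> inR p y \<Longrightarrow> inR p (x - y)"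
  using inR_add[of p x "of_int (-1) * y"] inR_mult[OF inR_of_int[of p "-1"], of y] by simp

lemma inR_1: "inR p 1" using inR_of_nat[of p 1] by simp

lemma inR_power: "inR p x \<Longrightarrow> inR p (x ^ k)"
  by (induction k) (auto simp: inR_1 inR_mult)

lemma inR_prod: "(\<And>i. i \<in> I \<Longrightarrow> inR p (g i)) \<Longrightarrow> inR p (\<Prod>i\<in>I. g i)"
  by (induction I rule: infinite_finite_induct) (auto simp: inR_1 inR_mult)

lemma inR_evi: "inR p x \<Longrightarrow> inR p (evi h x)"
  using inR_of_int[of p 0] by (induction h) (auto intro!: inR_add inR_mult inR_of_int)

lemma pdiv_add: "pdiv p k x \<Longrightarrow> pdiv p k y \<Longrightarrow> pdiv p k (x + y)"
  unfolding pdiv_def by (metis inR_add distrib_left)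

lemma pdiv_mult: "pdiv p k x \<Longrightarrow> inR p y \<Longrightarrow> pdiv p k (x * y)"
  unfolding pdiv_def by (metis inR_mult mult.assoc)

lemma pdiv_mult': "pdiv p k x \<Longrightarrow> inR p y \<Longrightarrow> pdiv p k (y * x)"
  using pdiv_mult[of p k x y] by (simp add: mult.commute)

lemma pdiv_diff: "pdiv p k x \<Longrightarrow> pdiv p k y \<Longrightarrow> pdiv p k (x - y)"
  using pdiv_add[of p k x "of_int (-1) * y"] pdiv_mult'[of p k y "of_int (-1)"] inR_of_int[of p "-1"] by simp

lemma pdiv_p: "inR p y \<Longrightarrow> pdiv p 1 (of_nat p * y)"
  unfolding pdiv_def by auto

text \<open>The relation p w = g at \<open>zeta N\<close> also holds at its conjugate
  \<open>zeta N ^ p\<close>, and cancelling \<open>p\<close> there shows that w is fixed. Division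
  by \<open>p\<close> thus stays inside the ring.\<close>

lemma inR_div_p:
  assumes p: "prime p" "\<not> p dvd N" and x: "inR p (of_nat p * evi w (zeta N))"
  shows "inR p (evi w (zeta N))"
proof -
  obtain g where g: "of_nat p * evi w (zeta N) = evi g (zeta N)" "evi g (zeta N ^ p) = of_nat p * evi w (zeta N)"
    using x unfolding inR_def by auto
  have cop: "coprime p N" using p by (rule prime_imp_coprime)
  have "ev (ratp (smult (int p) w - g)) (zeta N) = 0" unfolding ev_ratp using g(1) by simp
  then have "ev (ratp (smult (int p) w - g)) (zeta N ^ p) = 0" by (rule zeta_conjugate[OF N cop])
  then have "of_nat p * evi w (zeta N ^ p) = of_nat p * evi w (zeta N)" unfolding ev_ratp using g(2) by simp
  then have "evi w (zeta N ^ p) = evi w (zeta N)" using p(1) by simp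
  then show ?thesis unfolding inR_def by blast
qed

text \<open>Modulo \<open>p\<close> the p-th power is the Frobenius substitution, which returns a
  fixed element unchanged.\<close>

lemma pdiv_frobenius:
  assumes p: "prime p" "\<not> p dvd N" and x: "inR p x"
  shows "pdiv p 1 (x ^ p - x)"
proof -
  obtain g where g: "x = evi g (zeta N)" "evi g (zeta N ^ p) = x" using x unfolding inR_def by blast
  obtain w where w: "\<And>z. evi g z ^ p = evi g (z ^ p) + of_nat p * evi w z"
    using evi_frobenius[OF p(1)] by blast
  have e: "x ^ p - x = of_nat p * evi w (zeta N)" using w[of "zeta N"] g by simp
  have "inR p (x ^ p - x)" by (intro inR_diff inR_power x)
  then have "inR p (evi w (zeta N))" unfolding e by (rule inR_div_p[OF p])
  then show ?thesis unfolding e by (rule pdiv_p)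
qed

lemma not_pdiv_1:
  assumes p: "prime p"
  shows "\<not> pdiv p 1 1"
proof
  assume "pdiv p 1 1"
  then obtain g where "1 = of_nat p * evi g (zeta N)" unfolding pdiv_def inR_def by auto
  then show False
    using not_inverse_prime_in_Zzeta[OF zeta_power_self[OF N] N p, of 1 g] p by (simp add: prime_nat_iff)
qed

lemma pdiv_prod_linear:
  assumes p: "prime p" "\<not> p dvd N" and x: "inR p x"
  shows "pdiv p 1 (\<Prod>a<p. x - of_nat a)"
proof -
  obtain h where h: "monom 1 p - monom 1 1 = (\<Prod>a<p. [:- int a, 1:]) + smult (int p) h"
    using fermat_poly[OF p(1)] by blast
  have "evi (monom 1 p - monom 1 1) x = evi ((\<Prod>a<p. [:- int a, 1:]) + smult (int p) h) x"
    unfolding h ..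
  then have "(\<Prod>a<p. x - of_nat a) = (x ^ p - x) - of_nat p * evi h x"
    by (simp add: evi_prod)
  then show ?thesis by (simp only:) (intro pdiv_diff pdiv_frobenius p x pdiv_p inR_evi)
qed

text \<open>The integers \<open>c\<close> approximate the generator along an approximate idempotent \<open>e\<close> not divisible by \<open>p\<close>;
  this replaces the choice of a prime ideal above \<open>p\<close>.\<close>

lemma padic_step:
  assumes p: "prime p" "\<not> p dvd N" and x: "inR p x"
    and e: "inR p e" "\<not> pdiv p 1 e" and c: "pdiv p k ((x - of_int c) * e)"
  shows "\<exists>c' e'. inR p e' \<and> \<not> pdiv p 1 e' \<and> pdiv p (Suc k) ((x - of_int c') * e') \<and> int p ^ k dvd c' - c"
proof -
  \<comment> \<open>Since e^p is e modulo \<open>p\<close>, this power is idempotent modulo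
    \<open>p\<close>, and like \<open>e\<close> it is not divisible by \<open>p\<close>.\<close>
  define u where "u = e ^ (p - 1)"
  have p2: "p \<ge> 2" using p(1) prime_ge_2_nat by blast
  have uR: "inR p u" unfolding u_def by (intro inR_power e)
  have eu: "e * u = e ^ p" unfolding u_def using p2 by (simp flip: power_Suc)
  have fe: "pdiv p 1 (e ^ p - e)" by (rule pdiv_frobenius[OF p e(1)])
  have nu: "\<not> pdiv p 1 u"
  proof
    assume "pdiv p 1 u"
    then have "pdiv p 1 (e * u)" using e(1) by (rule pdiv_mult')
    then have "pdiv p 1 (e * u - (e ^ p - e))" using fe by (rule pdiv_diff)
    then show False using eu e(2) by simp
  qed
  have idem: "pdiv p 1 (u * u - u)"
  proof -
    have "u * u - u = (e ^ p - e) * e ^ (p - 2)"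
    proof -
      have "u * u = e ^ p * e ^ (p - 2)" unfolding u_def using p2 by (simp flip: power_add add: mult_2 numeral_2_eq_2)
      moreover have "u = e * e ^ (p - 2)" unfolding u_def using p2 by (simp flip: power_Suc add: Suc_diff_Suc numeral_2_eq_2)
      ultimately show ?thesis by (simp add: algebra_simps)
    qed
    then show ?thesis using pdiv_mult[OF fe inR_power[OF e(1), of "p - 2"]] by simp
  qed
  have "pdiv p k ((x - of_int c) * e * e ^ (p - 2))" by (rule pdiv_mult[OF c inR_power[OF e(1)]])
  moreover have "e * e ^ (p - 2) = u" unfolding u_def using p2 by (simp flip: power_Suc add: Suc_diff_Suc numeral_2_eq_2)
  ultimately have "pdiv p k ((x - of_int c) * u)" by (simp add: mult.assoc)
  then obtain s where s: "inR p s" "(x - of_int c) * u = of_nat (p ^ k) * s" unfolding pdiv_def by blast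
  \<comment> \<open>\<open>w 0\<close> is \<open>u\<close>, not divisible by \<open>p\<close>, while
    \<open>w p\<close> is divisible. The index just before divisibility sets in is the next digit:
    \<open>s\<close> is congruent to it on the part cut out by \<open>w i\<close>.\<close>
  define w where "w = (\<lambda>j. u * (\<Prod>a<j. s - of_nat a))"
  have wR: "inR p (w j)" for j
    unfolding w_def by (intro inR_mult uR inR_prod inR_diff s inR_of_nat)
  have wp: "pdiv p 1 (w p)" unfolding w_def by (rule pdiv_mult'[OF pdiv_prod_linear[OF p s(1)] uR])
  define j where "j = (LEAST j. pdiv p 1 (w j))"
  have j: "pdiv p 1 (w j)" unfolding j_def using wp by (rule LeastI)
  have "j \<noteq> 0"
  proof
    assume "j = 0"
    then have "w j = u" by (simp add: w_def)
    then show False using j nu by simp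
  qed
  then obtain i where i: "j = Suc i" by (cases j) auto
  have ni: "\<not> pdiv p 1 (w i)" using not_less_Least[of i "\<lambda>j. pdiv p 1 (w j)"] i by (simp add: j_def)
  \<comment> \<open>One factor \<open>u\<close> is consumed by the relation for (x - c) u, the other
    stays inside \<open>w i\<close>. Modulo \<open>p\<close> the additional factor changes
    nothing.\<close>
  define v where "v = u * w i"
  have vw: "pdiv p 1 (v - w i)"
  proof -
    have "v - w i = (u * u - u) * (\<Prod>a<i. s - of_nat a)" by (simp add: v_def w_def algebra_simps)
    then show ?thesis using pdiv_mult[OF idem inR_prod[of "{..<i}" p "\<lambda>a. s - of_nat a"]]
      by (simp add: inR_diff s inR_of_nat)
  qed
  have nv: "\<not> pdiv p 1 v"
  proof
    assume "pdiv p 1 v"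
    then have "pdiv p 1 (v - (v - w i))" using vw by (rule pdiv_diff)
    then show False using ni by simp
  qed
  have vR: "inR p v" unfolding v_def by (intro inR_mult uR wR)
  have "w j = w i * (s - of_nat i)" unfolding i w_def by simp
  then have 1: "pdiv p 1 (w i * (s - of_nat i))" using j by simp
  define c' where "c' = c + int (p ^ k) * int i"
  have "(x - of_int c') * v = (x - of_int c) * u * w i - of_nat (p ^ k) * of_nat i * v"
    by (simp add: c'_def v_def algebra_simps)
  also have "\<dots> = of_nat (p ^ k) * (s * w i - of_nat i * v)" unfolding s(2) by (simp add: algebra_simps)
  also have "s * w i - of_nat i * v = w i * (s - of_nat i) - of_nat i * (v - w i)" by (simp add: algebra_simps)
  finally have 2: "(x - of_int c') * v = of_nat (p ^ k) * (w i * (s - of_nat i) - of_nat i * (v - w i))" .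
  have "pdiv p 1 (w i * (s - of_nat i) - of_nat i * (v - w i))"
    by (intro pdiv_diff 1 pdiv_mult' vw inR_of_nat)
  then have "pdiv p (Suc k) ((x - of_int c') * v)" unfolding 2 pdiv_def by auto
  moreover have "int p ^ k dvd c' - c" by (simp add: c'_def)
  ultimately show ?thesis using vR nv by blast
qed

text \<open>An integer prime to \<open>p\<close> could be cancelled by Bezout, and \<open>e\<close>
  would be divisible by \<open>p\<close>; so \<open>p\<close> divides \<open>m\<close> and is split
  off, one factor at a time.\<close>

lemma pdiv_of_int:
  assumes p: "prime p" and e: "inR p e" "\<not> pdiv p 1 e" and m: "pdiv p k (of_int m * e)"
  shows "int p ^ k dvd m"
  using m
proof (induction k arbitrary: m)
  case (Suc k)
  obtain y where y: "inR p y" "of_int m * e = of_nat (p ^ Suc k) * y" using Suc.prems unfolding pdiv_def by blast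
  have pd: "int p dvd m"
  proof (rule ccontr)
    assume "\<not> int p dvd m"
    then have "coprime (int p) m" using p by (intro prime_imp_coprime) auto
    then obtain a b where ab: "a * int p + b * m = 1" using bezout_int[of "int p" m] by auto
    have "e = of_int (a * int p + b * m) * e" unfolding ab by simp
    also have "\<dots> = of_nat p * (of_int a * e) + of_int b * (of_int m * e)" by (simp add: algebra_simps)
    also have "\<dots> = of_nat p * (of_int a * e + of_int b * (of_nat (p ^ k) * y))" unfolding y(2) by (simp add: algebra_simps)
    finally have "e = of_nat p * (of_int a * e + of_int b * (of_nat (p ^ k) * y))" .
    moreover have "inR p (of_int a * e + of_int b * (of_nat (p ^ k) * y))"
      by (intro inR_add inR_mult inR_of_int inR_of_nat e y)
    ultimately show False using e(2) pdiv_p by metis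
  qed
  then obtain m' where m': "m = int p * m'" by (elim dvdE)
  have "of_nat p * (of_int m' * e) = of_nat p * (of_nat (p ^ k) * y)" using y(2) unfolding m' by (simp add: mult.assoc)
  then have "of_int m' * e = of_nat (p ^ k) * y" using p by simp
  then have "pdiv p k (of_int m' * e)" unfolding pdiv_def using y(1) by blast
  then have "int p ^ k dvd m'" by (rule Suc.IH)
  then show ?case unfolding m' by simp
qed simp

text \<open>\<open>\<psi> p = 0\<close> says that Frobenius fixes all conjugates, so the generator
  lies in the ring where its digits can be found.\<close>

lemma padic_root:
  assumes p: "prime p" "\<not> p dvd N" and psi: "\<psi> p = 0"
  shows "\<exists>c :: nat \<Rightarrow> int. \<forall>k. int p ^ k dvd c (Suc k) - c k \<and> int p ^ k dvd poly F (c k)"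
proof -
  have cR: "inR p (conj c)" if "c < n" for c
  proof -
    have "evi (fc c) (zeta N ^ p) = conj c"
      using evi_fc[OF that prime_imp_coprime[OF p]] psi that by simp
    then show ?thesis unfolding inR_def using evi_fc_zeta[OF that] by metis
  qed
  define x where "x = conj 0"
  have x: "inR p x" unfolding x_def using cR n_pos by simp
  \<comment> \<open>The multiplier is part of the state and may change at each step; only the
    integers have to form a coherent sequence.\<close>
  define Q where "Q = (\<lambda>k (c, e). inR p e \<and> \<not> pdiv p 1 e \<and> pdiv p k ((x - of_int c) * e))"
  have "\<exists>h. \<forall>k. Q k (h k) \<and> (int p ^ k dvd fst (h (Suc k)) - fst (h k))"
  proof (rule dependent_nat_choice)
    show "\<exists>y. Q 0 y"
      unfolding Q_def using inR_1 not_pdiv_1[OF p(1)] x by (intro exI[of _ "(0, 1)"]) (auto simp: pdiv_def)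
    fix y k assume "Q k y"
    then show "\<exists>z. Q (Suc k) z \<and> int p ^ k dvd fst z - fst y"
      using padic_step[OF p x, of "snd y" k "fst y"] unfolding Q_def by (auto split: prod.splits)
  qed
  then obtain h where h: "\<And>k. Q k (h k)" "\<And>k. int p ^ k dvd fst (h (Suc k)) - fst (h k)" by blast
  define c where "c = (\<lambda>k. fst (h k))"
  have "int p ^ k dvd poly F (c k)" for k
  proof -
    define e where "e = snd (h k)"
    have e: "inR p e" "\<not> pdiv p 1 e" "pdiv p k ((x - of_int (c k)) * e)"
      using h(1)[of k] unfolding Q_def e_def c_def by (auto split: prod.splits)
    have "(of_int (poly F (c k)) :: complex) = poly (map_poly of_int F) (of_int (c k))"
      by (simp add: poly_altdef degree_map_poly coeff_map_poly)
    also have "\<dots> = (\<Prod>i<n. of_int (c k) - conj i)" unfolding F charpoly_def by (simp add: poly_prod)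
    also have "\<dots> = (of_int (c k) - x) * (\<Prod>i\<in>{..<n}-{0}. of_int (c k) - conj i)"
      unfolding x_def using n_pos by (subst prod.remove[of _ 0]) auto
    finally have eq: "of_int (poly F (c k)) = (of_int (c k) - x) * (\<Prod>i\<in>{..<n}-{0}. of_int (c k) - conj i)" .
    \<comment> \<open>The factor of label 0 in F(c) is c - x. Multiplied by \<open>e\<close> the
      value is divisible by p^k, and \<open>pdiv_of_int\<close> then removes
      \<open>e\<close>.\<close>
    have "of_int (poly F (c k)) * e = ((x - of_int (c k)) * e) * (of_int (-1) * (\<Prod>i\<in>{..<n}-{0}. of_int (c k) - conj i))"
      unfolding eq by (simp add: left_diff_distrib right_diff_distrib mult_ac)
    moreover have "pdiv p k (((x - of_int (c k)) * e) * (of_int (-1) * (\<Prod>i\<in>{..<n}-{0}. of_int (c k) - conj i)))"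
      by (intro pdiv_mult e(3) inR_mult inR_of_int inR_prod inR_diff cR) auto
    ultimately have "pdiv p k (of_int (poly F (c k)) * e)" by simp
    then show ?thesis by (rule pdiv_of_int[OF p(1) e(1,2)])
  qed
  then show ?thesis using h(2) unfolding c_def by (intro exI[of _ "\<lambda>k. fst (h k)"]) simp
qed

end

section \<open>Subfields of the complex numbers\<close>

lemma complex_ring_simps [simp]:
  "carrier complex_ring = UNIV" "x \<otimes>\<^bsub>complex_ring\<^esub> y = x * y" "x \<oplus>\<^bsub>complex_ring\<^esub> y = x + y"
  "\<one>\<^bsub>complex_ring\<^esub> = 1" "\<zero>\<^bsub>complex_ring\<^esub> = 0"
  by (simp_all add: ring_of_type_algebra_def)

lemma field_complex_ring: "field complex_ring"
  by (rule field_from_type_algebra)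

lemma complex_ring_uminus [simp]: "\<ominus>\<^bsub>complex_ring\<^esub> x = - x"
proof -
  interpret field complex_ring by (rule field_complex_ring)
  have "x \<oplus>\<^bsub>complex_ring\<^esub> (\<ominus>\<^bsub>complex_ring\<^esub> x) = \<zero>\<^bsub>complex_ring\<^esub>" by (rule r_neg) simp
  then show ?thesis by (simp add: add_eq_0_iff)
qed

lemma complex_ring_inv: "x \<noteq> 0 \<Longrightarrow> inv\<^bsub>complex_ring\<^esub> x = inverse x"
proof -
  interpret field complex_ring by (rule field_complex_ring)
  assume x: "x \<noteq> 0"
  then have "x \<in> Units complex_ring" using field_Units by simp
  then have "x \<otimes>\<^bsub>complex_ring\<^esub> (inv\<^bsub>complex_ring\<^esub> x) = \<one>\<^bsub>complex_ring\<^esub>" by (rule Units_r_inv)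
  then show ?thesis by (simp add: inverse_unique)
qed

text \<open>Homomorphisms into the complex numbers. Values outside \<open>L\<close> are arbitrary,
  so such maps are compared on \<open>L\<close> only.\<close>

definition chom :: "complex set \<Rightarrow> (complex \<Rightarrow> complex) \<Rightarrow> bool" where
  "chom L h \<longleftrightarrow> (\<forall>x\<in>L. \<forall>y\<in>L. h (x + y) = h x + h y \<and> h (x * y) = h x * h y) \<and> h 1 = 1"

lemma ring_hom_chom: "h \<in> ring_hom (field_of L) (field_of M) \<longleftrightarrow> chom L h \<and> h ` L \<subseteq> M"
  unfolding ring_hom_def chom_def by auto

lemma subfield_complex_iff:
  "subfield L complex_ring \<longleftrightarrow> 1 \<in> L \<and> (\<forall>x\<in>L. - x \<in> L) \<and> (\<forall>x\<in>L. \<forall>y\<in>L. x + y \<in> L \<and> x * y \<in> L)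
     \<and> (\<forall>x\<in>L. inverse x \<in> L)"
proof -
  interpret field complex_ring by (rule field_complex_ring)
  show ?thesis
  proof
    assume L: "subfield L complex_ring"
    note s = subringE[OF subfieldE(1)[OF L]]
    have "inverse x \<in> L" if "x \<in> L" for x
    proof (cases "x = 0")
      case False
      then have "inv\<^bsub>complex_ring\<^esub> x \<in> L" using subfield_m_inv(1)[OF L, of x] that by simp
      then show ?thesis using complex_ring_inv[OF False] by simp
    qed (use that in simp)
    then show "1 \<in> L \<and> (\<forall>x\<in>L. - x \<in> L) \<and> (\<forall>x\<in>L. \<forall>y\<in>L. x + y \<in> L \<and> x * y \<in> L) \<and> (\<forall>x\<in>L. inverse x \<in> L)"
      using s by simp
  next
    assume L: "1 \<in> L \<and> (\<forall>x\<in>L. - x \<in> L) \<and> (\<forall>x\<in>L. \<forall>y\<in>L. x + y \<in> L \<and> x * y \<in> L) \<and> (\<forall>x\<in>L. inverse x \<in> L)"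
    show "subfield L complex_ring"
    proof (rule subfieldI')
      show "subring L complex_ring" using L by (intro subringI) auto
      show "inv\<^bsub>complex_ring\<^esub> k \<in> L" if "k \<in> L - {\<zero>\<^bsub>complex_ring\<^esub>}" for k
        using L that complex_ring_inv[of k] by simp
    qed
  qed
qed

definition gen :: "complex set \<Rightarrow> complex set" where "gen S = generate_field complex_ring S"

lemma gen_subfield: "subfield (gen S) complex_ring"
  unfolding gen_def by (rule field.generate_field_is_subfield[OF field_complex_ring]) simp

lemma gen_incl: "x \<in> S \<Longrightarrow> x \<in> gen S"
  unfolding gen_def by (rule generate_field.incl)

lemma gen_induct [consumes 1, case_names one incl uminus inverse add mult]:
  assumes "x \<in> gen S" "P 1" "\<And>x. x \<in> S \<Longrightarrow> P x" "\<And>x. x \<in> gen S \<Longrightarrow> P x \<Longrightarrow> P (- x)"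
    "\<And>x. x \<in> gen S \<Longrightarrow> x \<noteq> 0 \<Longrightarrow> P x \<Longrightarrow> P (inverse x)"
    "\<And>x y. x \<in> gen S \<Longrightarrow> y \<in> gen S \<Longrightarrow> P x \<Longrightarrow> P y \<Longrightarrow> P (x + y)"
    "\<And>x y. x \<in> gen S \<Longrightarrow> y \<in> gen S \<Longrightarrow> P x \<Longrightarrow> P y \<Longrightarrow> P (x * y)"
  shows "P x"
  using assms(1) unfolding gen_def
proof (induction rule: generate_field.induct)
  case (m_inv h) then show ?case using assms(5)[of h] by (simp add: gen_def complex_ring_inv)
qed (use assms in \<open>simp_all add: gen_def\<close>)

lemma gen_mono: "S \<subseteq> T \<Longrightarrow> gen S \<subseteq> gen T"
  unfolding gen_def by (rule field.mono_generate_field[OF field_complex_ring]) simp_all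

lemma gen_least: "S \<subseteq> M \<Longrightarrow> subfield M complex_ring \<Longrightarrow> gen S \<subseteq> M"
  unfolding gen_def by (rule field.generate_field_min_subfield1[OF field_complex_ring]) simp_all

lemma subfield_closed:
  assumes "subfield L complex_ring"
  shows "0 \<in> L" "1 \<in> L" "x \<in> L \<Longrightarrow> - x \<in> L" "x \<in> L \<Longrightarrow> inverse x \<in> L"
    "x \<in> L \<Longrightarrow> y \<in> L \<Longrightarrow> x + y \<in> L" "x \<in> L \<Longrightarrow> y \<in> L \<Longrightarrow> x - y \<in> L"
    "x \<in> L \<Longrightarrow> y \<in> L \<Longrightarrow> x * y \<in> L" "x \<in> L \<Longrightarrow> y \<in> L \<Longrightarrow> x / y \<in> L"
proof -
  have L: "1 \<in> L" "\<And>x. x \<in> L \<Longrightarrow> - x \<in> L" "\<And>x y. x \<in> L \<Longrightarrow> y \<in> L \<Longrightarrow> x + y \<in> L"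
    "\<And>x y. x \<in> L \<Longrightarrow> y \<in> L \<Longrightarrow> x * y \<in> L" "\<And>x. x \<in> L \<Longrightarrow> inverse x \<in> L"
    using assms unfolding subfield_complex_iff by auto
  show "0 \<in> L" using L(3)[OF L(1) L(2)[OF L(1)]] by simp
  show "x \<in> L \<Longrightarrow> y \<in> L \<Longrightarrow> x - y \<in> L" using L(3)[of x "-y"] L(2) by simp
  show "x \<in> L \<Longrightarrow> y \<in> L \<Longrightarrow> x / y \<in> L" using L(4)[of x "inverse y"] L(5) by (simp add: divide_inverse)
qed (use assms in \<open>simp_all add: subfield_complex_iff\<close>)

lemma subfield_of_int: "subfield L complex_ring \<Longrightarrow> of_int k \<in> L"
  by (induction k rule: int_induct[where k = 0]) (simp_all add: subfield_closed)

lemma subfield_Rats: "subfield L complex_ring \<Longrightarrow> \<rat> \<subseteq> L"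
  by (auto elim!: Rats_cases' intro!: subfield_closed(8) subfield_of_int)

lemma subfield_evi: "subfield L complex_ring \<Longrightarrow> x \<in> L \<Longrightarrow> evi g x \<in> L"
  by (induction g) (simp_all add: subfield_closed subfield_of_int)

lemma Rats_subfield: "subfield \<rat> complex_ring"
  unfolding subfield_complex_iff by auto

context
  fixes L h assumes L: "subfield L complex_ring" and h: "chom L h"
begin

lemma chom_add: "x \<in> L \<Longrightarrow> y \<in> L \<Longrightarrow> h (x + y) = h x + h y"
  using h unfolding chom_def by blast

lemma chom_mult: "x \<in> L \<Longrightarrow> y \<in> L \<Longrightarrow> h (x * y) = h x * h y"
  using h unfolding chom_def by blast

lemma chom_1: "h 1 = 1" using h unfolding chom_def by blast

lemma chom_0: "h 0 = 0"
  using chom_add[of 0 0] subfield_closed(1)[OF L] by simp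

lemma chom_uminus: "x \<in> L \<Longrightarrow> h (- x) = - h x"
  using chom_add[of x "-x"] subfield_closed(3)[OF L] chom_0 by (simp add: eq_neg_iff_add_eq_0 add.commute)

lemma chom_inverse: "x \<in> L \<Longrightarrow> h (inverse x) = inverse (h x)"
proof (cases "x = 0")
  case False
  assume x: "x \<in> L"
  have "h (x * inverse x) = h x * h (inverse x)" by (rule chom_mult[OF x subfield_closed(4)[OF L x]])
  then have "h x * h (inverse x) = 1" using False chom_1 by simp
  then show ?thesis by (simp add: inverse_unique)
qed (simp add: chom_0)

lemma chom_divide: "x \<in> L \<Longrightarrow> y \<in> L \<Longrightarrow> h (x / y) = h x / h y"
  by (simp add: divide_inverse chom_mult chom_inverse subfield_closed(4)[OF L])

lemma chom_of_int: "h (of_int k) = of_int k"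
proof (induction k rule: int_induct[where k = 0])
  case (step2 i)
  have "h (of_int i + - 1) = h (of_int i) + h (- 1)"
    by (intro chom_add subfield_of_int[OF L] subfield_closed(2,3)[OF L])
  then show ?case using step2 chom_uminus[of 1] subfield_closed(2)[OF L] chom_1 by simp
next
  case (step1 i)
  have "h (of_int i + 1) = h (of_int i) + h 1"
    by (intro chom_add subfield_of_int[OF L] subfield_closed(2,3)[OF L])
  then show ?case using step1 chom_1 by simp
qed (simp add: chom_0)

lemma chom_Rats: "x \<in> \<rat> \<Longrightarrow> h x = x"
  by (auto elim!: Rats_cases' simp: chom_divide subfield_of_int[OF L] chom_of_int)

lemma chom_evi: "x \<in> L \<Longrightarrow> h (evi g x) = evi g (h x)"
  by (induction g) (simp_all add: chom_0 chom_add chom_mult chom_of_int subfield_of_int[OF L] subfield_evi[OF L] subfield_closed[OF L])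

lemma chom_inj: "inj_on h L"
proof (rule inj_onI)
  fix x y assume xy: "x \<in> L" "y \<in> L" "h x = h y"
  show "x = y"
  proof (rule ccontr)
    assume "x \<noteq> y"
    have "h ((x + - y) * inverse (x + - y)) = h (x + - y) * h (inverse (x + - y))"
      using xy by (intro chom_mult subfield_closed[OF L])
    moreover have "h (x + - y) = 0" using xy by (simp only: chom_add chom_uminus subfield_closed[OF L]) simp
    moreover have "(x + - y) * inverse (x + - y) = 1" using \<open>x \<noteq> y\<close> by (intro right_inverse) simp
    ultimately show False using chom_1 by simp
  qed
qed

end

lemma chom_compose:
  assumes "chom L h" "chom M k" "h ` L \<subseteq> M"
  shows "chom L (k \<circ> h)"
  using assms unfolding chom_def by (auto simp: image_subset_iff)

lemma chom_agree:
  assumes L: "subfield L complex_ring" and h: "chom L h" and k: "chom L k" and S: "S \<subseteq> L"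
    and e: "\<And>x. x \<in> S \<Longrightarrow> h x = k x" and x: "x \<in> gen S"
  shows "h x = k x"
proof -
  have sub: "gen S \<subseteq> L" by (rule gen_least[OF S L])
  show ?thesis using x
  proof (induction rule: gen_induct)
    case one then show ?case using h k by (simp add: chom_1[OF L])
  next
    case (uminus x) then show ?case using sub chom_uminus[OF L h] chom_uminus[OF L k] by auto
  next
    case (inverse x) then show ?case using sub chom_inverse[OF L h] chom_inverse[OF L k] by auto
  next
    case (add x y) then show ?case using sub chom_add[OF L h] chom_add[OF L k] by (metis subsetD)
  next
    case (mult x y) then show ?case using sub chom_mult[OF L h] chom_mult[OF L k] by (metis subsetD)
  qed (use e in simp)
qed

lemma chom_image_gen:
  assumes L: "subfield L complex_ring" and h: "chom L h" and S: "S \<subseteq> L"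
    and M: "subfield M complex_ring" and e: "\<And>x. x \<in> S \<Longrightarrow> h x \<in> M" and x: "x \<in> gen S"
  shows "h x \<in> M"
proof -
  have sub: "gen S \<subseteq> L" by (rule gen_least[OF S L])
  show ?thesis using x
  proof (induction rule: gen_induct)
    case one then show ?case using subfield_closed[OF M] chom_1[OF L h] by simp
  next
    case (uminus x) then show ?case using sub chom_uminus[OF L h] subfield_closed(3)[OF M] by auto
  next
    case (inverse x) then show ?case using sub chom_inverse[OF L h] subfield_closed(4)[OF M] by auto
  next
    case (add x y) then show ?case using sub chom_add[OF L h] subfield_closed(5)[OF M] by (metis subsetD)
  next
    case (mult x y) then show ?case using sub chom_mult[OF L h] subfield_closed(7)[OF M] by (metis subsetD)
  qed (use e in simp)
qed

text \<open>List polynomials have the highest coefficient first, hence the reversal.\<close>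

lemma eval_complex_ring: "ring.eval complex_ring cs x = poly (Poly (rev cs)) x"
proof -
  interpret field complex_ring by (rule field_complex_ring)
  have pow: "x [^]\<^bsub>complex_ring\<^esub> k = x ^ k" for k :: nat
    by (induction k) (simp_all add: mult.commute)
  show ?thesis
  proof (induction cs)
    case (Cons c cs)
    have "eval (c # cs) x = c * x ^ length cs + eval cs x" by (simp add: pow)
    then show ?case using Cons by (simp add: Poly_append poly_monom add.commute)
  qed simp
qed

lemma algebraic_over_Rats:
  assumes "g \<noteq> 0" "evi g x = 0"
  shows "((ring.algebraic complex_ring) over \<rat>) x"
proof -
  interpret field complex_ring by (rule field_complex_ring)
  define P where "P = (map_poly of_int g :: complex poly)"
  have P: "P \<noteq> 0" using assms by (simp add: P_def map_poly_eq_0_iff)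
  define cs where "cs = rev (coeffs P)"
  have "cs \<noteq> []" using P by (simp add: cs_def)
  have "hd cs = last (coeffs P)" using P by (simp add: cs_def hd_rev)
  then have "hd cs \<noteq> 0" using P by (simp add: last_coeffs_eq_coeff_degree)
  moreover have "set cs \<subseteq> \<rat>"
  proof -
    have "set (coeffs P) \<subseteq> range (poly.coeff P)" by (auto simp: range_coeff)
    moreover have "poly.coeff P i \<in> \<rat>" for i by (simp add: P_def coeff_map_poly)
    ultimately show ?thesis by (auto simp: cs_def)
  qed
  ultimately have "cs \<in> carrier (\<rat>[X]\<^bsub>complex_ring\<^esub>)"
    using \<open>cs \<noteq> []\<close> by (simp add: univ_poly_def polynomial_def)
  moreover have "eval cs x = \<zero>\<^bsub>complex_ring\<^esub>"
    unfolding eval_complex_ring using assms(2) by (simp add: cs_def P_def evi_def)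
  ultimately show ?thesis using \<open>cs \<noteq> []\<close> by (intro algebraicI)
qed

text \<open>Reduces questions about an infinite compositum to finitely many generators.\<close>

lemma gen_finite:
  assumes x: "x \<in> gen (a ` S)"
  shows "\<exists>I. finite I \<and> I \<subseteq> S \<and> x \<in> gen (a ` I)"
  using x
proof (induction rule: gen_induct)
  case one show ?case by (intro exI[of _ "{}"]) (simp add: subfield_closed[OF gen_subfield])
next
  case (incl x)
  then obtain q where "q \<in> S" "x = a q" by blast
  then show ?case by (intro exI[of _ "{q}"]) (simp add: gen_incl)
next
  case (uminus x) then show ?case using subfield_closed(3)[OF gen_subfield] by blast
next
  case (inverse x) then show ?case using subfield_closed(4)[OF gen_subfield] by blast
next
  case (add x y)
  then obtain I J where "finite I" "I \<subseteq> S" "x \<in> gen (a ` I)" "finite J" "J \<subseteq> S" "y \<in> gen (a ` J)" by blast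
  then show ?case using gen_mono[of "a ` I" "a ` (I \<union> J)"] gen_mono[of "a ` J" "a ` (I \<union> J)"]
    by (intro exI[of _ "I \<union> J"]) (auto intro!: subfield_closed(5)[OF gen_subfield])
next
  case (mult x y)
  then obtain I J where "finite I" "I \<subseteq> S" "x \<in> gen (a ` I)" "finite J" "J \<subseteq> S" "y \<in> gen (a ` J)" by blast
  then show ?case using gen_mono[of "a ` I" "a ` (I \<union> J)"] gen_mono[of "a ` J" "a ` (I \<union> J)"]
    by (intro exI[of _ "I \<union> J"]) (auto intro!: subfield_closed(7)[OF gen_subfield])
qed

section \<open>The Galois group of a compositum\<close>

lemma rat_poly_algebraic:
  assumes "P \<noteq> 0" "ev P x = 0"
  shows "algebraic x"
proof -
  obtain d g where d: "d > 0" "smult (of_int d) P = ratp g" using rat_poly_clear_denominators by blast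
  have "g \<noteq> 0" using d assms(1) by auto
  have "ev (smult (of_int d) P) x = 0" using assms(2) by simp
  then have "evi g x = 0" unfolding d(2) by simp
  then show ?thesis using \<open>g \<noteq> 0\<close> unfolding evi_def
    by (intro algebraicI[of "map_poly of_int g"]) (auto simp: coeff_map_poly map_poly_eq_0_iff)
qed

text \<open>An irreducible polynomial with root \<open>x\<close> is a constant times the minimal
  polynomial of \<open>x\<close>, so its roots are among those of any rational polynomial vanishing
  at \<open>x\<close>. One split polynomial for each element is enough.\<close>

lemma galois_over_QI:
  assumes L: "subfield L complex_ring"
    and split: "\<And>x. x \<in> L \<Longrightarrow> \<exists>P. P \<noteq> 0 \<and> ev P x = 0 \<and> (\<forall>z. ev P z = 0 \<longrightarrow> z \<in> L)"
  shows "galois_over_Q L"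
  unfolding galois_over_Q_def
proof (intro conjI L ballI allI impI)
  fix x assume "x \<in> L"
  then show "algebraic x" using split rat_poly_algebraic by blast
next
  fix Q :: "rat poly" and z :: complex
  assume Q: "irreducible Q \<and> (\<exists>x\<in>L. poly (map_poly of_rat Q) x = 0)" and z: "poly (map_poly of_rat Q) z = 0"
  then obtain x where x: "x \<in> L" "ev Q x = 0" unfolding ev_def by blast
  obtain P where P: "P \<noteq> 0" "ev P x = 0" "\<And>z. ev P z = 0 \<Longrightarrow> z \<in> L" using split[OF x(1)] by blast
  obtain m where m: "is_min_poly m x" using is_min_poly_exists[OF P(1,2)] by blast
  then have "m dvd Q" "m dvd P" using x P unfolding is_min_poly_def by auto
  then obtain u v where u: "Q = m * u" and v: "P = m * v" by (metis dvdE)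
  have "\<not> is_unit m" using is_min_poly_degree_pos[OF m] by (auto simp: is_unit_poly_iff)
  then have "is_unit u" using Q u irreducible_multD by blast
  then obtain c where c: "u = [:c:]" "c \<noteq> 0" by (auto simp: is_unit_poly_iff dvd_field_iff)
  have "ev Q z = 0" using z by (simp add: ev_def)
  then have "ev m z = 0" unfolding u c using c(2) by (simp del: mult_pCons_right)
  then show "z \<in> L" using P(3) v by simp
qed

text \<open>Interface between the arithmetic of the blocks and Galois theory. \<open>A q c\<close>
  is the conjugate with label \<open>c\<close> of the q-th generator, \<open>G\<close> over the
  derivative of \<open>F\<close> translates labels, \<open>emb\<close> expresses independence of the
  generators and \<open>split\<close> normality.\<close>

locale galois_data =
  fixes A :: "nat \<Rightarrow> nat \<Rightarrow> complex" and F :: "nat \<Rightarrow> int poly" and G :: "nat \<Rightarrow> nat \<Rightarrow> int poly"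
    and L :: "complex set"
  assumes L_def: "L = gen ((\<lambda>q. A q 0) ` Lambda)"
    and A_inj: "\<And>q. q \<in> Lambda \<Longrightarrow> inj_on (A q) {..<q - 1}"
    and F_nonzero: "\<And>q. q \<in> Lambda \<Longrightarrow> F q \<noteq> 0"
    and F_root: "\<And>q z. q \<in> Lambda \<Longrightarrow> evi (F q) z = 0 \<longleftrightarrow> (\<exists>c<q - 1. z = A q c)"
    and dF: "\<And>q j. q \<in> Lambda \<Longrightarrow> j < q - 1 \<Longrightarrow> evi (pderiv (F q)) (A q j) \<noteq> 0"
    and G: "\<And>q s j. q \<in> Lambda \<Longrightarrow> j < q - 1 \<Longrightarrow>
      evi (G q s) (A q j) = A q ((s + j) mod (q - 1)) * evi (pderiv (F q)) (A q j)"
    and emb: "\<And>c. (\<And>q. q \<in> Lambda \<Longrightarrow> c q < q - 1) \<Longrightarrow>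
      \<exists>h. chom L h \<and> (\<forall>q\<in>Lambda. h (A q 0) = A q (c q))"
    and split: "\<And>x. x \<in> L \<Longrightarrow> \<exists>P. P \<noteq> 0 \<and> ev P x = 0 \<and> (\<forall>z. ev P z = 0 \<longrightarrow> z \<in> L)"
begin

lemma L: "subfield L complex_ring" unfolding L_def by (rule gen_subfield)

lemma gens: "(\<lambda>q. A q 0) ` Lambda \<subseteq> L" by (auto simp: L_def intro: gen_incl)

lemma Lambda_gt: "q \<in> Lambda \<Longrightarrow> q - 1 > 0"
  unfolding Lambda_def using prime_gt_1_nat by auto

lemma A_quotient:
  assumes "q \<in> Lambda" "j < q - 1"
  shows "A q ((s + j) mod (q - 1)) = evi (G q s) (A q j) / evi (pderiv (F q)) (A q j)"
  using G[OF assms] dF[OF assms] by simp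

lemma A_in_L:
  assumes q: "q \<in> Lambda" and j: "j < q - 1"
  shows "A q j \<in> L"
proof -
  have "A q 0 \<in> L" using gens q by blast
  then have "evi (G q j) (A q 0) / evi (pderiv (F q)) (A q 0) \<in> L"
    by (intro subfield_closed(8)[OF L] subfield_evi[OF L])
  then show ?thesis using A_quotient[OF q Lambda_gt[OF q], of j] j by simp
qed

text \<open>\<open>A q s\<close> is a rational function of \<open>A q 0\<close> over the integers,
  and the same function takes \<open>A q j\<close> to the translated label. The image of one
  generator thus decides the action on its conjugates.\<close>

lemma chom_shift:
  assumes h: "chom L h" and q: "q \<in> Lambda" and j: "j < q - 1" "h (A q 0) = A q j" and s: "s < q - 1"
  shows "h (A q s) = A q ((s + j) mod (q - 1))"
proof -
  have A0: "A q 0 \<in> L" using gens q by blast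
  have "A q s = evi (G q s) (A q 0) / evi (pderiv (F q)) (A q 0)"
    using A_quotient[OF q Lambda_gt[OF q], of s] s by simp
  then have "h (A q s) = h (evi (G q s) (A q 0)) / h (evi (pderiv (F q)) (A q 0))"
    using chom_divide[OF L h] subfield_evi[OF L A0] by simp
  also have "\<dots> = evi (G q s) (A q j) / evi (pderiv (F q)) (A q j)"
    using chom_evi[OF L h A0] j by simp
  also have "\<dots> = A q ((s + j) mod (q - 1))" using A_quotient[OF q j(1)] by simp
  finally show ?thesis .
qed

lemma chom_index:
  assumes h: "chom L h" and q: "q \<in> Lambda"
  shows "\<exists>!j. j < q - 1 \<and> h (A q 0) = A q j"
proof -
  have A0: "A q 0 \<in> L" using gens q by blast
  have "evi (F q) (A q 0) = 0" using F_root[OF q] Lambda_gt[OF q] by blast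
  then have "evi (F q) (h (A q 0)) = 0" using chom_evi[OF L h A0, of "F q"] chom_0[OF L h] by simp
  then obtain j where j: "j < q - 1" "h (A q 0) = A q j" using F_root[OF q] by blast
  moreover have "j' = j" if "j' < q - 1" "h (A q 0) = A q j'" for j'
    using A_inj[OF q] j that unfolding inj_on_def by simp
  ultimately show ?thesis by blast
qed

definition idx :: "(complex \<Rightarrow> complex) \<Rightarrow> nat \<Rightarrow> nat" where
  "idx h q = (THE j. j < q - 1 \<and> h (A q 0) = A q j)"

lemma idx: "chom L h \<Longrightarrow> q \<in> Lambda \<Longrightarrow> idx h q < q - 1"
    "chom L h \<Longrightarrow> q \<in> Lambda \<Longrightarrow> h (A q 0) = A q (idx h q)"
  using theI'[OF chom_index, of h q] unfolding idx_def by blast+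

lemma idx_unique: "chom L h \<Longrightarrow> q \<in> Lambda \<Longrightarrow> j < q - 1 \<Longrightarrow> h (A q 0) = A q j \<Longrightarrow> idx h q = j"
  using chom_index idx by blast

lemma chom_eqI:
  assumes "chom L h" "chom L k" "\<And>q. q \<in> Lambda \<Longrightarrow> h (A q 0) = k (A q 0)" "x \<in> L"
  shows "h x = k x"
  using chom_agree[OF L assms(1,2) gens] assms(3,4) unfolding L_def by blast

lemma chom_into: "chom L h \<Longrightarrow> x \<in> L \<Longrightarrow> h x \<in> L"
proof -
  assume h: "chom L h" and x: "x \<in> L"
  have "h y \<in> L" if "y \<in> (\<lambda>q. A q 0) ` Lambda" for y
    using that idx[OF h] A_in_L by fastforce
  then show "h x \<in> L" using chom_image_gen[OF L h gens L] x unfolding L_def by blast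
qed

section \<open>The automorphism group as a product of cyclic groups\<close>

abbreviation "GQ \<equiv> Gal L \<rat>"

lemma Gal_carrier: "carrier (Gal L K) = {h \<in> Bij L. chom L h \<and> (\<forall>x\<in>K. h x = x)}"
  unfolding Gal_def ring_hom_chom by (auto simp: Bij_def bij_betw_def)

lemma GQ_carrier: "carrier GQ = {h \<in> Bij L. chom L h}"
  unfolding Gal_carrier using chom_Rats[OF L] by blast

lemma GQ_mult: "h \<in> Bij L \<Longrightarrow> k \<in> Bij L \<Longrightarrow> h \<otimes>\<^bsub>Gal L K\<^esub> k = compose L h k"
  unfolding Gal_def BijGroup_def by simp

definition coords :: "(complex \<Rightarrow> complex) \<Rightarrow> nat \<Rightarrow> int" where
  "coords h = (\<lambda>q\<in>Lambda. int (idx h q))"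

lemma idx_compose:
  assumes h: "chom L h" and k: "chom L k" and q: "q \<in> Lambda"
  shows "idx (h \<circ> k) q = (idx h q + idx k q) mod (q - 1)"
proof (rule idx_unique)
  show "chom L (h \<circ> k)" using chom_compose[OF k h] chom_into[OF k] by blast
  show "(h \<circ> k) (A q 0) = A q ((idx h q + idx k q) mod (q - 1))"
    using idx[OF k q] chom_shift[OF h q idx[OF h q] idx(1)[OF k q]] by (simp add: add.commute)
qed (use q Lambda_gt[OF q] in auto)

lemma chom_cong: "(\<And>x. x \<in> L \<Longrightarrow> h x = k x) \<Longrightarrow> chom L h \<longleftrightarrow> chom L k"
proof -
  have "chom L h" if e: "\<And>x. x \<in> L \<Longrightarrow> h x = k x" and k: "chom L k" for h k
    unfolding chom_def
  proof (intro conjI ballI)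
    fix x y assume xy: "x \<in> L" "y \<in> L"
    have "x + y \<in> L" "x * y \<in> L" using xy by (simp_all add: subfield_closed[OF L])
    then show "h (x + y) = h x + h y" "h (x * y) = h x * h y"
      using xy chom_add[OF L k] chom_mult[OF L k] by (simp_all add: e)
  qed (use e chom_1[OF L k] subfield_closed(2)[OF L] in simp)
  from this[of h k] this[of k h] show "(\<And>x. x \<in> L \<Longrightarrow> h x = k x) \<Longrightarrow> chom L h \<longleftrightarrow> chom L k" by auto
qed

lemma idx_cong: "h (A q 0) = k (A q 0) \<Longrightarrow> idx h q = idx k q"
  unfolding idx_def by simp

text \<open>\<open>emb\<close> provides only an embedding. The one with the opposite labels inverts
  it on the generators, hence on \<open>L\<close>, and this gives bijectivity.\<close>

lemma Gal_exists:
  assumes c: "\<And>q. q \<in> Lambda \<Longrightarrow> c q < q - 1"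
  shows "\<exists>h\<in>carrier GQ. \<forall>q\<in>Lambda. idx h q = c q"
proof -
  obtain h where h: "chom L h" "\<And>q. q \<in> Lambda \<Longrightarrow> h (A q 0) = A q (c q)" using emb[OF c] by blast
  define d where "d = (\<lambda>q. (q - 1 - c q) mod (q - 1))"
  have "d q < q - 1" if "q \<in> Lambda" for q using Lambda_gt[OF that] by (simp add: d_def)
  then obtain k where k: "chom L k" "\<And>q. q \<in> Lambda \<Longrightarrow> k (A q 0) = A q (d q)" using emb by metis
  have ih: "idx h q = c q" if "q \<in> Lambda" for q using idx_unique[OF h(1) that c[OF that] h(2)[OF that]] .
  have ik: "idx k q = d q" if "q \<in> Lambda" for q
    using idx_unique[OF k(1) that _ k(2)[OF that]] Lambda_gt[OF that] by (simp add: d_def)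
  have cd: "(c q + d q) mod (q - 1) = 0" if "q \<in> Lambda" for q
    using c[OF that] by (simp add: d_def mod_add_right_eq)
  have hk: "chom L (h \<circ> k)" "chom L (k \<circ> h)"
    using chom_compose[OF k(1) h(1)] chom_compose[OF h(1) k(1)] chom_into[OF k(1)] chom_into[OF h(1)] by blast+
  have idL: "chom L id" by (simp add: chom_def)
  have 1: "h (k x) = x" if "x \<in> L" for x
  proof -
    have "(h \<circ> k) x = id x"
    proof (rule chom_eqI[OF hk(1) idL _ that])
      fix q assume q: "q \<in> Lambda"
      have "(h \<circ> k) (A q 0) = A q (idx (h \<circ> k) q)" by (rule idx(2)[OF hk(1) q])
      also have "idx (h \<circ> k) q = 0" using idx_compose[OF h(1) k(1) q] ih[OF q] ik[OF q] cd[OF q] by simp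
      finally show "(h \<circ> k) (A q 0) = id (A q 0)" by simp
    qed
    then show ?thesis by simp
  qed
  have 2: "k (h x) = x" if "x \<in> L" for x
  proof -
    have "(k \<circ> h) x = id x"
    proof (rule chom_eqI[OF hk(2) idL _ that])
      fix q assume q: "q \<in> Lambda"
      have "(k \<circ> h) (A q 0) = A q (idx (k \<circ> h) q)" by (rule idx(2)[OF hk(2) q])
      also have "idx (k \<circ> h) q = 0" using idx_compose[OF k(1) h(1) q] ih[OF q] ik[OF q] cd[OF q] by (simp add: add.commute)
      finally show "(k \<circ> h) (A q 0) = id (A q 0)" by simp
    qed
    then show ?thesis by simp
  qed
  have "bij_betw h L L" using 1 2 chom_into[OF k(1)] chom_into[OF h(1)]
    by (intro bij_betw_byWitness[of _ k]) auto
  \<comment> \<open>\<open>Bij\<close> contains only functions that are undefined outside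
    \<open>L\<close>.\<close>
  define r where "r = restrict h L"
  have "r \<in> Bij L" using \<open>bij_betw h L L\<close> unfolding Bij_def r_def by (simp add: bij_betw_restrict_eq)
  moreover have "chom L r" using h(1) chom_cong[of r h] by (simp add: r_def)
  moreover have "idx r q = c q" if "q \<in> Lambda" for q
    using ih[OF that] idx_cong[of r q h] gens that by (auto simp: r_def)
  ultimately show ?thesis unfolding GQ_carrier by blast
qed

lemma Gal_eqI:
  assumes h: "h \<in> carrier GQ" and k: "k \<in> carrier GQ" and e: "\<And>q. q \<in> Lambda \<Longrightarrow> idx h q = idx k q"
  shows "h = k"
proof (rule extensionalityI)
  show "h \<in> extensional L" "k \<in> extensional L" using h k unfolding GQ_carrier Bij_def by auto
  fix x assume x: "x \<in> L"
  have c: "chom L h" "chom L k" using h k unfolding GQ_carrier by auto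
  show "h x = k x" by (rule chom_eqI[OF c _ x]) (simp add: idx(2)[OF c(1)] idx(2)[OF c(2)] e)
qed

lemma GQ_mult_closed:
  assumes h: "h \<in> carrier GQ" and k: "k \<in> carrier GQ"
  shows "h \<otimes>\<^bsub>GQ\<^esub> k \<in> carrier GQ" "q \<in> Lambda \<Longrightarrow> idx (h \<otimes>\<^bsub>GQ\<^esub> k) q = (idx h q + idx k q) mod (q - 1)"
proof -
  have c: "chom L h" "chom L k" "h \<in> Bij L" "k \<in> Bij L" using h k unfolding GQ_carrier by auto
  have m: "h \<otimes>\<^bsub>GQ\<^esub> k = compose L h k" by (rule GQ_mult[OF c(3,4)])
  have "chom L (compose L h k)"
    using chom_cong[of "compose L h k" "h \<circ> k"] chom_compose[OF c(2,1)] chom_into[OF c(2)] by (auto simp: compose_def)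
  then show "h \<otimes>\<^bsub>GQ\<^esub> k \<in> carrier GQ" unfolding m GQ_carrier using compose_Bij[OF c(3,4)] by simp
  assume q: "q \<in> Lambda"
  have "idx (compose L h k) q = idx (h \<circ> k) q" using gens q by (intro idx_cong) (auto simp: compose_def)
  then show "idx (h \<otimes>\<^bsub>GQ\<^esub> k) q = (idx h q + idx k q) mod (q - 1)"
    unfolding m using idx_compose[OF c(1,2) q] by simp
qed

text \<open>The moduli are positive; \<open>integer_mod_group 0\<close> would be the group of all
  integers.\<close>

lemma G_Lambda_carrier: "carrier G_Lambda = (\<Pi>\<^sub>E q\<in>Lambda. {0..<int (q - 1)})"
  unfolding G_Lambda_def carrier_product_group
proof (rule PiE_cong)
  fix q assume "q \<in> Lambda"
  then show "carrier (integer_mod_group (q - 1)) = {0..<int (q - 1)}"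
    using Lambda_gt[of q] by (simp add: carrier_integer_mod_group)
qed

lemma coords_in: "h \<in> carrier GQ \<Longrightarrow> coords h \<in> carrier G_Lambda"
  unfolding G_Lambda_carrier coords_def GQ_carrier using idx by (auto simp: nat_less_iff)

lemma coords_surj:
  assumes c: "c \<in> carrier G_Lambda"
  shows "\<exists>h\<in>carrier GQ. coords h = c"
proof -
  have "nat (c q) < q - 1" "c q \<ge> 0" if "q \<in> Lambda" for q
    using c that unfolding G_Lambda_carrier by (force simp: PiE_iff)+
  then obtain h where h: "h \<in> carrier GQ" "\<And>q. q \<in> Lambda \<Longrightarrow> idx h q = nat (c q)"
    using Gal_exists[of "\<lambda>q. nat (c q)"] by blast
  have "coords h = c"
  proof (rule extensionalityI)
    show "coords h \<in> extensional Lambda" by (simp add: coords_def)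
    show "c \<in> extensional Lambda" using c unfolding G_Lambda_carrier by (auto simp: PiE_def)
    show "coords h q = c q" if "q \<in> Lambda" for q
      using h(2)[OF that] \<open>\<And>q. q \<in> Lambda \<Longrightarrow> c q \<ge> 0\<close>[OF that] that by (simp add: coords_def)
  qed
  then show ?thesis using h(1) by blast
qed

lemma coords_eq_iff:
  assumes "h \<in> carrier GQ" "k \<in> carrier GQ"
  shows "coords h = coords k \<longleftrightarrow> h = k"
proof
  assume e: "coords h = coords k"
  have "idx h q = idx k q" if "q \<in> Lambda" for q
    using fun_cong[OF e, of q] that by (simp add: coords_def)
  then show "h = k" by (rule Gal_eqI[OF assms])
qed simp

lemma coords_iso: "coords \<in> iso GQ G_Lambda"
proof -
  have "coords \<in> hom GQ G_Lambda"
  proof (rule homI)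
    fix h k assume hk: "h \<in> carrier GQ" "k \<in> carrier GQ"
    show "coords (h \<otimes>\<^bsub>GQ\<^esub> k) = coords h \<otimes>\<^bsub>G_Lambda\<^esub> coords k"
      unfolding G_Lambda_def mult_product_group
      by (rule ext) (use GQ_mult_closed(2)[OF hk] in \<open>simp add: coords_def zmod_int\<close>)
  qed (rule coords_in)
  moreover have "bij_betw coords (carrier GQ) (carrier G_Lambda)"
  proof (rule bij_betw_imageI)
    show "inj_on coords (carrier GQ)" by (rule inj_onI) (simp only: coords_eq_iff)
    show "coords ` carrier GQ = carrier G_Lambda"
    proof
      show "coords ` carrier GQ \<subseteq> carrier G_Lambda" using coords_in by blast
      show "carrier G_Lambda \<subseteq> coords ` carrier GQ"
      proof
        fix c assume "c \<in> carrier G_Lambda"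
        then obtain h where "h \<in> carrier GQ" "coords h = c" using coords_surj[of c] by blast
        then show "c \<in> coords ` carrier GQ" by blast
      qed
    qed
  qed
  ultimately show ?thesis by (simp add: iso_def)
qed

section \<open>The Krull topology in coordinates\<close>

definition Gens :: "(complex \<Rightarrow> complex) set set" where
  "Gens = {\<sigma> <#\<^bsub>GQ\<^esub> carrier (Gal L K) |\<sigma> K. \<sigma> \<in> carrier GQ \<and> subfield K complex_ring \<and> K \<subseteq> L \<and>
          ring.finite_dimension complex_ring \<rat> K}"

lemma id_in_Gal: "K \<subseteq> L \<Longrightarrow> (\<lambda>x\<in>L. x) \<in> carrier (Gal L K)"
  unfolding Gal_carrier using id_Bij[of L] chom_cong[of "\<lambda>x\<in>L. x" id] by (auto simp: chom_def)

lemma Gal_subset: "carrier (Gal L K) \<subseteq> carrier GQ"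
  unfolding GQ_carrier unfolding Gal_carrier by blast

lemma coset_in:
  assumes s: "\<sigma> \<in> carrier GQ"
  shows "\<sigma> <#\<^bsub>GQ\<^esub> carrier (Gal L K) \<subseteq> carrier GQ"
  using GQ_mult_closed(1)[OF s] Gal_subset[of K] by (auto simp: l_coset_def)

lemma coset_self:
  assumes s: "\<sigma> \<in> carrier GQ" and K: "K \<subseteq> L"
  shows "\<sigma> \<in> \<sigma> <#\<^bsub>GQ\<^esub> carrier (Gal L K)"
proof -
  have b: "\<sigma> \<in> Bij L" using s unfolding GQ_carrier by simp
  have "\<sigma> \<otimes>\<^bsub>GQ\<^esub> (\<lambda>x\<in>L. x) = \<sigma>"
    unfolding GQ_mult[OF b id_Bij] by (rule compose_Id[OF Bij_imp_funcset[OF b] Bij_imp_extensional[OF b]])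
  then show ?thesis using id_in_Gal[OF K] unfolding l_coset_def by force
qed

lemma coset_iff:
  assumes s: "\<sigma> \<in> carrier GQ" and t: "\<tau> \<in> carrier GQ" and K: "K \<subseteq> L"
  shows "\<tau> \<in> \<sigma> <#\<^bsub>GQ\<^esub> carrier (Gal L K) \<longleftrightarrow> (\<forall>x\<in>K. \<tau> x = \<sigma> x)"
proof
  have b: "\<sigma> \<in> Bij L" "chom L \<sigma>" using s unfolding GQ_carrier by auto
  assume "\<tau> \<in> \<sigma> <#\<^bsub>GQ\<^esub> carrier (Gal L K)"
  then obtain g where g: "g \<in> carrier (Gal L K)" "\<tau> = \<sigma> \<otimes>\<^bsub>GQ\<^esub> g" unfolding l_coset_def by blast
  then have "\<tau> = compose L \<sigma> g" using GQ_mult[OF b(1)] unfolding Gal_carrier by simp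
  then show "\<forall>x\<in>K. \<tau> x = \<sigma> x" using g(1) K unfolding Gal_carrier by (auto simp: compose_def)
next
  assume e: "\<forall>x\<in>K. \<tau> x = \<sigma> x"
  have b: "\<sigma> \<in> Bij L" "chom L \<sigma>" "\<tau> \<in> Bij L" "chom L \<tau>" using s t unfolding GQ_carrier by auto
  \<comment> \<open>Coordinates of the quotient of \<open>\<tau>\<close> by \<open>\<sigma>\<close>;
    the summand q - 1 avoids truncated subtraction.\<close>
  define c where "c = (\<lambda>q. (idx \<tau> q + (q - 1 - idx \<sigma> q)) mod (q - 1))"
  obtain g where g: "g \<in> carrier GQ" "\<And>q. q \<in> Lambda \<Longrightarrow> idx g q = c q"
    using Gal_exists[of c] Lambda_gt by (auto simp: c_def)
  have "\<sigma> \<otimes>\<^bsub>GQ\<^esub> g = \<tau>"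
  proof (rule Gal_eqI[OF GQ_mult_closed(1)[OF s g(1)] t])
    fix q assume q: "q \<in> Lambda"
    have i: "idx \<sigma> q < q - 1" "idx \<tau> q < q - 1" using idx(1) b q by blast+
    have "idx (\<sigma> \<otimes>\<^bsub>GQ\<^esub> g) q = (idx \<sigma> q + (idx \<tau> q + (q - 1 - idx \<sigma> q))) mod (q - 1)"
      using GQ_mult_closed(2)[OF s g(1) q] g(2)[OF q] by (simp add: c_def mod_add_right_eq)
    also have "idx \<sigma> q + (idx \<tau> q + (q - 1 - idx \<sigma> q)) = idx \<tau> q + (q - 1)" using i by simp
    also have "\<dots> mod (q - 1) = idx \<tau> q" unfolding mod_add_self2 using i(2) by (rule mod_less)
    finally show "idx (\<sigma> \<otimes>\<^bsub>GQ\<^esub> g) q = idx \<tau> q" .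
  qed
  moreover have "g \<in> carrier (Gal L K)"
  proof -
    have gb: "g \<in> Bij L" "chom L g" using g(1) unfolding GQ_carrier by auto
    have "g x = x" if x: "x \<in> K" for x
    proof -
      have xL: "x \<in> L" using x K by blast
      have "\<tau> x = \<sigma> (g x)" using GQ_mult[OF b(1) gb(1), of \<rat>] \<open>\<sigma> \<otimes>\<^bsub>GQ\<^esub> g = \<tau>\<close> xL by (auto simp: compose_def)
      then have "\<sigma> (g x) = \<sigma> x" using e x by simp
      then show ?thesis using chom_inj[OF L b(2)] chom_into[OF gb(2) xL] xL unfolding inj_on_def by blast
    qed
    then show ?thesis unfolding Gal_carrier using gb by simp
  qed
  ultimately show "\<tau> \<in> \<sigma> <#\<^bsub>GQ\<^esub> carrier (Gal L K)" unfolding l_coset_def by blast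
qed

lemma topspace_krull: "topspace (krull_topology L) = carrier GQ"
proof -
  have "\<Union>Gens = carrier GQ"
  proof
    show "\<Union>Gens \<subseteq> carrier GQ" unfolding Gens_def using coset_in by blast
    show "carrier GQ \<subseteq> \<Union>Gens"
    proof
      fix \<sigma> assume s: "\<sigma> \<in> carrier GQ"
      interpret field complex_ring by (rule field_complex_ring)
      have "finite_dimension \<rat> \<rat>" using dimension_one[OF Rats_subfield] by (rule finite_dimensionI)
      then have "\<sigma> <#\<^bsub>GQ\<^esub> carrier (Gal L \<rat>) \<in> Gens"
        unfolding Gens_def using s Rats_subfield subfield_Rats[OF L] by blast
      then show "\<sigma> \<in> \<Union>Gens" using coset_self[OF s subfield_Rats[OF L]] by blast
    qed
  qed
  then show ?thesis unfolding krull_topology_def Gens_def[symmetric] by simp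
qed

lemma finite_support:
  assumes x: "x \<in> L"
  shows "\<exists>I. finite I \<and> I \<subseteq> Lambda \<and> (\<forall>h k. chom L h \<longrightarrow> chom L k \<longrightarrow> (\<forall>q\<in>I. idx h q = idx k q) \<longrightarrow> h x = k x)"
proof -
  obtain I where I: "finite I" "I \<subseteq> Lambda" "x \<in> gen ((\<lambda>q. A q 0) ` I)"
    using gen_finite[OF x[unfolded L_def]] by blast
  have "h x = k x" if hk: "chom L h" "chom L k" "\<forall>q\<in>I. idx h q = idx k q" for h k
  proof (rule chom_agree[OF L hk(1,2) _ _ I(3)])
    show "(\<lambda>q. A q 0) ` I \<subseteq> L" using gens I(2) by blast
    show "h y = k y" if "y \<in> (\<lambda>q. A q 0) ` I" for y
      using that I(2) hk(3) idx(2)[OF hk(1)] idx(2)[OF hk(2)] by force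
  qed
  then show ?thesis using I by blast
qed

text \<open>A finite-dimensional field is spanned by finitely many elements, each of which depends
  on finitely many coordinates. This is what makes Krull-open sets open in the product
  topology.\<close>

lemma finite_support_field:
  assumes K: "subfield K complex_ring" "K \<subseteq> L" "ring.finite_dimension complex_ring \<rat> K"
  shows "\<exists>I. finite I \<and> I \<subseteq> Lambda \<and>
    (\<forall>h k. chom L h \<longrightarrow> chom L k \<longrightarrow> (\<forall>q\<in>I. idx h q = idx k q) \<longrightarrow> (\<forall>x\<in>K. h x = k x))"
proof -
  interpret field complex_ring by (rule field_complex_ring)
  obtain n where "dimension n \<rat> K" using K(3) by blast
  then obtain Us where Us: "set Us \<subseteq> carrier complex_ring" "Span \<rat> Us = K"
    using exists_base[OF Rats_subfield] by blast
  have "set Us \<subseteq> K" using Span_base_incl[OF Rats_subfield Us(1)] Us(2) by simp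
  then have UL: "set Us \<subseteq> L" using K(2) by blast
  have "\<exists>I. \<forall>u\<in>L. finite (I u) \<and> I u \<subseteq> Lambda \<and>
      (\<forall>h k. chom L h \<longrightarrow> chom L k \<longrightarrow> (\<forall>q\<in>I u. idx h q = idx k q) \<longrightarrow> h u = k u)"
    by (rule bchoice) (use finite_support in blast)
  then obtain I where I: "\<And>u. u \<in> L \<Longrightarrow> finite (I u)" "\<And>u. u \<in> L \<Longrightarrow> I u \<subseteq> Lambda"
      "\<And>u h k. u \<in> L \<Longrightarrow> chom L h \<Longrightarrow> chom L k \<Longrightarrow> (\<forall>q\<in>I u. idx h q = idx k q) \<Longrightarrow> h u = k u" by metis
  define J where "J = (\<Union>u\<in>set Us. I u)"
  have "h x = k x" if hk: "chom L h" "chom L k" "\<forall>q\<in>J. idx h q = idx k q" and x: "x \<in> K" for h k x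
  proof -
    have u: "h u = k u" if "u \<in> set Us" for u
      using I(3)[OF _ hk(1,2), of u] hk(3) that UL by (auto simp: J_def)
    have "x \<in> L \<and> h x = k x" if "x \<in> Span \<rat> Vs" "set Vs \<subseteq> set Us" for Vs x
      using that
    proof (induction Vs arbitrary: x)
      case Nil then show ?case by (simp add: subfield_closed[OF L] chom_0[OF L hk(1)] chom_0[OF L hk(2)])
    next
      case (Cons v Vs)
      then have "x \<in> line_extension \<rat> v (Span \<rat> Vs)" by simp
      then obtain r y where ry: "r \<in> \<rat>" "y \<in> Span \<rat> Vs" "x = r * v + y"
        unfolding line_extension_mem_iff by auto
      have y: "y \<in> L" "h y = k y" using Cons ry by auto
      have v: "v \<in> L" "h v = k v" "r \<in> L" using Cons u UL ry subfield_Rats[OF L] by auto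
      have "h r = k r" using chom_Rats[OF L hk(1) ry(1)] chom_Rats[OF L hk(2) ry(1)] by simp
      then show ?case unfolding ry(3)
        using y v by (simp add: subfield_closed[OF L] chom_add[OF L hk(1)] chom_add[OF L hk(2)] chom_mult[OF L hk(1)] chom_mult[OF L hk(2)])
    qed
    then show ?thesis using x Us(2) by blast
  qed
  moreover have "finite J" unfolding J_def using I(1) UL by (intro finite_UN_I) auto
  moreover have "J \<subseteq> Lambda" unfolding J_def using I(2) UL by blast
  ultimately show ?thesis by blast
qed

text \<open>Krull neighbourhoods contain cylinders. The induction follows the generation of open
  sets from cosets; for a coset the finite support of its field defines the cylinder.\<close>

lemma open_nbhd:
  assumes "openin (krull_topology L) S" "\<sigma> \<in> S"
  shows "\<exists>I. finite I \<and> I \<subseteq> Lambda \<and> (\<forall>\<tau>\<in>carrier GQ. (\<forall>q\<in>I. idx \<tau> q = idx \<sigma> q) \<longrightarrow> \<tau> \<in> S)"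
proof -
  have "generate_topology_on Gens S"
    using assms(1) unfolding krull_topology_def Gens_def[symmetric] by (rule openin_topology_generated_by)
  then show ?thesis using assms(2)
  proof (induction)
    case (Int a b)
    then obtain I J where I: "finite I" "I \<subseteq> Lambda" "\<forall>\<tau>\<in>carrier GQ. (\<forall>q\<in>I. idx \<tau> q = idx \<sigma> q) \<longrightarrow> \<tau> \<in> a"
      and J: "finite J" "J \<subseteq> Lambda" "\<forall>\<tau>\<in>carrier GQ. (\<forall>q\<in>J. idx \<tau> q = idx \<sigma> q) \<longrightarrow> \<tau> \<in> b" by blast
    then show ?case by (intro exI[of _ "I \<union> J"]) auto
  next
    case (UN Z)
    then obtain k where "k \<in> Z" "\<sigma> \<in> k" by blast
    then show ?case using UN.IH by (meson UnionI)
  next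
    case (Basis s)
    then obtain \<rho> K where s: "s = \<rho> <#\<^bsub>GQ\<^esub> carrier (Gal L K)" "\<rho> \<in> carrier GQ"
        and K: "subfield K complex_ring" "K \<subseteq> L" "ring.finite_dimension complex_ring \<rat> K"
      unfolding Gens_def by blast
    have sg: "\<sigma> \<in> carrier GQ" using Basis.prems coset_in[OF s(2)] s(1) by blast
    have e: "\<forall>x\<in>K. \<sigma> x = \<rho> x" using Basis.prems coset_iff[OF s(2) sg K(2)] s(1) by simp
    obtain I where I: "finite I" "I \<subseteq> Lambda"
      "\<And>h k. chom L h \<Longrightarrow> chom L k \<Longrightarrow> (\<forall>q\<in>I. idx h q = idx k q) \<Longrightarrow> (\<forall>x\<in>K. h x = k x)"
      using finite_support_field[OF K] by blast
    have "\<tau> \<in> s" if t: "\<tau> \<in> carrier GQ" "\<forall>q\<in>I. idx \<tau> q = idx \<sigma> q" for \<tau>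
    proof -
      have "\<forall>x\<in>K. \<tau> x = \<sigma> x" using I(3)[of \<tau> \<sigma>] t sg unfolding GQ_carrier by blast
      then show ?thesis unfolding s(1) coset_iff[OF s(2) t(1) K(2)] using e by simp
    qed
    then show ?case using I by blast
  qed simp
qed

text \<open>On the cosets belonging to this field the coordinate at \<open>q\<close> is constant,
  which gives the continuity of that coordinate.\<close>

lemma simple_ext:
  assumes q: "q \<in> Lambda"
  obtains K where "subfield K complex_ring" "K \<subseteq> L" "ring.finite_dimension complex_ring \<rat> K" "A q 0 \<in> K"
proof -
  interpret field complex_ring by (rule field_complex_ring)
  have alg: "(algebraic over \<rat>) (A q 0)"
    using algebraic_over_Rats[OF F_nonzero[OF q]] F_root[OF q] Lambda_gt[OF q] by blast
  define K where "K = finite_extension \<rat> [A q 0]"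
  have "subfield K complex_ring" unfolding K_def
    using alg by (intro finite_extension_is_subfield[OF Rats_subfield]) auto
  moreover have "finite_dimension \<rat> K" unfolding K_def
    using alg by (intro finite_extension_finite_dimension(1)[OF Rats_subfield]) auto
  moreover have "A q 0 \<in> K" unfolding K_def
    using finite_extension_mem[OF subfieldE(1)[OF Rats_subfield], of "[A q 0]"] by simp
  moreover have "K \<subseteq> L" unfolding K_def
    using finite_extension_subring_incl[OF subfieldE(1)[OF L] subfield_Rats[OF L], of "[A q 0]"] gens q by auto
  ultimately show thesis using that by blast
qed

lemma coords_continuous: "continuous_map (krull_topology L) G_Lambda_topology coords"
  unfolding G_Lambda_topology_def continuous_map_componentwise
proof (intro conjI ballI)
  show "coords ` topspace (krull_topology L) \<subseteq> extensional Lambda"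
    by (auto simp: coords_def)
  fix q assume q: "q \<in> Lambda"
  show "continuous_map (krull_topology L) (discrete_topology (carrier (integer_mod_group (q - 1)))) (\<lambda>h. coords h q)"
    unfolding continuous_map_def
  proof (intro conjI allI impI)
    show "(\<lambda>h. coords h q) \<in> topspace (krull_topology L) \<rightarrow> topspace (discrete_topology (carrier (integer_mod_group (q - 1))))"
      unfolding topspace_krull using coords_in q unfolding G_Lambda_def by fastforce
    fix U
    show "openin (krull_topology L) {h \<in> topspace (krull_topology L). coords h q \<in> U}"
    proof (subst openin_subopen, intro ballI)
      fix \<sigma> assume "\<sigma> \<in> {h \<in> topspace (krull_topology L). coords h q \<in> U}"
      then have s: "\<sigma> \<in> carrier GQ" "coords \<sigma> q \<in> U" unfolding topspace_krull by auto
      obtain K where K: "subfield K complex_ring" "K \<subseteq> L" "ring.finite_dimension complex_ring \<rat> K" "A q 0 \<in> K"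
        using simple_ext[OF q] .
      define T where "T = \<sigma> <#\<^bsub>GQ\<^esub> carrier (Gal L K)"
      have "T \<in> Gens" unfolding T_def Gens_def using s K by blast
      then have "openin (krull_topology L) T" unfolding krull_topology_def Gens_def[symmetric]
        by (rule topology_generated_by_Basis)
      moreover have "\<sigma> \<in> T" unfolding T_def by (rule coset_self[OF s(1) K(2)])
      moreover have Tc: "coords \<tau> q = coords \<sigma> q \<and> \<tau> \<in> carrier GQ" if "\<tau> \<in> T" for \<tau>
      proof
        show t: "\<tau> \<in> carrier GQ" using that coset_in[OF s(1)] unfolding T_def by blast
        have "\<tau> (A q 0) = \<sigma> (A q 0)" using that coset_iff[OF s(1) t K(2)] K(4) unfolding T_def by simp
        then have "idx \<tau> q = idx \<sigma> q" by (rule idx_cong)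
        then show "coords \<tau> q = coords \<sigma> q" unfolding coords_def by simp
      qed
      moreover have "T \<subseteq> {h \<in> topspace (krull_topology L). coords h q \<in> U}"
      proof
        fix \<tau> assume "\<tau> \<in> T"
        from Tc[OF this] show "\<tau> \<in> {h \<in> topspace (krull_topology L). coords h q \<in> U}"
          using s(2) unfolding topspace_krull by simp
      qed
      ultimately show "\<exists>T. openin (krull_topology L) T \<and> \<sigma> \<in> T \<and> T \<subseteq> {h \<in> topspace (krull_topology L). coords h q \<in> U}"
        by (intro exI[of _ T] conjI)
    qed
  qed
qed

lemma topspace_G: "topspace G_Lambda_topology = carrier G_Lambda"
  unfolding G_Lambda_topology_def G_Lambda_def by simp

lemma coords_open: "open_map (krull_topology L) G_Lambda_topology coords"
  unfolding open_map_def
proof (intro allI impI)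
  fix S assume S: "openin (krull_topology L) S"
  have SG: "S \<subseteq> carrier GQ" using openin_subset[OF S] topspace_krull by simp
  show "openin G_Lambda_topology (coords ` S)"
  proof (subst openin_subopen, intro ballI)
    fix y assume "y \<in> coords ` S"
    then obtain \<sigma> where s: "\<sigma> \<in> S" "y = coords \<sigma>" by blast
    obtain I where I: "finite I" "I \<subseteq> Lambda" "\<And>\<tau>. \<tau> \<in> carrier GQ \<Longrightarrow> (\<forall>q\<in>I. idx \<tau> q = idx \<sigma> q) \<Longrightarrow> \<tau> \<in> S"
      using open_nbhd[OF S s(1)] by blast
    define W where "W = (\<lambda>q. if q \<in> I then {y q} else carrier (integer_mod_group (q - 1)))"
    define T where "T = Pi\<^sub>E Lambda W"
    have yG: "y \<in> carrier G_Lambda" using coords_in s SG by blast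
    have yq: "y q \<in> carrier (integer_mod_group (q - 1))" if "q \<in> Lambda" for q
      using yG that unfolding G_Lambda_def by (auto simp: PiE_iff)
    have "openin G_Lambda_topology T"
      unfolding G_Lambda_topology_def T_def
      unfolding openin_PiE_gen
    proof (intro disjI2 conjI ballI)
      show "finite {q \<in> Lambda. W q \<noteq> topspace (discrete_topology (carrier (integer_mod_group (q - 1))))}"
        by (rule finite_subset[OF _ I(1)]) (auto simp: W_def)
      show "openin (discrete_topology (carrier (integer_mod_group (q - 1)))) (W q)" if "q \<in> Lambda" for q
        using yq[OF that] by (simp add: W_def)
    qed
    moreover have "y \<in> T" using yG yq unfolding T_def W_def G_Lambda_def by (auto simp: PiE_iff)
    moreover have "T \<subseteq> coords ` S"
    proof
      fix z assume z: "z \<in> T"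
      have zW: "z q \<in> W q" if "q \<in> Lambda" for q using z that unfolding T_def by blast
      have "z \<in> carrier G_Lambda"
        using z yq zW unfolding T_def G_Lambda_def carrier_product_group by (force simp: PiE_iff W_def split: if_splits)
      then obtain \<tau> where t: "\<tau> \<in> carrier GQ" "coords \<tau> = z" using coords_surj by blast
      have "idx \<tau> q = idx \<sigma> q" if "q \<in> I" for q
      proof -
        have "q \<in> Lambda" using that I by blast
        then have "coords \<tau> q = coords \<sigma> q" using zW[of q] that s(2) t(2) by (simp add: W_def)
        then show ?thesis using \<open>q \<in> Lambda\<close> by (simp add: coords_def)
      qed
      then have "\<tau> \<in> S" using I(3)[OF t(1)] by blast
      then show "z \<in> coords ` S" using t(2) by blast
    qed
    ultimately show "\<exists>T. openin G_Lambda_topology T \<and> y \<in> T \<and> T \<subseteq> coords ` S" by blast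
  qed
qed

lemma realisation: "realisation_over_Q L G_Lambda G_Lambda_topology"
  unfolding realisation_over_Q_def
proof (intro conjI bexI[OF _ coords_iso])
  show "galois_over_Q L" by (rule galois_over_QI[OF L split])
  show "homeomorphic_map (krull_topology L) G_Lambda_topology coords"
  proof (rule bijective_open_imp_homeomorphic_map[OF coords_continuous coords_open])
    show "coords ` topspace (krull_topology L) = topspace G_Lambda_topology"
      unfolding topspace_krull topspace_G using coords_in coords_surj by blast
    show "inj_on coords (topspace (krull_topology L))"
      unfolding topspace_krull inj_on_def using coords_eq_iff by blast
  qed
qed

end

section \<open>Homomorphisms out of cyclotomic fields\<close>

text \<open>Evaluation of a type-class polynomial in a field given as a record, with coefficients
  sent through \<open>\<rho>\<close>. For the complex numbers and \<open>of_rat\<close> it is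
  \<open>ev\<close>.\<close>

definition hev :: "('k, 'm) ring_scheme \<Rightarrow> ('a :: comm_ring_1 \<Rightarrow> 'k) \<Rightarrow> 'a poly \<Rightarrow> 'k \<Rightarrow> 'k" where
  "hev K \<rho> f y = fold_coeffs (\<lambda>c a. \<rho> c \<oplus>\<^bsub>K\<^esub> y \<otimes>\<^bsub>K\<^esub> a) f \<zero>\<^bsub>K\<^esub>"

text \<open>The domain is a subset \<open>C\<close>, so that two kinds of coefficient map are
  covered: a map on all rationals, and a homomorphism that is meaningful only on a subfield of the
  complex numbers.\<close>

locale coeff_hom = K: field K for K :: "('k, 'm) ring_scheme" (structure) +
  fixes C :: "'a :: comm_ring_1 set" and \<rho> :: "'a \<Rightarrow> 'k"
  assumes C0: "0 \<in> C" and C1: "1 \<in> C"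
    and C_add: "\<And>x y. x \<in> C \<Longrightarrow> y \<in> C \<Longrightarrow> x + y \<in> C"
    and C_mult: "\<And>x y. x \<in> C \<Longrightarrow> y \<in> C \<Longrightarrow> x * y \<in> C"
    and C_minus: "\<And>x. x \<in> C \<Longrightarrow> - x \<in> C"
    and rho_closed: "\<And>x. x \<in> C \<Longrightarrow> \<rho> x \<in> carrier K"
    and rho_add: "\<And>x y. x \<in> C \<Longrightarrow> y \<in> C \<Longrightarrow> \<rho> (x + y) = \<rho> x \<oplus> \<rho> y"
    and rho_mult: "\<And>x y. x \<in> C \<Longrightarrow> y \<in> C \<Longrightarrow> \<rho> (x * y) = \<rho> x \<otimes> \<rho> y"
    and rho_1: "\<rho> 1 = \<one>"
begin

lemma rho_0: "\<rho> 0 = \<zero>"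
proof -
  have "\<rho> 0 \<oplus> \<rho> 0 = \<rho> 0 \<oplus> \<zero>" using rho_add[OF C0 C0] rho_closed[OF C0] by simp
  then show ?thesis using rho_closed[OF C0] by simp
qed

lemma rho_minus: "x \<in> C \<Longrightarrow> \<rho> (- x) = \<ominus> \<rho> x"
proof -
  assume x: "x \<in> C"
  have "\<rho> (- x) \<oplus> \<rho> x = \<zero>" using rho_add[OF C_minus[OF x] x] rho_0 by simp
  then show ?thesis using rho_closed x C_minus[OF x] by (simp add: K.minus_equality)
qed

definition Cp :: "'a poly \<Rightarrow> bool" where "Cp f \<longleftrightarrow> (\<forall>i. coeff f i \<in> C)"

lemma Cp_pCons: "Cp (pCons c f) \<longleftrightarrow> c \<in> C \<and> Cp f"
  unfolding Cp_def by (auto simp: coeff_pCons split: nat.splits)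

lemma hev_0 [simp]: "hev K \<rho> 0 y = \<zero>" by (simp add: hev_def)

lemma hev_pCons: "y \<in> carrier K \<Longrightarrow> hev K \<rho> (pCons c f) y = \<rho> c \<oplus> y \<otimes> hev K \<rho> f y"
  by (cases "c = 0 \<and> f = 0") (auto simp: hev_def rho_0)

lemma hev_closed: "y \<in> carrier K \<Longrightarrow> Cp f \<Longrightarrow> hev K \<rho> f y \<in> carrier K"
  by (induction f) (auto simp: hev_pCons Cp_pCons rho_closed)

lemma hev_const: "y \<in> carrier K \<Longrightarrow> c \<in> C \<Longrightarrow> hev K \<rho> [:c:] y = \<rho> c"
  by (simp add: hev_pCons rho_closed)

lemma hev_add: "y \<in> carrier K \<Longrightarrow> Cp f \<Longrightarrow> Cp g \<Longrightarrow> hev K \<rho> (f + g) y = hev K \<rho> f y \<oplus> hev K \<rho> g y"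
proof (induction f g rule: poly_induct2)
  case (pCons a p b q)
  then have c: "a \<in> C" "b \<in> C" "Cp p" "Cp q" by (simp_all add: Cp_pCons)
  note cl = rho_closed[OF c(1)] rho_closed[OF c(2)] hev_closed[OF pCons.prems(1) c(3)] hev_closed[OF pCons.prems(1) c(4)]
  show ?case using pCons.IH[OF pCons.prems(1) c(3,4)] pCons.prems(1) c cl
    by (simp add: hev_pCons rho_add K.r_distr K.a_ac)
qed simp

lemma hev_smult: "y \<in> carrier K \<Longrightarrow> Cp f \<Longrightarrow> c \<in> C \<Longrightarrow> hev K \<rho> (Polynomial.smult c f) y = \<rho> c \<otimes> hev K \<rho> f y"
proof (induction f)
  case (pCons a p)
  then have c: "a \<in> C" "Cp p" by (simp_all add: Cp_pCons)
  note cl = rho_closed[OF c(1)] hev_closed[OF pCons.prems(1) c(2)] rho_closed[OF pCons.prems(3)]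
  show ?case using pCons.IH[OF pCons.prems(1) c(2) pCons.prems(3)] pCons.prems c cl
    by (simp add: hev_pCons rho_mult K.r_distr K.m_lcomm)
qed (simp add: rho_closed)

lemma Cp_add: "Cp f \<Longrightarrow> Cp g \<Longrightarrow> Cp (f + g)" unfolding Cp_def by (simp add: C_add)
lemma Cp_smult: "c \<in> C \<Longrightarrow> Cp f \<Longrightarrow> Cp (Polynomial.smult c f)" unfolding Cp_def by (simp add: C_mult)
lemma Cp_0 [simp]: "Cp 0" unfolding Cp_def by (simp add: C0)

lemma hev_diff:
  assumes y: "y \<in> carrier K" and f: "Cp f" and g: "Cp g"
  shows "hev K \<rho> (f - g) y = hev K \<rho> f y \<oplus> \<ominus> hev K \<rho> g y"
proof -
  have "hev K \<rho> (f + Polynomial.smult (-1) g) y = hev K \<rho> f y \<oplus> \<rho> (-1) \<otimes> hev K \<rho> g y"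
    using C_minus[OF C1] by (simp only: hev_add[OF y f Cp_smult[OF _ g]] hev_smult[OF y g])
  then show ?thesis using hev_closed[OF y g] by (simp add: rho_minus[OF C1] rho_1 K.l_minus)
qed

lemma Cp_mult: "Cp f \<Longrightarrow> Cp g \<Longrightarrow> Cp (f * g)"
proof (induction f)
  case (pCons a p)
  then show ?case by (simp add: Cp_pCons mult_pCons_left) (intro Cp_add Cp_smult, auto simp: Cp_pCons C0)
qed simp

lemma hev_mult: "y \<in> carrier K \<Longrightarrow> Cp f \<Longrightarrow> Cp g \<Longrightarrow> hev K \<rho> (f * g) y = hev K \<rho> f y \<otimes> hev K \<rho> g y"
proof (induction f)
  case (pCons a p)
  then have c: "a \<in> C" "Cp p" by (simp_all add: Cp_pCons)
  have y: "y \<in> carrier K" and g: "Cp g" by fact+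
  have pg: "Cp (p * g)" "Cp (pCons 0 (p * g))" "Cp (Polynomial.smult a g)"
    using c g by (simp_all add: Cp_mult Cp_pCons C0 Cp_smult)
  have "hev K \<rho> (pCons a p * g) y = hev K \<rho> (Polynomial.smult a g) y \<oplus> hev K \<rho> (pCons 0 (p * g)) y"
    unfolding mult_pCons_left by (rule hev_add[OF y pg(3,2)])
  also have "\<dots> = \<rho> a \<otimes> hev K \<rho> g y \<oplus> y \<otimes> (hev K \<rho> p y \<otimes> hev K \<rho> g y)"
    using pCons.IH[OF y c(2) g] y c g pg by (simp add: hev_smult hev_pCons rho_0 hev_closed)
  finally show ?case using y c g rho_closed[OF c(1)] hev_closed[OF y c(2)] hev_closed[OF y g]
    by (simp add: hev_pCons K.l_distr K.m_assoc)
qed (simp add: hev_closed)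

lemma hev_pow: "y \<in> carrier K \<Longrightarrow> hev K \<rho> (monom 1 n) y = y [^] n"
proof (induction n)
  case 0
  then show ?case using hev_const[of y 1] C1 rho_1 by (simp add: monom_0)
next
  case (Suc n)
  then show ?case by (simp add: monom_Suc hev_pCons rho_0 K.m_comm)
qed

lemma hev_pcompose_monom:
  "y \<in> carrier K \<Longrightarrow> Cp f \<Longrightarrow> hev K \<rho> (pcompose f (monom 1 n)) y = hev K \<rho> f (y [^] n)"
proof (induction f)
  case (pCons a p)
  then have c: "a \<in> C" "Cp p" by (simp_all add: Cp_pCons)
  have y: "y \<in> carrier K" by fact
  have m: "Cp (monom 1 n)" unfolding Cp_def using C0 C1 by simp
  have pm: "Cp (pcompose p (monom 1 n))" using c(2)
  proof (induction p)
    case (pCons a p)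
    then show ?case by (simp add: pcompose_pCons Cp_pCons) (intro Cp_add Cp_mult m, auto simp: Cp_pCons)
  qed (simp add: pcompose_0)
  have "hev K \<rho> (pcompose (pCons a p) (monom 1 n)) y = hev K \<rho> [:a:] y \<oplus> hev K \<rho> (monom 1 n * pcompose p (monom 1 n)) y"
    unfolding pcompose_pCons using c by (intro hev_add y Cp_mult m pm) (simp add: Cp_pCons)
  also have "\<dots> = \<rho> a \<oplus> y [^] n \<otimes> hev K \<rho> p (y [^] n)"
    using pCons.IH[OF y c(2)] by (simp add: hev_const[OF y c(1)] hev_mult[OF y m pm] hev_pow[OF y])
  finally show ?case using y by (simp add: hev_pCons)
qed simp

lemma Cp_prod: "(\<And>i. i \<in> J \<Longrightarrow> Cp (g i)) \<Longrightarrow> Cp (\<Prod>i\<in>J. g i)"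
  by (induction J rule: infinite_finite_induct) (simp_all add: Cp_mult one_pCons Cp_pCons C1)

lemma hev_prod_linear:
  assumes y: "y \<in> carrier K" and "finite I" "\<And>i. i \<in> I \<Longrightarrow> a i \<in> C" "hev K \<rho> (\<Prod>i\<in>I. [:- a i, 1:]) y = \<zero>"
  shows "\<exists>i\<in>I. y = \<rho> (a i)"
  using assms(2-4)
proof (induction I)
  case empty
  then show ?case using hev_const[OF y C1] rho_1 by (simp add: one_pCons[symmetric])
next
  case (insert j I)
  have lin: "Cp [:- a i, 1:]" if "i \<in> insert j I" for i
    using insert.prems(1)[OF that] C_minus C1 by (simp add: Cp_pCons)
  have Ip: "Cp (\<Prod>i\<in>I. [:- a i, 1:])" by (rule Cp_prod) (simp add: lin)
  have aj: "a j \<in> C" using insert.prems by simp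
  have "hev K \<rho> ([:- a j, 1:] * (\<Prod>i\<in>I. [:- a i, 1:])) y = \<zero>" using insert by simp
  then have "hev K \<rho> [:- a j, 1:] y \<otimes> hev K \<rho> (\<Prod>i\<in>I. [:- a i, 1:]) y = \<zero>"
    using hev_mult[OF y lin Ip, of j] by simp
  then consider "hev K \<rho> [:- a j, 1:] y = \<zero>" | "hev K \<rho> (\<Prod>i\<in>I. [:- a i, 1:]) y = \<zero>"
    using K.integral[OF _ hev_closed[OF y lin] hev_closed[OF y Ip], of j] by auto
  then show ?case
  proof cases
    case 1
    then have "\<ominus> \<rho> (a j) \<oplus> y = \<zero>" using y aj by (simp add: hev_pCons rho_minus rho_1)
    then have "y = \<rho> (a j)" using y rho_closed[OF aj] by (metis K.add.inv_closed K.minus_equality K.minus_minus K.add.m_comm)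
    then show ?thesis by blast
  next
    case 2
    then show ?thesis using insert by auto
  qed
qed

end

lemma hev_complex: "hev complex_ring of_rat f y = ev f y"
proof -
  interpret coeff_hom complex_ring UNIV "of_rat :: rat \<Rightarrow> complex"
    by (intro coeff_hom.intro field_complex_ring coeff_hom_axioms.intro) (simp_all add: of_rat_add of_rat_mult)
  show ?thesis by (induction f) (simp_all add: hev_pCons)
qed

definition cyc :: "nat \<Rightarrow> complex set" where "cyc N = range (\<lambda>h. ev h (zeta N))"

lemma cyc_subfield: "N > 0 \<Longrightarrow> subfield (cyc N) complex_ring"
proof -
  assume N: "N > 0"
  obtain g h where g: "is_min_poly (ratp g) (zeta N)" using root_of_unity_min_poly[OF zeta_power_self[OF N] N] .
  have mem: "ev f (zeta N) \<in> cyc N" for f unfolding cyc_def by (rule rangeI)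
  have inv: "inverse x \<in> cyc N" if "x \<in> cyc N" for x
  proof (cases "x = 0")
    case False
    obtain f where "x = ev f (zeta N)" using \<open>x \<in> cyc N\<close> unfolding cyc_def by blast
    then show ?thesis using False is_min_poly_inverse[OF g, of f] unfolding cyc_def by (auto intro: sym)
  qed (use that in simp)
  have "x + y \<in> cyc N" "x * y \<in> cyc N" "- x \<in> cyc N" if "x \<in> cyc N" "y \<in> cyc N" for x y
  proof -
    obtain f where "x = ev f (zeta N)" using \<open>x \<in> cyc N\<close> unfolding cyc_def by blast
    moreover obtain g where "y = ev g (zeta N)" using \<open>y \<in> cyc N\<close> unfolding cyc_def by blast
    ultimately show "x + y \<in> cyc N" "x * y \<in> cyc N" "- x \<in> cyc N"
      using mem[of "f + g"] mem[of "f * g"] mem[of "- f"] by simp_all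
  qed
  then show ?thesis unfolding subfield_complex_iff using inv mem[of 1] by simp
qed

lemma cyc_evi: "evi f (zeta N ^ a) \<in> cyc N"
proof -
  have "evi f (zeta N ^ a) = ev (pcompose (ratp f) (monom 1 a)) (zeta N)" by simp
  then show ?thesis unfolding cyc_def by blast
qed

locale rat_hom = coeff_hom K UNIV \<rho> for K :: "('k, 'm) ring_scheme" (structure) and \<rho> :: "rat \<Rightarrow> 'k"
begin

lemma Cp_UNIV [simp]: "Cp f" unfolding Cp_def by simp

text \<open>\<open>\<eta>\<close> satisfies every rational relation of \<open>zeta N\<close>. This
  is exactly what makes the substitution of \<open>\<eta>\<close> for \<open>zeta N\<close> well
  defined.\<close>

definition is_conj :: "nat \<Rightarrow> 'k \<Rightarrow> bool" where
  "is_conj N \<eta> \<longleftrightarrow> \<eta> \<in> carrier K \<and> (\<forall>h. ev h (zeta N) = 0 \<longrightarrow> hev K \<rho> h \<eta> = \<zero>)"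

text \<open>Composition with X^a turns relations of \<open>zeta N\<close> into relations of
  \<open>zeta N\<close>, by conjugation in the complex numbers; evaluated at \<open>\<eta>\<close>
  they are the relations for its a-th power.\<close>

lemma is_conj_power:
  assumes "N > 0" "coprime a N" "is_conj N \<eta>"
  shows "is_conj N (\<eta> [^] a)"
proof -
  have e: "\<eta> \<in> carrier K" using assms(3) by (simp add: is_conj_def)
  have "hev K \<rho> h (\<eta> [^] a) = \<zero>" if "ev h (zeta N) = 0" for h
  proof -
    have "ev (pcompose h (monom 1 a)) (zeta N) = 0" using zeta_conjugate[OF assms(1,2) that] by simp
    then have "hev K \<rho> (pcompose h (monom 1 a)) \<eta> = \<zero>" using assms(3) unfolding is_conj_def by blast
    then show ?thesis using hev_pcompose_monom[OF e] by simp
  qed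
  then show ?thesis using e unfolding is_conj_def by simp
qed

text \<open>The choice of the polynomial does not matter once \<open>is_conj N \<eta>\<close>
  holds.\<close>

definition phi :: "nat \<Rightarrow> 'k \<Rightarrow> complex \<Rightarrow> 'k" where
  "phi N \<eta> x = hev K \<rho> (SOME h. ev h (zeta N) = x) \<eta>"

lemma phi_ev:
  assumes "is_conj N \<eta>"
  shows "phi N \<eta> (ev h (zeta N)) = hev K \<rho> h \<eta>"
proof -
  have e: "\<eta> \<in> carrier K" using assms by (simp add: is_conj_def)
  define g where "g = (SOME g. ev g (zeta N) = ev h (zeta N))"
  have g: "ev g (zeta N) = ev h (zeta N)" unfolding g_def by (rule someI[of _ h]) simp
  then have "ev (g - h) (zeta N) = 0" by simp
  then have "hev K \<rho> (g - h) \<eta> = \<zero>" using assms unfolding is_conj_def by blast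
  then have "hev K \<rho> g \<eta> \<oplus> \<ominus> hev K \<rho> h \<eta> = \<zero>"
    using hev_diff[OF e, of g h] by simp
  then have "hev K \<rho> g \<eta> = hev K \<rho> h \<eta>"
    using hev_closed[OF e, of g] hev_closed[OF e, of h] by (metis Cp_UNIV K.add.inv_closed K.minus_equality K.minus_minus)
  then show ?thesis unfolding phi_def g_def .
qed

lemma phi_hom:
  assumes "is_conj N \<eta>"
  shows "phi N \<eta> \<in> ring_hom (field_of (cyc N)) K"
proof -
  have e: "\<eta> \<in> carrier K" using assms by (simp add: is_conj_def)
  note p = phi_ev[OF assms]
  show ?thesis
  proof (rule ring_hom_memI)
    fix x y assume "x \<in> carrier (field_of (cyc N))" "y \<in> carrier (field_of (cyc N))"
    then obtain g h where gh: "x = ev g (zeta N)" "y = ev h (zeta N)" unfolding cyc_def by auto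
    show "phi N \<eta> x \<in> carrier K" unfolding gh p using hev_closed[OF e] by simp
    have "phi N \<eta> (x * y) = phi N \<eta> x \<otimes> phi N \<eta> y" "phi N \<eta> (x + y) = phi N \<eta> x \<oplus> phi N \<eta> y"
      unfolding gh ev_simps(3,4)[symmetric] p using e by (simp_all add: hev_mult hev_add)
    then show "phi N \<eta> (x \<otimes>\<^bsub>field_of (cyc N)\<^esub> y) = phi N \<eta> x \<otimes> phi N \<eta> y"
      "phi N \<eta> (x \<oplus>\<^bsub>field_of (cyc N)\<^esub> y) = phi N \<eta> x \<oplus> phi N \<eta> y" by simp_all
  next
    have "phi N \<eta> 1 = hev K \<rho> 1 \<eta>" using p[of 1] by simp
    also have "\<dots> = \<one>" using hev_const[OF e, of 1] rho_1 by (simp add: one_pCons)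
    finally show "phi N \<eta> \<one>\<^bsub>field_of (cyc N)\<^esub> = \<one>" by simp
  qed
qed

lemma phi_evi: 
  assumes "is_conj N \<eta>"
  shows "phi N \<eta> (evi f (zeta N ^ a)) = hev K \<rho> (ratp f) (\<eta> [^] a)"
proof -
  have e: "\<eta> \<in> carrier K" using assms by (simp add: is_conj_def)
  have "phi N \<eta> (ev (pcompose (ratp f) (monom 1 a)) (zeta N)) = hev K \<rho> (ratp f) (\<eta> [^] a)"
    unfolding phi_ev[OF assms] using hev_pcompose_monom[OF e] by simp
  then show ?thesis by simp
qed

lemma hom_of_rat:
  assumes L: "subfield L complex_ring" and h: "h \<in> ring_hom (field_of L) K"
  shows "coeff_hom K L h" "h (of_int k) = \<rho> (of_int k)"
proof -
  note s = subfield_closed[OF L]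
  show c: "coeff_hom K L h"
    using ring_hom_memE[OF h] s by (intro coeff_hom.intro K.field_axioms coeff_hom_axioms.intro) auto
  interpret h: coeff_hom K L h by (rule c)
  have m1: "h (- 1) = \<rho> (- 1)" using h.rho_minus[OF s(2)] rho_minus[of 1] rho_1 h.rho_1 by simp
  show "h (of_int k) = \<rho> (of_int k)"
  proof (induction k rule: int_induct[where k = 0])
    case base then show ?case by (simp add: rho_0 h.rho_0)
  next
    case (step1 i)
    then show ?case using h.rho_add[OF subfield_of_int[OF L, of i] s(2)] rho_add[of "of_int i" 1] rho_1 h.rho_1 by simp
  next
    case (step2 i)
    then show ?case using h.rho_add[OF subfield_of_int[OF L, of i] s(3)[OF s(2)]] rho_add[of "of_int i" "-1"] m1 by simp
  qed
qed

lemma hev_hom_int: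
  assumes L: "subfield L complex_ring" and h: "h \<in> ring_hom (field_of L) K" and y: "y \<in> carrier K"
  shows "hev K h (map_poly of_int f) y = hev K \<rho> (ratp f) y"
proof -
  interpret h: coeff_hom K L h by (rule hom_of_rat(1)[OF L h])
  show ?thesis
    by (induction f) (simp_all add: map_poly_pCons h.hev_pCons[OF y] hev_pCons[OF y] hom_of_rat(2)[OF L h])
qed

text \<open>A homomorphism agrees with \<open>\<rho>\<close> on the integers, so it carries the
  linear factors of \<open>F\<close> to \<open>K\<close>, where a product vanishes only if a factor
  does. Every root in \<open>K\<close> is the image of a root in \<open>L\<close>.\<close>

lemma rational_poly_pushforward:
  assumes L: "subfield L complex_ring" and h: "h \<in> ring_hom (field_of L) K" and y: "y \<in> carrier K"
    and a: "\<And>c. c < (n::nat) \<Longrightarrow> a c \<in> L" and F: "map_poly of_int F = (\<Prod>c<n. [:- a c, 1:])"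
    and root: "hev K \<rho> (ratp F) y = \<zero>"
  shows "\<exists>c<n. y = h (a c)"
proof -
  interpret h: coeff_hom K L h by (rule hom_of_rat(1)[OF L h])
  have "hev K h (\<Prod>c<n. [:- a c, 1:]) y = \<zero>" using hev_hom_int[OF L h y, of F] root F by simp
  then show ?thesis using h.hev_prod_linear[OF y, of "{..<n}" a] a by auto
qed

end

lemma ring_hom_agree:
  assumes K: "field K" and L: "subfield L complex_ring" "h \<in> ring_hom (field_of L) K" "S \<subseteq> L"
    and M: "subfield M complex_ring" "k \<in> ring_hom (field_of M) K" "S \<subseteq> M"
    and e: "\<And>x. x \<in> S \<Longrightarrow> h x = k x" and x: "x \<in> gen S"
  shows "h x = k x"
proof -
  interpret K: field K by (rule K)
  have c: "coeff_hom K L h" if L: "subfield L complex_ring" and h: "h \<in> ring_hom (field_of L) K" for L h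
    using ring_hom_memE[OF h] subfield_closed[OF L]
    by (intro coeff_hom.intro K.field_axioms coeff_hom_axioms.intro) auto
  interpret h: coeff_hom K L h by (rule c[OF L(1,2)])
  interpret k: coeff_hom K M k by (rule c[OF M(1,2)])
  have sub: "gen S \<subseteq> L" "gen S \<subseteq> M" using gen_least L M by blast+
  show ?thesis using x
  proof (induction rule: gen_induct)
    case one show ?case by (simp add: h.rho_1 k.rho_1)
  next
    case (uminus x)
    then have "x \<in> L" "x \<in> M" using sub by blast+
    then show ?case using uminus.IH by (simp add: h.rho_minus k.rho_minus)
  next
    case (inverse x)
    have xs: "x \<in> L" "x \<in> M" "inverse x \<in> L" "inverse x \<in> M"
      using inverse.hyps(1) sub subfield_closed(4)[OF L(1)] subfield_closed(4)[OF M(1)] by blast+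
    have 1: "h x \<otimes>\<^bsub>K\<^esub> h (inverse x) = \<one>\<^bsub>K\<^esub>" using h.rho_mult[OF xs(1,3)] inverse.hyps(2) h.rho_1 by simp
    have 2: "h x \<otimes>\<^bsub>K\<^esub> k (inverse x) = \<one>\<^bsub>K\<^esub>" using k.rho_mult[OF xs(2,4)] inverse k.rho_1 by simp
    have "h (inverse x) = h (inverse x) \<otimes>\<^bsub>K\<^esub> (h x \<otimes>\<^bsub>K\<^esub> k (inverse x))" using 2 h.rho_closed[OF xs(3)] by simp
    also have "\<dots> = (h x \<otimes>\<^bsub>K\<^esub> h (inverse x)) \<otimes>\<^bsub>K\<^esub> k (inverse x)"
      using h.rho_closed[OF xs(1)] h.rho_closed[OF xs(3)] k.rho_closed[OF xs(4)] by (simp add: K.m_ac)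
    finally show ?case using 1 k.rho_closed[OF xs(4)] by simp
  next
    case (add x y) then show ?case using sub h.rho_add k.rho_add by (metis subsetD)
  next
    case (mult x y) then show ?case using sub h.rho_mult k.rho_mult by (metis subsetD)
  qed (use e in simp)
qed

lemma ring_hom_gen_into:
  assumes K: "field K" and L: "subfield L complex_ring" "h \<in> ring_hom (field_of L) K" "S \<subseteq> L"
    and E: "subfield E K" and e: "\<And>x. x \<in> S \<Longrightarrow> h x \<in> E" and x: "x \<in> gen S"
  shows "h x \<in> E"
proof -
  interpret K: field K by (rule K)
  interpret h: coeff_hom K L h
    using ring_hom_memE[OF L(2)] subfield_closed[OF L(1)]
    by (intro coeff_hom.intro K.field_axioms coeff_hom_axioms.intro) auto
  note s = subringE[OF subfieldE(1)[OF E]]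
  have sub: "gen S \<subseteq> L" using gen_least L by blast
  show ?thesis using x
  proof (induction rule: gen_induct)
    case one show ?case using s by (simp add: h.rho_1)
  next
    case (uminus x)
    then have "x \<in> L" using sub by blast
    then show ?case using uminus.IH s by (simp add: h.rho_minus)
  next
    case (inverse x)
    have xs: "x \<in> L" "inverse x \<in> L"
      using inverse.hyps(1) sub subfield_closed(4)[OF L(1)] by blast+
    have 1: "h x \<otimes>\<^bsub>K\<^esub> h (inverse x) = \<one>\<^bsub>K\<^esub>" using h.rho_mult[OF xs] inverse.hyps(2) h.rho_1 by simp
    then have "h x \<noteq> \<zero>\<^bsub>K\<^esub>" using h.rho_closed[OF xs(2)] by auto
    then show ?case using K.subfield_m_inv_simprule[OF E _ h.rho_closed[OF xs(2)]] 1 s inverse.IH by simp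
  next
    case (add x y)
    then have "x \<in> L" "y \<in> L" using sub by blast+
    then show ?case using add.IH s by (simp add: h.rho_add)
  next
    case (mult x y)
    then have "x \<in> L" "y \<in> L" using sub by blast+
    then show ?case using mult.IH s by (simp add: h.rho_mult)
  qed (use e in simp)
qed

section \<open>Composita of cyclic subfields of cyclotomic fields\<close>

locale cyc_data =
  fixes N :: "nat \<Rightarrow> nat" and \<psi> :: "nat \<Rightarrow> nat \<Rightarrow> nat" and f :: "nat \<Rightarrow> int poly"
  assumes blk: "\<And>q. q \<in> Lambda \<Longrightarrow> block (N q) (q - 1) (\<psi> q) (f q)"
    and cop: "\<And>q r. q \<in> Lambda \<Longrightarrow> r \<in> Lambda \<Longrightarrow> q \<noteq> r \<Longrightarrow> coprime (N q) (N r)"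
begin

definition A :: "nat \<Rightarrow> nat \<Rightarrow> complex" where "A q = block.conj (N q) (\<psi> q) (f q)"
definition FF :: "nat \<Rightarrow> int poly" where "FF q = block.F (N q) (q - 1) (\<psi> q) (f q)"
definition GG :: "nat \<Rightarrow> nat \<Rightarrow> int poly" where "GG q = block.G (N q) (q - 1) (\<psi> q) (f q)"
definition Lf :: "complex set" where "Lf = gen ((\<lambda>q. A q 0) ` Lambda)"
definition MI :: "nat set \<Rightarrow> nat" where "MI I = (\<Prod>q\<in>I. N q)"

lemma Lf: "subfield Lf complex_ring" unfolding Lf_def by (rule gen_subfield)

lemma N_pos: "q \<in> Lambda \<Longrightarrow> N q > 0" using block.N[OF blk] .

lemma MI_pos: "I \<subseteq> Lambda \<Longrightarrow> MI I > 0"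
  unfolding MI_def using N_pos by (intro prod_pos) blast

text \<open>Expresses the conjugates of one block over the common conductor, whose root of unity
  raised to \<open>MI I div N q\<close> is \<open>zeta (N q)\<close>.\<close>

lemma A_conj:
  assumes I: "finite I" "I \<subseteq> Lambda" "q \<in> I" and a: "coprime a (N q)"
  shows "A q (\<psi> q a) = evi (f q) (zeta (MI I) ^ (MI I div N q * a))"
proof -
  have q: "q \<in> Lambda" using I by blast
  have "MI I = N q * (\<Prod>r\<in>I - {q}. N r)" unfolding MI_def using I by (simp add: prod.remove)
  then have e: "MI I = N q * (MI I div N q)" using N_pos[OF q] by simp
  then have "MI I div N q > 0" using MI_pos[OF I(2)] by (metis gr0I mult_0_right less_irrefl)
  then have "zeta (MI I) ^ (MI I div N q) = zeta (N q)" using zeta_mult_power e by metis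
  then have "zeta (MI I) ^ (MI I div N q * a) = zeta (N q) ^ a" by (simp add: power_mult)
  then show ?thesis unfolding A_def using block.conj_psi[OF blk[OF q] a] by simp
qed

lemma A_index: "q \<in> Lambda \<Longrightarrow> c < q - 1 \<Longrightarrow> \<exists>a. coprime a (N q) \<and> \<psi> q a = c"
  using block.psi_surj[OF blk] by blast

lemma A_cyc:
  assumes I: "finite I" "I \<subseteq> Lambda" "q \<in> I" and c: "c < q - 1"
  shows "A q c \<in> cyc (MI I)"
proof -
  obtain a where a: "coprime a (N q)" "\<psi> q a = c" using A_index[of q c] I c by blast
  show ?thesis unfolding a(2)[symmetric] A_conj[OF I a(1)] by (rule cyc_evi)
qed

lemma Lambda_pred_pos: "q \<in> Lambda \<Longrightarrow> 0 < q - 1"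
  unfolding Lambda_def using prime_gt_1_nat by auto

lemma A_0: "q \<in> Lambda \<Longrightarrow> A q 0 = A q (\<psi> q 1)"
  using block.psi_1[OF blk] by simp

lemma psi_less: "q \<in> Lambda \<Longrightarrow> \<psi> q a < q - 1"
  using block.psi_less[OF blk] by blast

lemma coprime_MI: "finite I \<Longrightarrow> I \<subseteq> Lambda \<Longrightarrow> coprime a (MI I) \<longleftrightarrow> (\<forall>q\<in>I. coprime a (N q))"
  unfolding MI_def by (induction I rule: finite_induct) auto

text \<open>Chinese remainder theorem; it is through this lemma that coprime conductors make the
  blocks independent.\<close>

lemma simultaneous_index:
  assumes I: "finite I" "I \<subseteq> Lambda" and c: "\<And>q. q \<in> I \<Longrightarrow> c q < q - 1"
  shows "\<exists>a. coprime a (MI I) \<and> (\<forall>q\<in>I. \<psi> q a = c q)"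
proof -
  have "\<forall>q\<in>I. \<exists>a. coprime a (N q) \<and> \<psi> q a = c q" using A_index c I by blast
  then obtain u where u: "\<And>q. q \<in> I \<Longrightarrow> coprime (u q) (N q)" "\<And>q. q \<in> I \<Longrightarrow> \<psi> q (u q) = c q" by metis
  have "\<exists>x. \<forall>q\<in>I. [x = u q] (mod N q)"
    using I cop by (intro chinese_remainder_nat) auto
  then obtain a where a: "\<And>q. q \<in> I \<Longrightarrow> [a = u q] (mod N q)" by blast
  have "coprime a (N q)" if "q \<in> I" for q using u(1)[OF that] a[OF that] cong_imp_coprime cong_sym by blast
  moreover have "\<psi> q a = c q" if "q \<in> I" for q
    using block.psi_cong[OF blk a[OF that]] u(2)[OF that] that I by auto
  ultimately show ?thesis using coprime_MI[OF I] by blast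
qed

lemma FF_eq: "q \<in> Lambda \<Longrightarrow> map_poly of_int (FF q) = (\<Prod>c<q - 1. [:- A q c, 1:])"
  unfolding FF_def A_def using block.F[OF blk] block.charpoly_def[OF blk] by simp

text \<open>For some homomorphism of the cyclotomic field into \<open>K\<close>, each prescribed
  root is the image of a conjugate with some label. One exponent \<open>a\<close> realises all these
  labels together, and replacing \<open>\<eta>\<close> by its a-th power moves the images of the
  generators to the prescribed roots.\<close>

lemma finite_stage:
  assumes rh: "rat_hom K \<rho>" and eta: "\<And>N. N > 0 \<Longrightarrow> \<exists>\<eta>. rat_hom.is_conj K \<rho> N \<eta>"
    and \<beta>: "\<And>q. q \<in> Lambda \<Longrightarrow> \<beta> q \<in> carrier K" "\<And>q. q \<in> Lambda \<Longrightarrow> hev K \<rho> (ratp (FF q)) (\<beta> q) = \<zero>\<^bsub>K\<^esub>"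
    and I: "finite I" "I \<subseteq> Lambda"
  shows "\<exists>h\<in>ring_hom (field_of (cyc (MI I))) K. \<forall>q\<in>I. h (A q 0) = \<beta> q"
proof -
  interpret rat_hom K \<rho> by (rule rh)
  have M: "MI I > 0" by (rule MI_pos[OF I(2)])
  obtain \<eta> where eta: "is_conj (MI I) \<eta>" using eta[OF M] by blast
  have ec: "\<eta> \<in> carrier K" using eta unfolding is_conj_def by blast
  note h0 = phi_hom[OF eta]
  have "\<forall>q\<in>I. \<exists>c. c < q - 1 \<and> \<beta> q = phi (MI I) \<eta> (A q c)"
  proof
    fix q assume q: "q \<in> I"
    then have qL: "q \<in> Lambda" using I by blast
    show "\<exists>c. c < q - 1 \<and> \<beta> q = phi (MI I) \<eta> (A q c)"
      using rational_poly_pushforward[OF cyc_subfield[OF M] h0 \<beta>(1)[OF qL] A_cyc[OF I q] FF_eq[OF qL] \<beta>(2)[OF qL]] by blast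
  qed
  then obtain c where c: "\<And>q. q \<in> I \<Longrightarrow> c q < q - 1" "\<And>q. q \<in> I \<Longrightarrow> \<beta> q = phi (MI I) \<eta> (A q (c q))" by metis
  obtain a where a: "coprime a (MI I)" "\<And>q. q \<in> I \<Longrightarrow> \<psi> q a = c q" using simultaneous_index[OF I c(1)] by blast
  have ca: "is_conj (MI I) (\<eta> [^]\<^bsub>K\<^esub> a)" by (rule is_conj_power[OF M a(1) eta])
  have "phi (MI I) (\<eta> [^]\<^bsub>K\<^esub> a) (A q 0) = \<beta> q" if q: "q \<in> I" for q
  proof -
    define e where "e = MI I div N q"
    have qL: "q \<in> Lambda" using q I by blast
    have aq: "coprime a (N q)" using a(1) coprime_MI[OF I] q by blast
    have "A q 0 = evi (f q) (zeta (MI I) ^ e)" using A_0[OF qL] A_conj[OF I q, of 1] unfolding e_def by simp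
    then have "phi (MI I) (\<eta> [^]\<^bsub>K\<^esub> a) (A q 0) = hev K \<rho> (ratp (f q)) ((\<eta> [^]\<^bsub>K\<^esub> a) [^]\<^bsub>K\<^esub> e)"
      using phi_evi[OF ca] by simp
    also have "(\<eta> [^]\<^bsub>K\<^esub> a) [^]\<^bsub>K\<^esub> e = \<eta> [^]\<^bsub>K\<^esub> (e * a)" using ec by (simp add: K.nat_pow_pow mult.commute)
    also have "hev K \<rho> (ratp (f q)) (\<eta> [^]\<^bsub>K\<^esub> (e * a)) = phi (MI I) \<eta> (evi (f q) (zeta (MI I) ^ (e * a)))"
      using phi_evi[OF eta] by simp
    also have "evi (f q) (zeta (MI I) ^ (e * a)) = A q (c q)" using A_conj[OF I q aq] a(2)[OF q] unfolding e_def by simp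
    finally show ?thesis using c(2)[OF q] by simp
  qed
  then show ?thesis using phi_hom[OF ca] by blast
qed

lemma gens_cyc: "finite I \<Longrightarrow> I \<subseteq> Lambda \<Longrightarrow> J \<subseteq> I \<Longrightarrow> (\<lambda>q. A q 0) ` J \<subseteq> cyc (MI I)"
  using Lambda_pred_pos by (intro image_subsetI A_cyc) blast+

lemma A0_Lf: "q \<in> Lambda \<Longrightarrow> A q 0 \<in> Lf"
  unfolding Lf_def by (rule gen_incl) (rule imageI)

text \<open>Any choice of roots of the generating polynomials extends to a homomorphism: the generators are
  independent of each other because the conductors are pairwise coprime.\<close>

theorem hom_exists:
  assumes rh: "rat_hom K \<rho>" and eta: "\<And>N. N > 0 \<Longrightarrow> \<exists>\<eta>. rat_hom.is_conj K \<rho> N \<eta>"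
    and \<beta>: "\<And>q. q \<in> Lambda \<Longrightarrow> \<beta> q \<in> carrier K" "\<And>q. q \<in> Lambda \<Longrightarrow> hev K \<rho> (ratp (FF q)) (\<beta> q) = \<zero>\<^bsub>K\<^esub>"
  shows "\<exists>h\<in>ring_hom (field_of Lf) K. \<forall>q\<in>Lambda. h (A q 0) = \<beta> q"
proof -
  interpret rat_hom K \<rho> by (rule rh)
  define g where "g = (\<lambda>q. A q 0)"
  have "\<forall>I. \<exists>h. finite I \<and> I \<subseteq> Lambda \<longrightarrow> h \<in> ring_hom (field_of (cyc (MI I))) K \<and> (\<forall>q\<in>I. h (A q 0) = \<beta> q)"
  proof
    fix I
    show "\<exists>h. finite I \<and> I \<subseteq> Lambda \<longrightarrow> h \<in> ring_hom (field_of (cyc (MI I))) K \<and> (\<forall>q\<in>I. h (A q 0) = \<beta> q)"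
    proof (cases "finite I \<and> I \<subseteq> Lambda")
      case True
      then have I: "finite I" "I \<subseteq> Lambda" by simp_all
      have "\<exists>h\<in>ring_hom (field_of (cyc (MI I))) K. \<forall>q\<in>I. h (A q 0) = \<beta> q" by (rule finite_stage[OF assms I])
      then obtain h where h: "h \<in> ring_hom (field_of (cyc (MI I))) K" "\<forall>q\<in>I. h (A q 0) = \<beta> q" by (rule bexE)
      show ?thesis by (intro exI[of _ h] impI conjI h)
    qed blast
  qed
  from choice[OF this] obtain h where h0: "\<forall>I. finite I \<and> I \<subseteq> Lambda \<longrightarrow>
    h I \<in> ring_hom (field_of (cyc (MI I))) K \<and> (\<forall>q\<in>I. h I (A q 0) = \<beta> q)" ..
  have h: "\<And>I. finite I \<Longrightarrow> I \<subseteq> Lambda \<Longrightarrow> h I \<in> ring_hom (field_of (cyc (MI I))) K"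
    "\<And>I q. finite I \<Longrightarrow> I \<subseteq> Lambda \<Longrightarrow> q \<in> I \<Longrightarrow> h I (A q 0) = \<beta> q" by (simp_all add: h0)
  \<comment> \<open>Two stages agree on the field generated by their common generators, so
    independently chosen maps can be glued there.\<close>
  have agree: "h I x = h J x" if I: "finite I" "I \<subseteq> Lambda" "J \<subseteq> I" and x: "x \<in> gen (g ` J)" for I J x
  proof (rule ring_hom_agree[OF K.field_axioms _ h(1)[OF I(1,2)] _ _ h(1)[of J] _ _ x])
    have J: "finite J" "J \<subseteq> Lambda" using I finite_subset by auto
    show "finite J" "J \<subseteq> Lambda" by fact+
    show "subfield (cyc (MI I)) complex_ring" by (rule cyc_subfield[OF MI_pos[OF I(2)]])
    show "subfield (cyc (MI J)) complex_ring" by (rule cyc_subfield[OF MI_pos[OF J(2)]])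
    show "g ` J \<subseteq> cyc (MI I)" unfolding g_def by (rule gens_cyc[OF I])
    show "g ` J \<subseteq> cyc (MI J)" unfolding g_def by (rule gens_cyc[OF J subset_refl])
    fix y assume "y \<in> g ` J"
    then obtain q where q: "q \<in> J" "y = A q 0" unfolding g_def by blast
    then show "h I y = h J y" using h(2)[OF I(1,2), of q] h(2)[OF J q(1)] I(3) by auto
  qed
  \<comment> \<open>A finite support of \<open>x\<close>, chosen once. The glued map evaluates each
    element at its own stage, and sums and products are compared at the union of the
    supports.\<close>
  define S where "S = (\<lambda>x. SOME I. finite I \<and> I \<subseteq> Lambda \<and> x \<in> gen (g ` I))"
  have S: "finite (S x)" "S x \<subseteq> Lambda" "x \<in> gen (g ` S x)" if "x \<in> Lf" for x
  proof -
    have "\<exists>I. finite I \<and> I \<subseteq> Lambda \<and> x \<in> gen (g ` I)"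
      using gen_finite[of x g Lambda] that unfolding Lf_def g_def by blast
    from someI_ex[OF this] show "finite (S x)" "S x \<subseteq> Lambda" "x \<in> gen (g ` S x)" unfolding S_def by auto
  qed
  define k where "k = (\<lambda>x. h (S x) x)"
  have k: "k x = h I x" if "x \<in> Lf" "finite I" "I \<subseteq> Lambda" "S x \<subseteq> I" for x I
    unfolding k_def using agree[OF that(2-4) S(3)[OF that(1)]] by simp
  have sub: "x \<in> cyc (MI I)" if "x \<in> Lf" "finite I" "I \<subseteq> Lambda" "S x \<subseteq> I" for x I
    using gen_least[OF gens_cyc[OF that(2-4)] cyc_subfield[OF MI_pos[OF that(3)]]] S(3)[OF that(1)] unfolding g_def by blast
  have hom: "k \<in> ring_hom (field_of Lf) K"
  proof (rule ring_hom_memI)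
    fix x y assume "x \<in> carrier (field_of Lf)" "y \<in> carrier (field_of Lf)"
    then have xy: "x \<in> Lf" "y \<in> Lf" by simp_all
    have xy': "x + y \<in> Lf" "x * y \<in> Lf" using xy by (simp_all add: subfield_closed[OF Lf])
    define I where "I = S x \<union> S y \<union> S (x + y) \<union> S (x * y)"
    have I: "finite I" "I \<subseteq> Lambda" "S x \<subseteq> I" "S y \<subseteq> I" "S (x + y) \<subseteq> I" "S (x * y) \<subseteq> I"
      unfolding I_def using S xy xy' by auto
    note hI = ring_hom_memE[OF h(1)[OF I(1,2)]]
    note xI = sub[OF xy(1) I(1,2,3)] sub[OF xy(2) I(1,2,4)]
    show "k x \<in> carrier K" using hI(1)[of x] xI k[OF xy(1) I(1,2,3)] by simp
    show "k (x \<otimes>\<^bsub>field_of Lf\<^esub> y) = k x \<otimes>\<^bsub>K\<^esub> k y"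
      using hI(2)[of x y] xI k[OF xy(1) I(1,2,3)] k[OF xy(2) I(1,2,4)] k[OF xy'(2) I(1,2,6)] by simp
    show "k (x \<oplus>\<^bsub>field_of Lf\<^esub> y) = k x \<oplus>\<^bsub>K\<^esub> k y"
      using hI(3)[of x y] xI k[OF xy(1) I(1,2,3)] k[OF xy(2) I(1,2,4)] k[OF xy'(1) I(1,2,5)] by simp
  next
    have 1: "1 \<in> Lf" by (rule subfield_closed(2)[OF Lf])
    have "h (S 1) 1 = \<one>\<^bsub>K\<^esub>" using ring_hom_memE(4)[OF h(1)[OF S(1,2)[OF 1]]] by simp
    then show "k \<one>\<^bsub>field_of Lf\<^esub> = \<one>\<^bsub>K\<^esub>" by (simp add: k_def)
  qed
  have "k (A q 0) = \<beta> q" if q: "q \<in> Lambda" for q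
  proof -
    have qL: "A q 0 \<in> Lf" by (rule A0_Lf[OF q])
    define I where "I = insert q (S (A q 0))"
    have I: "finite I" "I \<subseteq> Lambda" "S (A q 0) \<subseteq> I" "q \<in> I" using S[OF qL] q by (auto simp: I_def)
    show ?thesis using k[OF qL I(1-3)] h(2)[OF I(1,2,4)] by simp
  qed
  then show ?thesis using hom by blast
qed

lemma rat_hom_complex: "rat_hom complex_ring of_rat"
  by (intro rat_hom.intro coeff_hom.intro field_complex_ring coeff_hom_axioms.intro) (simp_all add: of_rat_add of_rat_mult)

lemma conj_complex:
  assumes M: "M > 0" and a: "coprime a M"
  shows "rat_hom.is_conj complex_ring of_rat M (zeta M ^ a)"
proof -
  interpret rat_hom complex_ring of_rat by (rule rat_hom_complex)
  show ?thesis unfolding is_conj_def hev_complex using zeta_conjugate[OF M a] by simp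
qed

lemma emb:
  assumes c: "\<And>q. q \<in> Lambda \<Longrightarrow> c q < q - 1"
  shows "\<exists>h. chom Lf h \<and> (\<forall>q\<in>Lambda. h (A q 0) = A q (c q))"
proof -
  have "\<exists>h\<in>ring_hom (field_of Lf) complex_ring. \<forall>q\<in>Lambda. h (A q 0) = A q (c q)"
  proof (rule hom_exists[OF rat_hom_complex])
    show "\<exists>\<eta>. rat_hom.is_conj complex_ring of_rat N \<eta>" if "N > 0" for N
      using conj_complex[OF that, of 1] by auto
    fix q assume q: "q \<in> Lambda"
    show "A q (c q) \<in> carrier complex_ring" by simp
    have "evi (FF q) (A q (c q)) = 0"
      unfolding FF_def A_def using block.F_root[OF blk[OF q]] c[OF q] by blast
    then show "hev complex_ring of_rat (ratp (FF q)) (A q (c q)) = \<zero>\<^bsub>complex_ring\<^esub>" by (simp add: hev_complex)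
  qed
  then show ?thesis unfolding ring_hom_def chom_def by auto
qed

lemma A_in_Lf:
  assumes q: "q \<in> Lambda" and c: "c < q - 1"
  shows "A q c \<in> Lf"
proof -
  have A0: "A q 0 \<in> Lf" by (rule A0_Lf[OF q])
  have "evi (GG q c) (A q 0) / evi (pderiv (FF q)) (A q 0) \<in> Lf"
    by (intro subfield_closed(8)[OF Lf] subfield_evi[OF Lf] A0)
  moreover have "evi (GG q c) (A q 0) = A q c * evi (pderiv (FF q)) (A q 0)"
    using block.G_eval[OF blk[OF q] Lambda_pred_pos[OF q], of c] c unfolding GG_def FF_def A_def by simp
  moreover have "evi (pderiv (FF q)) (A q 0) \<noteq> 0"
    using block.pderiv_F_nonzero[OF blk[OF q] Lambda_pred_pos[OF q]] unfolding FF_def A_def by simp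
  ultimately show ?thesis by simp
qed

text \<open>Conjugation at a cyclotomic stage sends each generator to a conjugate of the same block,
  which lies in \<open>Lf\<close>; it therefore maps the field they generate into
  \<open>Lf\<close>.\<close>

lemma conj_in_Lf:
  assumes I: "finite I" "I \<subseteq> Lambda" and x: "x \<in> gen ((\<lambda>q. A q 0) ` I)" "x = ev h (zeta (MI I))"
    and a: "coprime a (MI I)"
  shows "ev h (zeta (MI I) ^ a) \<in> Lf"
proof -
  interpret rat_hom complex_ring of_rat by (rule rat_hom_complex)
  have M: "MI I > 0" by (rule MI_pos[OF I(2)])
  define s where "s = phi (MI I) (zeta (MI I) ^ a)"
  note ca = conj_complex[OF M a]
  have "s \<in> ring_hom (field_of (cyc (MI I))) complex_ring" unfolding s_def by (rule phi_hom[OF ca])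
  then have sc: "chom (cyc (MI I)) s" unfolding ring_hom_def chom_def by auto
  have "s y \<in> Lf" if y: "y \<in> (\<lambda>q. A q 0) ` I" for y
  proof -
    obtain q where q: "q \<in> I" "y = A q 0" using y by blast
    have qL: "q \<in> Lambda" using q I by blast
    have aq: "coprime a (N q)" using a coprime_MI[OF I] q by blast
    have "y = evi (f q) (zeta (MI I) ^ (MI I div N q))" using A_0[OF qL] A_conj[OF I q(1), of 1] q(2) by simp
    then have "s y = evi (f q) ((zeta (MI I) ^ a) [^]\<^bsub>complex_ring\<^esub> (MI I div N q))"
      unfolding s_def using phi_evi[OF ca] by (simp add: hev_complex)
    also have "(zeta (MI I) ^ a) [^]\<^bsub>complex_ring\<^esub> k = zeta (MI I) ^ (k * a)" for k :: nat
      by (induction k) (simp_all add: power_add mult.commute)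
    finally have "s y = A q (\<psi> q a)" using A_conj[OF I q(1) aq] by simp
    then show ?thesis using A_in_Lf[OF qL psi_less[OF qL]] by simp
  qed
  then have "s x \<in> Lf"
    by (rule chom_image_gen[OF cyc_subfield[OF M] sc gens_cyc[OF I subset_refl] Lf _ x(1)])
  moreover have "s x = ev h (zeta (MI I) ^ a)" unfolding s_def x(2) phi_ev[OF ca] hev_complex ..
  ultimately show ?thesis by simp
qed

text \<open>The product over all exponents coprime to the conductor of X minus the conjugates of
  \<open>x\<close>. It is invariant under conjugation, hence rational, and its roots lie in
  \<open>Lf\<close> by the previous lemma.\<close>

lemma split:
  assumes x: "x \<in> Lf"
  shows "\<exists>P. P \<noteq> 0 \<and> ev P x = 0 \<and> (\<forall>z. ev P z = 0 \<longrightarrow> z \<in> Lf)"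
proof -
  obtain I where I: "finite I" "I \<subseteq> Lambda" "x \<in> gen ((\<lambda>q. A q 0) ` I)"
    using gen_finite[of x "\<lambda>q. A q 0" Lambda] x unfolding Lf_def by blast
  define M where "M = MI I"
  have M: "M > 0" unfolding M_def by (rule MI_pos[OF I(2)])
  have "x \<in> cyc M" using gen_least[OF gens_cyc[OF I(1,2) subset_refl] cyc_subfield[OF MI_pos[OF I(2)]]] I(3) unfolding M_def by blast
  then obtain h where h: "x = ev h (zeta M)" unfolding cyc_def by blast
  \<comment> \<open>The conjugates of d x are values of an integral polynomial; the substitution of
    d X in the product later undoes the factor.\<close>
  obtain d h' where d: "d > 0" "Polynomial.smult (of_int d) h = ratp h'" using rat_poly_clear_denominators by blast
  have hh: "evi h' z = of_int d * ev h z" for z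
  proof -
    have "ev (Polynomial.smult (of_int d) h) z = ev (ratp h') z" unfolding d(2) ..
    then show ?thesis by simp
  qed
  define T where "T = {a. a < M \<and> coprime a M}"
  have T: "finite T" unfolding T_def by simp
  define r where "r = (\<lambda>z. \<Prod>a\<in>T. [:- evi h' (z ^ a), 1:])"
  obtain H where H: "\<And>z k. evi (H k) z = coeff (\<Prod>a\<in>T. [:- evi (pcompose h' (monom 1 a)) z, 1:]) k"
    using coeff_prod_evi[OF T, of "\<lambda>a. pcompose h' (monom 1 a)"] by blast
  then have H: "evi (H k) z = coeff (r z) k" for z k unfolding r_def by simp
  have inv: "r (zeta M ^ b) = r (zeta M)" if b: "coprime b M" for b
  proof -
    have inj: "inj_on (\<lambda>a. (b * a) mod M) T"
    proof (rule inj_onI)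
      fix a a' assume aa: "a \<in> T" "a' \<in> T" "(b * a) mod M = (b * a') mod M"
      then have "[b * a = b * a'] (mod M)" by (simp add: cong_def)
      then have "[a = a'] (mod M)" using cong_mult_lcancel_nat[OF b] by blast
      then show "a = a'" using aa by (simp add: T_def cong_def)
    qed
    have "(\<lambda>a. (b * a) mod M) ` T \<subseteq> T"
    proof
      fix y assume "y \<in> (\<lambda>a. (b * a) mod M) ` T"
      then obtain a where a: "a \<in> T" "y = (b * a) mod M" by blast
      then have "coprime (b * a) M" using b by (simp add: T_def)
      then have "coprime y M" unfolding a(2) using M by (simp add: coprime_mod_left_iff)
      then show "y \<in> T" using M by (simp add: T_def a(2))
    qed
    then have bij: "bij_betw (\<lambda>a. (b * a) mod M) T T" using endo_inj_surj[OF T] inj by (simp add: bij_betw_def)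
    have "r (zeta M ^ b) = (\<Prod>a\<in>T. [:- evi h' (zeta M ^ ((b * a) mod M)), 1:])"
      unfolding r_def zeta_power_mod[OF M] by (simp add: power_mult)
    also have "\<dots> = r (zeta M)" unfolding r_def by (rule prod.reindex_bij_betw[OF bij])
    finally show ?thesis .
  qed
  have "coeff (r (zeta M)) k \<in> \<int>" for k
    using galois_invariant_integral[OF M, of "H k"] inv unfolding H by simp
  then obtain R :: "int poly" where R: "map_poly of_int R = r (zeta M)" using integral_poly by blast
  define P where "P = pcompose (ratp R) [:0, of_int d:]"
  have evP: "ev P z = (\<Prod>a\<in>T. of_int d * z - evi h' (zeta M ^ a))" for z
  proof -
    have "ev P z = evi R (of_int d * z)" unfolding P_def by (simp add: mult.commute)
    then show ?thesis unfolding evi_def R r_def by (simp add: poly_prod)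
  qed
  have root: "ev P z = 0 \<longleftrightarrow> (\<exists>a\<in>T. z = ev h (zeta M ^ a))" for z
    unfolding evP hh using d(1) T by (simp add: prod_zero_iff)
  have "ev P x = 0"
  proof -
    \<comment> \<open>For M = 1 the only exponent below M is 0, hence the reduction of 1.\<close>
    have "1 mod M \<in> T" using M by (cases "M = 1") (auto simp: T_def)
    moreover have "zeta M ^ (1 mod M) = zeta M" using zeta_power_mod[OF M, of 1] by simp
    ultimately show ?thesis unfolding root using h by metis
  qed
  moreover have "z \<in> Lf" if "ev P z = 0" for z
    using that conj_in_Lf[OF I(1,2,3), of h] h unfolding root T_def M_def by auto
  moreover have "P \<noteq> 0"
  proof
    assume "P = 0"
    then have "ev P z = 0" for z by simp
    then have "(UNIV :: complex set) \<subseteq> (\<lambda>a. ev h (zeta M ^ a)) ` T" unfolding root by blast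
    then have "finite (UNIV :: complex set)" using T finite_surj by blast
    then show False using infinite_UNIV_char_0 by blast
  qed
  ultimately show ?thesis by blast
qed

sublocale galois_data A FF GG Lf
proof
  show "Lf = gen ((\<lambda>q. A q 0) ` Lambda)" by (rule Lf_def)
  fix q assume q: "q \<in> Lambda"
  show "inj_on (A q) {..<q - 1}" unfolding A_def by (rule block.conj_inj[OF blk[OF q]])
  show "FF q \<noteq> 0" using block.lead_coeff_F[OF blk[OF q]] unfolding FF_def by auto
  show "evi (FF q) z = 0 \<longleftrightarrow> (\<exists>c<q - 1. z = A q c)" for z
    unfolding FF_def A_def by (rule block.F_root[OF blk[OF q]])
  show "evi (pderiv (FF q)) (A q j) \<noteq> 0" if "j < q - 1" for j
    using block.pderiv_F_nonzero[OF blk[OF q] that] unfolding FF_def A_def .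
  show "evi (GG q s) (A q j) = A q ((s + j) mod (q - 1)) * evi (pderiv (FF q)) (A q j)" if "j < q - 1" for s j
    using block.G_eval[OF blk[OF q] that] unfolding GG_def FF_def A_def .
next
  fix c :: "nat \<Rightarrow> nat" assume "\<And>q. q \<in> Lambda \<Longrightarrow> c q < q - 1"
  then show "\<exists>h. chom Lf h \<and> (\<forall>q\<in>Lambda. h (A q 0) = A q (c q))" by (rule emb)
next
  fix x assume "x \<in> Lf"
  then show "\<exists>P. P \<noteq> 0 \<and> ev P x = 0 \<and> (\<forall>z. ev P z = 0 \<longrightarrow> z \<in> Lf)" by (rule split)
qed

end

section \<open>The field of p-adic numbers\<close>

context
  fixes p :: nat assumes p: "prime p"
begin

lemma p_gt_1: "real p > 1" using prime_gt_1_nat[OF p] by simp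

lemma prime_elem_p: "prime_elem (int p)" using p by simp

text \<open>\<open>padic_val\<close> refers to the reduced fraction; additivity of multiplicities
  makes every fraction admissible.\<close>

lemma padic_val_quotient:
  assumes "a \<noteq> 0" "b \<noteq> 0"
  shows "padic_val p (of_int a / of_int b) = int (multiplicity (int p) a) - int (multiplicity (int p) b)"
proof -
  obtain n d where nd: "quotient_of (of_int a / of_int b) = (n, d)" by (cases "quotient_of (of_int a / of_int b)")
  then have d: "d > 0" and q: "of_int a / of_int b = (of_int n / of_int d :: rat)"
    using quotient_of_denom_pos quotient_of_div by blast+
  then have "(of_int (n * b) :: rat) = of_int (a * d)" using assms by (simp add: field_simps)
  then have e: "n * b = a * d" by (simp only: of_int_eq_iff)
  then have "n \<noteq> 0" using assms d by auto
  have "multiplicity (int p) (n * b) = multiplicity (int p) n + multiplicity (int p) b"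
    using \<open>n \<noteq> 0\<close> assms by (intro prime_elem_multiplicity_mult_distrib prime_elem_p) auto
  moreover have "multiplicity (int p) (a * d) = multiplicity (int p) a + multiplicity (int p) d"
    using d assms by (intro prime_elem_multiplicity_mult_distrib prime_elem_p) auto
  ultimately show ?thesis unfolding padic_val_def nd using e by simp
qed

lemma rat_quotient:
  fixes x :: rat
  obtains a b :: int where "b > 0" "x = of_int a / of_int b"
  by (metis quotient_of_denom_pos quotient_of_div surj_pair)

lemma padic_abs_quotient:
  assumes "a \<noteq> 0" "b \<noteq> 0"
  shows "padic_abs p (of_int a / of_int b) = real p powi (int (multiplicity (int p) b) - int (multiplicity (int p) a))"
  using assms by (simp add: padic_abs_def padic_val_quotient)

lemma padic_abs_0 [simp]: "padic_abs p 0 = 0" by (simp add: padic_abs_def)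

lemma padic_abs_nonneg: "padic_abs p x \<ge> 0" by (simp add: padic_abs_def)

lemma padic_abs_eq_0_iff: "padic_abs p x = 0 \<longleftrightarrow> x = 0"
  using p_gt_1 by (simp add: padic_abs_def)

lemma padic_abs_of_int: "a \<noteq> 0 \<Longrightarrow> padic_abs p (of_int a) = real p powi (- int (multiplicity (int p) a))"
  using padic_abs_quotient[of a 1] by simp

lemma padic_abs_1 [simp]: "padic_abs p 1 = 1"
  using padic_abs_of_int[of 1] by simp

lemma padic_abs_mult: "padic_abs p (x * y) = padic_abs p x * padic_abs p y"
proof (cases "x = 0 \<or> y = 0")
  case False
  obtain a b where x: "b > 0" "x = of_int a / of_int b" by (rule rat_quotient)
  obtain c d where y: "d > 0" "y = of_int c / of_int d" by (rule rat_quotient)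
  have nz: "a \<noteq> 0" "c \<noteq> 0" using False x y by auto
  have m: "multiplicity (int p) (a * c) = multiplicity (int p) a + multiplicity (int p) c"
     "multiplicity (int p) (b * d) = multiplicity (int p) b + multiplicity (int p) d"
    using nz x y by (auto intro!: prime_elem_multiplicity_mult_distrib prime_elem_p)
  have "x * y = of_int (a * c) / of_int (b * d)" using x y by simp
  then have "padic_abs p (x * y) = real p powi (int (multiplicity (int p) (b * d)) - int (multiplicity (int p) (a * c)))"
    using padic_abs_quotient[of "a * c" "b * d"] nz x y by simp
  also have "\<dots> = padic_abs p x * padic_abs p y"
    using padic_abs_quotient[of a b] padic_abs_quotient[of c d] nz x y m p_gt_1
    by (simp add: power_int_add[symmetric] algebra_simps)
  finally show ?thesis .
qed auto

lemma padic_abs_minus [simp]: "padic_abs p (- x) = padic_abs p x"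
proof -
  have "padic_abs p (-1) = 1" using padic_abs_of_int[of "-1"] by simp
  then show ?thesis using padic_abs_mult[of "-1" x] by simp
qed

lemma padic_abs_minus_commute: "padic_abs p (x - y) = padic_abs p (y - x)"
  using padic_abs_minus[of "x - y"] by simp

lemma padic_abs_add: "padic_abs p (x + y) \<le> max (padic_abs p x) (padic_abs p y)"
proof (cases "x = 0 \<or> y = 0 \<or> x + y = 0")
  case True
  then show ?thesis using padic_abs_nonneg by (auto simp: le_max_iff_disj)
next
  case False
  obtain a b where x: "b > 0" "x = of_int a / of_int b" by (rule rat_quotient)
  obtain c d where y: "d > 0" "y = of_int c / of_int d" by (rule rat_quotient)
  define u v w where "u = a * d" and "v = c * b" and "w = b * d"
  have w: "w \<noteq> 0" using x y by (simp add: w_def)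
  have xw: "x = of_int u / of_int w" and yw: "y = of_int v / of_int w" using x y by (simp_all add: u_def v_def w_def)
  have s: "x + y = of_int (u + v) / of_int w" unfolding xw yw by (simp add: add_divide_distrib)
  have nz: "u \<noteq> 0" "v \<noteq> 0" "u + v \<noteq> 0" using False s xw yw by auto
  define k where "k = min (multiplicity (int p) u) (multiplicity (int p) v)"
  have "int p ^ k dvd u" "int p ^ k dvd v" by (auto intro!: multiplicity_dvd' simp: k_def)
  then have "int p ^ k dvd u + v" by (rule dvd_add)
  then have k: "k \<le> multiplicity (int p) (u + v)"
    using nz p by (intro multiplicity_geI) auto
  have "padic_abs p (x + y) = real p powi (int (multiplicity (int p) w) - int (multiplicity (int p) (u + v)))"
    unfolding s using padic_abs_quotient nz w by blast
  also have "\<dots> \<le> real p powi (int (multiplicity (int p) w) - int k)"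
    using k p_gt_1 by (intro power_int_increasing) auto
  also have "\<dots> \<le> max (padic_abs p x) (padic_abs p y)"
    unfolding xw yw padic_abs_quotient[OF nz(1) w] padic_abs_quotient[OF nz(2) w] by (auto simp: k_def min_def le_max_iff_disj)
  finally show ?thesis .
qed

lemma padic_abs_add_le: "padic_abs p x \<le> e \<Longrightarrow> padic_abs p y \<le> e \<Longrightarrow> padic_abs p (x + y) \<le> e"
  using padic_abs_add[of x y] by simp

lemma padic_abs_add_less: "padic_abs p x < e \<Longrightarrow> padic_abs p y < e \<Longrightarrow> padic_abs p (x + y) < e"
  using padic_abs_add[of x y] by simp

lemma padic_abs_isosceles:
  assumes "padic_abs p (x - y) < padic_abs p y"
  shows "padic_abs p x = padic_abs p y"
proof (rule antisym)
  have "padic_abs p ((x - y) + y) \<le> max (padic_abs p (x - y)) (padic_abs p y)" by (rule padic_abs_add)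
  then show "padic_abs p x \<le> padic_abs p y" using assms by simp
  have "padic_abs p ((y - x) + x) \<le> max (padic_abs p (y - x)) (padic_abs p x)" by (rule padic_abs_add)
  then show "padic_abs p y \<le> padic_abs p x" using assms padic_abs_minus_commute[of x y] by simp
qed

lemma padic_abs_of_int_le: "int p ^ k dvd a \<Longrightarrow> padic_abs p (of_int a) \<le> (1 / real p) ^ k"
proof (cases "a = 0")
  case False
  assume "int p ^ k dvd a"
  then have "k \<le> multiplicity (int p) a" using False p by (intro multiplicity_geI) auto
  then have "real p powi (- int (multiplicity (int p) a)) \<le> real p powi (- int k)"
    using p_gt_1 by (intro power_int_increasing) auto
  then show ?thesis using padic_abs_of_int[OF False] by (simp add: power_int_minus power_divide inverse_eq_divide)
qed (simp)

lemma padic_abs_of_int_le_1: "padic_abs p (of_int a) \<le> 1"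
  using padic_abs_of_int_le[of 0 a] by simp

lemma padic_abs_p: "padic_abs p (of_nat p) = 1 / real p"
proof -
  have "multiplicity (int p) (int p) = 1" using p by simp
  then show ?thesis using padic_abs_of_int[of "int p"] p_gt_1 by (simp add: power_int_minus inverse_eq_divide)
qed

text \<open>The valuation is discrete: nonzero absolute values are integral powers of
  \<open>p\<close>.\<close>

lemma padic_abs_less_1: "padic_abs p x < 1 \<Longrightarrow> padic_abs p x \<le> 1 / real p"
proof (cases "x = 0")
  case False
  assume "padic_abs p x < 1"
  moreover obtain k where k: "padic_abs p x = real p powi k" using False by (auto simp: padic_abs_def)
  ultimately have "k < 0" using p_gt_1 one_le_power_int[of "real p" k] by fastforce
  then have "real p powi k \<le> real p powi (-1)" using p_gt_1 by (intro power_int_increasing) auto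
  then show ?thesis using k by (simp add: inverse_eq_divide)
qed simp

text \<open>The reduced denominator is prime to \<open>p\<close>, so its inverse modulo
  \<open>p\<close> replaces it by an integer factor.\<close>

lemma padic_integer_approx:
  assumes "padic_abs p x \<le> 1"
  shows "\<exists>z. padic_abs p (x - of_int z) \<le> 1 / real p"
proof -
  obtain a b where ab: "quotient_of x = (a, b)" by (cases "quotient_of x")
  then have b: "b > 0" "x = of_int a / of_int b" "coprime a b"
    using quotient_of_denom_pos quotient_of_div quotient_of_coprime by blast+
  have nd: "\<not> int p dvd b"
  proof
    assume d: "int p dvd b"
    then have "\<not> int p dvd a" using b(3) p by (meson coprime_common_divisor not_prime_unit prime_int_nat_transfer prime_nat_int_transfer)
    then have "multiplicity (int p) a = 0" by (rule not_dvd_imp_multiplicity_0)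
    moreover have "1 \<le> multiplicity (int p) b" using d b(1) p by (intro multiplicity_geI) auto
    moreover have "a \<noteq> 0" using \<open>\<not> int p dvd a\<close> by auto
    ultimately have "padic_abs p x > 1" using padic_abs_quotient[of a b] b p_gt_1
      by (simp add: one_less_power_int)
    then show False using assms by simp
  qed
  then have "coprime b (int p)" using p by (metis coprime_commute prime_imp_coprime prime_nat_int_transfer)
  then obtain c where c: "[b * c = 1] (mod int p)" using cong_solve_coprime_int by blast
  have "x - of_int (a * c) = of_int (a * (1 - b * c)) / of_int b"
    unfolding b(2) using b(1) by (simp add: field_simps)
  then have "padic_abs p (x - of_int (a * c)) = padic_abs p (of_int (a * (1 - b * c)) / of_int b)"
    by (rule arg_cong)
  also have "\<dots> = padic_abs p (of_int a) * padic_abs p (of_int (1 - b * c)) * padic_abs p (1 / of_int b)"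
    by (simp add: padic_abs_mult[symmetric])
  also have "padic_abs p (1 / of_int b) = 1"
    using padic_abs_quotient[of 1 b] b(1) not_dvd_imp_multiplicity_0[OF nd] by simp
  also have "padic_abs p (of_int a) * padic_abs p (of_int (1 - b * c)) * 1 \<le> 1 * (1 / real p) * 1"
  proof (intro mult_mono padic_abs_of_int_le_1)
    have "int p dvd 1 - b * c" using cong_sym[OF c] by (simp add: cong_iff_dvd_diff)
    then show "padic_abs p (of_int (1 - b * c)) \<le> 1 / real p" using padic_abs_of_int_le[of 1 "1 - b * c"] by simp
  qed (auto simp: padic_abs_nonneg)
  finally show ?thesis by (intro exI[of _ "a * c"]) simp
qed

lemma padic_CauchyE:
  assumes "padic_Cauchy p s" "e > 0"
  obtains N where "\<And>m n. m \<ge> N \<Longrightarrow> n \<ge> N \<Longrightarrow> padic_abs p (s m - s n) < e"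
  using assms unfolding padic_Cauchy_def by blast

lemma padic_Cauchy_bounded:
  assumes "padic_Cauchy p s"
  obtains B where "B > 0" "\<And>n. padic_abs p (s n) \<le> B"
proof -
  obtain N where N: "\<And>m n. m \<ge> N \<Longrightarrow> n \<ge> N \<Longrightarrow> padic_abs p (s m - s n) < 1"
    using padic_CauchyE[OF assms, of 1] by auto
  define B where "B = 1 + (\<Sum>i\<le>N. padic_abs p (s i))"
  have B1: "B \<ge> 1" unfolding B_def by (simp add: sum_nonneg padic_abs_nonneg)
  have le: "padic_abs p (s i) \<le> B" if "i \<le> N" for i
    using member_le_sum[of i "{..N}" "\<lambda>i. padic_abs p (s i)"] that by (simp add: B_def padic_abs_nonneg)
  have "padic_abs p (s n) \<le> B" for n
  proof (cases "n \<le> N")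
    case False
    then have "padic_abs p ((s n - s N) + s N) \<le> max (padic_abs p (s n - s N)) (padic_abs p (s N))"
      by (intro padic_abs_add)
    then show ?thesis using N[of n N] False le[of N] B1 by simp
  qed (rule le)
  moreover have "B > 0" using B1 by simp
  ultimately show thesis by (rule that[rotated])
qed

lemma padic_null_iff: "s \<in> padic_null p \<longleftrightarrow> (\<forall>e>0. \<exists>N. \<forall>n\<ge>N. padic_abs p (s n) < e)"
  unfolding padic_null_def by (simp add: LIMSEQ_iff padic_abs_nonneg)

lemma padic_null_Cauchy: "s \<in> padic_null p \<Longrightarrow> padic_Cauchy p s"
  unfolding padic_null_iff padic_Cauchy_def
  by (metis add_uminus_conv_diff padic_abs_add_less padic_abs_minus)

lemma padic_Cauchy_const: "padic_Cauchy p (\<lambda>_. c)" unfolding padic_Cauchy_def by simp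

lemma padic_Cauchy_add:
  assumes "padic_Cauchy p s" "padic_Cauchy p t" shows "padic_Cauchy p (\<lambda>n. s n + t n)"
  unfolding padic_Cauchy_def
proof (intro allI impI)
  fix e :: real assume e: "e > 0"
  obtain N where N: "\<And>m n. m \<ge> N \<Longrightarrow> n \<ge> N \<Longrightarrow> padic_abs p (s m - s n) < e" by (rule padic_CauchyE[OF assms(1) e]) blast
  obtain M where M: "\<And>m n. m \<ge> M \<Longrightarrow> n \<ge> M \<Longrightarrow> padic_abs p (t m - t n) < e" by (rule padic_CauchyE[OF assms(2) e]) blast
  have "padic_abs p (s m + t m - (s n + t n)) < e" if "m \<ge> max N M" "n \<ge> max N M" for m n
    using padic_abs_add_less[OF N[of m n] M[of m n]] that by (simp add: algebra_simps)
  then show "\<exists>N. \<forall>m\<ge>N. \<forall>n\<ge>N. padic_abs p (s m + t m - (s n + t n)) < e" by blast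
qed

lemma padic_null_mult:
  assumes "s \<in> padic_null p" "padic_Cauchy p t" shows "(\<lambda>n. s n * t n) \<in> padic_null p"
  unfolding padic_null_iff
proof (intro allI impI)
  fix e :: real assume e: "e > 0"
  obtain B where B: "B > 0" "\<And>n. padic_abs p (t n) \<le> B" using padic_Cauchy_bounded[OF assms(2)] by blast
  have "e / B > 0" using e B by simp
  then obtain N where N: "\<forall>n\<ge>N. padic_abs p (s n) < e / B" using assms(1) unfolding padic_null_iff by blast
  have "padic_abs p (s n * t n) < e" if "n \<ge> N" for n
  proof -
    have "padic_abs p (s n * t n) \<le> padic_abs p (s n) * B"
      unfolding padic_abs_mult by (intro mult_left_mono B padic_abs_nonneg)
    also have "\<dots> < e" using N that B(1) by (simp add: pos_less_divide_eq)
    finally show ?thesis .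
  qed
  then show "\<exists>N. \<forall>n\<ge>N. padic_abs p (s n * t n) < e" by blast
qed

lemma padic_Cauchy_mult:
  assumes s: "padic_Cauchy p s" and t: "padic_Cauchy p t" shows "padic_Cauchy p (\<lambda>n. s n * t n)"
  unfolding padic_Cauchy_def
proof (intro allI impI)
  fix e :: real assume e: "e > 0"
  obtain B where B: "B > 0" "\<And>n. padic_abs p (s n) \<le> B" using padic_Cauchy_bounded[OF s] by blast
  obtain D where D: "D > 0" "\<And>n. padic_abs p (t n) \<le> D" using padic_Cauchy_bounded[OF t] by blast
  have "e / D > 0" "e / B > 0" using e B D by simp_all
  obtain N where N: "\<And>m n. m \<ge> N \<Longrightarrow> n \<ge> N \<Longrightarrow> padic_abs p (s m - s n) < e / D" by (rule padic_CauchyE[OF s \<open>e / D > 0\<close>]) blast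
  obtain M where M: "\<And>m n. m \<ge> M \<Longrightarrow> n \<ge> M \<Longrightarrow> padic_abs p (t m - t n) < e / B" by (rule padic_CauchyE[OF t \<open>e / B > 0\<close>]) blast
  have "padic_abs p (s m * t m - s n * t n) < e" if mn: "m \<ge> max N M" "n \<ge> max N M" for m n
  proof -
    have "padic_abs p ((s m - s n) * t m) \<le> padic_abs p (s m - s n) * D"
      unfolding padic_abs_mult by (intro mult_left_mono D padic_abs_nonneg)
    also have "\<dots> < e" using N[of m n] mn D(1) by (simp add: pos_less_divide_eq)
    finally have 1: "padic_abs p ((s m - s n) * t m) < e" .
    have "padic_abs p ((t m - t n) * s n) \<le> padic_abs p (t m - t n) * B"
      unfolding padic_abs_mult by (intro mult_left_mono B padic_abs_nonneg)
    also have "\<dots> < e" using M[of m n] mn B(1) by (simp add: pos_less_divide_eq)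
    finally have 2: "padic_abs p ((t m - t n) * s n) < e" .
    have "s m * t m - s n * t n = (s m - s n) * t m + (t m - t n) * s n" by (simp add: algebra_simps)
    then show ?thesis using padic_abs_add_less[OF 1 2] by simp
  qed
  then show "\<exists>N. \<forall>m\<ge>N. \<forall>n\<ge>N. padic_abs p (s m * t m - s n * t n) < e" by blast
qed

lemma padic_Cauchy_uminus: "padic_Cauchy p s \<Longrightarrow> padic_Cauchy p (\<lambda>n. - s n)"
  using padic_Cauchy_mult[OF padic_Cauchy_const[of "-1"], of s] by simp

lemma padic_null_add:
  assumes "s \<in> padic_null p" "t \<in> padic_null p" shows "(\<lambda>n. s n + t n) \<in> padic_null p"
  unfolding padic_null_iff
proof (intro allI impI)
  fix e :: real assume e: "e > 0"
  obtain N where N: "\<forall>n\<ge>N. padic_abs p (s n) < e" using assms(1) e unfolding padic_null_iff by blast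
  obtain M where M: "\<forall>n\<ge>M. padic_abs p (t n) < e" using assms(2) e unfolding padic_null_iff by blast
  show "\<exists>N. \<forall>n\<ge>N. padic_abs p (s n + t n) < e"
    using N M by (intro exI[of _ "max N M"]) (auto intro: padic_abs_add_less)
qed

lemma padic_null_uminus: "s \<in> padic_null p \<Longrightarrow> (\<lambda>n. - s n) \<in> padic_null p"
  unfolding padic_null_iff by simp

text \<open>Terms closer to each other than their own size have equal absolute value, by the
  ultrametric inequality. The absolute value is thus eventually constant and not merely bounded
  below.\<close>

lemma padic_not_null:
  assumes s: "padic_Cauchy p s" and n: "s \<notin> padic_null p"
  obtains N c where "c > 0" "\<And>n. n \<ge> N \<Longrightarrow> padic_abs p (s n) = c"
proof -
  obtain e where e: "e > 0" "\<And>N. \<exists>n\<ge>N. \<not> padic_abs p (s n) < e" using n unfolding padic_null_iff by blast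
  obtain N where N: "\<And>m n. m \<ge> N \<Longrightarrow> n \<ge> N \<Longrightarrow> padic_abs p (s m - s n) < e" by (rule padic_CauchyE[OF s e(1)]) blast
  obtain k where k: "k \<ge> N" "\<not> padic_abs p (s k) < e" using e(2) by blast
  have "padic_abs p (s n) = padic_abs p (s k)" if "n \<ge> N" for n
    by (rule padic_abs_isosceles) (use N[OF that k(1)] k(2) in linarith)
  moreover have "padic_abs p (s k) > 0" using k(2) e(1) by linarith
  ultimately show thesis by (rule that[rotated])
qed

section \<open>The quotient of the Cauchy sequences by the null sequences is a field\<close>

abbreviation "CR \<equiv> padic_Cauchy_ring p"

lemma CR_simps [simp]:
  "carrier CR = {s. padic_Cauchy p s}" "s \<otimes>\<^bsub>CR\<^esub> t = (\<lambda>n. s n * t n)" "s \<oplus>\<^bsub>CR\<^esub> t = (\<lambda>n. s n + t n)"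
  "\<one>\<^bsub>CR\<^esub> = (\<lambda>_. 1)" "\<zero>\<^bsub>CR\<^esub> = (\<lambda>_. 0)"
  by (simp_all add: padic_Cauchy_ring_def)

lemma CR_cring: "cring CR"
proof (rule cringI)
  show "abelian_group CR"
  proof (rule abelian_groupI)
    fix x assume "x \<in> carrier CR"
    then show "\<exists>y\<in>carrier CR. y \<oplus>\<^bsub>CR\<^esub> x = \<zero>\<^bsub>CR\<^esub>"
      by (intro bexI[of _ "\<lambda>n. - x n"]) (simp_all add: padic_Cauchy_uminus)
  qed (simp_all add: padic_Cauchy_add padic_Cauchy_const add_ac)
  show "comm_monoid CR"
    by (rule comm_monoidI) (simp_all add: padic_Cauchy_mult padic_Cauchy_const mult_ac)
qed (simp add: algebra_simps)

lemma CR_uminus: "padic_Cauchy p s \<Longrightarrow> \<ominus>\<^bsub>CR\<^esub> s = (\<lambda>n. - s n)"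
proof -
  interpret cring CR by (rule CR_cring)
  assume "padic_Cauchy p s"
  then show ?thesis by (intro minus_equality) (simp_all add: padic_Cauchy_uminus)
qed

lemma null_ideal: "ideal (padic_null p) CR"
proof -
  interpret cring CR by (rule CR_cring)
  show ?thesis
  proof (rule idealI)
    show "ring CR" by (rule ring_axioms)
    show "subgroup (padic_null p) (add_monoid CR)"
    proof (rule add.subgroupI)
      show "padic_null p \<subseteq> carrier CR" using padic_null_Cauchy by auto
      have "(\<lambda>_. 0) \<in> padic_null p" unfolding padic_null_iff by simp
      then show "padic_null p \<noteq> {}" by blast
      show "\<ominus>\<^bsub>CR\<^esub> s \<in> padic_null p" if "s \<in> padic_null p" for s
        using CR_uminus[OF padic_null_Cauchy[OF that]] padic_null_uminus[OF that] by simp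
    qed (simp add: padic_null_add)
    fix s t assume "s \<in> padic_null p" "t \<in> carrier CR"
    then have st: "(\<lambda>n. s n * t n) \<in> padic_null p" by (simp add: padic_null_mult)
    then show "s \<otimes>\<^bsub>CR\<^esub> t \<in> padic_null p" by simp
    show "t \<otimes>\<^bsub>CR\<^esub> s \<in> padic_null p" using st by (simp add: mult.commute)
  qed
qed

lemma null_inverse:
  assumes s: "padic_Cauchy p s" and n: "s \<notin> padic_null p"
  shows "\<exists>t. padic_Cauchy p t \<and> (\<lambda>n. s n * t n - 1) \<in> padic_null p"
proof -
  obtain N c where c: "c > 0" "\<And>n. n \<ge> N \<Longrightarrow> padic_abs p (s n) = c" using padic_not_null[OF s n] by metis
  have nz: "s n \<noteq> 0" if "n \<ge> N" for n using c(2)[OF that] c(1) by auto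
  \<comment> \<open>Finitely many terms may be 0, where \<open>inverse\<close> returns 0; the claims
    concern only the tail.\<close>
  define t where "t = (\<lambda>n. inverse (s n))"
  have t: "padic_abs p (t n) = 1 / c" if "n \<ge> N" for n
  proof -
    have "padic_abs p (s n * t n) = 1" using nz[OF that] by (simp add: t_def)
    then show ?thesis using c(1) c(2)[OF that] by (simp add: padic_abs_mult field_simps)
  qed
  have "padic_Cauchy p t" unfolding padic_Cauchy_def
  proof (intro allI impI)
    fix e :: real assume "e > 0"
    then have "e * c * c > 0" using c by simp
    then obtain M where M: "\<And>m n. m \<ge> M \<Longrightarrow> n \<ge> M \<Longrightarrow> padic_abs p (s m - s n) < e * c * c"
      by (rule padic_CauchyE[OF s]) blast
    have "padic_abs p (t m - t n) < e" if mn: "m \<ge> max N M" "n \<ge> max N M" for m n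
    proof -
      have "t m - t n = (s n - s m) * (t m * t n)" using nz[of m] nz[of n] mn by (simp add: t_def field_simps)
      then have "padic_abs p (t m - t n) = padic_abs p (s n - s m) * (1 / c * (1 / c))"
        using t[of m] t[of n] mn by (simp add: padic_abs_mult)
      also have "\<dots> < e * c * c * (1 / c * (1 / c))"
        using M[of n m] mn c(1) by (intro mult_strict_right_mono) auto
      finally show ?thesis using c(1) by simp
    qed
    then show "\<exists>N. \<forall>m\<ge>N. \<forall>n\<ge>N. padic_abs p (t m - t n) < e" by blast
  qed
  moreover have "(\<lambda>n. s n * t n - 1) \<in> padic_null p" unfolding padic_null_iff
  proof (intro allI impI)
    fix e :: real assume "e > 0"
    then show "\<exists>N. \<forall>n\<ge>N. padic_abs p (s n * t n - 1) < e"
      using nz by (intro exI[of _ N]) (simp add: t_def)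
  qed
  ultimately show ?thesis by blast
qed

lemma one_not_null: "(\<lambda>_. 1) \<notin> padic_null p"
proof
  assume "(\<lambda>_. 1) \<in> padic_null p"
  then have "\<exists>N::nat. \<forall>n\<ge>N. padic_abs p 1 < 1" unfolding padic_null_iff by (rule allE[of _ 1]) simp
  then show False by auto
qed

lemma null_maximal: "maximalideal (padic_null p) CR"
proof -
  interpret cring CR by (rule CR_cring)
  show ?thesis
  proof (rule maximalidealI[OF null_ideal])
    show "carrier CR \<noteq> padic_null p" using one_not_null padic_Cauchy_const[of 1] by auto
    fix J assume J: "ideal J CR" "padic_null p \<subseteq> J" "J \<subseteq> carrier CR"
    interpret J: ideal J CR by (rule J(1))
    show "J = padic_null p \<or> J = carrier CR"
    proof (cases "J = padic_null p")
      case False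
      then obtain s where s: "s \<in> J" "s \<notin> padic_null p" using J(2) by blast
      then have sC: "padic_Cauchy p s" using J(3) by auto
      obtain t where t: "padic_Cauchy p t" "(\<lambda>n. s n * t n - 1) \<in> padic_null p" using null_inverse[OF sC s(2)] by blast
      have 1: "(\<lambda>n. s n * t n) \<in> J" using J.I_r_closed[OF s(1), of t] t(1) by simp
      have "(\<lambda>n. - (s n * t n - 1)) \<in> J" using padic_null_uminus[OF t(2)] J(2) by blast
      then have "(\<lambda>n. s n * t n) \<oplus>\<^bsub>CR\<^esub> (\<lambda>n. - (s n * t n - 1)) \<in> J" by (rule J.a_closed[OF 1])
      then have "\<one>\<^bsub>CR\<^esub> \<in> J" by simp
      then show ?thesis using J.one_imp_carrier by blast
    qed simp
  qed
qed

lemma Qp_field: "field (Qp p)"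
  unfolding Qp_def by (rule maximalideal.quotient_is_field[OF null_maximal CR_cring])

definition cls :: "(nat \<Rightarrow> rat) \<Rightarrow> (nat \<Rightarrow> rat) set" where
  "cls s = padic_null p +>\<^bsub>CR\<^esub> s"

lemma cls_hom: "cls \<in> ring_hom CR (Qp p)"
  unfolding Qp_def cls_def using ideal.rcos_ring_hom[OF null_ideal] by simp

lemma Qp_carrier: "carrier (Qp p) = cls ` {s. padic_Cauchy p s}"
  unfolding Qp_def cls_def FactRing_def A_RCOSETS_defs a_r_coset_def by auto

lemma cls_add: "padic_Cauchy p s \<Longrightarrow> padic_Cauchy p t \<Longrightarrow> cls s \<oplus>\<^bsub>Qp p\<^esub> cls t = cls (\<lambda>n. s n + t n)"
  using ring_hom_add[OF cls_hom, of s t] by simp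

lemma cls_mult: "padic_Cauchy p s \<Longrightarrow> padic_Cauchy p t \<Longrightarrow> cls s \<otimes>\<^bsub>Qp p\<^esub> cls t = cls (\<lambda>n. s n * t n)"
  using ring_hom_mult[OF cls_hom, of s t] by simp

lemma cls_1: "cls (\<lambda>_. 1) = \<one>\<^bsub>Qp p\<^esub>"
  using ring_hom_one[OF cls_hom] by simp

lemma cls_closed: "padic_Cauchy p s \<Longrightarrow> cls s \<in> carrier (Qp p)"
  unfolding Qp_carrier by blast

lemma cls_eq_0: "padic_Cauchy p s \<Longrightarrow> cls s = \<zero>\<^bsub>Qp p\<^esub> \<longleftrightarrow> s \<in> padic_null p"
proof -
  interpret ideal "padic_null p" CR by (rule null_ideal)
  assume s: "padic_Cauchy p s"
  have "\<zero>\<^bsub>Qp p\<^esub> = padic_null p" unfolding Qp_def FactRing_def by simp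
  moreover have "s \<in> cls s" unfolding cls_def using s by (intro a_rcos_self) simp
  moreover have "cls s = padic_null p" if "s \<in> padic_null p" unfolding cls_def using that by (rule a_rcos_const)
  ultimately show ?thesis by auto
qed

lemma cls_uminus: "padic_Cauchy p s \<Longrightarrow> \<ominus>\<^bsub>Qp p\<^esub> cls s = cls (\<lambda>n. - s n)"
proof -
  interpret field "Qp p" by (rule Qp_field)
  assume s: "padic_Cauchy p s"
  have "cls (\<lambda>n. - s n) \<oplus>\<^bsub>Qp p\<^esub> cls s = cls (\<lambda>_. 0)"
    using cls_add[OF padic_Cauchy_uminus[OF s] s] by simp
  also have "\<dots> = \<zero>\<^bsub>Qp p\<^esub>" using cls_eq_0[OF padic_Cauchy_const[of 0]] unfolding padic_null_iff by simp
  finally show ?thesis using cls_closed s padic_Cauchy_uminus[OF s] by (intro minus_equality) auto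
qed

lemma cls_eq_iff:
  assumes s: "padic_Cauchy p s" and t: "padic_Cauchy p t"
  shows "cls s = cls t \<longleftrightarrow> (\<lambda>n. s n - t n) \<in> padic_null p"
proof -
  interpret field "Qp p" by (rule Qp_field)
  have "padic_Cauchy p (\<lambda>n. s n - t n)" using padic_Cauchy_add[OF s padic_Cauchy_uminus[OF t]] by simp
  moreover have "cls (\<lambda>n. s n - t n) = cls s \<ominus>\<^bsub>Qp p\<^esub> cls t"
    unfolding a_minus_def using cls_add[OF s padic_Cauchy_uminus[OF t]] cls_uminus[OF t] by simp
  ultimately show ?thesis using cls_eq_0 cls_closed[OF s] cls_closed[OF t] by (metis r_right_minus_eq)
qed

text \<open>p-integrality is demanded of all terms of a representative, not only of the late ones;
  shifting a sequence achieves this without changing its class.\<close>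

definition Zp :: "(nat \<Rightarrow> rat) set set" where
  "Zp = cls ` {s. padic_Cauchy p s \<and> (\<forall>n. padic_abs p (s n) \<le> 1)}"

definition rho :: "rat \<Rightarrow> (nat \<Rightarrow> rat) set" where "rho r = cls (\<lambda>_. r)"

lemma ZpI: "padic_Cauchy p s \<Longrightarrow> (\<And>n. padic_abs p (s n) \<le> 1) \<Longrightarrow> cls s \<in> Zp"
  unfolding Zp_def by blast

lemma ZpE: assumes "x \<in> Zp" obtains s where "padic_Cauchy p s" "\<And>n. padic_abs p (s n) \<le> 1" "x = cls s"
proof -
  obtain s where s: "s \<in> {s. padic_Cauchy p s \<and> (\<forall>n. padic_abs p (s n) \<le> 1)}" "x = cls s"
    using assms unfolding Zp_def by blast
  show thesis by (rule that[of s]) (use s in auto)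
qed

lemma Zp_carrier: "Zp \<subseteq> carrier (Qp p)" unfolding Zp_def Qp_carrier by blast

lemma rho_in_Zp: "rho (of_int z) \<in> Zp"
  unfolding rho_def by (intro ZpI padic_Cauchy_const padic_abs_of_int_le_1)

lemma Zp_add: "x \<in> Zp \<Longrightarrow> y \<in> Zp \<Longrightarrow> x \<oplus>\<^bsub>Qp p\<^esub> y \<in> Zp"
  by (elim ZpE) (auto simp: cls_add intro!: ZpI padic_Cauchy_add padic_abs_add_le)

lemma Zp_mult: "x \<in> Zp \<Longrightarrow> y \<in> Zp \<Longrightarrow> x \<otimes>\<^bsub>Qp p\<^esub> y \<in> Zp"
  by (elim ZpE) (auto simp: cls_mult padic_abs_mult padic_abs_nonneg intro!: ZpI padic_Cauchy_mult mult_le_one)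

lemma rho_mult_power: "padic_Cauchy p s \<Longrightarrow> rho (of_nat p ^ k) \<otimes>\<^bsub>Qp p\<^esub> cls s = cls (\<lambda>n. of_nat p ^ k * s n)"
  unfolding rho_def by (rule cls_mult[OF padic_Cauchy_const])

lemma padic_abs_p_power: "padic_abs p (of_nat p ^ k) = (1 / real p) ^ k"
  by (induction k) (simp_all add: padic_abs_mult padic_abs_p)

lemma Zp_approx:
  assumes "x \<in> Zp"
  shows "\<exists>z y. y \<in> Zp \<and> x = rho (of_int z) \<oplus>\<^bsub>Qp p\<^esub> rho (of_nat p) \<otimes>\<^bsub>Qp p\<^esub> y"
proof -
  obtain s where s0: "padic_Cauchy p s \<and> (\<forall>n. padic_abs p (s n) \<le> 1)" "x = cls s"
    using assms unfolding Zp_def by blast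
  then have s: "padic_Cauchy p s" "\<And>n. padic_abs p (s n) \<le> 1" "x = cls s" by simp_all
  obtain N where N: "\<And>m n. m \<ge> N \<Longrightarrow> n \<ge> N \<Longrightarrow> padic_abs p (s m - s n) < 1"
    using padic_CauchyE[OF s(1), of 1] by auto
  obtain z where z: "padic_abs p (s N - of_int z) \<le> 1 / real p" using padic_integer_approx[OF s(2)] by blast
  \<comment> \<open>The shift by \<open>N\<close> makes every term congruent to \<open>z\<close>, so
    that the quotient by \<open>p\<close> is p-integral from its first term on.\<close>
  define t where "t = (\<lambda>n. (s (n + N) + - of_int z) * (1 / of_nat p))"
  have p0: "of_nat p \<noteq> (0 :: rat)" using p_gt_1 by auto
  have sh: "padic_Cauchy p (\<lambda>n. s (n + N))" using s(1) unfolding padic_Cauchy_def by (meson trans_le_add1)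
  have tC: "padic_Cauchy p t" unfolding t_def by (intro padic_Cauchy_mult padic_Cauchy_add sh padic_Cauchy_const)
  have "padic_abs p (t n) \<le> 1" for n
  proof -
    have "padic_abs p (s (n + N) - s N) \<le> 1 / real p" by (intro padic_abs_less_1 N) auto
    then have "padic_abs p ((s (n + N) - s N) + (s N - of_int z)) \<le> 1 / real p" using z by (rule padic_abs_add_le)
    moreover have "padic_abs p (1 / of_nat p) = real p"
    proof -
      have "padic_abs p (1 / of_nat p) * padic_abs p (of_nat p) = 1" using p0 by (simp flip: padic_abs_mult)
      then show ?thesis using p_gt_1 by (simp add: padic_abs_p field_simps)
    qed
    ultimately show ?thesis unfolding t_def padic_abs_mult using p_gt_1 by (simp add: field_simps)
  qed
  then have tZ: "cls t \<in> Zp" by (intro ZpI tC)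
  have "rho (of_int z) \<oplus>\<^bsub>Qp p\<^esub> rho (of_nat p) \<otimes>\<^bsub>Qp p\<^esub> cls t = cls (\<lambda>n. of_int z + of_nat p * t n)"
    unfolding rho_def cls_mult[OF padic_Cauchy_const tC]
    by (rule cls_add[OF padic_Cauchy_const padic_Cauchy_mult[OF padic_Cauchy_const tC]])
  also have "(\<lambda>n. of_int z + of_nat p * t n) = (\<lambda>n. s (n + N))" using p0 by (simp add: t_def)
  also have "cls (\<lambda>n. s (n + N)) = x" unfolding s(3) cls_eq_iff[OF sh s(1)] padic_null_iff
  proof (intro allI impI)
    fix e :: real assume "e > 0"
    then obtain M where M: "\<And>m n. m \<ge> M \<Longrightarrow> n \<ge> M \<Longrightarrow> padic_abs p (s m - s n) < e"
      using padic_CauchyE[OF s(1)] by metis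
    show "\<exists>M. \<forall>n\<ge>M. padic_abs p (s (n + N) - s n) < e" using M by (intro exI[of _ M]) auto
  qed
  finally show ?thesis using tZ by metis
qed

lemma Zp_separated:
  assumes x: "x \<in> carrier (Qp p)" and d: "\<And>k. \<exists>y\<in>Zp. x = rho (of_nat p ^ k) \<otimes>\<^bsub>Qp p\<^esub> y"
  shows "x = \<zero>\<^bsub>Qp p\<^esub>"
proof -
  obtain s where s: "padic_Cauchy p s" "x = cls s" using x unfolding Qp_carrier by blast
  have "s \<in> padic_null p" unfolding padic_null_iff
  proof (intro allI impI)
    fix e :: real assume e: "e > 0"
    obtain k where k: "(1 / real p) ^ k < e" using real_arch_pow_inv[OF e, of "1 / real p"] p_gt_1 by auto
    obtain t where t: "padic_Cauchy p t" "\<And>n. padic_abs p (t n) \<le> 1" "x = cls (\<lambda>n. of_nat p ^ k * t n)"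
      using d[of k] rho_mult_power by (metis ZpE)
    have tC: "padic_Cauchy p (\<lambda>n. of_nat p ^ k * t n)" by (intro padic_Cauchy_mult padic_Cauchy_const t)
    have "(\<lambda>n. s n - of_nat p ^ k * t n) \<in> padic_null p" using cls_eq_iff[OF s(1) tC] s t by simp
    then obtain N where N: "\<forall>n\<ge>N. padic_abs p (s n - of_nat p ^ k * t n) < e" using e unfolding padic_null_iff by blast
    have "padic_abs p (s n) < e" if "n \<ge> N" for n
    proof -
      have "padic_abs p (of_nat p ^ k * t n) \<le> (1 / real p) ^ k * 1"
        unfolding padic_abs_mult padic_abs_p_power using t(2) by (intro mult_left_mono) auto
      then have "padic_abs p (of_nat p ^ k * t n) < e" using k by simp
      then have "padic_abs p ((s n - of_nat p ^ k * t n) + of_nat p ^ k * t n) < e"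
        using N that by (intro padic_abs_add_less) auto
      then show ?thesis by simp
    qed
    then show "\<exists>N. \<forall>n\<ge>N. padic_abs p (s n) < e" by blast
  qed
  then show ?thesis using cls_eq_0 s by simp
qed

lemma Zp_scale:
  assumes x: "x \<in> carrier (Qp p)"
  shows "\<exists>k. rho (of_nat p ^ k) \<otimes>\<^bsub>Qp p\<^esub> x \<in> Zp"
proof -
  obtain s where s: "padic_Cauchy p s" "x = cls s" using x unfolding Qp_carrier by blast
  obtain B where B: "B > 0" "\<And>n. padic_abs p (s n) \<le> B" using padic_Cauchy_bounded[OF s(1)] by blast
  obtain k where k: "B < real p ^ k" using real_arch_pow[OF p_gt_1] by blast
  have "padic_abs p (of_nat p ^ k * s n) \<le> 1" for n
  proof -
    have "padic_abs p (s n) \<le> real p ^ k" using B(2)[of n] k by simp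
    then show ?thesis using p_gt_1 by (simp add: padic_abs_mult padic_abs_p_power power_divide)
  qed
  then show ?thesis unfolding s(2) rho_mult_power[OF s(1)]
    by (intro exI[of _ k] ZpI padic_Cauchy_mult padic_Cauchy_const s)
qed

lemma rho_hom: "rho (x + y) = rho x \<oplus>\<^bsub>Qp p\<^esub> rho y" "rho (x * y) = rho x \<otimes>\<^bsub>Qp p\<^esub> rho y"
  "rho 1 = \<one>\<^bsub>Qp p\<^esub>" "rho x \<in> carrier (Qp p)"
  unfolding rho_def by (simp_all add: cls_add cls_mult padic_Cauchy_const cls_1 cls_closed)

lemma padic_limit_root:
  assumes c: "\<And>k. int p ^ k dvd c (Suc k) - c k" and f: "\<And>k. int p ^ k dvd poly f (c k)"
  defines "s \<equiv> (\<lambda>k. of_int (c k))"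
  shows "padic_Cauchy p s" "(\<lambda>k. of_int (poly f (c k))) \<in> padic_null p"
proof -
  have small: "\<exists>N. \<forall>k\<ge>N. (1 / real p) ^ k < e" if e: "e > 0" for e :: real
  proof -
    obtain N where N: "(1 / real p) ^ N < e" using real_arch_pow_inv[OF e, of "1 / real p"] p_gt_1 by auto
    have "(1 / real p) ^ k \<le> (1 / real p) ^ N" if "k \<ge> N" for k
      using that p_gt_1 by (intro power_decreasing) auto
    then show ?thesis using N by (intro exI[of _ N]) force
  qed
  have dv: "int p ^ k dvd c m - c k" if "m \<ge> k" for m k
    using that
  proof (induction m rule: dec_induct)
    case (step m)
    have "int p ^ k dvd c (Suc m) - c m" using c[of m] le_imp_power_dvd[OF step(1), of "int p"] dvd_trans by blast
    then have "int p ^ k dvd (c (Suc m) - c m) + (c m - c k)" using step.IH by (rule dvd_add)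
    then show ?case by simp
  qed simp
  show "padic_Cauchy p s" unfolding padic_Cauchy_def
  proof (intro allI impI)
    fix e :: real assume "e > 0"
    then obtain N where N: "\<forall>k\<ge>N. (1 / real p) ^ k < e" using small by blast
    have le: "padic_abs p (s m - s N) < e" if "m \<ge> N" for m
    proof -
      have "padic_abs p (of_int (c m - c N)) \<le> (1 / real p) ^ N" by (rule padic_abs_of_int_le[OF dv[OF that]])
      then show ?thesis using N unfolding s_def by fastforce
    qed
    have "padic_abs p (s m - s n) < e" if "m \<ge> N" "n \<ge> N" for m n
      using padic_abs_add_less[OF le[OF that(1)], of "- (s n - s N)"] le[OF that(2)] padic_abs_minus[of "s n - s N"] by simp
    then show "\<exists>N. \<forall>m\<ge>N. \<forall>n\<ge>N. padic_abs p (s m - s n) < e" by blast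
  qed
  show "(\<lambda>k. of_int (poly f (c k))) \<in> padic_null p" unfolding padic_null_iff
  proof (intro allI impI)
    fix e :: real assume "e > 0"
    then obtain N where N: "\<forall>k\<ge>N. (1 / real p) ^ k < e" using small by blast
    have "padic_abs p (of_int (poly f (c n))) < e" if "n \<ge> N" for n
      using padic_abs_of_int_le[OF f] N[rule_format, OF that] by (rule order.strict_trans1)
    then show "\<exists>N. \<forall>n\<ge>N. padic_abs p (of_int (poly f (c n))) < e" by blast
  qed
qed

end

section \<open>Roots of unity in finite extensions of a field with a discrete valuation\<close>

text \<open>Let \<open>J\<close> contain a prime \<open>p\<close> and the \<open>q\<close>-th cyclotomic polynomial. Modulo \<open>J\<close> every power of the
  variable is congruent to one of \<open>p ^ d\<close> polynomials; if \<open>q > p ^ d\<close>, two powers coincide, so the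
  variable is congruent to 1, hence \<open>q\<close> is congruent to 0.\<close>

lemma int_poly_ideal_trivial:
  fixes J :: "int poly set"
  assumes J: "\<And>g h. g \<in> J \<Longrightarrow> h \<in> J \<Longrightarrow> g + h \<in> J" "\<And>g h. g \<in> J \<Longrightarrow> h * g \<in> J"
    and p: "prime p" "[:int p:] \<in> J" and q: "prime q" "q \<noteq> p" "(\<Sum>i<q. monom 1 i) \<in> J" "p ^ d < q"
    and f: "f \<in> J" "\<And>i. i > d \<Longrightarrow> coeff f i = 0" "\<not> (\<forall>i. int p dvd coeff f i)"
  shows "1 \<in> J"
proof -
  have zero: "0 \<in> J" using J(2)[OF p(2), of 0] by simp
  have diff: "g - h \<in> J" if "g \<in> J" "h \<in> J" for g h using J(1)[OF that(1) J(2)[OF that(2), of "- 1"]] by simp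
  have pJ: "h \<in> J" if "\<And>i. int p dvd coeff h i" for h
  proof -
    have "[:int p:] dvd h" unfolding const_poly_dvd_iff using that by blast
    then obtain k where "h = [:int p:] * k" by (rule dvdE)
    then have "h = k * [:int p:]" by (simp only: mult.commute)
    then show ?thesis using J(2)[OF p(2), of k] by simp
  qed
  \<comment> \<open>The degree of \<open>f\<close> modulo \<open>p\<close>.\<close>
  define e where "e = (GREATEST i. \<not> int p dvd coeff f i)"
  have bd: "\<not> int p dvd coeff f i \<Longrightarrow> i \<le> d" for i using f(2)[of i] by (cases "i \<le> d") auto
  obtain i0 where i0: "\<not> int p dvd coeff f i0" using f(3) by blast
  have e: "\<not> int p dvd coeff f e" unfolding e_def by (rule GreatestI_nat[of _ i0 d]) (use i0 bd in auto)
  have e_max: "int p dvd coeff f i" if "i > e" for i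
  proof (rule ccontr)
    assume "\<not> int p dvd coeff f i"
    then have "i \<le> e" unfolding e_def by (rule Greatest_le_nat[of _ i d]) (use bd in auto)
    then show False using that by simp
  qed
  have ed: "e \<le> d" using bd[OF e] .
  have "coprime (coeff f e) (int p)" using e p(1) by (metis coprime_commute prime_imp_coprime prime_nat_int_transfer)
  then obtain u where u: "[coeff f e * u = 1] (mod int p)" using cong_solve_coprime_int by blast
  \<comment> \<open>\<open>f\<close> divided by its leading coefficient modulo \<open>p\<close>,
    with the higher coefficients dropped: a monic element of \<open>J\<close> of degree at most
    \<open>d\<close>.\<close>
  define g where "g = poly_cutoff e (smult u f) + monom 1 e"
  have cg: "coeff g i = (if i < e then u * coeff f i else if i = e then 1 else 0)" for i
    unfolding g_def by (simp add: coeff_poly_cutoff)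
  have "smult u f - g \<in> J"
  proof (rule pJ)
    fix i
    show "int p dvd coeff (smult u f - g) i"
      using u e_max[of i] unfolding cong_iff_dvd_diff by (cases "i < e"; cases "i = e") (auto simp: cg mult.commute)
  qed
  moreover have "smult u f \<in> J" using J(2)[OF f(1), of "[:u:]"] by simp
  ultimately have gJ: "g \<in> J" using diff[of "smult u f" "smult u f - g"] by simp
  have dg: "degree g = e"
  proof (rule antisym)
    show "degree g \<le> e" by (rule degree_le) (simp add: cg)
    show "e \<le> degree g" by (rule le_degree) (simp add: cg)
  qed
  have g0: "g \<noteq> 0" using cg[of e] by auto
  define rr where "rr h = snd (pseudo_divmod h g)" for h
  have rr: "h - rr h \<in> J" "coeff (rr h) i = 0" if "i \<ge> e" for h i
  proof -
    define Q where "Q = fst (pseudo_divmod h g)"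
    have s: "pseudo_divmod h g = (Q, rr h)" by (simp add: Q_def rr_def)
    have "h = g * Q + rr h" using pseudo_divmod(1)[OF g0 s] by (simp add: dg cg)
    then have "h - rr h = Q * g" by (simp add: mult.commute)
    then show "h - rr h \<in> J" using J(2)[OF gJ, of Q] by simp
    show "coeff (rr h) i = 0" using pseudo_divmod(2)[OF g0 s] that by (auto simp: dg intro: coeff_eq_0)
  qed
  define xx :: "int poly" where "xx = [:0, 1:]"
  have mon: "monom 1 i = xx ^ i" for i by (simp add: monom_altdef xx_def)
  \<comment> \<open>The remainder of X^i modulo \<open>g\<close>, with coefficients reduced modulo
    \<open>p\<close>, which leaves at most p^e possibilities.\<close>
  define F where "F i = restrict (\<lambda>j. coeff (rr (xx ^ i)) j mod int p) {..<e}" for i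
  have pp: "p > 0" using p(1) prime_gt_0_nat by blast
  have "F ` {..<q} \<subseteq> {..<e} \<rightarrow>\<^sub>E {0..<int p}"
    unfolding F_def using pp by (auto simp: restrict_def)
  then have "card (F ` {..<q}) \<le> card ({..<e} \<rightarrow>\<^sub>E {0..<int p})"
    by (intro card_mono finite_PiE) auto
  also have "\<dots> = p ^ e" by (simp add: card_PiE)
  also have "\<dots> \<le> p ^ d" using ed pp by (intro power_increasing) auto
  also have "\<dots> < card {..<q}" using q(4) by simp
  finally have "\<not> inj_on F {..<q}" by (rule pigeonhole)
  then obtain i i' where ii: "i < q" "i' < q" "i < i'" "F i = F i'"
    unfolding inj_on_def by (metis lessThan_iff linorder_neqE_nat)
  define R where "R a b \<longleftrightarrow> a - b \<in> J" for a b
  have R_refl: "R a a" for a unfolding R_def using zero by simp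
  have R_sym: "R b a" if "R a b" for a b using diff[OF zero that[unfolded R_def]] unfolding R_def by simp
  have R_trans: "R a c" if "R a b" "R b c" for a b c using J(1)[OF that[unfolded R_def]] unfolding R_def by simp
  have R_mult: "R (a * b) (c * b)" if "R a c" for a b c
    using J(2)[OF that[unfolded R_def], of b] unfolding R_def by (simp add: algebra_simps)
  have R_power: "R (a ^ m) 1" if "R a 1" for a m
  proof (induction m)
    case (Suc m)
    show ?case using R_trans[OF R_mult[OF that, of "a ^ m"], of 1] Suc by simp
  qed (simp add: R_refl)
  have "R (rr (xx ^ i)) (rr (xx ^ i'))" unfolding R_def
  proof (rule pJ)
    fix j
    show "int p dvd coeff (rr (xx ^ i) - rr (xx ^ i')) j"
    proof (cases "j < e")
      case True
      then have "coeff (rr (xx ^ i)) j mod int p = coeff (rr (xx ^ i')) j mod int p"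
        using fun_cong[OF ii(4), of j] by (simp add: F_def)
      then show ?thesis by (simp add: mod_eq_dvd_iff)
    qed (simp add: rr(2))
  qed
  moreover have "R (xx ^ k) (rr (xx ^ k))" for k unfolding R_def using rr(1)[of e] by simp
  ultimately have 1: "R (xx ^ i) (xx ^ i')" using R_trans R_sym by meson
  have "xx ^ q - 1 = (xx - 1) * (\<Sum>i<q. xx ^ i)" by (rule power_diff_1_eq)
  then have 2: "R (xx ^ q) 1" unfolding R_def using J(2)[OF q(3), of "xx - 1"] unfolding mon by simp
  \<comment> \<open>X^q is 1 modulo \<open>J\<close>, so X is invertible there, and the coincidence
    of two powers becomes X^k = 1.\<close>
  define k where "k = i' - i"
  have k: "0 < k" "k < q" using ii by (auto simp: k_def)
  have "R (xx ^ i * xx ^ (q - i)) (xx ^ i' * xx ^ (q - i))" by (rule R_mult[OF 1])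
  moreover have "xx ^ i * xx ^ (q - i) = xx ^ q" using ii by (simp flip: power_add)
  moreover have "i' + (q - i) = q + k" using ii by (simp add: k_def)
  then have "xx ^ i' * xx ^ (q - i) = xx ^ q * xx ^ k" by (simp only: power_add[symmetric])
  ultimately have "R (xx ^ q) (xx ^ q * xx ^ k)" by simp
  moreover have "R (xx ^ q * xx ^ k) (1 * xx ^ k)" by (rule R_mult[OF 2])
  ultimately have "R (xx ^ q) (xx ^ k)" using R_trans[of "xx ^ q" "xx ^ q * xx ^ k" "xx ^ k"] by simp
  then have 3: "R (xx ^ k) 1" using R_trans[OF R_sym 2] by blast
  \<comment> \<open>With both X^k and X^q equal to 1 for coprime k and q, X itself is 1, and the
    cyclotomic sum becomes \<open>q\<close>. Then \<open>J\<close> contains the coprime integers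
    \<open>p\<close> and \<open>q\<close>.\<close>
  have "coprime k q" using k q(1) by (metis coprime_commute nat_dvd_not_less prime_imp_coprime)
  then obtain m where m: "[k * m = 1] (mod q)" using cong_solve_coprime_nat by auto
  then obtain t where t: "k * m = 1 + t * q" using q(1) unfolding cong_to_1'_nat by auto
  have "xx * (xx ^ q) ^ t = (xx ^ k) ^ m" by (simp add: t mult.commute flip: power_mult power_Suc)
  then have 4: "R (xx * (xx ^ q) ^ t) 1" using R_power[OF 3, of m] by simp
  have "R ((xx ^ q) ^ t * xx) (1 * xx)" by (rule R_mult[OF R_power[OF 2]])
  then have "R xx (xx * (xx ^ q) ^ t)" using R_sym by (simp add: mult.commute)
  then have 5: "R xx 1" using R_trans 4 by blast
  have "R (\<Sum>i<m. xx ^ i) (of_nat m)" for m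
  proof (induction m)
    case (Suc m)
    have e: "(\<Sum>i<Suc m. xx ^ i) - of_nat (Suc m) = ((\<Sum>i<m. xx ^ i) - of_nat m) + (xx ^ m - 1)" by simp
    show ?case using J(1)[OF Suc[unfolded R_def] R_power[OF 5, of m, unfolded R_def]] unfolding R_def e .
  qed (simp add: R_refl)
  then have "(\<Sum>i<q. xx ^ i) - ((\<Sum>i<q. xx ^ i) - of_nat q) \<in> J" using diff[OF q(3)] unfolding R_def mon by blast
  then have qJ: "of_nat q \<in> J" by simp
  have "coprime (int q) (int p)" using primes_coprime[OF q(1) p(1) q(2)] by simp
  then obtain y where y: "[int q * y = 1] (mod int p)" using cong_solve_coprime_int by blast
  then have d: "int p dvd int q * y - 1" by (simp add: cong_iff_dvd_diff)
  have "[:int q * y - 1:] \<in> J" by (rule pJ) (use d in \<open>auto simp: coeff_pCons split: nat.splits\<close>)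
  moreover have "[:y:] * of_nat q \<in> J" by (rule J(2)[OF qJ])
  ultimately have "[:y:] * of_nat q - [:int q * y - 1:] \<in> J" by (rule diff[rotated])
  moreover have "[:y:] * of_nat q - [:int q * y - 1:] = 1" by (simp add: of_nat_poly mult.commute one_pCons)
  ultimately show ?thesis by simp
qed

lemma ratp_add: "ratp (f + g) = ratp f + ratp g"
  by (rule poly_eqI) (simp only: coeff_map_poly coeff_add of_int_add of_int_0)

text \<open>A valued field as a subfield \<open>B\<close> of \<open>K\<close>, with valuation ring
  \<open>VV\<close> and the prime \<open>p\<close> as uniformiser. \<open>VV_approx\<close> says
  that the integers represent all residues, \<open>VV_separated\<close> that the powers of
  \<open>p\<close> tend to 0, and \<open>VV_scale\<close> that denominators are powers of
  \<open>p\<close>.\<close>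

locale val_field = rat_hom K \<rho> for K :: "('k, 'm) ring_scheme" (structure) and \<rho> :: "rat \<Rightarrow> 'k" +
  fixes B VV :: "'k set" and p :: nat
  assumes p: "prime p" and B: "subfield B K" and VV_B: "VV \<subseteq> B"
    and VV_int: "\<And>z. \<rho> (of_int z) \<in> VV"
    and VV_add: "\<And>x y. x \<in> VV \<Longrightarrow> y \<in> VV \<Longrightarrow> x \<oplus> y \<in> VV"
    and VV_mult: "\<And>x y. x \<in> VV \<Longrightarrow> y \<in> VV \<Longrightarrow> x \<otimes> y \<in> VV"
    and VV_approx: "\<And>x. x \<in> VV \<Longrightarrow> \<exists>z y. y \<in> VV \<and> x = \<rho> (of_int z) \<oplus> \<rho> (of_nat p) \<otimes> y"
    and VV_separated: "\<And>x. x \<in> B \<Longrightarrow> (\<And>k. \<exists>y\<in>VV. x = \<rho> (of_nat p ^ k) \<otimes> y) \<Longrightarrow> x = \<zero>"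
    and VV_scale: "\<And>x. x \<in> B \<Longrightarrow> \<exists>k. \<rho> (of_nat p ^ k) \<otimes> x \<in> VV"
begin

abbreviation pp :: "nat \<Rightarrow> 'k" where "pp k \<equiv> \<rho> (of_nat p ^ k)"

lemma B_carrier: "B \<subseteq> carrier K" by (rule subfieldE(3)[OF B])

lemma VV_carrier: "x \<in> VV \<Longrightarrow> x \<in> carrier K" using VV_B B_carrier by blast

lemma pp_closed [simp]: "pp k \<in> carrier K" by (rule rho_closed) simp

lemma pp_VV: "pp k \<in> VV" using VV_int[of "int p ^ k"] by simp

lemma pp_add: "pp (j + k) = pp j \<otimes> pp k" by (simp add: power_add rho_mult)

lemma pp_nonzero: "pp k \<noteq> \<zero>"
proof
  assume "pp k = \<zero>"
  then have "\<rho> (of_nat p ^ k * (1 / of_nat p ^ k)) = \<zero>" by (simp only: rho_mult[OF UNIV_I UNIV_I] K.l_null rho_closed[OF UNIV_I])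
  moreover have "of_nat p ^ k * (1 / of_nat p ^ k) = (1 :: rat)" using p prime_gt_0_nat by auto
  ultimately show False using rho_1 by simp
qed

lemma pp_cancel: "x \<in> carrier K \<Longrightarrow> pp k \<otimes> x = \<zero> \<Longrightarrow> x = \<zero>"
  using K.integral[of "pp k" x] pp_nonzero[of k] pp_closed[of k] by blast

lemma zero_VV: "\<zero> \<in> VV" using VV_int[of 0] by (simp add: rho_0)
lemma one_VV: "\<one> \<in> VV" using VV_int[of 1] by (simp add: rho_1)

text \<open>The ring VV[v], built by Horner steps so that its properties follow by induction over
  polynomials.\<close>

inductive_set RR :: "'k \<Rightarrow> 'k set" for v :: 'k where
  RR_0: "\<zero> \<in> RR v"
| RR_Horner: "c \<in> VV \<Longrightarrow> r \<in> RR v \<Longrightarrow> c \<oplus> v \<otimes> r \<in> RR v"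

context
  fixes v assumes v: "v \<in> carrier K"
begin

lemma RR_closed: "r \<in> RR v \<Longrightarrow> r \<in> carrier K"
  by (induction rule: RR.induct) (use v VV_carrier in auto)

lemma RR_VV: "c \<in> VV \<Longrightarrow> c \<in> RR v"
  using RR_Horner[OF _ RR_0, of c v] v VV_carrier by simp

lemma RR_v: "r \<in> RR v \<Longrightarrow> v \<otimes> r \<in> RR v"
  using RR_Horner[OF zero_VV, of r v] v RR_closed by simp

lemma RR_add: "r \<in> RR v \<Longrightarrow> s \<in> RR v \<Longrightarrow> r \<oplus> s \<in> RR v"
proof (induction arbitrary: s rule: RR.induct)
  case RR_0
  then show ?case using RR_closed by simp
next
  case (RR_Horner c r)
  note cr = VV_carrier[OF RR_Horner(1)] RR_closed[OF RR_Horner(2)]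
  show ?case using RR_Horner(4)
  proof (cases rule: RR.cases)
    case RR_0
    then show ?thesis using RR.RR_Horner[OF RR_Horner(1,2)] cr v by simp
  next
    case Horner: (RR_Horner d t)
    note dt = VV_carrier[OF Horner(2)] RR_closed[OF Horner(3)]
    have "(c \<oplus> d) \<oplus> v \<otimes> (r \<oplus> t) \<in> RR v"
      by (intro RR.RR_Horner VV_add RR_Horner(1) RR_Horner(3) Horner(2,3))
    moreover have "(c \<oplus> d) \<oplus> v \<otimes> (r \<oplus> t) = (c \<oplus> v \<otimes> r) \<oplus> (d \<oplus> v \<otimes> t)"
      using v cr dt by (simp add: K.r_distr K.a_ac)
    ultimately show ?thesis unfolding Horner(1) by simp
  qed
qed

lemma RR_smult: "r \<in> RR v \<Longrightarrow> c \<in> VV \<Longrightarrow> c \<otimes> r \<in> RR v"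
proof (induction rule: RR.induct)
  case RR_0
  then show ?case using VV_carrier RR.RR_0 by simp
next
  case (RR_Horner d r)
  have "(c \<otimes> d) \<oplus> v \<otimes> (c \<otimes> r) \<in> RR v"
    by (intro RR.RR_Horner VV_mult RR_Horner)
  then show ?case using v VV_carrier[OF RR_Horner(1)] VV_carrier[OF RR_Horner(4)] RR_closed[OF RR_Horner(2)]
    by (simp add: K.r_distr K.m_ac)
qed

lemma RR_mult: "r \<in> RR v \<Longrightarrow> s \<in> RR v \<Longrightarrow> r \<otimes> s \<in> RR v"
proof (induction rule: RR.induct)
  case RR_0
  then show ?case using RR_closed RR.RR_0 by simp
next
  case (RR_Horner c r)
  have "c \<otimes> s \<oplus> v \<otimes> (r \<otimes> s) \<in> RR v"
    by (intro RR_add RR_smult RR_v RR_Horner)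
  then show ?case using v VV_carrier[OF RR_Horner(1)] RR_closed[OF RR_Horner(2)] RR_closed[OF RR_Horner(4)]
    by (simp add: K.l_distr K.r_distr K.m_ac)
qed

lemma hev_ratp_pCons: "hev K \<rho> (ratp (pCons z f)) v = \<rho> (of_int z) \<oplus> v \<otimes> hev K \<rho> (ratp f) v"
  using hev_pCons[OF v, of "of_int z" "ratp f"] by (simp add: map_poly_pCons)

lemma RR_hev: "hev K \<rho> (ratp f) v \<in> RR v"
proof (induction f)
  case 0
  show ?case by (simp add: hev_def RR.RR_0)
next
  case (pCons z f)
  then show ?case unfolding hev_ratp_pCons by (intro RR.RR_Horner VV_int)
qed

text \<open>Integer polynomials whose value at \<open>v\<close> is divisible by \<open>p\<close> in
  VV[v]: the ideal for \<open>int_poly_ideal_trivial\<close>.\<close>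

definition JJ :: "int poly set" where
  "JJ = {f. \<exists>r\<in>RR v. hev K \<rho> (ratp f) v = pp 1 \<otimes> r}"

lemma hevZ:
  "hev K \<rho> (ratp (f + g)) v = hev K \<rho> (ratp f) v \<oplus> hev K \<rho> (ratp g) v"
  "hev K \<rho> (ratp (f * g)) v = hev K \<rho> (ratp f) v \<otimes> hev K \<rho> (ratp g) v"
  "hev K \<rho> (ratp f) v \<in> carrier K"
  using v by (simp_all add: ratp_add ratp_mult hev_add hev_mult hev_closed Cp_def)

lemma JJ_add: "f \<in> JJ \<Longrightarrow> g \<in> JJ \<Longrightarrow> f + g \<in> JJ"
proof -
  assume "f \<in> JJ" "g \<in> JJ"
  then obtain r s where rs: "r \<in> RR v" "hev K \<rho> (ratp f) v = pp 1 \<otimes> r" "s \<in> RR v" "hev K \<rho> (ratp g) v = pp 1 \<otimes> s"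
    unfolding JJ_def by blast
  then have "hev K \<rho> (ratp (f + g)) v = pp 1 \<otimes> (r \<oplus> s)"
    using RR_closed rho_closed by (simp add: hevZ(1) K.r_distr)
  then show "f + g \<in> JJ" unfolding JJ_def using RR_add[OF rs(1,3)] by blast
qed

lemma JJ_mult: "f \<in> JJ \<Longrightarrow> g * f \<in> JJ"
proof -
  assume "f \<in> JJ"
  then obtain r where r: "r \<in> RR v" "hev K \<rho> (ratp f) v = pp 1 \<otimes> r" unfolding JJ_def by blast
  then have "hev K \<rho> (ratp (g * f)) v = pp 1 \<otimes> (hev K \<rho> (ratp g) v \<otimes> r)"
    using RR_closed rho_closed hevZ(3)[of g] by (simp add: hevZ(2) K.m_ac)
  then show "g * f \<in> JJ" unfolding JJ_def using RR_mult[OF RR_hev r(1)] by blast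
qed

lemma p_JJ: "[:int p:] \<in> JJ"
proof -
  have "hev K \<rho> (ratp [:int p:]) v = pp 1 \<otimes> \<one>"
    using hev_const[OF v, of "of_nat p"] rho_closed by (simp add: map_poly_pCons)
  then show ?thesis unfolding JJ_def using RR_VV[OF one_VV] by blast
qed

text \<open>Elements of \<open>VV\<close> are integers modulo \<open>p\<close>, so the coefficients
  may be replaced by integers. The last clause transports primitivity: the integer polynomial
  vanishes modulo \<open>p\<close> only if all original coefficients are divisible by
  \<open>p\<close>. The list ends with the constant term, which is why the induction is from the
  right.\<close>

lemma integer_approximation:
  "set Ks \<subseteq> VV \<Longrightarrow> \<exists>f. (\<forall>i\<ge>length Ks. coeff f i = 0) \<and>
     (\<exists>r\<in>RR v. K.eval Ks v = hev K \<rho> (ratp f) v \<oplus> pp 1 \<otimes> r) \<and>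
     ((\<forall>i. int p dvd coeff f i) \<longrightarrow> (\<forall>x\<in>set Ks. \<exists>y\<in>VV. x = pp 1 \<otimes> y))"
proof (induction Ks rule: rev_induct)
  case Nil
  show ?case
    by (intro exI[of _ 0] conjI bexI[of _ \<zero>]) (simp_all add: hev_def RR.RR_0 rho_closed)
next
  case (snoc x Ks)
  then obtain f r where f: "\<forall>i\<ge>length Ks. coeff f i = 0" "r \<in> RR v"
      "K.eval Ks v = hev K \<rho> (ratp f) v \<oplus> pp 1 \<otimes> r"
      "(\<forall>i. int p dvd coeff f i) \<longrightarrow> (\<forall>x\<in>set Ks. \<exists>y\<in>VV. x = pp 1 \<otimes> y)" by auto
  have x: "x \<in> VV" and Ks: "set Ks \<subseteq> carrier K" using snoc.prems VV_carrier by auto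
  obtain z y where zy: "y \<in> VV" "x = \<rho> (of_int z) \<oplus> pp 1 \<otimes> y" using VV_approx[OF x] by auto
  note cl = VV_carrier[OF x] VV_carrier[OF zy(1)] RR_closed[OF f(2)] hevZ(3)[of f] rho_closed[OF UNIV_I, of "of_int z"]
  have 1: "\<forall>i\<ge>length (Ks @ [x]). coeff (pCons z f) i = 0" using f(1) by (auto simp: coeff_pCons split: nat.splits)
  have 2: "K.eval (Ks @ [x]) v = hev K \<rho> (ratp (pCons z f)) v \<oplus> pp 1 \<otimes> (y \<oplus> v \<otimes> r)"
    unfolding K.eval_append_aux[OF Ks VV_carrier[OF x] v] f(3) hev_ratp_pCons
    using cl v pp_closed[of 1] by (simp add: zy(2) K.l_distr K.r_distr K.m_ac K.a_ac del: power_one_right)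
  have 3: "\<forall>x\<in>set (Ks @ [x]). \<exists>y\<in>VV. x = pp 1 \<otimes> y" if d: "\<forall>i. int p dvd coeff (pCons z f) i"
  proof -
    have "int p dvd z" using d by (metis coeff_pCons_0)
    then obtain w where w: "z = int p * w" by (rule dvdE)
    have "\<rho> (of_int z) = pp 1 \<otimes> \<rho> (of_int w)" unfolding w by (simp add: rho_mult)
    then have "x = pp 1 \<otimes> (\<rho> (of_int w) \<oplus> y)" unfolding zy(2) using cl rho_closed by (simp add: K.r_distr)
    then have "\<exists>y\<in>VV. x = pp 1 \<otimes> y" using VV_add[OF VV_int zy(1)] by blast
    moreover have "\<forall>i. int p dvd coeff f i" using d by (metis coeff_pCons_Suc)
    ultimately show ?thesis using f(4) by simp
  qed
  show ?case using 1 2 3 RR.RR_Horner[OF zy(1) f(2)] by blast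
qed

lemma eval_smult: "set Ks \<subseteq> carrier K \<Longrightarrow> c \<in> carrier K \<Longrightarrow> K.eval (map (\<lambda>x. c \<otimes> x) Ks) v = c \<otimes> K.eval Ks v"
proof (induction Ks rule: rev_induct)
  case (snoc x Ks)
  have Ks: "set Ks \<subseteq> carrier K" "x \<in> carrier K" "set (map (\<lambda>x. c \<otimes> x) Ks) \<subseteq> carrier K" using snoc.prems by auto
  have cl: "K.eval Ks v \<in> carrier K" by (rule K.eval_in_carrier[OF Ks(1) v])
  show ?case
    using K.eval_append_aux[OF Ks(1,2) v] K.eval_append_aux[OF Ks(3) _ v, of "c \<otimes> x"] snoc.IH[OF Ks(1) snoc.prems(2)]
      cl Ks(2) snoc.prems(2) v by (simp add: K.r_distr K.m_ac)
qed simp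

text \<open>Denominators are cleared, then the highest power of \<open>p\<close> common to all
  coefficients is divided out. It exists because some coefficient is nonzero and \<open>VV\<close>
  is separated.\<close>

lemma primitive_relation:
  assumes Ks: "set Ks \<subseteq> B" "\<not> set Ks \<subseteq> {\<zero>}" "K.eval Ks v = \<zero>"
  shows "\<exists>Ls. length Ls = length Ks \<and> set Ls \<subseteq> VV \<and> K.eval Ls v = \<zero> \<and>
    \<not> (\<forall>x\<in>set Ls. \<exists>y\<in>VV. x = pp 1 \<otimes> y)"
proof -
  have "\<exists>s. \<forall>x\<in>set Ks. pp s \<otimes> x \<in> VV" using Ks(1)
  proof (induction Ks)
    case (Cons x Ks)
    obtain s where s: "\<forall>x\<in>set Ks. pp s \<otimes> x \<in> VV" using Cons by auto
    obtain t where t: "pp t \<otimes> x \<in> VV" using VV_scale[of x] Cons.prems by auto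
    have xc: "x \<in> carrier K" "set Ks \<subseteq> carrier K" using Cons.prems B_carrier by auto
    have "pp (s + t) \<otimes> y \<in> VV" if "y \<in> set Ks" for y
    proof -
      have "pp t \<otimes> (pp s \<otimes> y) \<in> VV" by (rule VV_mult[OF pp_VV bspec[OF s that]])
      then show ?thesis using xc that by (auto simp: pp_add K.m_ac rho_closed)
    qed
    moreover have "pp (s + t) \<otimes> x \<in> VV"
      using VV_mult[OF pp_VV[of s] t] xc by (simp add: pp_add K.m_assoc rho_closed)
    ultimately show ?case by auto
  qed simp
  then obtain s where s: "\<forall>x\<in>set Ks. pp s \<otimes> x \<in> VV" by blast
  have Kc: "set Ks \<subseteq> carrier K" using Ks(1) B_carrier by blast
  define Ms where "Ms = map (\<lambda>x. pp s \<otimes> x) Ks"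
  have Ms: "set Ms \<subseteq> VV" "length Ms = length Ks" using s by (auto simp: Ms_def)
  have Me: "K.eval Ms v = \<zero>" unfolding Ms_def eval_smult[OF Kc pp_closed] Ks(3) by simp
  obtain x0 where x0: "x0 \<in> set Ms" "x0 \<noteq> \<zero>" using Ks(2) Kc pp_cancel[of _ s] unfolding Ms_def by auto
  define P where "P k \<longleftrightarrow> (\<forall>x\<in>set Ms. \<exists>y\<in>VV. x = pp k \<otimes> y)" for k
  have "x0 \<in> B" using x0 Ms VV_B by blast
  have "\<exists>k0. \<not> (\<exists>y\<in>VV. x0 = pp k0 \<otimes> y)"
  proof (rule ccontr)
    assume "\<nexists>k0. \<not> (\<exists>y\<in>VV. x0 = pp k0 \<otimes> y)"
    then have "\<exists>y\<in>VV. x0 = pp k \<otimes> y" for k by blast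
    from VV_separated[OF \<open>x0 \<in> B\<close> this] x0(2) show False by contradiction
  qed
  then obtain k0 where k0: "\<not> (\<exists>y\<in>VV. x0 = pp k0 \<otimes> y)" ..
  have bd: "k \<le> k0" if Pk': "P k" for k
  proof (rule ccontr)
    assume "\<not> k \<le> k0"
    then have e: "pp k = pp k0 \<otimes> pp (k - k0)" using pp_add[of k0 "k - k0"] by simp
    obtain y where y: "y \<in> VV" "x0 = pp k \<otimes> y" using Pk' x0(1) unfolding P_def by blast
    then have "x0 = pp k0 \<otimes> (pp (k - k0) \<otimes> y)" using VV_carrier unfolding e by (simp add: K.m_assoc rho_closed)
    then show False using k0 VV_mult[OF pp_VV y(1)] by blast
  qed
  have P0: "P 0"
    unfolding P_def
  proof
    fix x assume "x \<in> set Ms"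
    then have "x \<in> VV" using Ms by blast
    moreover from this have "x = pp 0 \<otimes> x" using VV_carrier by (simp add: rho_1)
    ultimately show "\<exists>y\<in>VV. x = pp 0 \<otimes> y" by blast
  qed
  define k where "k = (GREATEST k. P k)"
  have Pk: "P k" unfolding k_def by (rule GreatestI_nat[of P 0 k0, OF P0 bd])
  have nPk: "\<not> P (Suc k)"
  proof
    assume "P (Suc k)"
    then have "Suc k \<le> k" unfolding k_def by (rule Greatest_le_nat[of P _ k0, OF _ bd])
    then show False by simp
  qed
  from Pk have "\<forall>x\<in>set Ms. \<exists>y. y \<in> VV \<and> x = pp k \<otimes> y" unfolding P_def by blast
  from bchoice[OF this] obtain Y where Y: "\<forall>x\<in>set Ms. Y x \<in> VV \<and> x = pp k \<otimes> Y x" ..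
  define Ls where "Ls = map Y Ms"
  have Ls: "set Ls \<subseteq> VV" using Y by (auto simp: Ls_def)
  have Lc: "set Ls \<subseteq> carrier K" using Ls VV_carrier by blast
  have "map (\<lambda>x. pp k \<otimes> x) Ls = Ms" unfolding Ls_def map_map using Y by (intro map_idI) simp
  then have "pp k \<otimes> K.eval Ls v = \<zero>" using eval_smult[OF Lc pp_closed, of k] Me by simp
  then have Le: "K.eval Ls v = \<zero>" by (rule pp_cancel[OF K.eval_in_carrier[OF Lc v]])
  have "\<not> (\<forall>x\<in>set Ls. \<exists>y\<in>VV. x = pp 1 \<otimes> y)"
  proof
    assume a: "\<forall>x\<in>set Ls. \<exists>y\<in>VV. x = pp 1 \<otimes> y"
    have "P (Suc k)" unfolding P_def
    proof
      fix x assume x: "x \<in> set Ms"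
      then have "Y x \<in> set Ls" by (simp add: Ls_def)
      then obtain y where y: "y \<in> VV" "Y x = pp 1 \<otimes> y" using a by blast
      have "x = pp k \<otimes> Y x" using Y x by blast
      also have "\<dots> = pp (k + 1) \<otimes> y" unfolding y(2) pp_add using VV_carrier[OF y(1)] by (simp add: K.m_assoc rho_closed)
      finally show "\<exists>y\<in>VV. x = pp (Suc k) \<otimes> y" using y(1) by auto
    qed
    then show False using nPk by blast
  qed
  then show ?thesis using Ls Le Ms(2) by (intro exI[of _ Ls]) (simp add: Ls_def)
qed

end

text \<open>The order \<open>RR v\<close> is not \<open>p\<close>-divisible: a \<open>B\<close>-linear projection of \<open>E\<close> onto \<open>B\<close> has bounded
  denominators on it.\<close>

lemma RR_not_divisible:
  assumes E: "subfield E K" "B \<subseteq> E" "K.dimension d B E" and v: "v \<in> E" "v [^] q = \<one>" "(q::nat) > 0"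
  shows "\<not> (\<exists>r\<in>RR v. \<one> = pp 1 \<otimes> r)"
proof
  note sE = subringE[OF subfieldE(1)[OF E(1)]]
  note sB = subringE[OF subfieldE(1)[OF B]]
  have vc: "v \<in> carrier K" using v(1) sE(1) by blast
  assume "\<exists>r\<in>RR v. \<one> = pp 1 \<otimes> r"
  then obtain r where r: "r \<in> RR v" "\<one> = pp 1 \<otimes> r" by blast
  \<comment> \<open>Powers of the relation 1 = p r make 1 divisible by all powers of
    \<open>p\<close>.\<close>
  have div: "\<exists>r\<in>RR v. \<one> = pp k \<otimes> r" for k
  proof (induction k)
    case 0
    show ?case using RR_VV[OF vc one_VV] by (intro bexI[of _ \<one>]) (simp_all add: rho_1)
  next
    case (Suc k)
    then obtain s where s: "s \<in> RR v" "\<one> = pp k \<otimes> s" by blast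
    have "\<one> = (pp 1 \<otimes> r) \<otimes> (pp k \<otimes> s)" using r s by (metis K.l_one K.one_closed)
    also have "\<dots> = (pp 1 \<otimes> pp k) \<otimes> (r \<otimes> s)"
      using RR_closed[OF vc r(1)] RR_closed[OF vc s(1)] pp_closed[of 1] pp_closed[of k]
      by (simp add: K.m_ac del: power_one_right)
    also have "pp 1 \<otimes> pp k = pp (Suc k)" using pp_add[of 1 k] by simp
    finally show ?case using RR_mult[OF vc r(1) s(1)] by blast
  qed
  \<comment> \<open>1 is completed to a basis of \<open>E\<close>. The other basis vectors span the
    complement \<open>W\<close>, and the component along 1 is the projection onto
    \<open>B\<close>.\<close>
  have "K.independent B [\<one>]"
    by (rule K.li_Cons) (auto simp: K.li_Nil)
  then obtain Vs where Vs: "K.independent B (Vs @ [\<one>])" "K.Span B (Vs @ [\<one>]) = E"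
    using K.complete_base[OF B E(3), of "[\<one>]"] sE(3) by auto
  have li: "K.independent B (\<one> # Vs)"
    using K.independent_same_set[OF B _ _ Vs(1), of "\<one> # Vs"] by simp
  have sp: "K.Span B (\<one> # Vs) = E"
    using K.Span_same_set[OF B, of "\<one> # Vs" "Vs @ [\<one>]"] K.independent_in_carrier[OF li] Vs(2) by auto
  define W where "W = K.Span B Vs"
  have Vc: "set Vs \<subseteq> carrier K" using K.independent_in_carrier[OF li] by simp
  note W = K.Span_subgroup_props[OF B Vc, folded W_def] K.Span_smult_closed[OF B Vc, folded W_def]
  have 1: "\<one> \<notin> W" unfolding W_def by (rule K.independent_backwards(1)[OF li])
  have W0: "x = \<zero>" if "x \<in> B" "x \<in> W" for x
  proof (rule ccontr)
    assume "x \<noteq> \<zero>"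
    then have "x \<in> B - {\<zero>}" using that by blast
    then have "inv x \<in> B" "inv x \<otimes> x = \<one>" using K.subfield_m_inv[OF B] by auto
    then show False using W(5)[of "inv x" x] that 1 by simp
  qed
  have dec: "\<exists>a\<in>B. \<exists>w\<in>W. x = a \<oplus> w" if "x \<in> E" for x
  proof -
    have "x \<in> K.line_extension B \<one> W" using that sp unfolding W_def by simp
    then obtain a w where aw: "a \<in> B" "w \<in> W" "x = a \<otimes> \<one> \<oplus> w" unfolding K.line_extension_mem_iff by blast
    then show ?thesis using B_carrier by (metis K.r_one subsetD)
  qed
  \<comment> \<open>The component of \<open>x\<close> along 1 has denominator at most p^s.\<close>
  define Q where "Q s x \<longleftrightarrow> (\<exists>a\<in>VV. \<exists>w\<in>W. pp s \<otimes> x = a \<oplus> w)" for s x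
  have ppB: "pp k \<in> B" for k using pp_VV VV_B by blast
  have Q_ex: "\<exists>s. Q s x" if xE: "x \<in> E" for x
  proof -
    obtain a w where aw: "a \<in> B" "w \<in> W" "x = a \<oplus> w" using dec[OF xE] by blast
    obtain s where s: "pp s \<otimes> a \<in> VV" using VV_scale[OF aw(1)] by blast
    have "pp s \<otimes> x = pp s \<otimes> a \<oplus> pp s \<otimes> w" unfolding aw(3) using aw B_carrier W(1) by (auto intro!: K.r_distr)
    then show ?thesis unfolding Q_def using s W(5)[OF ppB aw(2)] by blast
  qed
  have Q_add: "Q s (x \<oplus> y)" if xy: "Q s x" "Q s y" "x \<in> carrier K" "y \<in> carrier K" for s x y
  proof -
    obtain a w where aw: "a \<in> VV" "w \<in> W" "pp s \<otimes> x = a \<oplus> w" using xy(1) unfolding Q_def by blast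
    obtain b u where bu: "b \<in> VV" "u \<in> W" "pp s \<otimes> y = b \<oplus> u" using xy(2) unfolding Q_def by blast
    have "pp s \<otimes> (x \<oplus> y) = (a \<oplus> w) \<oplus> (b \<oplus> u)" using xy by (simp add: K.r_distr aw(3) bu(3))
    also have "\<dots> = (a \<oplus> b) \<oplus> (w \<oplus> u)"
      using VV_carrier[OF aw(1)] VV_carrier[OF bu(1)] W(1) aw(2) bu(2) by (simp add: K.a_ac subset_iff)
    finally show ?thesis unfolding Q_def using VV_add[OF aw(1) bu(1)] W(3)[OF aw(2) bu(2)] by blast
  qed
  have Q_smult: "Q s (c \<otimes> x)" if cx: "Q s x" "c \<in> VV" "x \<in> carrier K" for s c x
  proof -
    obtain a w where aw: "a \<in> VV" "w \<in> W" "pp s \<otimes> x = a \<oplus> w" using cx(1) unfolding Q_def by blast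
    have cB: "c \<in> B" "c \<in> carrier K" using cx(2) VV_B VV_carrier by auto
    have "pp s \<otimes> (c \<otimes> x) = c \<otimes> (pp s \<otimes> x)" using cB cx(3) pp_closed[of s] by (simp only: K.m_lcomm)
    also have "\<dots> = c \<otimes> a \<oplus> c \<otimes> w" unfolding aw(3) using cB VV_carrier[OF aw(1)] W(1) aw(2) by (auto intro!: K.r_distr)
    finally show ?thesis unfolding Q_def using VV_mult[OF cx(2) aw(1)] W(5)[OF cB(1) aw(2)] by blast
  qed
  have vE: "v [^] i \<in> E" for i :: nat
    by (induction i) (use v sE in auto)
  \<comment> \<open>Because v^q = 1 there are only finitely many powers of \<open>v\<close>; one
    \<open>s\<close> serves for all of them and hence for all of VV[v].\<close>
  have "\<exists>s. \<forall>i<n. Q s (v [^] i)" for n :: nat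
  proof (induction n)
    case (Suc n)
    then obtain s where s: "\<forall>i<n. Q s (v [^] i)" by blast
    obtain t where t: "Q t (v [^] n)" using Q_ex[OF vE] by blast
    have shift: "Q (i + j) x" if xQ: "Q i x" "x \<in> carrier K" for i j x
    proof -
      obtain a w where aw: "a \<in> VV" "w \<in> W" "pp i \<otimes> x = a \<oplus> w" using xQ(1) unfolding Q_def by blast
      have "pp (i + j) \<otimes> x = pp j \<otimes> (pp i \<otimes> x)" unfolding pp_add using xQ(2) pp_closed[of i] pp_closed[of j] by (simp only: K.m_ac K.m_closed)
      also have "\<dots> = pp j \<otimes> a \<oplus> pp j \<otimes> w" unfolding aw(3) using VV_carrier[OF aw(1)] W(1) aw(2) by (auto intro!: K.r_distr)
      finally show ?thesis unfolding Q_def using VV_mult[OF pp_VV aw(1)] W(5)[OF ppB aw(2)] by blast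
    qed
    have "Q (s + t) (v [^] i)" if "i < Suc n" for i
    proof (cases "i < n")
      case True
      then show ?thesis using shift[of s "v [^] i" t] s vc by simp
    next
      case False
      then have "i = n" using that by simp
      then show ?thesis using shift[OF t, of s] vc by (simp add: add.commute)
    qed
    then show ?case by blast
  qed simp
  from this[of q] obtain s where s0: "\<forall>i<q. Q s (v [^] i)" ..
  have vq: "v [^] i = v [^] (i mod q)" for i :: nat
  proof -
    have "v [^] i = v [^] (q * (i div q) + i mod q)" by simp
    also have "\<dots> = (v [^] q) [^] (i div q) \<otimes> v [^] (i mod q)" using vc by (simp only: K.nat_pow_mult K.nat_pow_pow)
    finally show ?thesis using v(2) vc by simp
  qed
  have s: "Q s (v [^] i)" for i :: nat unfolding vq[of i] using s0 v(3) by simp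
  have Qr: "Q s (v [^] i \<otimes> r)" if "r \<in> RR v" for r and i :: nat
    using that
  proof (induction arbitrary: i rule: RR.induct)
    case RR_0
    have "pp s \<otimes> (v [^] i \<otimes> \<zero>) = \<zero> \<oplus> \<zero>" using vc by (simp add: rho_closed)
    then show ?case unfolding Q_def using zero_VV W(2) by blast
  next
    case (RR_Horner c r)
    note cl = VV_carrier[OF RR_Horner(1)] RR_closed[OF vc RR_Horner(2)]
    have "v [^] i \<otimes> (c \<oplus> v \<otimes> r) = c \<otimes> v [^] i \<oplus> v [^] Suc i \<otimes> r"
      using cl vc by (simp add: K.r_distr K.m_ac)
    then show ?case using Q_add[OF Q_smult[OF s RR_Horner(1)] RR_Horner(3)[of "Suc i"]] vc cl by simp
  qed
  \<comment> \<open>Projection of p^s = p^k (p^s r) to \<open>B\<close> shows that p^s is divisible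
    by p^k in \<open>VV\<close>, for every k; separatedness then makes it 0.\<close>
  have "pp s = \<zero>"
  proof (rule VV_separated[OF ppB])
    fix k
    obtain r where r: "r \<in> RR v" "\<one> = pp k \<otimes> r" using div by blast
    have rc: "r \<in> carrier K" by (rule RR_closed[OF vc r(1)])
    obtain a w where aw: "a \<in> VV" "w \<in> W" "pp s \<otimes> r = a \<oplus> w" using Qr[OF r(1), of 0] rc unfolding Q_def by auto
    have ac: "a \<in> carrier K" "w \<in> carrier K" "a \<in> B" using aw VV_carrier W(1) VV_B by auto
    have "pp s = pp s \<otimes> (pp k \<otimes> r)" unfolding r(2)[symmetric] using pp_closed[of s] by simp
    also have "\<dots> = pp k \<otimes> (pp s \<otimes> r)" using rc pp_closed[of s] pp_closed[of k] by (simp only: K.m_lcomm)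
    also have "\<dots> = pp k \<otimes> a \<oplus> pp k \<otimes> w" unfolding aw(3) using ac pp_closed[of k] by (simp add: K.r_distr)
    finally have e: "pp s = pp k \<otimes> a \<oplus> pp k \<otimes> w" .
    have kw: "pp k \<otimes> w \<in> W" by (rule W(5)[OF ppB aw(2)])
    have ka: "pp k \<otimes> a \<in> B" by (rule sB(6)[OF ppB ac(3)])
    have kwc: "pp k \<otimes> w \<in> carrier K" "pp k \<otimes> a \<in> carrier K" using ac pp_closed[of k] by simp_all
    have "pp k \<otimes> w = pp s \<oplus> \<ominus> (pp k \<otimes> a)" unfolding e using kwc
      by (simp only: K.a_comm[of "pp k \<otimes> a" "pp k \<otimes> w"] K.a_assoc K.r_neg K.r_zero K.a_inv_closed)
    then have "pp k \<otimes> w \<in> B" using sB(7)[OF ppB sB(5)[OF ka]] by simp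
    then have "pp k \<otimes> w = \<zero>" using W0 kw by blast
    then have "pp s = pp k \<otimes> a" using e kwc by simp
    then show "\<exists>y\<in>VV. pp s = pp k \<otimes> y" using aw(1) by blast
  qed
  then show False using pp_nonzero by blast
qed

text \<open>d + 1 powers of \<open>v\<close> are linearly dependent over \<open>B\<close>. A
  primitive relation, approximated by integers, becomes an element of \<open>JJ v\<close> of degree
  at most \<open>d\<close> that is nonzero modulo \<open>p\<close>. The cyclotomic sum is a second
  element; for q > p^d they force 1 into \<open>JJ v\<close>, against
  \<open>RR_not_divisible\<close>.\<close>

theorem prime_root_of_unity_bound:
  assumes E: "subfield E K" "B \<subseteq> E" "K.dimension d B E"
    and v: "v \<in> E" "v [^] q = \<one>" "v \<noteq> \<one>" and q: "prime q" "q \<noteq> p"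
  shows "q \<le> p ^ d"
proof (rule ccontr)
  assume "\<not> q \<le> p ^ d"
  then have qd: "p ^ d < q" by simp
  note sE = subringE[OF subfieldE(1)[OF E(1)]]
  have vc: "v \<in> carrier K" using v(1) sE(1) by blast
  have vE: "v [^] i \<in> E" for i :: nat
    by (induction i) (use v sE in auto)
  have q0: "q > 0" using q(1) prime_gt_0_nat by blast
  have "\<not> K.independent B (K.exp_base v (Suc d))"
  proof
    assume "K.independent B (K.exp_base v (Suc d))"
    moreover have "set (K.exp_base v (Suc d)) \<subseteq> E" unfolding K.exp_base_def using vE by auto
    ultimately have "length (K.exp_base v (Suc d)) \<le> d" by (rule K.independent_length_le_dimension[OF B E(3)])
    then show False by (simp add: K.exp_base_def)
  qed
  then obtain Ks where Ks: "length Ks = length (K.exp_base v (Suc d))" "K.combine Ks (K.exp_base v (Suc d)) = \<zero>"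
      "set Ks \<subseteq> B" "set Ks \<noteq> {\<zero>}"
    using K.dependent_imp_non_trivial_combine[OF B K.exp_base_closed[OF vc]] by metis
  have l: "length Ks = Suc d" using Ks(1) by (simp add: K.exp_base_def)
  have "K.eval Ks v = \<zero>" using Ks(2) K.combine_eq_eval[of Ks v] unfolding l by simp
  moreover have "\<not> set Ks \<subseteq> {\<zero>}" using Ks(4) l by (cases Ks) auto
  ultimately obtain Ls where Ls: "length Ls = Suc d" "set Ls \<subseteq> VV" "K.eval Ls v = \<zero>"
      "\<not> (\<forall>x\<in>set Ls. \<exists>y\<in>VV. x = pp 1 \<otimes> y)"
    using primitive_relation[OF vc Ks(3)] l by auto
  obtain f r where f: "\<forall>i\<ge>Suc d. coeff f i = 0" "r \<in> RR v" "\<zero> = hev K \<rho> (ratp f) v \<oplus> pp 1 \<otimes> r"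
      "\<not> (\<forall>i. int p dvd coeff f i)"
    using integer_approximation[OF vc Ls(2)] Ls(1,3,4) by auto
  \<comment> \<open>The relation yields f(v) = - p r, so the sign is moved to the
    polynomial.\<close>
  have fJ: "- 1 * f \<in> JJ v"
  proof -
    have rc: "r \<in> carrier K" by (rule RR_closed[OF vc f(2)])
    have "\<zero> = hev K \<rho> (ratp (- 1 * f + f)) v" by (simp add: hev_def)
    then have "\<zero> = hev K \<rho> (ratp (- 1 * f)) v \<oplus> hev K \<rho> (ratp f) v" unfolding hevZ(1)[OF vc] .
    then have "hev K \<rho> (ratp (- 1 * f)) v = \<ominus> hev K \<rho> (ratp f) v"
      using K.minus_equality hevZ(3)[OF vc] by metis
    also have "\<dots> = pp 1 \<otimes> r"
      using K.minus_equality[of "pp 1 \<otimes> r" "hev K \<rho> (ratp f) v"] f(3) hevZ(3)[OF vc, of f] rc pp_closed[of 1]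
      by (simp add: K.a_comm del: power_one_right)
    finally show ?thesis unfolding JJ_def[OF vc] using f(2) by blast
  qed
  have sJ: "(\<Sum>i<q. monom 1 i) \<in> JJ v"
  proof -
    define S where "S = hev K \<rho> (ratp (\<Sum>i<q. monom 1 i)) v"
    have Sc: "S \<in> carrier K" unfolding S_def by (rule hevZ(3)[OF vc])
    have "monom 1 q + - 1 = (monom 1 1 + - 1) * (\<Sum>i<q. monom (1::int) i)"
      using power_diff_1_eq[of "monom (1::int) 1" q] by (simp add: monom_power)
    moreover have m: "hev K \<rho> (ratp (monom 1 i + - 1)) v = v [^] i \<ominus> \<one>" for i
    proof -
      have "hev K \<rho> (ratp (monom 1 i + - 1)) v = hev K \<rho> (ratp (monom 1 i)) v \<oplus> hev K \<rho> (ratp [:- 1:]) v"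
        unfolding hevZ(1)[OF vc, symmetric] by (simp add: one_pCons)
      moreover have "hev K \<rho> (ratp [:- 1:]) v = \<ominus> \<one>"
        using hev_const[OF vc, of "- 1"] rho_minus[of 1] by (simp add: map_poly_pCons rho_1)
      moreover have "hev K \<rho> (ratp (monom 1 i)) v = v [^] i" using hev_pow[OF vc, of i] by (simp add: map_poly_monom)
      ultimately show ?thesis by (simp add: K.minus_eq)
    qed
    ultimately have "v [^] q \<ominus> \<one> = (v [^] (1::nat) \<ominus> \<one>) \<otimes> S"
      unfolding S_def hevZ(2)[OF vc, symmetric] m[symmetric] by simp
    then have "(v \<ominus> \<one>) \<otimes> S = \<zero>" using v(2) vc by (simp add: K.nat_pow_eone K.r_neg K.minus_eq)
    moreover have "v \<ominus> \<one> \<noteq> \<zero>" using v(3) vc K.r_right_minus_eq by simp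
    ultimately have "S = \<zero>" using K.integral[of "v \<ominus> \<one>" S] Sc vc by auto
    then have "S = pp 1 \<otimes> \<zero>" using pp_closed[of 1] by simp
    then show ?thesis unfolding JJ_def[OF vc] S_def using RR.RR_0 by blast
  qed
  have "1 \<in> JJ v"
  proof (rule int_poly_ideal_trivial[OF JJ_add[OF vc] JJ_mult[OF vc] p p_JJ[OF vc] q sJ qd fJ])
    show "coeff (- 1 * f) i = 0" if "i > d" for i using f(1) that by simp
    show "\<not> (\<forall>i. int p dvd coeff (- 1 * f) i)" using f(4) by simp
  qed
  then obtain r where r: "r \<in> RR v" "hev K \<rho> (ratp 1) v = pp 1 \<otimes> r" unfolding JJ_def[OF vc] by blast
  have "hev K \<rho> (ratp 1) v = \<one>" using hev_const[OF vc, of 1] by (simp add: rho_1 map_poly_pCons one_pCons)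
  then show False using r RR_not_divisible[OF E v(1,2) q0] by metis
qed

end

section \<open>Local degrees\<close>

context rat_hom
begin

lemma rho_nonzero: "c \<noteq> 0 \<Longrightarrow> \<rho> c \<noteq> \<zero>"
proof
  assume c: "c \<noteq> 0" "\<rho> c = \<zero>"
  have "\<rho> (c * (1 / c)) = \<zero>" by (simp only: rho_mult[OF UNIV_I UNIV_I] c(2) K.l_null rho_closed[OF UNIV_I])
  then show False using c(1) rho_1 by simp
qed

lemma eval_coeffs: "y \<in> carrier K \<Longrightarrow> K.eval (map \<rho> (rev (coeffs f))) y = hev K \<rho> f y"
proof (induction f)
  case 0
  show ?case by (simp add: hev_def)
next
  case (pCons a f)
  have sub: "set (map \<rho> (rev (coeffs f))) \<subseteq> carrier K" using rho_closed by auto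
  have "coeffs (pCons a f) = a # coeffs f" using pCons.hyps by (auto simp: cCons_def)
  then have "K.eval (map \<rho> (rev (coeffs (pCons a f)))) y = hev K \<rho> f y \<otimes> y \<oplus> \<rho> a"
    using K.eval_append_aux[OF sub rho_closed[OF UNIV_I, of a] pCons.prems] pCons.IH[OF pCons.prems] by simp
  also have "\<dots> = hev K \<rho> (pCons a f) y"
    unfolding hev_pCons[OF pCons.prems] using pCons.prems hev_closed[OF pCons.prems] rho_closed
    by (simp add: Cp_def K.a_comm K.m_comm)
  finally show ?case .
qed

lemma rat_poly_root:
  assumes K: "algebraically_closed K" and f: "degree f > 0"
  shows "\<exists>y\<in>carrier K. hev K \<rho> f y = \<zero>"
proof -
  define P where "P = map \<rho> (rev (coeffs f))"
  have f0: "f \<noteq> 0" using f by auto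
  have "hd P = \<rho> (coeff f (degree f))"
    unfolding P_def using f0 by (simp add: hd_map hd_rev last_coeffs_eq_coeff_degree)
  then have "hd P \<noteq> \<zero>" using rho_nonzero f0 by simp
  then have "polynomial\<^bsub>K\<^esub> (carrier K) P" unfolding polynomial_def P_def using rho_closed by auto
  then have P: "P \<in> carrier (poly_ring K)" unfolding univ_poly_carrier .
  have "size (K.roots P) = length P - 1"
    using algebraically_closed.roots_over_carrier[OF K P] unfolding K.splitted_def .
  also have "length P - 1 = degree f" using f0 by (simp add: P_def length_coeffs_degree)
  finally have "K.roots P \<noteq> {#}" using f by auto
  then obtain y where "y \<in># K.roots P" by (meson multiset_nonemptyE)
  then have "K.is_root P y" unfolding K.roots_mem_iff_is_root[OF P] .
  then have "y \<in> carrier K" "K.eval P y = \<zero>" unfolding K.is_root_def by auto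
  then show ?thesis using eval_coeffs unfolding P_def by auto
qed

text \<open>The minimal polynomial of \<open>zeta N\<close> has a root in \<open>K\<close>, and it
  divides every other relation of \<open>zeta N\<close>.\<close>

lemma is_conj_exists:
  assumes K: "algebraically_closed K" and N: "N > 0"
  shows "\<exists>\<eta>. is_conj N \<eta>"
proof -
  obtain g h where g: "is_min_poly (ratp g) (zeta N)" "unity_poly N = g * h"
    using root_of_unity_min_poly[OF zeta_power_self[OF N] N] by blast
  obtain \<eta> where y: "\<eta> \<in> carrier K" "hev K \<rho> (ratp g) \<eta> = \<zero>"
    using rat_poly_root[OF K is_min_poly_degree_pos[OF g(1)]] by blast
  have "hev K \<rho> k \<eta> = \<zero>" if k: "ev k (zeta N) = 0" for k
  proof -
    obtain l where l: "k = ratp g * l" using g(1) k unfolding is_min_poly_def by (blast elim: dvdE)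
    show ?thesis unfolding l using y hev_mult[OF y(1), of "ratp g" l] hev_closed[OF y(1), of l] by (simp add: Cp_def)
  qed
  then show ?thesis unfolding is_conj_def using y(1) by blast
qed

end

definition Qp_incl :: "nat \<Rightarrow> (nat \<Rightarrow> rat) set \<Rightarrow> ((nat \<Rightarrow> rat) set list \<times> nat) multiset \<Rightarrow> (nat \<Rightarrow> rat) set" where
  "Qp_incl p = ring.indexed_const (Qp p)"

context
  fixes p :: nat
  assumes p: "prime p"
begin

lemma Qp_bar_closure: "algebraic_closure (Qp_bar p) (Qp_in_Qp_bar p)"
  and Qp_incl_hom: "Qp_incl p \<in> ring_hom (Qp p) (Qp_bar p)"
  using field.alg_closureE[OF Qp_field[OF p]] unfolding Qp_bar_def Qp_in_Qp_bar_def Qp_incl_def by blast+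

lemma Qp_in_Qp_bar_eq: "Qp_in_Qp_bar p = Qp_incl p ` carrier (Qp p)"
  by (simp add: Qp_in_Qp_bar_def Qp_incl_def)

lemma Qp_incl_inj: "Qp_incl p x = Qp_incl p y \<Longrightarrow> x = y"
  unfolding Qp_incl_def
  using ring.indexed_const_is_inj[OF field.is_ring[OF Qp_field[OF p]]] by (rule injD)

lemma Qp_bar_field: "field (Qp_bar p)"
  using Qp_bar_closure by (rule algebraic_closure.axioms)

lemma Qp_bar_closed: "algebraically_closed (Qp_bar p)"
proof -
  interpret algebraic_closure "Qp_bar p" "Qp_in_Qp_bar p" by (rule Qp_bar_closure)
  show ?thesis by (rule algebraically_closed_axioms)
qed

lemmas Qp_incl = ring_hom_memE[OF Qp_incl_hom]

lemma rat_hom_Qp_bar: "rat_hom (Qp_bar p) (\<lambda>r. Qp_incl p (rho p r))"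
  by (intro rat_hom.intro coeff_hom.intro Qp_bar_field coeff_hom_axioms.intro)
    (simp_all add: rho_hom[OF p] Qp_incl)

lemma val_field_Qp_bar:
  "val_field (Qp_bar p) (\<lambda>r. Qp_incl p (rho p r)) (Qp_in_Qp_bar p) (Qp_incl p ` Zp p) p"
proof (intro val_field.intro rat_hom_Qp_bar val_field_axioms.intro)
  note ZQ = Zp_carrier[OF p]
  show "prime p" by (rule p)
  show "subfield (Qp_in_Qp_bar p) (Qp_bar p)" by (rule algebraic_closure.axioms[OF Qp_bar_closure])
  show "Qp_incl p ` Zp p \<subseteq> Qp_in_Qp_bar p" unfolding Qp_in_Qp_bar_eq using ZQ by blast
  show "Qp_incl p (rho p (of_int z)) \<in> Qp_incl p ` Zp p" for z using rho_in_Zp[OF p] by blast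
  fix x assume x: "x \<in> Qp_incl p ` Zp p"
  then obtain a where a: "a \<in> Zp p" "x = Qp_incl p a" by blast
  show "\<exists>z y. y \<in> Qp_incl p ` Zp p \<and> x = Qp_incl p (rho p (of_int z)) \<oplus>\<^bsub>Qp_bar p\<^esub> Qp_incl p (rho p (of_nat p)) \<otimes>\<^bsub>Qp_bar p\<^esub> y"
  proof -
    obtain z y where zy: "y \<in> Zp p" "a = rho p (of_int z) \<oplus>\<^bsub>Qp p\<^esub> rho p (of_nat p) \<otimes>\<^bsub>Qp p\<^esub> y"
      using Zp_approx[OF p a(1)] by blast
    interpret Q: field "Qp p" by (rule Qp_field[OF p])
    have yc: "y \<in> carrier (Qp p)" using ZQ zy(1) by blast
    have "x = Qp_incl p (rho p (of_int z)) \<oplus>\<^bsub>Qp_bar p\<^esub> Qp_incl p (rho p (of_nat p)) \<otimes>\<^bsub>Qp_bar p\<^esub> Qp_incl p y"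
      unfolding a(2) zy(2) using yc rho_hom(4)[OF p] by (simp add: Qp_incl)
    then show ?thesis using zy(1) by blast
  qed
  fix y assume "y \<in> Qp_incl p ` Zp p"
  then obtain b where b: "b \<in> Zp p" "y = Qp_incl p b" by blast
  have c: "a \<in> carrier (Qp p)" "b \<in> carrier (Qp p)" using a b ZQ by blast+
  show "x \<oplus>\<^bsub>Qp_bar p\<^esub> y \<in> Qp_incl p ` Zp p" "x \<otimes>\<^bsub>Qp_bar p\<^esub> y \<in> Qp_incl p ` Zp p"
    unfolding a(2) b(2) Qp_incl(2,3)[OF c, symmetric] using Zp_add[OF p a(1) b(1)] Zp_mult[OF p a(1) b(1)] by blast+
next
  note ZQ = Zp_carrier[OF p]
  interpret Q: field "Qp p" by (rule Qp_field[OF p])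
  interpret QB: field "Qp_bar p" by (rule Qp_bar_field)
  interpret h: ring_hom_ring "Qp p" "Qp_bar p" "Qp_incl p"
    by (rule ring_hom_ringI2[OF Q.is_ring QB.is_ring Qp_incl_hom])
  fix x assume "x \<in> Qp_in_Qp_bar p"
  then obtain a where a: "a \<in> carrier (Qp p)" "x = Qp_incl p a" unfolding Qp_in_Qp_bar_eq by blast
  show "\<exists>k. Qp_incl p (rho p (of_nat p ^ k)) \<otimes>\<^bsub>Qp_bar p\<^esub> x \<in> Qp_incl p ` Zp p"
  proof -
    obtain k where "rho p (of_nat p ^ k) \<otimes>\<^bsub>Qp p\<^esub> a \<in> Zp p" using Zp_scale[OF p a(1)] by blast
    then show ?thesis unfolding a(2) Qp_incl(2)[OF rho_hom(4)[OF p] a(1), symmetric] by blast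
  qed
  assume d: "\<And>k. \<exists>y\<in>Qp_incl p ` Zp p. x = Qp_incl p (rho p (of_nat p ^ k)) \<otimes>\<^bsub>Qp_bar p\<^esub> y"
  have "a = \<zero>\<^bsub>Qp p\<^esub>"
  proof (rule Zp_separated[OF p a(1)])
    fix k
    obtain y where y: "y \<in> Zp p" "x = Qp_incl p (rho p (of_nat p ^ k)) \<otimes>\<^bsub>Qp_bar p\<^esub> Qp_incl p y" using d[of k] by blast
    have yc: "y \<in> carrier (Qp p)" using ZQ y(1) by blast
    have "Qp_incl p a = Qp_incl p (rho p (of_nat p ^ k) \<otimes>\<^bsub>Qp p\<^esub> y)"
      using y(2) unfolding a(2) Qp_incl(2)[OF rho_hom(4)[OF p] yc] .
    then have "a = rho p (of_nat p ^ k) \<otimes>\<^bsub>Qp p\<^esub> y" by (rule Qp_incl_inj)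
    then show "\<exists>y\<in>Zp p. a = rho p (of_nat p ^ k) \<otimes>\<^bsub>Qp p\<^esub> y" using y(1) by blast
  qed
  then show "x = \<zero>\<^bsub>Qp_bar p\<^esub>" unfolding a(2) by simp
qed

text \<open>Polynomial evaluation can be done termwise on Cauchy sequences, so the class of the
  approximate roots is a root.\<close>

lemma padic_limit_root_in_Qp:
  assumes c: "\<And>k. int p ^ k dvd c (Suc k) - c k" and f: "\<And>k. int p ^ k dvd poly f (c k)"
  shows "\<exists>y\<in>Qp_in_Qp_bar p. hev (Qp_bar p) (\<lambda>r. Qp_incl p (rho p r)) (ratp f) y = \<zero>\<^bsub>Qp_bar p\<^esub>"
proof -
  interpret V: val_field "Qp_bar p" "\<lambda>r. Qp_incl p (rho p r)" "Qp_in_Qp_bar p" "Qp_incl p ` Zp p" p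
    by (rule val_field_Qp_bar)
  interpret Q: field "Qp p" by (rule Qp_field[OF p])
  interpret h: ring_hom_ring "Qp p" "Qp_bar p" "Qp_incl p"
    by (rule ring_hom_ringI2[OF Q.is_ring V.K.is_ring Qp_incl_hom])
  define s :: "nat \<Rightarrow> rat" where "s = (\<lambda>k. of_int (c k))"
  note lim = padic_limit_root[OF p c f, folded s_def]
  have s: "padic_Cauchy p s" by (rule lim)
  define y where "y = Qp_incl p (cls p s)"
  have yc: "y \<in> carrier (Qp_bar p)" unfolding y_def by (rule Qp_incl(1)[OF cls_closed[OF p s]])
  have "padic_Cauchy p (\<lambda>k. of_int (poly g (c k))) \<and>
    hev (Qp_bar p) (\<lambda>r. Qp_incl p (rho p r)) (ratp g) y = Qp_incl p (cls p (\<lambda>k. of_int (poly g (c k))))" for g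
  proof (induction g)
    case 0
    have "padic_Cauchy p (\<lambda>_. 0)" by (rule padic_Cauchy_const[OF p])
    moreover have "cls p (\<lambda>_. 0) = \<zero>\<^bsub>Qp p\<^esub>"
      unfolding cls_eq_0[OF p padic_Cauchy_const[OF p]] padic_null_def by (simp add: padic_abs_def)
    ultimately show ?case by (simp add: hev_def)
  next
    case (pCons z g)
    define t :: "nat \<Rightarrow> rat" where "t = (\<lambda>k. of_int (poly g (c k)))"
    have t: "padic_Cauchy p t" "hev (Qp_bar p) (\<lambda>r. Qp_incl p (rho p r)) (ratp g) y = Qp_incl p (cls p t)"
      using pCons.IH unfolding t_def by blast+
    have zc: "padic_Cauchy p (\<lambda>_. of_int z)" by (rule padic_Cauchy_const[OF p])
    note st = padic_Cauchy_mult[OF p s t(1)]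
    have e: "(\<lambda>k. of_int (poly (pCons z g) (c k))) = (\<lambda>k. of_int z + s k * t k)" by (simp add: s_def t_def)
    have "hev (Qp_bar p) (\<lambda>r. Qp_incl p (rho p r)) (ratp (pCons z g)) y
      = Qp_incl p (rho p (of_int z) \<oplus>\<^bsub>Qp p\<^esub> (cls p s \<otimes>\<^bsub>Qp p\<^esub> cls p t))"
      unfolding V.hev_ratp_pCons[OF yc] t(2) using rho_hom(4)[OF p] cls_closed[OF p s] cls_closed[OF p t(1)]
      by (simp add: y_def Qp_incl)
    also have "\<dots> = Qp_incl p (cls p (\<lambda>k. of_int z + s k * t k))"
      unfolding rho_def[OF p] cls_mult[OF p s t(1)] cls_add[OF p zc st] ..
    finally show ?case unfolding e using padic_Cauchy_add[OF p zc st] by simp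
  qed
  then have "hev (Qp_bar p) (\<lambda>r. Qp_incl p (rho p r)) (ratp f) y = Qp_incl p (cls p (\<lambda>k. of_int (poly f (c k))))"
    and fc: "padic_Cauchy p (\<lambda>k. of_int (poly f (c k)))" by blast+
  moreover have "cls p (\<lambda>k. of_int (poly f (c k))) = \<zero>\<^bsub>Qp p\<^esub>"
    unfolding cls_eq_0[OF p fc] by (rule lim)
  moreover have "y \<in> Qp_in_Qp_bar p" unfolding Qp_in_Qp_bar_eq y_def using cls_closed[OF p s] by blast
  ultimately show ?thesis by auto
qed

theorem unbounded_if_roots_of_unity:
  assumes L: "subfield L complex_ring" and inf: "infinite {q. prime q \<and> zeta q \<in> L}"
  shows "unbounded_local_degrees L p"
proof
  assume "bounded_local_degrees L p"
  then obtain E \<phi> where E: "finite_extension_of_Qp p E" and \<phi>: "\<phi> \<in> ring_hom (field_of L) (Qp_bar p\<lparr>carrier := E\<rparr>)"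
    unfolding bounded_local_degrees_def by blast
  interpret V: val_field "Qp_bar p" "\<lambda>r. Qp_incl p (rho p r)" "Qp_in_Qp_bar p" "Qp_incl p ` Zp p" p
    by (rule val_field_Qp_bar)
  have E: "subfield E (Qp_bar p)" "Qp_in_Qp_bar p \<subseteq> E" "V.K.finite_dimension (Qp_in_Qp_bar p) E"
    using E unfolding finite_extension_of_Qp_def by auto
  obtain d where d: "V.K.dimension d (Qp_in_Qp_bar p) E" using E(3) by (rule V.K.finite_dimensionE')
  have "infinite ({q. prime q \<and> zeta q \<in> L} - {..p ^ d + p})" using inf by (simp add: Diff_infinite_finite)
  then have "{q. prime q \<and> zeta q \<in> L} - {..p ^ d + p} \<noteq> {}" by (rule infinite_imp_nonempty)
  then obtain q where "q \<in> {q. prime q \<and> zeta q \<in> L} - {..p ^ d + p}" by blast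
  then have q: "prime q" "zeta q \<in> L" "q > p ^ d + p" by simp_all
  have qp: "q > 0" "q > 1" using q(1) prime_gt_0_nat prime_gt_1_nat by auto
  note m = ring_hom_memE[OF \<phi>]
  note s = subfield_closed[OF L]
  have sE: "E \<subseteq> carrier (Qp_bar p)" by (rule subfieldE(3)[OF E(1)])
  have one: "\<phi> 1 = \<one>\<^bsub>Qp_bar p\<^esub>" using m(4) by simp
  have vE: "\<phi> (zeta q) \<in> E" using m(1)[of "zeta q"] q(2) by simp
  have vc: "\<phi> (zeta q) \<in> carrier (Qp_bar p)" using vE sE by blast
  have pw: "zeta q ^ k \<in> L \<and> \<phi> (zeta q) [^]\<^bsub>Qp_bar p\<^esub> k = \<phi> (zeta q ^ k)" for k :: nat
  proof (induction k)
    case (Suc k)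
    then show ?case using m(2)[of "zeta q ^ k" "zeta q"] q(2) s by (simp add: mult.commute)
  qed (simp add: one s)
  have v1: "\<phi> (zeta q) [^]\<^bsub>Qp_bar p\<^esub> q = \<one>\<^bsub>Qp_bar p\<^esub>"
    using pw[of q] zeta_power_self[OF qp(1)] one by simp
  have "\<phi> (zeta q) \<noteq> \<one>\<^bsub>Qp_bar p\<^esub>"
  proof
    assume e: "\<phi> (zeta q) = \<one>\<^bsub>Qp_bar p\<^esub>"
    \<comment> \<open>zeta q - 1 is invertible in \<open>L\<close>, so its image cannot be 0; the
      image of \<open>zeta q\<close> remains a nontrivial root of unity.\<close>
    have zq: "zeta q \<noteq> 1" using zeta_power_eq_1_iff[OF qp(1), of 1] qp(2) by auto
    define w where "w = zeta q + - 1"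
    have w: "w \<in> L" "inverse w \<in> L" "w * inverse w = 1" using q(2) s zq by (simp_all add: w_def)
    have wc: "\<phi> w \<in> carrier (Qp_bar p)" "\<phi> (inverse w) \<in> carrier (Qp_bar p)" using m(1) w sE by auto
    have "\<phi> (w + 1) = \<phi> w \<oplus>\<^bsub>Qp_bar p\<^esub> \<one>\<^bsub>Qp_bar p\<^esub>" using m(3)[of w 1] w s one by simp
    then have "\<one>\<^bsub>Qp_bar p\<^esub> = \<phi> w \<oplus>\<^bsub>Qp_bar p\<^esub> \<one>\<^bsub>Qp_bar p\<^esub>" using e by (simp add: w_def)
    then have "\<phi> w \<oplus>\<^bsub>Qp_bar p\<^esub> \<one>\<^bsub>Qp_bar p\<^esub> = \<zero>\<^bsub>Qp_bar p\<^esub> \<oplus>\<^bsub>Qp_bar p\<^esub> \<one>\<^bsub>Qp_bar p\<^esub>" by simp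
    then have "\<phi> w = \<zero>\<^bsub>Qp_bar p\<^esub>"
      unfolding V.K.add.right_cancel[OF V.K.one_closed wc(1) V.K.zero_closed] .
    moreover have "\<phi> w \<otimes>\<^bsub>Qp_bar p\<^esub> \<phi> (inverse w) = \<one>\<^bsub>Qp_bar p\<^esub>" using m(2)[of w "inverse w"] w one by simp
    ultimately show False using wc by simp
  qed
  then have "q \<le> p ^ d" using V.prime_root_of_unity_bound[OF E(1,2) d vE v1 _ q(1)] q(3) by simp
  then show False using q(3) by simp
qed

end

context cyc_data
begin

text \<open>At the finitely many exceptional \<open>q\<close> any algebraic root is taken and
  adjoined to the p-adic numbers. All other generators are sent to p-adic roots, so one finite
  extension contains the image.\<close>

theorem bounded_if_almost_split:
  assumes p: "prime p" and fin: "finite {q \<in> Lambda. p dvd N q \<or> \<psi> q p \<noteq> 0}"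
  shows "bounded_local_degrees Lf p"
proof -
  define \<rho> where "\<rho> = (\<lambda>r. Qp_incl p (rho p r))"
  define Bd where "Bd = {q \<in> Lambda. p dvd N q \<or> \<psi> q p \<noteq> 0}"
  interpret rat_hom "Qp_bar p" \<rho> unfolding \<rho>_def by (rule rat_hom_Qp_bar[OF p])
  interpret C: algebraic_closure "Qp_bar p" "Qp_in_Qp_bar p" by (rule Qp_bar_closure[OF p])
  have "\<forall>q\<in>Lambda. \<exists>\<beta>. \<beta> \<in> carrier (Qp_bar p) \<and> hev (Qp_bar p) \<rho> (ratp (FF q)) \<beta> = \<zero>\<^bsub>Qp_bar p\<^esub> \<and>
    (q \<in> Bd \<or> \<beta> \<in> Qp_in_Qp_bar p)"
  proof
    fix q assume q: "q \<in> Lambda"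
    show "\<exists>\<beta>. \<beta> \<in> carrier (Qp_bar p) \<and> hev (Qp_bar p) \<rho> (ratp (FF q)) \<beta> = \<zero>\<^bsub>Qp_bar p\<^esub> \<and> (q \<in> Bd \<or> \<beta> \<in> Qp_in_Qp_bar p)"
    proof (cases "q \<in> Bd")
      case True
      have "degree (ratp (FF q)) > 0"
        using block.degree_F[OF blk[OF q]] Lambda_pred_pos[OF q] unfolding FF_def by simp
      then show ?thesis using rat_poly_root[OF Qp_bar_closed[OF p]] True by blast
    next
      case False
      then have "\<not> p dvd N q" "\<psi> q p = 0" using q unfolding Bd_def by auto
      then obtain c :: "nat \<Rightarrow> int" where "\<forall>k. int p ^ k dvd c (Suc k) - c k \<and> int p ^ k dvd poly (FF q) (c k)"
        using block.padic_root[OF blk[OF q] p] unfolding FF_def by blast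
      then obtain y where y: "y \<in> Qp_in_Qp_bar p" "hev (Qp_bar p) \<rho> (ratp (FF q)) y = \<zero>\<^bsub>Qp_bar p\<^esub>"
        using padic_limit_root_in_Qp[OF p, of c "FF q"] unfolding \<rho>_def by blast
      then show ?thesis using subfieldE(3)[OF C.subfield_axioms] by blast
    qed
  qed
  from bchoice[OF this] obtain \<beta> where \<beta>: "\<forall>q\<in>Lambda. \<beta> q \<in> carrier (Qp_bar p) \<and>
    hev (Qp_bar p) \<rho> (ratp (FF q)) (\<beta> q) = \<zero>\<^bsub>Qp_bar p\<^esub> \<and> (q \<in> Bd \<or> \<beta> q \<in> Qp_in_Qp_bar p)" ..
  have "\<exists>h\<in>ring_hom (field_of Lf) (Qp_bar p). \<forall>q\<in>Lambda. h (A q 0) = \<beta> q"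
    by (rule hom_exists[OF rat_hom_axioms is_conj_exists[OF Qp_bar_closed[OF p]]]) (use \<beta> in auto)
  then obtain h where h: "h \<in> ring_hom (field_of Lf) (Qp_bar p)" "\<forall>q\<in>Lambda. h (A q 0) = \<beta> q" by blast
  define bs where "bs = map \<beta> (sorted_list_of_set Bd)"
  have fB: "finite Bd" using fin unfolding Bd_def .
  have sbs: "set bs = \<beta> ` Bd" unfolding bs_def using fB by simp
  have bs: "set bs \<subseteq> carrier (Qp_bar p)" unfolding sbs using \<beta> unfolding Bd_def by auto
  define E where "E = K.finite_extension (Qp_in_Qp_bar p) bs"
  have alg: "(K.algebraic over Qp_in_Qp_bar p) x" if "x \<in> set bs" for x using C.algebraic_extension bs that by blast
  have Es: "subfield E (Qp_bar p)" unfolding E_def by (rule K.finite_extension_is_subfield[OF C.subfield_axioms bs alg])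
  have Ed: "K.finite_dimension (Qp_in_Qp_bar p) E"
    unfolding E_def by (rule K.finite_extension_finite_dimension(1)[OF C.subfield_axioms bs alg])
  have QE: "Qp_in_Qp_bar p \<subseteq> E" unfolding E_def
    by (rule K.finite_extension_incl[OF subfieldE(3)[OF C.subfield_axioms] bs])
  have bE: "set bs \<subseteq> E" unfolding E_def by (rule K.finite_extension_mem[OF subfieldE(1)[OF C.subfield_axioms] bs])
  have into: "h x \<in> E" if "x \<in> Lf" for x
  proof (rule ring_hom_gen_into[OF K.field_axioms Lf h(1) _ Es])
    show "(\<lambda>q. A q 0) ` Lambda \<subseteq> Lf" using A0_Lf by (rule image_subsetI)
    show "x \<in> gen ((\<lambda>q. A q 0) ` Lambda)" using that unfolding Lf_def .
    fix y assume "y \<in> (\<lambda>q. A q 0) ` Lambda"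
    then obtain q where q: "q \<in> Lambda" "y = A q 0" by blast
    then have "h y = \<beta> q" using h(2) by simp
    moreover have "q \<in> Bd \<or> \<beta> q \<in> Qp_in_Qp_bar p" using bspec[OF \<beta> q(1)] by (elim conjE)
    then have "\<beta> q \<in> E"
    proof
      assume "q \<in> Bd"
      then have "\<beta> q \<in> set bs" unfolding sbs by (rule imageI)
      then show ?thesis using bE by (rule rev_subsetD)
    next
      assume "\<beta> q \<in> Qp_in_Qp_bar p"
      then show ?thesis using QE by (rule rev_subsetD)
    qed
    ultimately show "h y \<in> E" by simp
  qed
  have "h \<in> ring_hom (field_of Lf) (Qp_bar p\<lparr>carrier := E\<rparr>)"
    using h(1) into unfolding ring_hom_def by auto
  moreover have "finite_extension_of_Qp p E" unfolding finite_extension_of_Qp_def using Es QE Ed by blast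
  ultimately show ?thesis unfolding bounded_local_degrees_def by blast
qed

end

section \<open>Conductors and characters\<close>

text \<open>Division by a monic polynomial stays over the integers, so divisibility descends from
  the rationals.\<close>

lemma min_poly_dvd_int:
  assumes g: "is_min_poly (ratp g) z" "lead_coeff g = 1" and s: "evi s z = 0"
  shows "g dvd s"
proof -
  define Q R where "Q = fst (pseudo_divmod s g)" and "R = snd (pseudo_divmod s g)"
  have "g \<noteq> 0" using g(2) by auto
  moreover have "pseudo_divmod s g = (Q, R)" by (simp add: Q_def R_def)
  ultimately have s': "s = g * Q + R" and R: "R = 0 \<or> degree R < degree g"
    using pseudo_divmod[of g s Q R] g(2) by auto
  have "evi g z = 0" using g(1) unfolding is_min_poly_def by simp
  then have "evi R z = 0" using s unfolding s' by simp
  then have d: "ratp g dvd ratp R" using g(1) unfolding is_min_poly_def by simp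
  have "R = 0"
  proof (rule ccontr)
    assume "R \<noteq> 0"
    then have "ratp R \<noteq> 0" using ratp_inject[of R 0] by auto
    then have "degree (ratp g) \<le> degree (ratp R)" using dvd_imp_degree_le[OF d] by blast
    then show False using R \<open>R \<noteq> 0\<close> by simp
  qed
  then show ?thesis unfolding s' by simp
qed

text \<open>A prime divisor \<open>u\<close> of the minimal polynomial of \<open>zeta n\<close>, evaluated at a multiple \<open>x\<close> of \<open>n\<close>:
  the order of \<open>x\<close> modulo \<open>u\<close> is \<open>n\<close>.\<close>

lemma prime_cong_1_exists:
  assumes n: "n > 0"
  shows "\<exists>u>b. prime u \<and> n dvd u - (1::nat)"
proof -
  define z where "z = zeta n"
  obtain g h where g: "is_min_poly (ratp g) z" "lead_coeff g = 1" "unity_poly n = g * h"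
    using root_of_unity_min_poly[OF zeta_power_self[OF n] n] unfolding z_def by blast
  have dg: "degree g > 0" using is_min_poly_degree_pos[OF g(1)] by simp
  \<comment> \<open>A value other than 0, 1 and -1 is wanted, so that it has a genuine prime
    divisor; only finitely many arguments fail.\<close>
  define Z where "Z = {x::int. poly g x \<in> {-1, 0, 1}}"
  have "finite {x. poly (g - [:c:]) x = 0}" for c
  proof (rule poly_roots_finite, rule notI)
    assume "g - [:c:] = 0"
    then have "g = [:c:]" by simp
    then show False using dg by simp
  qed
  then have "finite (\<Union>c\<in>{-1, 0, 1}. {x. poly (g - [:c:]) x = 0})" by blast
  moreover have "Z \<subseteq> (\<Union>c\<in>{-1, 0, 1}. {x. poly (g - [:c:]) x = 0})" unfolding Z_def by auto
  ultimately have finZ: "finite Z" by (rule finite_subset[rotated])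
  \<comment> \<open>A prime dividing the value does not divide the argument. As the argument is a
    multiple of n b!, the prime does not divide \<open>n\<close> and exceeds
    \<open>b\<close>.\<close>
  define m where "m = n * fact b"
  have m: "m > 0" using n by (simp add: m_def)
  have "inj_on (\<lambda>k. int (m * k)) {1..}" using m by (intro inj_onI) simp
  then have "infinite ((\<lambda>k. int (m * k)) ` {1..})" using finite_imageD infinite_Ici by blast
  then have "\<not> (\<lambda>k. int (m * k)) ` {1..} \<subseteq> Z" using finZ finite_subset by blast
  then obtain k where k: "k \<ge> 1" "int (m * k) \<notin> Z" by auto
  define x where "x = m * k"
  have x: "x > 0" using m k by (simp add: x_def)
  have "poly g (int x) \<notin> {-1, 0, 1}" using k(2) unfolding Z_def x_def by simp
  then have nu: "\<not> is_unit (poly g (int x))" "poly g (int x) \<noteq> 0" by auto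
  then obtain v :: int where v: "prime v" "v dvd poly g (int x)" using prime_divisor_exists by blast
  define u where "u = nat v"
  have u: "prime u" "int u dvd poly g (int x)" using v prime_ge_0_int[of v] by (simp_all add: u_def)
  have "poly (unity_poly n) (int x) = int x ^ n - 1"
    unfolding unity_poly_def by (simp add: poly_monom)
  then have "int u dvd int x ^ n - 1" using u(2) unfolding g(3) by (metis dvd_mult2 poly_mult)
  then have xn: "[int x ^ n = 1] (mod int u)" by (simp add: cong_iff_dvd_diff)
  then have xn': "[x ^ n = 1] (mod u)" by (metis cong_int_iff of_nat_1 of_nat_power)
  have ux: "\<not> u dvd x"
  proof
    assume "u dvd x"
    then have "u dvd x ^ n" using n by (simp add: dvd_power_iff dvd_trans[OF _ dvd_power])
    then have "u dvd 1" using xn' cong_dvd_iff by blast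
    then show False using u(1) by simp
  qed
  have un: "\<not> u dvd n" using ux unfolding x_def m_def by auto
  have ub: "u > b"
  proof (rule ccontr)
    assume "\<not> u > b"
    then have "u dvd fact b" using prime_dvd_fact_iff[OF u(1)] by simp
    then show False using ux unfolding x_def m_def by simp
  qed
  define d where "d = ord u x"
  have dn: "d dvd n" using xn' unfolding d_def ord_divides by simp
  \<comment> \<open>For a proper divisor d of n the minimal polynomial divides 1 + X^d + ... +
    X^(n-d), which at \<open>x\<close> is n / d modulo \<open>u\<close>. Then \<open>u\<close> would
    divide \<open>n\<close>.\<close>
  have "d = n"
  proof (rule ccontr)
    assume "d \<noteq> n"
    then have d: "d > 0" "d < n" using dn n dvd_imp_le[OF dn n] by (auto intro: gr0I)
    define t where "t = n div d"
    have t: "d * t = n" using dn by (simp add: t_def)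
    define s where "s = (\<Sum>j<t. monom (1::int) (d * j))"
    have zd: "z ^ d \<noteq> 1" unfolding z_def zeta_power_eq_1_iff[OF n] using d by (auto dest: dvd_imp_le)
    have "evi s z = (\<Sum>j<t. (z ^ d) ^ j)" unfolding s_def by (simp add: evi_sum power_mult)
    moreover have "(z ^ d - 1) * (\<Sum>j<t. (z ^ d) ^ j) = 0"
      using power_diff_1_eq[of "z ^ d" t] zeta_power_self[OF n] t unfolding z_def by (simp flip: power_mult)
    ultimately have "evi s z = 0" using zd by simp
    then have "g dvd s" by (rule min_poly_dvd_int[OF g(1,2)])
    then obtain w where "s = g * w" by (rule dvdE)
    then have us: "int u dvd poly s (int x)" using u(2) by simp
    have "[x ^ d = 1] (mod u)" unfolding d_def ord_divides by simp
    then have "[int x ^ d = 1] (mod int u)" by (metis cong_int_iff of_nat_1 of_nat_power)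
    then have "[(int x ^ d) ^ j = 1 ^ j] (mod int u)" for j by (rule cong_pow)
    then have "[(\<Sum>j<t. (int x ^ d) ^ j) = (\<Sum>j<t. 1)] (mod int u)" by (intro cong_sum) simp
    moreover have "poly s (int x) = (\<Sum>j<t. (int x ^ d) ^ j)" unfolding s_def by (simp add: poly_sum poly_monom power_mult)
    ultimately have "[poly s (int x) = int t] (mod int u)" by simp
    then have "int u dvd int t" using us cong_dvd_iff by blast
    then have "u dvd t" by simp
    then show False using un t by auto
  qed
  moreover have "coprime u x" using u(1) ux by (rule prime_imp_coprime)
  ultimately have "n dvd totient u" using order_divides_totient[of u x] unfolding d_def by simp
  then have "n dvd u - 1" using u(1) by (simp add: totient_prime)
  then show ?thesis using ub u(1) by blast
qed

text \<open>A surjective character of the units modulo \<open>N\<close>, written additively: a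
  \<open>block\<close> before a generator is chosen.\<close>

locale character =
  fixes N n :: nat and \<psi> :: "nat \<Rightarrow> nat"
  assumes N: "N > 0"
    and psi_less: "\<And>a. \<psi> a < n"
    and psi_mult: "\<And>a b. coprime a N \<Longrightarrow> coprime b N \<Longrightarrow> \<psi> (a * b) = (\<psi> a + \<psi> b) mod n"
    and psi_surj: "\<And>c. c < n \<Longrightarrow> \<exists>a. coprime a N \<and> \<psi> a = c"
    and psi_cong: "\<And>a b. [a = b] (mod N) \<Longrightarrow> \<psi> a = \<psi> b"
begin

lemma psi_1: "\<psi> 1 = 0"
proof -
  have "\<psi> (1 * 1) = (\<psi> 1 + \<psi> 1) mod n" by (rule psi_mult) simp_all
  then have "[\<psi> 1 + 0 = \<psi> 1 + \<psi> 1] (mod n)" using psi_less[of 1] by (simp add: cong_def)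
  then have "[0 = \<psi> 1] (mod n)" by (simp only: cong_add_lcancel_nat)
  then show ?thesis using psi_less[of 1] by (simp add: cong_def)
qed

end

text \<open>The logarithm to a primitive root, reduced modulo \<open>n\<close>. For n = u - 1 the
  reduction loses nothing, so that the fixed field is the whole cyclotomic field.\<close>

lemma discrete_log_exists:
  assumes u: "prime u" and n: "n > 0" "n dvd u - 1"
  shows "\<exists>\<psi>. character u n \<psi> \<and>
    (n = u - 1 \<longrightarrow> (\<forall>a b. coprime a u \<longrightarrow> coprime b u \<longrightarrow> \<psi> a = \<psi> b \<longrightarrow> [a = b] (mod u)))"
proof -
  obtain g where "residue_primroot u g" using prime_primitive_root_exists[of u] u prime_gt_1_nat by blast
  then have g: "coprime u g" "ord u g = u - 1" using u by (auto simp: residue_primroot_def totient_prime)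
  have u0: "u > 1" using u prime_gt_1_nat by blast
  have gex: "\<exists>i. [g ^ i = a] (mod u)" if "coprime a u" for a
  proof -
    have bij: "bij_betw (\<lambda>i. g ^ i mod u) {..<totient u} (totatives u)"
      using residue_primroot_is_generator[OF u0 \<open>residue_primroot u g\<close>] .
    have "a mod u \<in> totatives u"
    proof -
      have c: "coprime (a mod u) u" using that u0 by (simp add: coprime_mod_left_iff)
      have "a mod u \<noteq> 0"
      proof
        assume "a mod u = 0"
        then show False using c u0 by simp
      qed
      then show ?thesis using c u0 by (simp add: totatives_def less_imp_le)
    qed
    then obtain i where "a mod u = g ^ i mod u" using bij unfolding bij_betw_def by blast
    then show ?thesis by (intro exI[of _ i]) (simp add: cong_def)
  qed
  have geq: "[g ^ i = g ^ j] (mod u) \<longleftrightarrow> [i = j] (mod (u - 1))" for i j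
    using order_divides_expdiff[OF g(1)] g(2) by simp
  define L where "L a = (SOME i. [g ^ i = a] (mod u))" for a
  have L: "[g ^ L a = a] (mod u)" if "coprime a u" for a
    unfolding L_def using gex[OF that] by (rule someI_ex)
  have L_eq: "[L a = i] (mod (u - 1))" if "[g ^ i = a] (mod u)" "coprime a u" for a i
    using cong_trans[OF L[OF that(2)] cong_sym[OF that(1)]] unfolding geq .
  define \<psi> where "\<psi> a = L a mod n" for a
  have psi: "\<psi> a = i mod n" if "[g ^ i = a] (mod u)" "coprime a u" for a i
    using cong_dvd_modulus_nat[OF L_eq[OF that] n(2)] unfolding \<psi>_def by (simp add: cong_def)
  have gc: "coprime (g ^ i) u" for i using g(1) by (simp add: coprime_commute)
  have "character u n \<psi>"
  proof
    show "u > 0" using u0 by simp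
    show "\<psi> a < n" for a unfolding \<psi>_def using n by simp
    show "\<psi> (a * b) = (\<psi> a + \<psi> b) mod n" if ab: "coprime a u" "coprime b u" for a b
    proof -
      have "[g ^ (L a + L b) = a * b] (mod u)" unfolding power_add by (intro cong_mult L ab)
      then show ?thesis using psi[of "L a + L b" "a * b"] ab by (simp add: \<psi>_def mod_add_eq)
    qed
    show "\<exists>a. coprime a u \<and> \<psi> a = c" if "c < n" for c
      by (intro exI[of _ "g ^ c"] conjI gc) (use psi[OF cong_refl gc, of c] that in simp)
    show "\<psi> a = \<psi> b" if "[a = b] (mod u)" for a b
    proof -
      have "[g ^ i = a] (mod u) \<longleftrightarrow> [g ^ i = b] (mod u)" for i using that cong_sym cong_trans by blast
      then show ?thesis unfolding \<psi>_def L_def by simp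
    qed
  qed
  moreover have "[a = b] (mod u)" if "n = u - 1" "coprime a u" "coprime b u" "\<psi> a = \<psi> b" for a b
  proof -
    have "[L a = L b] (mod (u - 1))" using that unfolding \<psi>_def cong_def by simp
    then have "[g ^ L a = g ^ L b] (mod u)" unfolding geq .
    then show ?thesis using L[OF that(2)] L[OF that(3)] cong_sym cong_trans by meson
  qed
  ultimately show ?thesis by blast
qed

text \<open>The quotient of two characters of coprime conductors that agree on the primes up to \<open>b\<close>.\<close>

lemma character_trivial_on_small_primes:
  assumes n: "n > 0"
  shows "\<exists>N \<psi>. character N n \<psi> \<and> (\<forall>p. prime p \<longrightarrow> p dvd N \<longrightarrow> b < p) \<and>
    (\<forall>p. prime p \<longrightarrow> p \<le> b \<longrightarrow> \<psi> p = 0)"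
proof -
  define U where "U = {u. prime u \<and> b < u \<and> n dvd u - (1::nat)}"
  have "infinite U" unfolding infinite_nat_iff_unbounded
  proof
    fix m
    obtain u where "u > max m b" "prime u" "n dvd u - 1" using prime_cong_1_exists[OF n] by blast
    then show "\<exists>u>m. u \<in> U" unfolding U_def by auto
  qed
  have "\<forall>u\<in>U. \<exists>\<psi>. character u n \<psi>" using discrete_log_exists[OF _ n] unfolding U_def by blast
  from bchoice[OF this] obtain dl where dl: "\<forall>u\<in>U. character u n (dl u)" ..
  \<comment> \<open>Pigeonhole: there are infinitely many primes \<open>u\<close> but only finitely
    many patterns of logarithms up to \<open>b\<close>.\<close>
  define V where "V u = restrict (dl u) {..b}" for u
  have "V ` U \<subseteq> {..b} \<rightarrow>\<^sub>E {..<n}"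
  proof
    fix w assume "w \<in> V ` U"
    then obtain u where "u \<in> U" "w = V u" by blast
    then show "w \<in> {..b} \<rightarrow>\<^sub>E {..<n}" using character.psi_less[of u n "dl u"] dl unfolding V_def by auto
  qed
  then have "finite (V ` U)" by (rule finite_subset) (simp add: finite_PiE)
  then have "\<not> inj_on V U" using \<open>infinite U\<close> finite_imageD by blast
  then obtain u v where uv: "u \<in> U" "v \<in> U" "u \<noteq> v" "V u = V v" unfolding inj_on_def by blast
  interpret cu: character u n "dl u" using dl uv(1) by blast
  interpret cv: character v n "dl v" using dl uv(2) by blast
  have pr: "prime u" "prime v" "b < u" "b < v" using uv unfolding U_def by auto
  have cop: "coprime u v" using primes_coprime[OF pr(1,2) uv(3)] .
  \<comment> \<open>The difference is taken in the integers, as it may be negative, and reduced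
    afterwards.\<close>
  define D where "D a = int (dl u a) - int (dl v a)" for a
  define \<psi> where "\<psi> a = nat (D a mod int n)" for a
  have int_psi: "int (\<psi> a) = D a mod int n" for a unfolding \<psi>_def using n by simp
  have "character (u * v) n \<psi>"
  proof
    show "u * v > 0" using pr prime_gt_0_nat by simp
    show "\<psi> a < n" for a
    proof -
      have "int (\<psi> a) < int n" unfolding int_psi using n by simp
      then show ?thesis by simp
    qed
    show "\<psi> (a * b) = (\<psi> a + \<psi> b) mod n" if "coprime a (u * v)" "coprime b (u * v)" for a b
    proof -
      have ab: "coprime a u" "coprime b u" "coprime a v" "coprime b v" using that by auto
      have "[int (dl u (a * b)) = int (dl u a) + int (dl u b)] (mod int n)"
        unfolding cu.psi_mult[OF ab(1,2)] by (simp add: cong_def zmod_int)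
      moreover have "[int (dl v (a * b)) = int (dl v a) + int (dl v b)] (mod int n)"
        unfolding cv.psi_mult[OF ab(3,4)] by (simp add: cong_def zmod_int)
      ultimately have "[D (a * b) = (int (dl u a) + int (dl u b)) - (int (dl v a) + int (dl v b))] (mod int n)"
        unfolding D_def by (rule cong_diff)
      also have "(int (dl u a) + int (dl u b)) - (int (dl v a) + int (dl v b)) = D a + D b" by (simp add: D_def)
      finally have "int (\<psi> (a * b)) = int ((\<psi> a + \<psi> b) mod n)"
        by (simp add: int_psi zmod_int cong_def mod_add_eq)
      then show ?thesis by (simp only: of_nat_eq_iff)
    qed
    show "\<exists>a. coprime a (u * v) \<and> \<psi> a = c" if c: "c < n" for c
    proof -
      obtain a0 where a0: "coprime a0 u" "dl u a0 = c" using cu.psi_surj[OF c] by blast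
      \<comment> \<open>On the classes that are 1 modulo \<open>v\<close> the second logarithm
        vanishes, and the first one takes every value.\<close>
      obtain a where a: "[a = a0] (mod u)" "[a = 1] (mod v)" using binary_chinese_remainder_nat[OF cop] by blast
      have "coprime a u" "coprime a v"
        using cong_imp_coprime[OF cong_sym[OF a(1)] a0(1)] cong_imp_coprime[OF cong_sym[OF a(2)]] by simp_all
      moreover have "D a = int c" unfolding D_def using cu.psi_cong[OF a(1)] a0(2) cv.psi_cong[OF a(2)] cv.psi_1 by simp
      ultimately show ?thesis using c by (intro exI[of _ a]) (simp add: \<psi>_def)
    qed
    show "\<psi> a = \<psi> b" if "[a = b] (mod u * v)" for a b
      using cu.psi_cong[OF cong_dvd_modulus_nat[OF that]] cv.psi_cong[OF cong_dvd_modulus_nat[OF that]]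
      by (simp add: \<psi>_def D_def)
  qed
  moreover have "b < p" if "prime p" "p dvd u * v" for p
  proof -
    have "p dvd u \<or> p dvd v" using that by (simp add: prime_dvd_mult_iff)
    then have "p = u \<or> p = v" using primes_dvd_imp_eq that(1) pr by blast
    then show ?thesis using pr by auto
  qed
  moreover have "\<psi> p = 0" if "p \<le> b" for p
    using fun_cong[OF uv(4), of p] that by (simp add: V_def \<psi>_def D_def)
  ultimately show ?thesis by blast
qed

text \<open>The generating polynomial is X, so the generators are the roots of unity
  \<open>zeta q\<close> themselves.\<close>

lemma cyc_data_roots_of_unity: "\<exists>\<psi>. cyc_data (\<lambda>q. q) \<psi> (\<lambda>_. monom 1 1)"
proof -
  have "\<forall>q. \<exists>\<psi>. q \<in> Lambda \<longrightarrow> block q (q - 1) \<psi> (monom 1 1)"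
  proof
    fix q
    show "\<exists>\<psi>. q \<in> Lambda \<longrightarrow> block q (q - 1) \<psi> (monom 1 1)"
    proof (cases "q \<in> Lambda")
      case True
      then have q: "prime q" unfolding Lambda_def by simp
      then have n: "q - 1 > 0" using prime_gt_1_nat by simp
      obtain \<psi> where \<psi>: "character q (q - 1) \<psi> \<and>
          (q - 1 = q - 1 \<longrightarrow> (\<forall>a b. coprime a q \<longrightarrow> coprime b q \<longrightarrow> \<psi> a = \<psi> b \<longrightarrow> [a = b] (mod q)))"
        using discrete_log_exists[OF q n dvd_refl] ..
      have c: "character q (q - 1) \<psi>" by (rule conjunct1[OF \<psi>])
      have inj: "\<forall>a b. coprime a q \<longrightarrow> coprime b q \<longrightarrow> \<psi> a = \<psi> b \<longrightarrow> [a = b] (mod q)"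
        by (rule mp[OF conjunct2[OF \<psi>] refl])
      note ch = character.N[OF c] character.psi_less[OF c] character.psi_mult[OF c] character.psi_surj[OF c] character.psi_cong[OF c]
      have "block q (q - 1) \<psi> (monom 1 1)"
      proof
        fix a b assume ab: "coprime a q" "coprime b q"
        have "evi (monom 1 1) (zeta q ^ a) = evi (monom 1 1) (zeta q ^ b) \<longleftrightarrow> [a = b] (mod q)"
          by simp (rule iffI, erule zeta_power_inj[OF ch(1)], erule zeta_power_cong[OF ch(1)])
        then show "evi (monom 1 1) (zeta q ^ a) = evi (monom 1 1) (zeta q ^ b) \<longleftrightarrow> \<psi> a = \<psi> b"
          using inj[rule_format, OF ab] ch(5)[of a b] by blast
      qed (fact ch)+
      then show ?thesis by blast
    qed blast
  qed
  from choice[OF this] obtain \<psi> where \<psi>: "\<forall>q. q \<in> Lambda \<longrightarrow> block q (q - 1) (\<psi> q) (monom 1 1)" ..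
  have "cyc_data (\<lambda>q. q) \<psi> (\<lambda>_. monom 1 1)"
  proof (rule cyc_data.intro)
    show "block q (q - 1) (\<psi> q) (monom 1 1)" if "q \<in> Lambda" for q using \<psi> that by blast
    show "coprime q r" if "q \<in> Lambda" "r \<in> Lambda" "q \<noteq> r" for q r
      using that primes_coprime unfolding Lambda_def by blast
  qed
  then show ?thesis by blast
qed

lemma cyc_data_almost_split:
  "\<exists>N \<psi> f. cyc_data N \<psi> f \<and> (\<forall>p. prime p \<longrightarrow> finite {q \<in> Lambda. p dvd N q \<or> \<psi> q p \<noteq> 0})"
proof -
  define Good where "Good q b N \<psi> f \<longleftrightarrow> block N (q - 1) \<psi> f \<and> (\<forall>p. prime p \<longrightarrow> p dvd N \<longrightarrow> b < p) \<and>
    (\<forall>p. prime p \<longrightarrow> p \<le> b \<longrightarrow> \<psi> p = 0)" for q b N \<psi> f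
  have ex: "\<exists>N \<psi> f. Good q b N \<psi> f" if q: "q \<in> Lambda" for q b
  proof -
    have n: "q - 1 > 0" using q prime_gt_1_nat unfolding Lambda_def by auto
    obtain N \<psi> where c: "character N (q - 1) \<psi>" and b: "\<forall>p. prime p \<longrightarrow> p dvd N \<longrightarrow> b < p"
      "\<forall>p. prime p \<longrightarrow> p \<le> b \<longrightarrow> \<psi> p = 0" using character_trivial_on_small_primes[OF n] by blast
    have "\<exists>f. block N (q - 1) \<psi> f" by (rule block_generator_exists) (fact character.N[OF c] character.psi_less[OF c]
       character.psi_mult[OF c] character.psi_surj[OF c] character.psi_cong[OF c])+
    then show ?thesis unfolding Good_def using b by blast
  qed
  have "\<forall>x. \<exists>y. fst x \<in> Lambda \<longrightarrow> Good (fst x) (snd x) (fst y) (fst (snd y)) (snd (snd y))"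
  proof
    fix x :: "nat \<times> nat"
    show "\<exists>y. fst x \<in> Lambda \<longrightarrow> Good (fst x) (snd x) (fst y) (fst (snd y)) (snd (snd y))"
    proof (cases "fst x \<in> Lambda")
      case True
      then obtain N \<psi> f where "Good (fst x) (snd x) N \<psi> f" using ex by blast
      then show ?thesis by (intro exI[of _ "(N, \<psi>, f)"]) simp
    qed blast
  qed
  from choice[OF this] obtain Y where Y: "\<forall>x. fst x \<in> Lambda \<longrightarrow> Good (fst x) (snd x) (fst (Y x)) (fst (snd (Y x))) (snd (snd (Y x)))" ..
  \<comment> \<open>All prime factors of the q-th conductor exceed \<open>bd q\<close>. Adding each
    conductor puts the later bounds above it, which gives coprimality; adding \<open>Suc q\<close>
    gives q <= bd q, so a prime \<open>p\<close> can be exceptional only for q < p.\<close>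
  define bd where "bd = rec_nat (0::nat) (\<lambda>q b. b + Suc q + fst (Y (q, b)))"
  have bd_Suc: "bd (Suc q) = bd q + Suc q + fst (Y (q, bd q))" for q unfolding bd_def by simp
  have bd_ge: "q \<le> bd q" for q by (induction q) (simp_all add: bd_Suc)
  have bd_mono: "mono bd" by (rule incseq_SucI) (simp add: bd_Suc)
  define N where "N q = fst (Y (q, bd q))" for q
  define \<psi> where "\<psi> q = fst (snd (Y (q, bd q)))" for q
  define f where "f q = snd (snd (Y (q, bd q)))" for q
  have G: "Good q (bd q) (N q) (\<psi> q) (f q)" if "q \<in> Lambda" for q
    using spec[OF Y, of "(q, bd q)"] that unfolding N_def \<psi>_def f_def fst_conv snd_conv by (rule mp)
  have cop_less: "coprime (N q) (N r)" if qr: "q \<in> Lambda" "r \<in> Lambda" "q < r" for q r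
  proof (rule ccontr)
    assume "\<not> coprime (N q) (N r)"
    then have "gcd (N q) (N r) \<noteq> 1" unfolding coprime_iff_gcd_eq_1 .
    then obtain p where "prime p" "p dvd gcd (N q) (N r)" using prime_factor_nat by blast
    then have p: "prime p" "p dvd N q" "p dvd N r" by simp_all
    have "N q > 0" by (rule block.N[OF conjunct1[OF G[OF qr(1), unfolded Good_def]]])
    then have "p \<le> N q" using p(2) dvd_imp_le by blast
    also have "\<dots> \<le> bd (Suc q)" unfolding bd_Suc N_def by simp
    also have "\<dots> \<le> bd r" using bd_mono qr(3) by (intro monoD[OF bd_mono]) simp
    also have "\<dots> < p" using G[OF qr(2)] p unfolding Good_def by blast
    finally show False by simp
  qed
  have "cyc_data N \<psi> f"
  proof (rule cyc_data.intro)
    show "block (N q) (q - 1) (\<psi> q) (f q)" if "q \<in> Lambda" for q using G[OF that] unfolding Good_def by blast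
    show "coprime (N q) (N r)" if "q \<in> Lambda" "r \<in> Lambda" "q \<noteq> r" for q r
      using cop_less[of q r] cop_less[of r q] that by (metis coprime_commute linorder_neqE_nat)
  qed
  moreover have "finite {q \<in> Lambda. p dvd N q \<or> \<psi> q p \<noteq> 0}" if p: "prime p" for p
  proof (rule finite_subset)
    show "{q \<in> Lambda. p dvd N q \<or> \<psi> q p \<noteq> 0} \<subseteq> {..<p}"
    proof (rule subsetI, rule ccontr)
      fix q assume q: "q \<in> {q \<in> Lambda. p dvd N q \<or> \<psi> q p \<noteq> 0}" "q \<notin> {..<p}"
      then have pb: "p \<le> bd q" using bd_ge[of q] by simp
      have qL: "q \<in> Lambda" and "p dvd N q \<or> \<psi> q p \<noteq> 0" using q(1) by simp_all
      moreover have "bd q < p" if "p dvd N q" using G[OF qL] p that unfolding Good_def by blast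
      moreover have "\<psi> q p = 0" using G[OF qL] p pb unfolding Good_def by blast
      ultimately show False using pb by linarith
    qed
  qed simp
  ultimately show ?thesis by blast
qed

section \<open>Primes \<open>q\<close> with \<open>q - 1\<close> squarefree\<close>

subsection \<open>Elementary estimates\<close>

text \<open>The tangent inequality at x = e^2; the optimal constant is 2 / e, about 0.736.\<close>

lemma ln_le_sqrt:
  assumes "x > 0" shows "ln x \<le> 0.74 * sqrt x"
proof -
  have e: "exp (1::real) \<ge> 2.71" using e_approx_32 by (simp add: abs_if split: if_splits)
  define y where "y = sqrt x / exp 1"
  have y: "y > 0" using assms by (simp add: y_def)
  have "ln y \<le> y - 1" using y by (rule ln_le_minus_one)
  moreover have "ln y = ln x / 2 - 1" using assms by (simp add: y_def ln_div ln_sqrt)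
  ultimately have "ln x \<le> 2 * (sqrt x / exp 1)" by (simp add: y_def mult.commute)
  also have "\<dots> = sqrt x * (2 / exp 1)" by simp
  also have "\<dots> \<le> sqrt x * 0.74" using assms e by (intro mult_left_mono) (auto simp: field_simps)
  finally show ?thesis by simp
qed

text \<open>A telescoping majorant of x^(-3/2) with step 2, which suits sums over odd x. It rests on
  sqrt(x-1) sqrt(x+1) <= x and sqrt(x-1) + sqrt(x+1) <= 2 sqrt x.\<close>

lemma inverse_power_three_halves:
  assumes "x > 1"
  shows "sqrt x / x\<^sup>2 \<le> 1 / sqrt (x - 1) - 1 / sqrt (x + 1)"
proof -
  define a b where "a = sqrt (x - 1)" and "b = sqrt (x + 1)"
  have ab: "a > 0" "b > 0" "a\<^sup>2 = x - 1" "b\<^sup>2 = x + 1" using assms by (simp_all add: a_def b_def)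
  have "(a * b)\<^sup>2 = (x - 1) * (x + 1)" by (simp add: power_mult_distrib ab)
  also have "\<dots> \<le> x\<^sup>2" by (simp add: algebra_simps power2_eq_square)
  finally have 1: "a * b \<le> x" using assms power2_le_imp_le by fastforce
  have "(a + b)\<^sup>2 = 2 * x + 2 * (a * b)" by (simp add: power2_sum ab)
  also have "\<dots> \<le> (2 * sqrt x)\<^sup>2" using 1 assms by (simp add: power_mult_distrib)
  finally have 2: "a + b \<le> 2 * sqrt x" by (rule power2_le_imp_le) (use assms in simp)
  have "(b - a) * (a + b) = 2" by (simp add: algebra_simps flip: power2_eq_square) (simp add: ab)
  then have ba: "b - a = 2 / (a + b)" using ab by (simp add: field_simps)
  have "a * b * (a + b) \<le> x * (2 * sqrt x)" using 1 2 ab assms by (intro mult_mono) auto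
  then have "2 / (x * (2 * sqrt x)) \<le> 2 / (a * b * (a + b))" 
    using ab assms by (intro divide_left_mono mult_pos_pos) auto
  also have "\<dots> = (b - a) / (a * b)" unfolding ba by simp
  also have "\<dots> = 1 / a - 1 / b" using ab by (simp add: field_simps)
  finally have "1 / (x * sqrt x) \<le> 1 / a - 1 / b" by simp
  moreover have "sqrt x / x\<^sup>2 = 1 / (x * sqrt x)" using assms by (simp add: field_simps power2_eq_square)
  ultimately show ?thesis unfolding a_def b_def by simp
qed

lemma sum_ln_ge: "(\<Sum>k=1..n. ln (real k)) \<ge> real n * ln (real n) - real n"
proof (induction n)
  case (Suc n)
  show ?case
  proof (cases "n = 0")
    case False
    define x where "x = real n"
    have x: "x > 0" using False by (simp add: x_def)
    have "ln ((x + 1) / x) \<le> (x + 1) / x - 1" using x by (intro ln_le_minus_one) simp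
    moreover have "ln ((x + 1) / x) = ln (x + 1) - ln x" using x by (simp add: ln_div)
    moreover have "(x + 1) / x - 1 = 1 / x" using x by (simp add: add_divide_distrib)
    ultimately have "ln (x + 1) - ln x \<le> 1 / x" by simp
    then have "x * (ln (x + 1) - ln x) \<le> x * (1 / x)" using x by (intro mult_left_mono) auto
    then have "(x + 1) * ln (x + 1) - (x + 1) \<le> x * ln x - x + ln (x + 1)"
      using x by (simp add: algebra_simps)
    then show ?thesis using Suc by (simp add: x_def add.commute)
  qed simp
qed simp

lemma sum_inverse_le: "n > 0 \<Longrightarrow> (\<Sum>k=1..n. 1 / real k) \<le> 1 + ln (real n)"
proof (induction n)
  case (Suc n)
  show ?case
  proof (cases "n = 0")
    case False
    define x where "x = real n"
    have x: "x > 0" using False by (simp add: x_def)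
    have "ln (x / (x + 1)) \<le> x / (x + 1) - 1" using x by (intro ln_le_minus_one) simp
    moreover have "ln (x / (x + 1)) = ln x - ln (x + 1)" using x by (simp add: ln_div)
    moreover have "x / (x + 1) - 1 = - (1 / (x + 1))" using x by (simp add: field_simps)
    ultimately have "1 / (x + 1) \<le> ln (x + 1) - ln x" by simp
    then show ?thesis using Suc False by (simp add: x_def add.commute)
  qed simp
qed simp

subsection \<open>Chebyshev bounds in arithmetic progressions\<close>

definition theta :: "(nat \<Rightarrow> bool) \<Rightarrow> nat \<Rightarrow> real" where
  "theta P x = (\<Sum>q | prime q \<and> q \<le> x \<and> P q. ln (real q))"

lemma finite_theta [simp]: "finite {q. prime q \<and> q \<le> (x::nat) \<and> P q}"
  by (rule finite_subset[of _ "{..x}"]) auto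

lemma ln_prime_nonneg: "prime (q::nat) \<Longrightarrow> ln (real q) \<ge> 0"
  using prime_gt_0_nat[of q] by simp

lemma theta_mono: "(\<And>q. prime q \<Longrightarrow> q \<le> x \<Longrightarrow> P q \<Longrightarrow> Q q \<and> q \<le> y) \<Longrightarrow> theta P x \<le> theta Q y"
  unfolding theta_def by (intro sum_mono2) (auto simp: ln_prime_nonneg)

lemma theta_nonneg: "theta P x \<ge> 0"
  unfolding theta_def by (intro sum_nonneg) (auto simp: ln_prime_nonneg)

lemma theta_card_bound:
  assumes "{q. prime q \<and> q \<le> x \<and> P q} \<subseteq> g ` {1..k}" "x \<ge> 1"
  shows "theta P x \<le> real k * ln (real x)"
proof -
  have "card {q. prime q \<and> q \<le> x \<and> P q} \<le> card (g ` {1..k})" using assms(1) by (intro card_mono) auto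
  also have "\<dots> \<le> k" using card_image_le[of "{1..k}" g] by simp
  finally have c: "card {q. prime q \<and> q \<le> x \<and> P q} \<le> k" .
  have "theta P x \<le> real (card {q. prime q \<and> q \<le> x \<and> P q}) * ln (real x)"
    unfolding theta_def
  proof (rule sum_bounded_above)
    fix q assume "q \<in> {q. prime q \<and> q \<le> x \<and> P q}"
    then have "0 < real q" "real q \<le> real x" using prime_gt_0_nat by auto
    then show "ln (real q) \<le> ln (real x)" by (simp add: ln_le_cancel_iff)
  qed
  also have "\<dots> \<le> real k * ln (real x)" using c assms(2) by (intro mult_right_mono) auto
  finally show ?thesis .
qed

text \<open>Legendre's bound by recursion from n to n div p: only the multiples of \<open>p\<close>
  count, each with one factor more than its quotient by \<open>p\<close>.\<close>

lemma multiplicity_fact_le: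
  assumes p: "prime (p::nat)"
  shows "multiplicity p (fact n) * (p - 1) \<le> n"
proof (induction n rule: less_induct)
  case (less n)
  have p2: "p \<ge> 2" using p prime_ge_2_nat by blast
  show ?case
  proof (cases "n = 0")
    case False
    define t where "t = n div p"
    have tn: "t < n" using False p2 by (simp add: t_def)
    have fs: "multiplicity p (fact m) = (\<Sum>k\<in>{1..m}. multiplicity p k)" for m
    proof -
      have "multiplicity p (fact m) = multiplicity p (\<Prod>k\<in>{1..m}. k)" by (simp add: fact_prod)
      also have "\<dots> = (\<Sum>k\<in>{1..m}. multiplicity p k)"
        using p by (intro prime_elem_multiplicity_prod_distrib) auto
      finally show ?thesis .
    qed
    have "multiplicity p (fact n) = (\<Sum>k\<in>{1..n}. multiplicity p k)" by (rule fs)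
    also have "\<dots> = (\<Sum>k\<in>(\<lambda>j. p * j) ` {1..t}. multiplicity p k)"
    proof (rule sum.mono_neutral_right)
      show "(\<lambda>j. p * j) ` {1..t} \<subseteq> {1..n}"
      proof
        fix y assume "y \<in> (\<lambda>j. p * j) ` {1..t}"
        then obtain j where j: "1 \<le> j" "j \<le> t" "y = p * j" by auto
        then have "p * j \<le> p * t" by simp
        also have "\<dots> \<le> n" unfolding t_def by simp
        finally show "y \<in> {1..n}" using j p2 by auto
      qed
      show "\<forall>k\<in>{1..n} - (\<lambda>j. p * j) ` {1..t}. multiplicity p k = 0"
      proof
        fix k assume k: "k \<in> {1..n} - (\<lambda>j. p * j) ` {1..t}"
        have "\<not> p dvd k"
        proof
          assume "p dvd k"
          then obtain j where j: "k = p * j" by (elim dvdE)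
          then have "1 \<le> j" using k by (cases j) auto
          moreover have "j \<le> t" unfolding t_def using k j p2 by (simp add: less_eq_div_iff_mult_less_eq mult.commute)
          ultimately show False using k j by auto
        qed
        then show "multiplicity p k = 0" by (rule not_dvd_imp_multiplicity_0)
      qed
    qed simp
    also have "\<dots> = (\<Sum>j\<in>{1..t}. multiplicity p (p * j))"
      using p2 by (subst sum.reindex) (auto simp: inj_on_def)
    also have "\<dots> = (\<Sum>j\<in>{1..t}. 1 + multiplicity p j)"
      using p p2 by (intro sum.cong refl) (simp add: multiplicity_times_same not_prime_unit)
    also have "\<dots> = t + multiplicity p (fact t)"
      unfolding fs sum.distrib by simp
    finally have "multiplicity p (fact n) * (p - 1) = t * (p - 1) + multiplicity p (fact t) * (p - 1)"
      by (simp add: add_mult_distrib)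
    also have "\<dots> \<le> t * (p - 1) + t" using less[OF tn] by simp
    also have "\<dots> = t * p" using p2 by (cases p) auto
    also have "\<dots> \<le> n" unfolding t_def by simp
    finally show ?thesis .
  qed simp
qed

lemma fact_dvd_consecutive: "(fact n :: nat) dvd (\<Prod>k\<in>{1..n}. c + k)"
proof -
  have "(\<Prod>k\<in>{1..n}. c + k) = fact n * ((c + n) choose n)"
  proof -
    have "fact (c + n) = fact c * (\<Prod>k\<in>{1..n}. c + k)"
      by (induction n) (simp_all add: algebra_simps)
    moreover have "fact (c + n) = fact n * fact c * ((c + n) choose n)"
      using binomial_fact_lemma[of n "c + n"] by simp
    ultimately have "fact c * (\<Prod>k\<in>{1..n}. c + k) = fact c * (fact n * ((c + n) choose n))"
      by (simp add: mult_ac)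
    then show ?thesis by simp
  qed
  then show ?thesis by simp
qed

text \<open>Modulo \<open>E\<close> the progression, multiplied by the inverse of \<open>m\<close>,
  becomes a run of consecutive integers, whose product is divisible by n!.\<close>

lemma coprime_part_dvd:
  assumes E: "E dvd fact n" "coprime m E"
  shows "(E::nat) dvd (\<Prod>k\<in>{1..n}. m * k + a)"
proof -
  obtain m' where m': "[m * m' = 1] (mod E)" using cong_solve_coprime_nat[OF E(2)] by auto
  have "[(\<Prod>k\<in>{1..n}. m' * (m * k + a)) = (\<Prod>k\<in>{1..n}. m' * a + k)] (mod E)"
  proof (rule cong_prod)
    fix k assume "k \<in> {1..n}"
    have "[m * m' * k + m' * a = 1 * k + m' * a] (mod E)" by (intro cong_add cong_mult m' cong_refl)
    then show "[m' * (m * k + a) = m' * a + k] (mod E)" by (simp add: algebra_simps)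
  qed
  moreover have "E dvd (\<Prod>k\<in>{1..n}. m' * a + k)" using E(1) fact_dvd_consecutive dvd_trans by blast
  ultimately have "E dvd (\<Prod>k\<in>{1..n}. m' * (m * k + a))" by (meson cong_dvd_iff)
  then have "E dvd m' ^ n * (\<Prod>k\<in>{1..n}. m * k + a)" by (simp add: prod.distrib)
  moreover have "coprime E (m' ^ n)"
  proof -
    have "coprime (m * m') E" using m' cong_imp_coprime cong_sym by (metis coprime_1_left)
    then show ?thesis by (simp add: coprime_commute)
  qed
  ultimately show ?thesis by (simp add: coprime_dvd_mult_right_iff)
qed

lemma prod_primes_dvd:
  assumes "finite S" "\<And>q. q \<in> S \<Longrightarrow> prime q" "\<And>q. q \<in> S \<Longrightarrow> q dvd w"
  shows "(\<Prod>q\<in>S. q) dvd (w :: nat)"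
  using assms
proof (induction S)
  case (insert q S)
  then obtain v where v: "w = (\<Prod>q\<in>S. q) * v" by (metis dvdE insertCI)
  have "\<not> q dvd (\<Prod>q\<in>S. q)"
  proof
    assume "q dvd (\<Prod>q\<in>S. q)"
    then obtain s where "s \<in> S" "q dvd s" using prime_dvd_prod_iff[of S q "\<lambda>q. q"] insert by auto
    then show False using insert by (metis insertCI primes_dvd_imp_eq)
  qed
  moreover have "q dvd (\<Prod>q\<in>S. q) * v" using insert.prems(2)[of q] v by simp
  ultimately have "q dvd v" using insert.prems(1)[of q] by (simp add: prime_dvd_mult_iff)
  then show ?case unfolding v using insert by (simp add: mult.commute mult_dvd_mono)
qed simp

text \<open>Exponential growth rate of the analogue of a binomial coefficient for modulus 4 r^2: the
  logarithm of the modulus, plus the cost of leaving the powers of 2 and of r in n!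
  undivided.\<close>

definition cr :: "nat \<Rightarrow> real" where
  "cr r = ln (real (4 * r\<^sup>2)) + ln 2 + ln (real r) / (real r - 1)"

text \<open>Chebyshev's device for a progression. The product of the m k + a is divided by
  \<open>E\<close>, the part of n! prime to 2 r. Primes of the class above \<open>n\<close> do not
  divide \<open>E\<close>, so they all divide the quotient, whose size is controlled.\<close>

lemma theta_progression_step:
  assumes r: "prime r" "odd r" and m: "m = 4 * r\<^sup>2" and a: "a < m" and n: "n \<ge> 1"
  shows "theta (\<lambda>q. q mod m = a \<and> n < q \<and> a < q) (m * n + a) \<le> real n * cr r + 1 + ln (real n)"
proof -
  have r3: "r \<ge> 3" using r prime_ge_2_nat[of r] by (cases "r = 2") auto
  define S where "S = {q. prime q \<and> q \<le> m * n + a \<and> (q mod m = a \<and> n < q \<and> a < q)}"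
  define T where "T = (\<Prod>k\<in>{1..n}. m * k + a)"
  have Tpos: "T > 0" unfolding T_def using m r3 by (intro prod_pos) auto
  define i where "i = multiplicity 2 (fact n :: nat)"
  define j where "j = multiplicity r (fact n :: nat)"
  have r0: "fact n \<noteq> (0::nat)" by simp
  define u where "u = (fact n :: nat) div 2 ^ i"
  have u: "fact n = 2 ^ i * u" "\<not> 2 dvd u"
    using multiplicity_decompose[OF r0, of 2] multiplicity_dvd[of 2 "fact n :: nat"] by (simp_all add: u_def i_def)
  have u0: "u \<noteq> 0" using u by (metis dvd_0_right)
  define E where "E = u div r ^ multiplicity r u"
  have E: "u = r ^ multiplicity r u * E" "\<not> r dvd E"
    using multiplicity_decompose[OF u0, of r] multiplicity_dvd[of r u] r3 by (simp_all add: E_def)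
  have "multiplicity r (fact n :: nat) = multiplicity r ((2::nat) ^ i) + multiplicity r u"
    unfolding u(1) using u0 r by (intro prime_elem_multiplicity_mult_distrib) auto
  moreover have "multiplicity r ((2::nat) ^ i) = 0"
  proof (rule not_dvd_imp_multiplicity_0, rule notI)
    assume "r dvd 2 ^ i"
    then have "r dvd 2" using r(1) prime_dvd_power by blast
    then have "r \<le> 2" by (rule dvd_imp_le) simp
    then show False using r3 by simp
  qed
  ultimately have ju: "multiplicity r u = j" unfolding j_def by simp
  have F: "fact n = 2 ^ i * r ^ j * E" using u(1) E(1) ju by simp
  have E0: "E > 0" using F by (cases "E = 0") auto
  have "\<not> 2 dvd E" using u(2) E(1) by (metis dvd_mult)
  then have "coprime 2 E" "coprime r E" using E(2) r by (simp_all add: prime_imp_coprime)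
  then have "coprime (2\<^sup>2 * r\<^sup>2) E" by (simp only: coprime_mult_left_iff coprime_power_left_iff simp_thms)
  then have "coprime m E" unfolding m by simp
  then have ET: "E dvd T" unfolding T_def by (intro coprime_part_dvd) (simp_all add: F)
  have qT: "q dvd T \<and> \<not> q dvd E" if "q \<in> S" for q
  proof
    define k where "k = q div m"
    have q: "prime q" "q \<le> m * n + a" "q mod m = a" "n < q" "a < q" using that by (auto simp: S_def)
    have qk: "q = m * k + a" using q(3) by (simp add: k_def flip: q(3))
    have "m > 0" using a by simp
    have "k \<ge> 1" using qk q(5) by (cases k) auto
    moreover have "k \<le> n" using qk q(2) \<open>m > 0\<close> by simp
    ultimately have "m * k + a dvd T" unfolding T_def by (intro dvd_prodI) auto
    then show "q dvd T" using qk by simp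
    have "\<not> q dvd fact n" using prime_dvd_fact_iff[OF q(1)] q(4) by simp
    then show "\<not> q dvd E" unfolding F by (metis dvd_mult)
  qed
  have TE: "T = E * (T div E)" using ET by simp
  have pS: "prime q" if "q \<in> S" for q using that by (simp add: S_def)
  have "(\<Prod>q\<in>S. q) dvd T div E"
  proof (rule prod_primes_dvd)
    show "finite S" unfolding S_def by (rule finite_theta)
    show "prime q" if "q \<in> S" for q using pS[OF that] .
    show "q dvd T div E" if "q \<in> S" for q
      using qT[OF that] pS[OF that] TE by (metis prime_dvd_mult_iff)
  qed
  moreover have TE0: "T div E > 0" using Tpos TE by (metis gr0I mult_0_right less_irrefl)
  ultimately have le: "(\<Prod>q\<in>S. q) \<le> T div E" by (rule dvd_imp_le)
  have Spos: "(\<Prod>q\<in>S. q) > 0" using pS prime_gt_0_nat by (intro prod_pos) auto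
  have "theta (\<lambda>q. q mod m = a \<and> n < q \<and> a < q) (m * n + a) = (\<Sum>q\<in>S. ln (real q))"
    unfolding theta_def S_def by simp
  also have "\<dots> = ln (real (\<Prod>q\<in>S. q))"
    unfolding of_nat_prod using pS prime_gt_0_nat by (subst ln_prod) (auto simp: S_def)
  also have "\<dots> \<le> ln (real (T div E))" using le Spos TE0 by (simp add: ln_le_cancel_iff del: of_nat_prod)
  also have "\<dots> = ln (real T) - ln (real E)"
  proof -
    have "ln (real T) = ln (real E * real (T div E))" by (subst TE) (simp only: of_nat_mult)
    then show ?thesis using E0 TE0 by (simp add: ln_mult)
  qed
  also have "ln (real E) = ln (fact n) - real i * ln 2 - real j * ln (real r)"
  proof -
    have "(fact n :: real) = real (fact n)" by simp
    also have "\<dots> = 2 ^ i * real r ^ j * real E" unfolding F by simp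
    finally have "ln (fact n) = ln (2 ^ i * real r ^ j * real E)" by simp
    then show ?thesis using E0 r3 by (simp add: ln_mult ln_realpow)
  qed
  also have "ln (real T) \<le> real n * ln (real m) + ln (fact n) + 1 + ln (real n)"
  proof -
    have "ln (real T) = (\<Sum>k=1..n. ln (real (m * k + a)))"
      unfolding T_def of_nat_prod
    proof (rule ln_prod)
      fix k assume "k \<in> {1..n}"
      then have "m * k + a \<noteq> 0" using m r3 by simp
      then show "real (m * k + a) \<noteq> 0" by (metis of_nat_eq_0_iff)
    qed simp
    also have "\<dots> \<le> (\<Sum>k=1..n. ln (real m) + ln (real k) + 1 / real k)"
    proof (rule sum_mono)
      fix k assume k: "k \<in> {1..n}"
      have k0: "real k > 0" using k by simp
      have m0: "real m > 0" using a by simp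
      have "real (m * k + a) \<le> real (m * (k + 1))" using a by (simp only: of_nat_le_iff) simp
      then have "real (m * k + a) \<le> real m * (real k + 1)" by (simp add: algebra_simps)
      then have "ln (real (m * k + a)) \<le> ln (real m * (real k + 1))" using m0 k0 by (subst ln_le_cancel_iff) (auto intro!: add_pos_nonneg)
      also have "\<dots> = ln (real m) + ln (real k + 1)" using m0 k0 by (simp add: ln_mult)
      also have "ln (real k + 1) \<le> ln (real k) + 1 / real k"
      proof -
        have "ln ((real k + 1) / real k) \<le> (real k + 1) / real k - 1" using k0 by (intro ln_le_minus_one) simp
        moreover have "ln ((real k + 1) / real k) = ln (real k + 1) - ln (real k)" using k0 by (simp add: ln_div)
        moreover have "(real k + 1) / real k - 1 = 1 / real k" using k0 by (simp add: add_divide_distrib)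
        ultimately show ?thesis by simp
      qed
      finally show "ln (real (m * k + a)) \<le> ln (real m) + ln (real k) + 1 / real k" by simp
    qed
    also have "\<dots> = real n * ln (real m) + (\<Sum>k=1..n. ln (real k)) + (\<Sum>k=1..n. 1 / real k)"
      by (simp add: sum.distrib)
    also have "(\<Sum>k=1..n. ln (real k)) = ln (fact n)"
      unfolding fact_prod of_nat_prod by (subst ln_prod) auto
    also have "(\<Sum>k=1..n. 1 / real k) \<le> 1 + ln (real n)" using n by (intro sum_inverse_le) simp
    finally show ?thesis by simp
  qed
  also have "real n * ln (real m) + ln (fact n) + 1 + ln (real n) - (ln (fact n) - real i * ln 2 - real j * ln (real r))
      = real n * ln (real m) + real i * ln 2 + real j * ln (real r) + 1 + ln (real n)" by simp
  also have "\<dots> \<le> real n * cr r + 1 + ln (real n)"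
  proof -
    have "i \<le> n" using multiplicity_fact_le[OF two_is_prime_nat, of n] by (simp add: i_def)
    then have 1: "real i * ln 2 \<le> real n * ln 2" by (intro mult_right_mono) auto
    have "j * (r - 1) \<le> n" using multiplicity_fact_le[OF r(1), of n] by (simp add: j_def)
    then have "real (j * (r - 1)) \<le> real n" by (simp only: of_nat_le_iff)
    then have "real j \<le> real n / (real r - 1)" using r3 by (simp add: of_nat_diff field_simps)
    then have "real j * ln (real r) \<le> real n / (real r - 1) * ln (real r)" using r3 by (intro mult_right_mono) auto
    moreover have "real n * cr r = real n * ln (real m) + real n * ln 2 + real n / (real r - 1) * ln (real r)"
      unfolding cr_def m by (simp add: ring_distribs)
    ultimately show ?thesis using 1 by linarith
  qed
  finally show ?thesis by simp
qed

lemma theta_union: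
  assumes "\<And>q. prime q \<Longrightarrow> q \<le> x \<Longrightarrow> P q \<Longrightarrow> Q q \<and> q \<le> y \<or> R q \<and> q \<le> z"
  shows "theta P x \<le> theta Q y + theta R z"
proof -
  have "theta P x \<le> (\<Sum>q\<in>{q. prime q \<and> q \<le> y \<and> Q q} \<union> {q. prime q \<and> q \<le> z \<and> R q}. ln (real q))"
    unfolding theta_def using assms by (intro sum_mono2) (auto simp: ln_prime_nonneg)
  also have "\<dots> \<le> theta Q y + theta R z"
  proof -
    have "0 \<le> (\<Sum>q\<in>{q. prime q \<and> q \<le> y \<and> Q q} \<inter> {q. prime q \<and> q \<le> z \<and> R q}. ln (real q))"
      by (intro sum_nonneg) (auto simp: ln_prime_nonneg)
    then show ?thesis
      using sum.union_inter[of "{q. prime q \<and> q \<le> y \<and> Q q}" "{q. prime q \<and> q \<le> z \<and> R q}" "\<lambda>q. ln (real q)"]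
      unfolding theta_def by simp
  qed
  finally show ?thesis .
qed

lemma cr_nonneg: "r \<ge> 3 \<Longrightarrow> cr r \<ge> 0"
proof -
  assume r: "r \<ge> 3"
  then have "9 \<le> r * r" using mult_mono[of 3 r 3 r] by simp
  then have "1 \<le> 4 * (r * r)" by linarith
  then have "real 1 \<le> real (4 * (r * r))" by (simp only: of_nat_le_iff)
  then have "real (4 * r\<^sup>2) \<ge> 1" unfolding power2_eq_square by (simp only: of_nat_1)
  then show ?thesis unfolding cr_def using r by (intro add_nonneg_nonneg) auto
qed

text \<open>The previous step is iterated along x, x div m, and so on. The main terms form a
  geometric series, whence the denominator m - 1; at most 1 + log x steps each cost at most 1 + 2
  log x.\<close>

lemma theta_progression:
  assumes r: "prime r" "odd r" and m: "m = 4 * r\<^sup>2" and a: "a < m" and x: "x \<ge> 1"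
  shows "theta (\<lambda>q. q mod m = a) x \<le> cr r * real x / (real m - 1) + (1 + 2 * ln (real x)) * (1 + ln (real x))"
  using x
proof (induction x rule: less_induct)
  case (less x)
  have r3: "r \<ge> 3" using r prime_ge_2_nat[of r] by (cases "r = 2") auto
  have "9 \<le> r * r" using mult_mono[of 3 r 3 r] r3 by simp
  then have m36: "m \<ge> 36" by (simp add: m power2_eq_square)
  have lx: "ln (real x) \<ge> 0" using less.prems by simp
  have one: "theta (\<lambda>q. q mod m = a \<and> q < m) x \<le> ln (real x)"
  proof -
    have "theta (\<lambda>q. q mod m = a \<and> q < m) x \<le> real 1 * ln (real x)"
      using less.prems by (intro theta_card_bound[where g = "\<lambda>_. a"]) auto
    then show ?thesis by simp
  qed
  have lxx: "0 \<le> ln (real x) * ln (real x)" using lx by simp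
  show ?case
  proof (cases "x < m")
    case True
    have "theta (\<lambda>q. q mod m = a) x \<le> theta (\<lambda>q. q mod m = a \<and> q < m) x"
      using True by (intro theta_mono) auto
    also have "\<dots> \<le> ln (real x)" by (rule one)
    also have "\<dots> \<le> 0 + (1 + 2 * ln (real x)) * (1 + ln (real x))" using lx lxx by (simp add: algebra_simps)
    also have "0 \<le> cr r * real x / (real m - 1)" using cr_nonneg[OF r3] m36 by simp
    finally show ?thesis by simp
  next
    case False
    define n where "n = x div m"
    have n: "n \<ge> 1" unfolding n_def using False m36 by (simp add: Suc_le_eq div_greater_zero_iff)
    have nx: "m * n \<le> x" unfolding n_def by simp
    have "n < x" 
    proof -
      have "2 * n \<le> m * n" using m36 by (intro mult_right_mono) auto
      then show ?thesis using nx n by linarith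
    qed
    note IH = less.IH[OF \<open>n < x\<close> n]
    \<comment> \<open>Outside the range of the step remain the primes up to \<open>n\<close>, left
      to the induction, and those below \<open>m\<close>, among which only \<open>a\<close> itself
      is in the class.\<close>
    have "theta (\<lambda>q. q mod m = a) x \<le>
        theta (\<lambda>q. q mod m = a \<and> (q \<le> n \<or> q < m)) x + theta (\<lambda>q. q mod m = a \<and> n < q \<and> a < q) (m * n + a)"
    proof (rule theta_union)
      fix q assume q: "q \<le> x" "q mod m = a"
      show "(q mod m = a \<and> (q \<le> n \<or> q < m)) \<and> q \<le> x \<or> (q mod m = a \<and> n < q \<and> a < q) \<and> q \<le> m * n + a"
      proof (cases "q \<le> n \<or> q < m")
        case False
        have "q = m * (q div m) + a" using q(2) by (metis div_mult_mod_eq mult.commute)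
        moreover have "q div m \<le> n" unfolding n_def using q(1) by (rule div_le_mono)
        ultimately have "q \<le> m * n + a" by (metis add_le_mono1 mult_le_mono2)
        then show ?thesis using False q a by auto
      qed (use q in auto)
    qed
    also have "theta (\<lambda>q. q mod m = a \<and> (q \<le> n \<or> q < m)) x \<le> theta (\<lambda>q. q mod m = a) n + theta (\<lambda>q. q mod m = a \<and> q < m) x"
      by (rule theta_union) auto
    also have "theta (\<lambda>q. q mod m = a \<and> n < q \<and> a < q) (m * n + a) \<le> real n * cr r + 1 + ln (real n)"
      by (rule theta_progression_step[OF r m a n])
    finally have 1: "theta (\<lambda>q. q mod m = a) x \<le>
        cr r * real n / (real m - 1) + (1 + 2 * ln (real n)) * (1 + ln (real n)) + ln (real x) + (real n * cr r + 1 + ln (real n))"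
      using IH one by simp
    have "real n * real m \<le> real x" using nx by (simp add: mult.commute flip: of_nat_mult)
    moreover have "cr r * real n / (real m - 1) + real n * cr r = cr r * (real n * real m) / (real m - 1)"
      using m36 by (simp add: field_simps)
    ultimately have 2: "cr r * real n / (real m - 1) + real n * cr r \<le> cr r * real x / (real m - 1)"
      using cr_nonneg[OF r3] m36 by (simp add: divide_right_mono mult_left_mono)
    \<comment> \<open>As m > e, a step lowers the logarithm by at least 1, which pays for the
      increase of the error term.\<close>
    have "real n * exp 1 \<le> real n * real m" using e_less_272 m36 by (intro mult_left_mono) auto
    then have "real n * exp 1 \<le> real x" using \<open>real n * real m \<le> real x\<close> by linarith
    then have "ln (real n * exp 1) \<le> ln (real x)" using n less.prems by (subst ln_le_cancel_iff) auto
    then have ln: "ln (real n) + 1 \<le> ln (real x)" using n by (simp add: ln_mult)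
    have n0: "ln (real n) \<ge> 0" using n by simp
    have "(1 + 2 * ln (real n)) * (1 + ln (real n)) \<le> (1 + 2 * ln (real x)) * ln (real x)"
      using ln n0 by (intro mult_mono) auto
    then show ?thesis using 1 2 ln by (simp add: algebra_simps)
  qed
qed

subsection \<open>The Mertens estimate for primes congruent to 3 modulo 4\<close>

definition chi :: "nat \<Rightarrow> real" where
  "chi n = (if n mod 4 = 1 then 1 else if n mod 4 = 3 then -1 else 0)"

lemma chi_mult: "chi (a * b) = chi a * chi b"
proof -
  have "a mod 4 < 4" "b mod 4 < 4" by simp_all
  then have "a mod 4 = 0 \<or> a mod 4 = 1 \<or> a mod 4 = 2 \<or> a mod 4 = 3"
    "b mod 4 = 0 \<or> b mod 4 = 1 \<or> b mod 4 = 2 \<or> b mod 4 = 3" by linarith+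
  moreover have "(a * b) mod 4 = ((a mod 4) * (b mod 4)) mod 4" by (simp add: mod_mult_eq)
  ultimately show ?thesis unfolding chi_def by (elim disjE) simp_all
qed

text \<open>The partial sums of \<open>chi\<close> in closed form; that they lie between 0 and 1
  drives all estimates below.\<close>

definition chisum :: "nat \<Rightarrow> real" where "chisum n = (if n mod 4 = 1 \<or> n mod 4 = 2 then 1 else 0)"

lemma chi_chisum: "chi (Suc n) = chisum (Suc n) - chisum n"
proof -
  have "n mod 4 < 4" by simp
  then have "n mod 4 = 0 \<or> n mod 4 = 1 \<or> n mod 4 = 2 \<or> n mod 4 = 3" by linarith
  then show ?thesis unfolding chi_def chisum_def by (elim disjE) (simp_all add: mod_Suc)
qed

text \<open>Partial summation, with both bounds proved in one induction. Monotonicity is asked only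
  beyond \<open>y\<close>, since log j / j decreases only from 3 on.\<close>

lemma chi_abel:
  fixes g :: "nat \<Rightarrow> real"
  assumes anti: "\<And>j. j > y \<Longrightarrow> g (Suc j) \<le> g j" and n: "n \<ge> y"
  shows "chisum n * g (Suc n) - chisum y * g (Suc y) \<le> (\<Sum>j\<in>{y<..n}. chi j * g j)"
    and "(\<Sum>j\<in>{y<..n}. chi j * g j) \<le> chisum n * g (Suc n) - chisum y * g (Suc y) + g (Suc y) - g (Suc n)"
proof -
  have "chisum n * g (Suc n) - chisum y * g (Suc y) \<le> (\<Sum>j\<in>{y<..n}. chi j * g j) \<and>
    (\<Sum>j\<in>{y<..n}. chi j * g j) \<le> chisum n * g (Suc n) - chisum y * g (Suc y) + g (Suc y) - g (Suc n)"
    using n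
  proof (induction n rule: dec_induct)
    case base
    then show ?case by simp
  next
    case (step n)
    have "{y<..Suc n} = insert (Suc n) {y<..n}" using step by auto
    then have e: "(\<Sum>j\<in>{y<..Suc n}. chi j * g j) = (\<Sum>j\<in>{y<..n}. chi j * g j) + (chisum (Suc n) - chisum n) * g (Suc n)"
      by (simp add: chi_chisum)
    have a: "g (Suc (Suc n)) \<le> g (Suc n)" using step by (intro anti) simp
    have c: "0 \<le> chisum (Suc n)" "chisum (Suc n) \<le> 1" by (simp_all add: chisum_def)
    have "chisum (Suc n) * g (Suc (Suc n)) \<le> chisum (Suc n) * g (Suc n)" using a c(1) by (rule mult_left_mono)
    moreover have "(1 - chisum (Suc n)) * g (Suc (Suc n)) \<le> (1 - chisum (Suc n)) * g (Suc n)" using a c(2) by (intro mult_left_mono) auto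
    ultimately show ?case using step.IH unfolding e by (simp add: algebra_simps)
  qed
  then show "chisum n * g (Suc n) - chisum y * g (Suc y) \<le> (\<Sum>j\<in>{y<..n}. chi j * g j)"
    "(\<Sum>j\<in>{y<..n}. chi j * g j) \<le> chisum n * g (Suc n) - chisum y * g (Suc y) + g (Suc y) - g (Suc n)" by auto
qed

text \<open>Partial sums of the series for L(1, chi).\<close>

definition Lsum :: "nat \<Rightarrow> real" where "Lsum n = (\<Sum>j\<in>{0<..n}. chi j * (1 / real j))"

lemma Lsum_diff:
  assumes "y \<le> n"
  shows "\<bar>Lsum n - Lsum y\<bar> \<le> 1 / real (Suc y)"
proof -
  have "{0<..n} = {0<..y} \<union> {y<..n}" using assms by auto
  then have "Lsum n = Lsum y + (\<Sum>j\<in>{y<..n}. chi j * (1 / real j))"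
    unfolding Lsum_def by (simp add: sum.union_disjoint)
  moreover have anti: "1 / real (Suc j) \<le> 1 / real j" if "j > y" for j using that by (simp add: frac_le)
  have b: "chisum n * (1 / real (Suc n)) - chisum y * (1 / real (Suc y)) \<le> (\<Sum>j\<in>{y<..n}. chi j * (1 / real j))"
    "(\<Sum>j\<in>{y<..n}. chi j * (1 / real j)) \<le> chisum n * (1 / real (Suc n)) - chisum y * (1 / real (Suc y)) + 1 / real (Suc y) - 1 / real (Suc n)"
    using chi_abel[of y "\<lambda>j. 1 / real j" n, OF anti assms] by auto
  have c: "0 \<le> chisum n * (1 / real (Suc n))" "chisum n * (1 / real (Suc n)) \<le> 1 / real (Suc n)"
    "0 \<le> chisum y * (1 / real (Suc y))" "chisum y * (1 / real (Suc y)) \<le> 1 / real (Suc y)"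
    by (simp_all add: chisum_def)
  ultimately show ?thesis using b by linarith
qed

text \<open>The terms 1 - 1/3 come first and every partial tail after them is nonnegative. This is
  the nonvanishing of L(1, chi) in quantitative form.\<close>

lemma Lsum_ge:
  assumes "n \<ge> 1" shows "Lsum n \<ge> 2 / 3"
proof -
  consider "n = 1" | "n = 2" | "n \<ge> 3" using assms by linarith
  then show ?thesis
  proof cases
    case 1
    have "{0<..1::nat} = {1}" by auto
    then show ?thesis using 1 by (simp add: Lsum_def chi_def)
  next
    case 2
    have "{0<..2::nat} = {1, 2}" by auto
    then show ?thesis using 2 by (simp add: Lsum_def chi_def)
  next
    case 3
    have "{0<..n} = {1, 2, 3} \<union> {3<..n}" using 3 by auto
    then have "Lsum n = (\<Sum>j\<in>{1,2,3}. chi j * (1 / real j)) + (\<Sum>j\<in>{3<..n}. chi j * (1 / real j))"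
      unfolding Lsum_def by (simp only:) (rule sum.union_disjoint, auto)
    moreover have "(\<Sum>j\<in>{1,2,3::nat}. chi j * (1 / real j)) = 2 / 3" by (simp add: chi_def)
    moreover have anti: "1 / real (Suc j) \<le> 1 / real j" if "j > 3" for j using that by (simp add: frac_le)
    have "chisum n * (1 / real (Suc n)) - chisum 3 * (1 / real (Suc 3)) \<le> (\<Sum>j\<in>{3<..n}. chi j * (1 / real j))"
      using chi_abel(1)[of 3 "\<lambda>j. 1 / real j" n, OF anti 3] by auto
    moreover have "chisum n * (1 / real (Suc n)) \<ge> 0" "chisum 3 = 0" by (simp_all add: chisum_def)
    ultimately show ?thesis by simp
  qed
qed

lemma ln_over_antimono:
  assumes "j > 2" shows "ln (real (Suc j)) / real (Suc j) \<le> ln (real j) / real j"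
proof -
  define x where "x = real j"
  have x: "x \<ge> 3" using assms by (simp add: x_def)
  have "ln ((x + 1) / x) \<le> (x + 1) / x - 1" using x by (intro ln_le_minus_one) simp
  moreover have "ln ((x + 1) / x) = ln (x + 1) - ln x" using x by (simp add: ln_div)
  moreover have "(x + 1) / x - 1 = 1 / x" using x by (simp add: add_divide_distrib)
  ultimately have 1: "ln (x + 1) \<le> ln x + 1 / x" by simp
  have "exp 1 \<le> x" using x e_less_272 by simp
  then have 2: "1 \<le> ln x" using x by (simp add: ln_ge_iff)
  have "x * ln (x + 1) \<le> x * (ln x + 1 / x)" using 1 x by (intro mult_left_mono) auto
  also have "\<dots> = x * ln x + 1" using x by (simp add: algebra_simps)
  also have "\<dots> \<le> (x + 1) * ln x" using 2 by (simp add: algebra_simps)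
  finally have "ln (x + 1) / (x + 1) \<le> ln x / x" using x by (simp add: field_simps)
  then show ?thesis by (simp add: x_def add.commute)
qed

lemma chi_ln_sum_bounded:
  "\<bar>\<Sum>k\<in>{0<..n}. chi k * (ln (real k) / real k)\<bar> \<le> 1"
proof (cases "n \<ge> 2")
  case True
  have "{0<..n} = {1, 2} \<union> {2<..n}" using True by auto
  then have "(\<Sum>k\<in>{0<..n}. chi k * (ln (real k) / real k)) =
     (\<Sum>k\<in>{1, 2}. chi k * (ln (real k) / real k)) + (\<Sum>k\<in>{2<..n}. chi k * (ln (real k) / real k))"
    by (simp only:) (rule sum.union_disjoint, auto)
  moreover have "(\<Sum>k\<in>{1, 2::nat}. chi k * (ln (real k) / real k)) = 0" by (simp add: chi_def)
  moreover have "chisum n * (ln (real (Suc n)) / real (Suc n)) - chisum 2 * (ln (real (Suc 2)) / real (Suc 2))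
      \<le> (\<Sum>j\<in>{2<..n}. chi j * (ln (real j) / real j))"
    "(\<Sum>j\<in>{2<..n}. chi j * (ln (real j) / real j)) \<le> chisum n * (ln (real (Suc n)) / real (Suc n))
      - chisum 2 * (ln (real (Suc 2)) / real (Suc 2)) + ln (real (Suc 2)) / real (Suc 2) - ln (real (Suc n)) / real (Suc n)"
    using chi_abel[of 2 "\<lambda>j. ln (real j) / real j" n, OF ln_over_antimono True] by auto
  moreover have "0 \<le> chisum n * (ln (real (Suc n)) / real (Suc n))"
     "chisum n * (ln (real (Suc n)) / real (Suc n)) \<le> ln (real (Suc n)) / real (Suc n)"
    by (simp_all add: chisum_def)
  moreover have "chisum 2 * (ln (real (Suc 2)) / real (Suc 2)) = ln (real (Suc 2)) / real (Suc 2)" by (simp add: chisum_def)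
  moreover have "ln (real (Suc 2)) / real (Suc 2) \<le> 1" using ln_le_minus_one[of "3::real"] by simp
  ultimately show ?thesis by linarith
next
  case False
  then have "{0<..n} \<subseteq> {1}" by auto
  then have "(\<Sum>k\<in>{0<..n}. chi k * (ln (real k) / real k)) = 0" by (intro sum.neutral) auto
  then show ?thesis by simp
qed

abbreviation vM :: "nat \<Rightarrow> real" where "vM \<equiv> mangoldt"

text \<open>log k is the sum of the von Mangoldt function over the divisors of k; the pairs are then
  regrouped by k = d j. It is used with weight 1 and with weight chi k / k.\<close>

lemma sum_divisors_swap:
  fixes w :: "nat \<Rightarrow> real"
  shows "(\<Sum>k\<in>{0<..n}. ln (real k) * w k) = (\<Sum>d\<in>{0<..n}. vM d * (\<Sum>j\<in>{0<..n div d}. w (d * j)))"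
proof -
  have "(\<Sum>k\<in>{0<..n}. ln (real k) * w k) = (\<Sum>k\<in>{0<..n}. \<Sum>d | d dvd k. vM d * w k)"
  proof (rule sum.cong)
    fix k assume "k \<in> {0<..n}"
    then have "(\<Sum>d | d dvd k. vM d) = ln (real k)" using mangoldt_sum[of k, where 'a = real] by simp
    then show "ln (real k) * w k = (\<Sum>d | d dvd k. vM d * w k)" by (simp only: sum_distrib_right[symmetric])
  qed simp
  also have "\<dots> = (\<Sum>(k, d)\<in>(SIGMA k:{0<..n}. {d. d dvd k}). vM d * w k)"
    by (rule sum.Sigma) auto
  also have "\<dots> = (\<Sum>(d, j)\<in>(SIGMA d:{0<..n}. {0<..n div d}). vM d * w (d * j))"
  proof (rule sum.reindex_bij_witness[where i = "\<lambda>(d, j). (d * j, d)" and j = "\<lambda>(k, d). (d, k div d)"])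
    fix a assume "a \<in> (SIGMA k:{0<..n}. {d. d dvd k})"
    then obtain k d where a: "a = (k, d)" "0 < k" "k \<le> n" "d dvd k" by auto
    then have d: "0 < d" "d \<le> n" "0 < k div d" "k div d \<le> n div d"
      by (auto intro: gr0I dvd_imp_le le_trans div_le_mono simp: dvd_div_eq_0_iff)
    then show "(case (case a of (k, d) \<Rightarrow> (d, k div d)) of (d, j) \<Rightarrow> (d * j, d)) = a"
      "(case a of (k, d) \<Rightarrow> (d, k div d)) \<in> (SIGMA d:{0<..n}. {0<..n div d})"
      "(case (case a of (k, d) \<Rightarrow> (d, k div d)) of (d, j) \<Rightarrow> vM d * w (d * j)) = (case a of (k, d) \<Rightarrow> vM d * w k)"
      using a by auto
  next
    fix b assume "b \<in> (SIGMA d:{0<..n}. {0<..n div d})"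
    then obtain d j where b: "b = (d, j)" "0 < d" "d \<le> n" "0 < j" "j \<le> n div d" by auto
    then have "d * j \<le> n" by (metis le_trans mult_le_mono2 times_div_less_eq_dividend)
    then show "(case (case b of (d, j) \<Rightarrow> (d * j, d)) of (k, d) \<Rightarrow> (d, k div d)) = b"
      "(case b of (d, j) \<Rightarrow> (d * j, d)) \<in> (SIGMA k:{0<..n}. {d. d dvd k})"
      using b by auto
  qed
  also have "\<dots> = (\<Sum>d\<in>{0<..n}. \<Sum>j\<in>{0<..n div d}. vM d * w (d * j))"
    by (rule sum.Sigma[symmetric]) auto
  finally show ?thesis by (simp add: sum_distrib_left)
qed

lemma sum_ln_vM: "(\<Sum>k\<in>{0<..n}. ln (real k)) = (\<Sum>d\<in>{0<..n}. vM d * real (n div d))"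
  using sum_divisors_swap[where w = "\<lambda>_. 1", of n] by simp

lemma ivl_0: "{0<..n} = {1..n::nat}" by auto

lemma mertens_vM:
  assumes "n \<ge> 1"
  shows "(\<Sum>d\<in>{0<..n}. vM d / real d) \<ge> ln (real n) - 1"
proof -
  have "real n * ln (real n) - real n \<le> (\<Sum>k\<in>{0<..n}. ln (real k))"
    using sum_ln_ge[of n] by (simp add: ivl_0)
  also have "\<dots> = (\<Sum>d\<in>{0<..n}. vM d * real (n div d))" by (rule sum_ln_vM)
  also have "\<dots> \<le> (\<Sum>d\<in>{0<..n}. real n * (vM d / real d))"
  proof (rule sum_mono)
    fix d assume "d \<in> {0<..n}"
    have "vM d * real (n div d) \<le> vM d * (real n / real d)"
      using of_nat_div_le_of_nat[of n d] by (intro mult_left_mono mangoldt_nonneg) auto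
    then show "vM d * real (n div d) \<le> real n * (vM d / real d)" by (simp add: mult.commute)
  qed
  also have "\<dots> = real n * (\<Sum>d\<in>{0<..n}. vM d / real d)" by (simp add: sum_distrib_left)
  finally have "real n * (ln (real n) - 1) \<le> real n * (\<Sum>d\<in>{0<..n}. vM d / real d)" by (simp add: algebra_simps)
  then show ?thesis using assms by simp
qed

definition psi_fn :: "nat \<Rightarrow> real" where "psi_fn n = (\<Sum>d\<in>{0<..n}. vM d)"

text \<open>Chebyshev: each d between n and 2 n contributes its full weight to the logarithm of the
  central binomial coefficient, all other d contribute nonnegatively, and the coefficient is at most
  4^n.\<close>

lemma psi_double: "psi_fn (2 * n) \<le> psi_fn n + 2 * real n * ln 2"
proof -
  have "ln (fact k :: real) = (\<Sum>j\<in>{0<..k}. ln (real j))" for k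
    unfolding fact_prod of_nat_prod ivl_0 by (subst ln_prod) auto
  then have lf: "ln (fact k :: real) = (\<Sum>d\<in>{0<..k}. vM d * real (k div d))" for k using sum_ln_vM by simp
  have "(2 * n choose n) \<le> 2 ^ (2 * n)" by (rule binomial_le_pow2)
  then have "real (2 * n choose n) \<le> 2 ^ (2 * n)" by (metis of_nat_le_iff of_nat_numeral of_nat_power)
  then have "ln (real (2 * n choose n)) \<le> ln (2 ^ (2 * n))" by (subst ln_le_cancel_iff) auto
  then have ub: "ln (real (2 * n choose n)) \<le> 2 * real n * ln 2" by (simp add: ln_realpow)
  have "fact n * fact (2 * n - n) * (2 * n choose n) = (fact (2 * n) :: nat)" by (rule binomial_fact_lemma) simp
  moreover have "2 * n - n = n" by simp
  ultimately have "(2 * n choose n) * (fact n * fact n) = (fact (2 * n) :: nat)" by (simp only: mult.commute)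
  then have "real ((2 * n choose n) * (fact n * fact n)) = real (fact (2 * n))" by (simp only:)
  then have "real (2 * n choose n) * (fact n * fact n) = fact (2 * n)" by (simp only: of_nat_mult of_nat_fact)
  then have "ln (fact (2 * n) :: real) = ln (real (2 * n choose n) * (fact n * fact n))" by simp
  also have "\<dots> = ln (real (2 * n choose n)) + 2 * ln (fact n)" by (simp add: ln_mult)
  finally have e: "ln (real (2 * n choose n)) = ln (fact (2 * n)) - 2 * ln (fact n :: real)" by simp
  have "ln (fact n :: real) = (\<Sum>d\<in>{0<..2 * n}. vM d * real (n div d))"
    unfolding lf by (rule sum.mono_neutral_left) auto
  then have "ln (real (2 * n choose n)) = (\<Sum>d\<in>{0<..2 * n}. vM d * (real (2 * n div d) - 2 * real (n div d)))"
    unfolding e lf[of "2 * n"] by (simp add: right_diff_distrib sum_subtractf sum_distrib_left mult_ac)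
  moreover have "(\<Sum>d\<in>{n<..2 * n}. vM d) \<le> (\<Sum>d\<in>{n<..2 * n}. vM d * (real (2 * n div d) - 2 * real (n div d)))"
  proof (rule sum_mono)
    fix d assume d: "d \<in> {n<..2 * n}"
    then have "n div d = 0" "2 * n div d \<ge> 1" by (auto simp: Suc_le_eq div_greater_zero_iff)
    then show "vM d \<le> vM d * (real (2 * n div d) - 2 * real (n div d))"
      using mangoldt_nonneg[of d] by (simp add: mult_le_cancel_left1)
  qed
  moreover have "(\<Sum>d\<in>{n<..2 * n}. vM d * (real (2 * n div d) - 2 * real (n div d)))
      \<le> (\<Sum>d\<in>{0<..2 * n}. vM d * (real (2 * n div d) - 2 * real (n div d)))"
  proof (rule sum_mono2)
    fix d
    have "2 * (n div d) \<le> 2 * n div d" 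
      by (cases "d = 0") (simp_all add: less_eq_div_iff_mult_less_eq mult.assoc)
    then have "real (2 * (n div d)) \<le> real (2 * n div d)" by (simp only: of_nat_le_iff)
    then show "0 \<le> vM d * (real (2 * n div d) - 2 * real (n div d))"
      by (intro mult_nonneg_nonneg mangoldt_nonneg) simp
  qed auto
  moreover have "psi_fn (2 * n) = psi_fn n + (\<Sum>d\<in>{n<..2 * n}. vM d)"
  proof -
    have "{0<..2 * n} = {0<..n} \<union> {n<..2 * n}" by auto
    then show ?thesis unfolding psi_fn_def by (simp add: sum.union_disjoint)
  qed
  ultimately show ?thesis using ub by linarith
qed

lemma psi_le: "psi_fn n \<le> 4 * real n"
proof (induction n rule: less_induct)
  case (less n)
  show ?case
  proof (cases "n = 0")
    case False
    define t where "t = n div 2"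
    have t: "t < n" using False by (simp add: t_def)
    have d: "psi_fn (2 * t) \<le> 4 * real t + 2 * real t * ln 2" using less[OF t] psi_double[of t] by simp
    have l2: "ln (2::real) \<le> 1" using ln2_le_25_over_36 by simp
    have "2 * real t * ln 2 \<le> 2 * real t * 1" using l2 by (intro mult_left_mono) auto
    then have d': "psi_fn (2 * t) \<le> 6 * real t" using d by simp
    consider "n = 2 * t" | "n = Suc (2 * t)" unfolding t_def by linarith
    then show ?thesis
    proof cases
      case 1 then show ?thesis using d' by simp
    next
      case 2
      have "psi_fn n = psi_fn (2 * t) + vM n" unfolding 2 psi_fn_def by (simp add: atLeastSucAtMost_greaterThanAtMost[symmetric])
      moreover have "vM n \<le> ln (real n)" using False by (intro mangoldt_le) simp
      moreover have "ln (real n) \<le> real n - 1" using False by (intro ln_le_minus_one) simp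
      ultimately show ?thesis using d' 2 by simp
    qed
  qed (simp add: psi_fn_def)
qed

text \<open>The sum of chi(k) log k / k equals the sum of chi(d) vM(d) / d times
  \<open>Lsum (n div d)\<close>. Replacing these partial sums by \<open>Lsum n\<close> costs at most
  psi(n) / n <= 4. The left side is at most 1 in absolute value, so the product with
  \<open>Lsum n\<close> is at most 5, and \<open>Lsum n >= 2/3\<close> gives 15/2.\<close>

lemma mertens_chi:
  assumes n: "n \<ge> 1"
  shows "\<bar>\<Sum>d\<in>{0<..n}. chi d * vM d / real d\<bar> \<le> 15 / 2"
proof -
  have "(\<Sum>k\<in>{0<..n}. ln (real k) * (chi k / real k)) =
      (\<Sum>d\<in>{0<..n}. vM d * (\<Sum>j\<in>{0<..n div d}. chi (d * j) / real (d * j)))"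
    by (rule sum_divisors_swap)
  also have "\<dots> = (\<Sum>d\<in>{0<..n}. chi d * vM d / real d * Lsum (n div d))"
    unfolding Lsum_def by (intro sum.cong refl) (simp add: chi_mult sum_distrib_left mult_ac)
  finally have 1: "(\<Sum>d\<in>{0<..n}. chi d * vM d / real d * Lsum (n div d)) = (\<Sum>k\<in>{0<..n}. chi k * (ln (real k) / real k))"
    by (simp add: mult_ac)
  define W where "W = (\<Sum>d\<in>{0<..n}. chi d * vM d / real d)"
  have "W * Lsum n = (\<Sum>d\<in>{0<..n}. chi d * vM d / real d * (Lsum n - Lsum (n div d))) + (\<Sum>d\<in>{0<..n}. chi d * vM d / real d * Lsum (n div d))"
    unfolding W_def by (simp add: sum_distrib_right right_diff_distrib sum_subtractf)
  moreover have "\<bar>\<Sum>d\<in>{0<..n}. chi d * vM d / real d * (Lsum n - Lsum (n div d))\<bar> \<le> (\<Sum>d\<in>{0<..n}. vM d / real n)"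
  proof (rule order_trans[OF sum_abs sum_mono])
    fix d assume d: "d \<in> {0<..n}"
    have "\<bar>Lsum n - Lsum (n div d)\<bar> \<le> 1 / real (Suc (n div d))" by (rule Lsum_diff) simp
    also have "\<dots> \<le> real d / real n"
    proof -
      have "n \<le> d * Suc (n div d)" using d by (metis dividend_less_times_div greaterThanAtMost_iff less_imp_le mult_Suc_right)
      then have "real n \<le> real (d * Suc (n div d))" by (simp only: of_nat_le_iff)
      then have "real n \<le> real d * real (Suc (n div d))" by (simp only: of_nat_mult)
      then show ?thesis using n by (simp add: field_simps del: of_nat_Suc)
    qed
    finally have l: "\<bar>Lsum n - Lsum (n div d)\<bar> \<le> real d / real n" .
    have "\<bar>chi d * vM d / real d\<bar> \<le> vM d / real d"
      using mangoldt_nonneg[of d] by (auto simp: chi_def)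
    then have "\<bar>chi d * vM d / real d\<bar> * \<bar>Lsum n - Lsum (n div d)\<bar> \<le> vM d / real d * (real d / real n)"
      using l by (intro mult_mono) (auto simp: mangoldt_nonneg)
    then show "\<bar>chi d * vM d / real d * (Lsum n - Lsum (n div d))\<bar> \<le> vM d / real n"
      using d by (simp add: abs_mult)
  qed
  moreover have "(\<Sum>d\<in>{0<..n}. vM d / real n) \<le> 4"
  proof -
    have "(\<Sum>d\<in>{0<..n}. vM d / real n) = psi_fn n / real n" by (simp add: psi_fn_def sum_divide_distrib)
    then show ?thesis using psi_le[of n] n by (simp add: divide_le_eq)
  qed
  ultimately have "\<bar>W * Lsum n\<bar> \<le> 5" using chi_ln_sum_bounded[of n] 1 by linarith
  then have "\<bar>W\<bar> * Lsum n \<le> 5" using Lsum_ge[OF n] by (simp add: abs_mult)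
  moreover have "\<bar>W\<bar> * (2 / 3) \<le> \<bar>W\<bar> * Lsum n" using Lsum_ge[OF n] by (intro mult_left_mono) auto
  ultimately show ?thesis unfolding W_def by simp
qed

text \<open>The geometric series over exponents from 2 on is at most 2 / p^2, and log p <= sqrt p
  leaves the telescoping majorant of 2 p^(-3/2).\<close>

lemma prime_power_sum_bounded:
  "(\<Sum>d | d \<in> {0<..n} \<and> \<not> prime d. vM d / real d) \<le> 4"
proof -
  define D where "D = {d. d \<in> {0<..n} \<and> \<not> prime d \<and> primepow d}"
  define Q where "Q = {p. prime p \<and> p \<le> n}"
  have finQ: "finite Q" by (rule finite_subset[of _ "{..n}"]) (auto simp: Q_def)
  define I where "I = (SIGMA p:Q. {2..n})"
  have finI: "finite I" unfolding I_def using finQ by auto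
  have "(\<Sum>d | d \<in> {0<..n} \<and> \<not> prime d. vM d / real d) = (\<Sum>d\<in>D. vM d / real d)"
    unfolding D_def by (rule sum.mono_neutral_right) (auto simp: mangoldt_def)
  also have "\<dots> \<le> (\<Sum>x\<in>I. ln (real (fst x)) / real (fst x) ^ snd x)"
  proof (rule sum_le_included[where i = "\<lambda>(p, j). p ^ j"])
    show "finite D" unfolding D_def by (rule finite_subset[of _ "{0<..n}"]) auto
    show "finite I" by (rule finI)
    show "\<forall>y\<in>I. 0 \<le> ln (real (fst y)) / real (fst y) ^ snd y"
      by (auto simp: I_def Q_def intro!: divide_nonneg_nonneg ln_prime_nonneg)
    show "\<forall>x\<in>D. \<exists>y\<in>I. (case y of (p, j) \<Rightarrow> p ^ j) = x \<and> vM x / real x \<le> ln (real (fst y)) / real (fst y) ^ snd y"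
    proof
      fix x assume x: "x \<in> D"
      then obtain p k where pk: "prime p" "k > 0" "x = p ^ k" unfolding D_def primepow_def by auto
      have "k \<noteq> 1" using x pk unfolding D_def by auto
      then have k2: "k \<ge> 2" using pk(2) by simp
      have p2: "p \<ge> 2" using pk(1) prime_ge_2_nat by blast
      have "p ^ k \<le> n" using x pk unfolding D_def by simp
      moreover have "p \<le> p ^ k" using pk p2 by (simp add: self_le_power)
      moreover have "k < p ^ k" using p2 by (intro power_gt_expt) simp
      ultimately have "(p, k) \<in> I" using pk k2 by (auto simp: I_def Q_def)
      then show "\<exists>y\<in>I. (case y of (p, j) \<Rightarrow> p ^ j) = x \<and> vM x / real x \<le> ln (real (fst y)) / real (fst y) ^ snd y"
        using pk by (intro bexI[of _ "(p, k)"]) auto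
    qed
  qed
  also have "\<dots> = (\<Sum>p\<in>Q. \<Sum>j=2..n. ln (real p) / real p ^ j)"
  proof -
    have "(\<Sum>x\<in>I. ln (real (fst x)) / real (fst x) ^ snd x) = (\<Sum>(p, j)\<in>I. ln (real p) / real p ^ j)"
      by (simp add: case_prod_unfold)
    also have "\<dots> = (\<Sum>p\<in>Q. \<Sum>j=2..n. ln (real p) / real p ^ j)"
      unfolding I_def by (rule sum.Sigma[symmetric]) (use finQ in auto)
    finally show ?thesis .
  qed
  also have "\<dots> \<le> (\<Sum>p\<in>Q. 2 * (1 / sqrt (real p - 1) - 1 / sqrt (real p + 1)))"
  proof (rule sum_mono)
    fix p assume "p \<in> Q"
    then have p2: "real p \<ge> 2" unfolding Q_def using prime_ge_2_nat by fastforce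
    have geo: "(\<Sum>j=2..n. 1 / real p ^ j) \<le> 2 / (real p)\<^sup>2"
    proof -
      have "(\<Sum>j=2..n. 1 / real p ^ j) \<le> 2 / (real p)\<^sup>2 - 1 / real p ^ n \<or> n < 2"
      proof (induction n)
        case (Suc m)
        show ?case
        proof (cases "m < 2")
          case True
          then consider "m = 0" | "m = 1" by linarith
          then show ?thesis by cases (auto simp: numeral_2_eq_2)
        next
          case False
          then have "(\<Sum>j=2..Suc m. 1 / real p ^ j) = (\<Sum>j=2..m. 1 / real p ^ j) + 1 / real p ^ Suc m" by simp
          moreover have "2 / real p ^ Suc m \<le> 1 / real p ^ m" using p2 by (simp add: field_simps)
          ultimately show ?thesis using Suc False by auto
        qed
      qed simp
      then show ?thesis
      proof
        assume "(\<Sum>j=2..n. 1 / real p ^ j) \<le> 2 / (real p)\<^sup>2 - 1 / real p ^ n"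
        moreover have "0 \<le> 1 / real p ^ n" by simp
        ultimately show ?thesis by linarith
      next
        assume "n < 2"
        then have "{2..n} = {}" by simp
        then show ?thesis by simp
      qed
    qed
    have "(\<Sum>j=2..n. ln (real p) / real p ^ j) = ln (real p) * (\<Sum>j=2..n. 1 / real p ^ j)" by (simp add: sum_distrib_left)
    also have "\<dots> \<le> sqrt (real p) * (2 / (real p)\<^sup>2)"
    proof (rule mult_mono)
      have "ln (real p) \<le> 0.74 * sqrt (real p)" using p2 by (intro ln_le_sqrt) simp
      also have "\<dots> \<le> sqrt (real p)" by simp
      finally show "ln (real p) \<le> sqrt (real p)" .
    qed (use geo in \<open>auto intro!: sum_nonneg\<close>)
    also have "\<dots> = 2 * (sqrt (real p) / (real p)\<^sup>2)" by simp
    also have "\<dots> \<le> 2 * (1 / sqrt (real p - 1) - 1 / sqrt (real p + 1))"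
      using p2 by (intro mult_left_mono inverse_power_three_halves) auto
    finally show "(\<Sum>j=2..n. ln (real p) / real p ^ j) \<le> 2 * (1 / sqrt (real p - 1) - 1 / sqrt (real p + 1))" .
  qed
  also have "\<dots> \<le> (\<Sum>p\<in>{2..n+2}. 2 * (1 / sqrt (real p - 1) - 1 / sqrt (real p + 1)))"
  proof (rule sum_mono2)
    show "Q \<subseteq> {2..n+2}" unfolding Q_def using prime_ge_2_nat by auto
    fix p assume "p \<in> {2..n+2} - Q"
    then have "real p \<ge> 2" by simp
    then show "0 \<le> 2 * (1 / sqrt (real p - 1) - 1 / sqrt (real p + 1))" by (simp add: frac_le)
  qed simp
  \<comment> \<open>The differences have step 2 but p runs through all integers, so two initial
    terms survive, 1 and 1 / sqrt 2.\<close>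
  also have "(\<Sum>p\<in>{2..n+2}. 2 * (1 / sqrt (real p - 1) - 1 / sqrt (real p + 1)))
     = 2 * (1 + 1 / sqrt 2 - 1 / sqrt (real n + 2) - 1 / sqrt (real n + 3))"
    by (induction n) (simp_all add: algebra_simps)
  also have "\<dots> \<le> 2 * (1 + 1)"
  proof -
    have "1 / sqrt 2 \<le> (1::real)" by simp
    moreover have "0 \<le> 1 / sqrt (real n + 2)" "0 \<le> 1 / sqrt (real n + 3)" by simp_all
    ultimately show ?thesis by (intro mult_left_mono) linarith+
  qed
  finally show ?thesis by simp
qed

text \<open>1 - chi is 2 on the class 3 and 0 on the class 1 modulo 4; the prime 2 and the proper
  prime powers are bounded. The losses 1, 15/2, 8 and 1 sum to less than 18 and are halved.\<close>

theorem mertens_3_mod_4: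
  assumes n: "n \<ge> 1"
  shows "(\<Sum>q | prime q \<and> q \<le> n \<and> q mod 4 = 3. ln (real q) / real q) \<ge> ln (real n) / 2 - 9"
proof -
  define P3 where "P3 = {q. prime q \<and> q \<le> n \<and> q mod 4 = 3}"
  define R where "R = {d. d \<in> {0<..n} \<and> \<not> prime d}"
  have fin: "finite P3" "finite R" unfolding P3_def R_def by (auto intro: finite_subset[of _ "{..n}"])
  have "ln (real n) - 1 - 15 / 2 \<le> (\<Sum>d\<in>{0<..n}. vM d / real d) - (\<Sum>d\<in>{0<..n}. chi d * vM d / real d)"
    using mertens_vM[OF n] mertens_chi[OF n] by linarith
  also have "\<dots> = (\<Sum>d\<in>{0<..n}. (1 - chi d) * (vM d / real d))"
    unfolding sum_subtractf[symmetric] by (intro sum.cong refl) (simp add: left_diff_distrib diff_divide_distrib)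
  also have "\<dots> \<le> (\<Sum>d\<in>P3 \<union> R \<union> {2}. (1 - chi d) * (vM d / real d))"
  proof -
    have "(\<Sum>d\<in>{0<..n}. (1 - chi d) * (vM d / real d)) = (\<Sum>d\<in>{0<..n} \<inter> (P3 \<union> R \<union> {2}). (1 - chi d) * (vM d / real d))"
    proof (rule sum.mono_neutral_right)
      show "\<forall>i\<in>{0<..n} - {0<..n} \<inter> (P3 \<union> R \<union> {2}). (1 - chi i) * (vM i / real i) = 0"
      proof
        fix i assume i: "i \<in> {0<..n} - {0<..n} \<inter> (P3 \<union> R \<union> {2})"
        then have "prime i" "i \<noteq> 2" "i mod 4 \<noteq> 3" unfolding P3_def R_def by auto
        then have "odd i" using prime_odd_nat[of i] prime_ge_2_nat[of i] by auto
        then have "i mod 4 = 1 \<or> i mod 4 = 3" by presburger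
        then show "(1 - chi i) * (vM i / real i) = 0" using \<open>i mod 4 \<noteq> 3\<close> by (simp add: chi_def)
      qed
    qed auto
    also have "\<dots> \<le> (\<Sum>d\<in>P3 \<union> R \<union> {2}. (1 - chi d) * (vM d / real d))"
      using fin by (intro sum_mono2) (auto simp: chi_def mangoldt_nonneg)
    finally show ?thesis .
  qed
  also have "\<dots> \<le> (\<Sum>d\<in>P3. (1 - chi d) * (vM d / real d)) + (\<Sum>d\<in>R. (1 - chi d) * (vM d / real d)) + (\<Sum>d\<in>{2}. (1 - chi d) * (vM d / real d))"
  proof -
    have nn: "0 \<le> (1 - chi d) * (vM d / real d)" for d by (auto simp: chi_def mangoldt_nonneg)
    have un: "(\<Sum>d\<in>A \<union> B. (1 - chi d) * (vM d / real d)) \<le> (\<Sum>d\<in>A. (1 - chi d) * (vM d / real d)) + (\<Sum>d\<in>B. (1 - chi d) * (vM d / real d))"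
      if "finite A" "finite B" for A B
    proof -
      have "0 \<le> (\<Sum>d\<in>A \<inter> B. (1 - chi d) * (vM d / real d))" by (intro sum_nonneg nn)
      then show ?thesis using sum.union_inter[OF that, of "\<lambda>d. (1 - chi d) * (vM d / real d)"] by linarith
    qed
    show ?thesis using un[of "P3 \<union> R" "{2}"] un[of P3 R] fin by simp
  qed
  also have "(\<Sum>d\<in>P3. (1 - chi d) * (vM d / real d)) = 2 * (\<Sum>q\<in>P3. ln (real q) / real q)"
    unfolding sum_distrib_left by (intro sum.cong refl) (auto simp: P3_def chi_def)
  also have "(\<Sum>d\<in>R. (1 - chi d) * (vM d / real d)) \<le> (\<Sum>d\<in>R. 2 * (vM d / real d))"
    by (intro sum_mono mult_right_mono) (auto simp: chi_def mangoldt_nonneg)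
  also have "\<dots> \<le> 2 * 4" using prime_power_sum_bounded[of n] unfolding R_def sum_distrib_left[symmetric] by simp
  also have "(\<Sum>d\<in>{2::nat}. (1 - chi d) * (vM d / real d)) \<le> 1"
    using ln2_le_25_over_36 mangoldt_prime[OF two_is_prime_nat, where 'a = real] by (simp add: chi_def)
  finally show ?thesis unfolding P3_def by simp
qed

subsection \<open>Infinitely many primes with squarefree predecessor\<close>

text \<open>Telescoping majorant for the modulus belonging to x = 2 i + 1, with 2 i = x - 1. The
  first term comes from 1 / (x^2 - 1), the second from x^(-3/2).\<close>

definition Ubd :: "nat \<Rightarrow> real" where
  "Ubd i = 3.09 / 8 / (2 * real i) + 0.381 / sqrt (2 * real i)"

lemma cr_ratio_bound:
  assumes i: "i \<ge> 1"
  shows "cr (2 * i + 1) / (4 * (real (2 * i + 1))\<^sup>2 - 1) \<le> Ubd i - Ubd (Suc i)"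
proof -
  define x where "x = real (2 * i + 1)"
  have x: "x \<ge> 3" using i by (simp add: x_def)
  have x2: "x\<^sup>2 \<ge> 9" using power_mono[of 3 x 2] x by simp
  have "ln (4 * x\<^sup>2) = 2 * ln 2 + 2 * ln x"
  proof -
    have "ln (4 * x\<^sup>2) = ln ((2 * x)\<^sup>2)" by (simp add: power_mult_distrib)
    also have "\<dots> = 2 * ln (2 * x)" using ln_realpow[of "2 * x" 2] x by simp
    finally show ?thesis using x by (simp add: ln_mult)
  qed
  moreover have "real (4 * (2 * i + 1)\<^sup>2) = 4 * x\<^sup>2" unfolding x_def by (simp only: of_nat_mult of_nat_power of_nat_numeral)
  ultimately have "cr (2 * i + 1) = 3 * ln 2 + 2 * ln x + ln x / (x - 1)"
    unfolding cr_def x_def[symmetric] by simp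
  \<comment> \<open>log 2 <= 25/36 and 3 * 25/36 + 1 < 3.09; the coefficient 1.48 is twice
    0.74.\<close>
  also have "\<dots> \<le> 3 * (25 / 36) + 2 * (0.74 * sqrt x) + 1"
  proof (intro add_mono mult_left_mono)
    show "ln x / (x - 1) \<le> 1" using x ln_le_minus_one[of x] by (simp add: divide_le_eq)
    show "ln x \<le> 0.74 * sqrt x" using x by (intro ln_le_sqrt) simp
  qed (use ln2_le_25_over_36 in auto)
  also have "\<dots> \<le> 3.09 + 1.48 * sqrt x" by simp
  finally have c: "cr (2 * i + 1) \<le> 3.09 + 1.48 * sqrt x" .
  have pos: "4 * x\<^sup>2 - 1 > 0" using x2 by simp
  have "cr (2 * i + 1) / (4 * x\<^sup>2 - 1) \<le> (3.09 + 1.48 * sqrt x) / (4 * x\<^sup>2 - 1)"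
    using c pos by (intro divide_right_mono) auto
  also have "\<dots> = 3.09 / (4 * x\<^sup>2 - 1) + 1.48 * sqrt x / (4 * x\<^sup>2 - 1)" by (simp add: add_divide_distrib)
  \<comment> \<open>From x = 3 on, 4 x^2 - 1 is at least 35/36 of 4 x^2; then 1.48 * 36 / 140 <
    0.381.\<close>
  also have "\<dots> \<le> 3.09 / (4 * (x\<^sup>2 - 1)) + 1.48 * sqrt x / (35 / 36 * 4 * x\<^sup>2)"
    using x x2 by (intro add_mono divide_left_mono) (auto intro!: mult_pos_pos)
  also have "3.09 / (4 * (x\<^sup>2 - 1)) = 3.09 / 8 * (1 / (x - 1) - 1 / (x + 1))"
  proof -
    have "1 / (x - 1) - 1 / (x + 1) = 2 / (x\<^sup>2 - 1)"
      using x by (simp add: diff_frac_eq power2_eq_square algebra_simps)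
    then show ?thesis by simp
  qed
  also have "1.48 * sqrt x / (35 / 36 * 4 * x\<^sup>2) = (1.48 * 36 / 140) * (sqrt x / x\<^sup>2)" using x by (simp add: field_simps)
  also have "\<dots> \<le> 0.381 * (sqrt x / x\<^sup>2)" using x by (intro mult_right_mono) auto
  also have "\<dots> \<le> 0.381 * (1 / sqrt (x - 1) - 1 / sqrt (x + 1))"
    using x by (intro mult_left_mono inverse_power_three_halves) auto
  finally have "cr (2 * i + 1) / (4 * x\<^sup>2 - 1) \<le> 3.09 / 8 * (1 / (x - 1) - 1 / (x + 1)) + 0.381 * (1 / sqrt (x - 1) - 1 / sqrt (x + 1))"
    by simp
  moreover have "x - 1 = 2 * real i" "x + 1 = 2 * real (Suc i)" by (simp_all add: x_def)
  ultimately show ?thesis unfolding x_def[symmetric] Ubd_def by (simp only:) (simp add: right_diff_distrib)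
qed

text \<open>Extended from odd primes to all odd r >= 3, the sum telescopes to at most
  \<open>Ubd 1\<close>, which is about 0.4626. What matters is that it stays below 1/2.\<close>

lemma sum_cr_bound: "(\<Sum>r | prime r \<and> odd r \<and> r \<le> R. cr r / (4 * (real r)\<^sup>2 - 1)) \<le> 0.463"
proof -
  define g where "g = (\<lambda>r. cr r / (4 * (real r)\<^sup>2 - 1))"
  have nn: "g r \<ge> 0" if "r \<ge> 3" for r
  proof -
    have "(real r)\<^sup>2 \<ge> 9" using power_mono[of 3 "real r" 2] that by simp
    then show ?thesis unfolding g_def using cr_nonneg[OF that] by simp
  qed
  have "(\<Sum>r | prime r \<and> odd r \<and> r \<le> R. g r) \<le> (\<Sum>r\<in>(\<lambda>i. 2 * i + 1) ` {1..R}. g r)"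
  proof (rule sum_mono2)
    show "{r. prime r \<and> odd r \<and> r \<le> R} \<subseteq> (\<lambda>i. 2 * i + 1) ` {1..R}"
    proof
      fix r assume "r \<in> {r. prime r \<and> odd r \<and> r \<le> R}"
      then have r: "prime r" "odd r" "r \<le> R" by auto
      then obtain i where i: "r = 2 * i + 1" by (elim oddE)
      then have "i \<ge> 1" using r(1) by (cases i) auto
      then show "r \<in> (\<lambda>i. 2 * i + 1) ` {1..R}" using i r(3) by auto
    qed
  qed (auto intro!: nn)
  also have "\<dots> = (\<Sum>i\<in>{1..R}. g (2 * i + 1))" by (subst sum.reindex) (auto simp: inj_on_def)
  also have "\<dots> \<le> (\<Sum>i\<in>{1..R}. Ubd i - Ubd (Suc i))"
    unfolding g_def by (intro sum_mono cr_ratio_bound) simp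
  also have "\<dots> = Ubd 1 - Ubd (Suc R)" by (induction R) (simp_all)
  also have "\<dots> \<le> Ubd 1"
  proof -
    have "0 \<le> Ubd (Suc R)" unfolding Ubd_def by (intro add_nonneg_nonneg divide_nonneg_nonneg) auto
    then show ?thesis by simp
  qed
  also have "\<dots> \<le> 0.463"
  proof -
    have "sqrt 2 \<ge> (1.414 :: real)" by (intro real_le_rsqrt) (simp add: power2_eq_square)
    then have "0.381 / sqrt 2 \<le> (0.381 / 1.414 :: real)" by (intro divide_left_mono) auto
    then show ?thesis unfolding Ubd_def by simp
  qed
  finally show ?thesis unfolding g_def .
qed

lemma sum_UN_le:
  fixes g :: "'a \<Rightarrow> real"
  assumes "finite I" "\<And>i. i \<in> I \<Longrightarrow> finite (B i)" "\<And>x. g x \<ge> 0"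
  shows "(\<Sum>x\<in>(\<Union>i\<in>I. B i). g x) \<le> (\<Sum>i\<in>I. \<Sum>x\<in>B i. g x)"
  using assms(1,2)
proof (induction I)
  case (insert i I)
  have fin: "finite (B i)" "finite (\<Union>j\<in>I. B j)" using insert by auto
  have "0 \<le> (\<Sum>x\<in>B i \<inter> (\<Union>j\<in>I. B j). g x)" by (intro sum_nonneg assms)
  then have "(\<Sum>x\<in>B i \<union> (\<Union>j\<in>I. B j). g x) \<le> (\<Sum>x\<in>B i. g x) + (\<Sum>x\<in>(\<Union>j\<in>I. B j). g x)"
    using sum.union_inter[OF fin, of g] by linarith
  moreover have "(\<Sum>x\<in>(\<Union>j\<in>I. B j). g x) \<le> (\<Sum>j\<in>I. \<Sum>x\<in>B j. g x)"
    by (rule insert.IH) (use insert.prems in auto)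
  ultimately show ?case using insert.hyps by simp
qed simp

lemma ln_nat_nonneg: "ln (real n) \<ge> 0"
  by (cases "n = 0") auto

text \<open>By the Chinese remainder theorem all these primes lie in a single class modulo 4 r^2,
  named by any one of them.\<close>

lemma theta_square_progression:
  assumes r: "prime r" "odd r" and x: "x \<ge> 1"
  shows "theta (\<lambda>q. q mod 4 = 3 \<and> r\<^sup>2 dvd q - 1) x \<le>
    cr r * real x / (4 * (real r)\<^sup>2 - 1) + (1 + 2 * ln (real x)) * (1 + ln (real x))"
proof (cases "\<exists>q. prime q \<and> q mod 4 = 3 \<and> r\<^sup>2 dvd q - 1")
  case True
  then obtain q0 where q0: "prime q0" "q0 mod 4 = 3" "r\<^sup>2 dvd q0 - 1" by blast
  define m where "m = 4 * r\<^sup>2"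
  have r0: "r > 0" using r prime_gt_0_nat by blast
  have "theta (\<lambda>q. q mod 4 = 3 \<and> r\<^sup>2 dvd q - 1) x \<le> theta (\<lambda>q. q mod m = q0 mod m) x"
  proof (rule theta_mono)
    fix q assume q: "prime q" "q \<le> x" "q mod 4 = 3 \<and> r\<^sup>2 dvd q - 1"
    have "[q = q0] (mod 4)" using q q0 by (simp add: cong_def)
    moreover have "[q = q0] (mod r\<^sup>2)"
    proof -
      have "[w = 1] (mod r\<^sup>2)" if w: "prime w" "r\<^sup>2 dvd w - 1" for w :: nat
      proof -
        obtain k where "w - 1 = r\<^sup>2 * k" using w(2) by (rule dvdE)
        then have "w = 1 + r\<^sup>2 * k" using prime_gt_0_nat[OF w(1)] by simp
        then show ?thesis by (simp only: cong_def mod_mult_self2)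
      qed
      then show ?thesis using q q0 cong_sym cong_trans by blast
    qed
    moreover have "coprime (4::nat) (r\<^sup>2)"
    proof -
      have "coprime (2::nat) r" using r(2) by simp
      then have "coprime ((2::nat)\<^sup>2) (r\<^sup>2)" by (simp only: coprime_power_left_iff coprime_power_right_iff simp_thms)
      moreover have "(2::nat)\<^sup>2 = 4" by simp
      ultimately show ?thesis by (simp only:)
    qed
    ultimately have "[q = q0] (mod m)" unfolding m_def by (rule coprime_cong_mult_nat)
    then show "q mod m = q0 mod m \<and> q \<le> x" using q by (simp add: cong_def)
  qed
  also have "\<dots> \<le> cr r * real x / (real m - 1) + (1 + 2 * ln (real x)) * (1 + ln (real x))"
    using r0 by (intro theta_progression[OF r m_def _ x]) (simp add: m_def)
  finally show ?thesis by (simp add: m_def)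
next
  case False
  then have "theta (\<lambda>q. q mod 4 = 3 \<and> r\<^sup>2 dvd q - 1) x = 0" unfolding theta_def by (intro sum.neutral) auto
  moreover have r3: "r \<ge> 3" using r prime_ge_2_nat[of r] by (cases "r = 2") auto
  moreover have "(real r)\<^sup>2 \<ge> 9" using power_mono[of 3 "real r" 2] r3 by simp
  ultimately show ?thesis using cr_nonneg[OF r3] ln_nat_nonneg[of x] by (auto intro!: add_nonneg_nonneg mult_nonneg_nonneg divide_nonneg_nonneg)
qed

text \<open>A plain count of integers, meant for large \<open>r\<close>, where the error terms of
  the progression bound would add up to too much.\<close>

lemma theta_square_trivial:
  assumes r: "r \<ge> 1" and x: "x \<ge> 1"
  shows "theta (\<lambda>q. r\<^sup>2 dvd q - 1) x \<le> real x * ln (real x) * (1 / (real r)\<^sup>2)"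
proof -
  have "theta (\<lambda>q. r\<^sup>2 dvd q - 1) x \<le> real (x div r\<^sup>2) * ln (real x)"
  proof (rule theta_card_bound[where g = "\<lambda>k. 1 + r\<^sup>2 * k"])
    show "{q. prime q \<and> q \<le> x \<and> r\<^sup>2 dvd q - 1} \<subseteq> (\<lambda>k. 1 + r\<^sup>2 * k) ` {1..x div r\<^sup>2}"
    proof
      fix q assume "q \<in> {q. prime q \<and> q \<le> x \<and> r\<^sup>2 dvd q - 1}"
      then have q: "prime q" "q \<le> x" "r\<^sup>2 dvd q - 1" by auto
      then obtain k where k: "q - 1 = r\<^sup>2 * k" by (elim dvdE)
      have q2: "q \<ge> 2" using q(1) prime_ge_2_nat by blast
      then have "k \<ge> 1" using k by (cases k) auto
      moreover have "k \<le> x div r\<^sup>2" using k q(2) r by (simp add: less_eq_div_iff_mult_less_eq mult.commute)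
      moreover have "q = 1 + r\<^sup>2 * k" using k q2 by simp
      ultimately show "q \<in> (\<lambda>k. 1 + r\<^sup>2 * k) ` {1..x div r\<^sup>2}" by auto
    qed
  qed (rule x)
  also have "\<dots> \<le> real x / real (r\<^sup>2) * ln (real x)"
    by (intro mult_right_mono of_nat_div_le_of_nat ln_nat_nonneg)
  finally show ?thesis by (simp add: mult_ac)
qed

lemma sum_inverse_squares_tail:
  assumes "R \<ge> 1" shows "(\<Sum>r\<in>{R<..x}. 1 / (real r)\<^sup>2) \<le> 1 / real R"
proof (cases "R \<le> x")
  case True
  then have "(\<Sum>r\<in>{R<..x}. 1 / (real r)\<^sup>2) \<le> 1 / real R - 1 / real x"
  proof (induction x rule: dec_induct)
    case (step x)
    have x: "real x > 0" using step assms by simp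
    have "{R<..Suc x} = insert (Suc x) {R<..x}" using step by auto
    then have "(\<Sum>r\<in>{R<..Suc x}. 1 / (real r)\<^sup>2) \<le> 1 / real R - 1 / real x + 1 / (real x + 1)\<^sup>2"
      using step.IH by (simp add: add.commute)
    moreover have "1 / (real x + 1)\<^sup>2 \<le> 1 / real x - 1 / (real x + 1)"
    proof -
      have "real x * (real x + 1) \<le> (real x + 1)\<^sup>2" using x by (simp add: power2_eq_square algebra_simps)
      then have "1 / (real x + 1)\<^sup>2 \<le> 1 / (real x * (real x + 1))" using x by (intro frac_le) auto
      also have "\<dots> = 1 / real x - 1 / (real x + 1)" using x by (simp add: diff_frac_eq)
      finally show ?thesis .
    qed
    ultimately show ?case by (simp add: add.commute)
  qed simp
  moreover have "0 \<le> 1 / real x" by simp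
  ultimately show ?thesis by linarith
qed simp

text \<open>A prime of the class outside \<open>Lambda\<close> is 1 modulo the square of an odd
  prime r. For r up to \<open>R\<close> the progression bound is used, with one error term for each
  r; beyond \<open>R\<close> the trivial count is used, and the tail of the inverse squares is at
  most 1 / R.\<close>

lemma theta3_bound:
  assumes fin: "finite Lambda" and x: "x \<ge> 1" and R: "R \<ge> 1"
  shows "theta (\<lambda>q. q mod 4 = 3) x \<le> (\<Sum>q\<in>Lambda. ln (real q)) + 0.463 * real x
    + real R * ((1 + 2 * ln (real x)) * (1 + ln (real x))) + real x * ln (real x) / real R"
proof -
  define P where "P = {r. prime r \<and> odd r \<and> r \<le> R}"
  define B where "B = (\<lambda>r. {q. prime q \<and> q \<le> x \<and> (q mod 4 = 3 \<and> r\<^sup>2 dvd q - 1)})"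
  define D where "D = (\<lambda>r. {q. prime q \<and> q \<le> x \<and> (r\<^sup>2 dvd q - 1)})"
  have finP: "finite P" unfolding P_def by (rule finite_subset[of _ "{..R}"]) auto
  have fB: "finite (B r)" "finite (D r)" for r unfolding B_def D_def by (auto intro: finite_theta)
  have cov: "{q. prime q \<and> q \<le> x \<and> q mod 4 = 3} \<subseteq> Lambda \<union> (\<Union>r\<in>P. B r) \<union> (\<Union>r\<in>{R<..x}. D r)"
  proof
    fix q assume "q \<in> {q. prime q \<and> q \<le> x \<and> q mod 4 = 3}"
    then have q: "prime q" "q \<le> x" "q mod 4 = 3" by auto
    show "q \<in> Lambda \<union> (\<Union>r\<in>P. B r) \<union> (\<Union>r\<in>{R<..x}. D r)"
    proof (cases "q \<in> Lambda")
      case False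
      then obtain y where y: "y\<^sup>2 dvd q - 1" "\<not> is_unit y" using q unfolding Lambda_def squarefree_def by auto
      have q2: "q \<ge> 2" using q(1) prime_ge_2_nat by blast
      have "y \<noteq> 1" using y(2) by auto
      then obtain r where r: "prime r" "r dvd y" using prime_factor_nat by blast
      have rd: "r\<^sup>2 dvd q - 1" using y(1) r(2) by (meson dvd_power_same dvd_trans)
      have "r \<noteq> 2"
      proof
        assume "r = 2"
        then have "4 dvd q - 1" using rd by simp
        then show False using q(3) q2 by presburger
      qed
      then have "odd r" using r(1) prime_odd_nat[of r] prime_ge_2_nat[of r] by auto
      have "r \<le> r\<^sup>2" by (simp add: power2_eq_square)
      also have "r\<^sup>2 \<le> q - 1" using rd q2 by (intro dvd_imp_le) auto
      finally have "r \<le> x" using q(2) by simp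
      show ?thesis
      proof (cases "r \<le> R")
        case True
        then have "r \<in> P" using r \<open>odd r\<close> by (simp add: P_def)
        moreover have "q \<in> B r" using q rd by (simp add: B_def)
        ultimately show ?thesis by blast
      next
        case False
        then have "r \<in> {R<..x}" using \<open>r \<le> x\<close> by simp
        moreover have "q \<in> D r" using q rd by (simp add: D_def)
        ultimately show ?thesis by blast
      qed
    qed blast
  qed
  have "theta (\<lambda>q. q mod 4 = 3) x \<le> (\<Sum>q\<in>Lambda \<union> (\<Union>r\<in>P. B r) \<union> (\<Union>r\<in>{R<..x}. D r). ln (real q))"
    unfolding theta_def using fin finP fB cov by (intro sum_mono2) (auto intro: ln_nat_nonneg)
  also have "\<dots> \<le> (\<Sum>q\<in>Lambda. ln (real q)) + (\<Sum>q\<in>(\<Union>r\<in>P. B r). ln (real q)) + (\<Sum>q\<in>(\<Union>r\<in>{R<..x}. D r). ln (real q))"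
  proof -
    have un: "(\<Sum>q\<in>U \<union> V. ln (real q)) \<le> (\<Sum>q\<in>U. ln (real q)) + (\<Sum>q\<in>V. ln (real q))" if "finite U" "finite V" for U V :: "nat set"
    proof -
      have "0 \<le> (\<Sum>q\<in>U \<inter> V. ln (real q))" by (intro sum_nonneg ln_nat_nonneg)
      then show ?thesis using sum.union_inter[OF that, of "\<lambda>q. ln (real q)"] by linarith
    qed
    have f: "finite (\<Union>r\<in>P. B r)" "finite (\<Union>r\<in>{R<..x}. D r)" using finP fB by auto
    show ?thesis using un[of "Lambda \<union> (\<Union>r\<in>P. B r)" "\<Union>r\<in>{R<..x}. D r"] un[of Lambda "\<Union>r\<in>P. B r"] fin f by simp
  qed
  also have "(\<Sum>q\<in>(\<Union>r\<in>P. B r). ln (real q)) \<le> (\<Sum>r\<in>P. \<Sum>q\<in>B r. ln (real q))"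
    by (intro sum_UN_le finP fB ln_nat_nonneg)
  also have "\<dots> \<le> (\<Sum>r\<in>P. cr r * real x / (4 * (real r)\<^sup>2 - 1) + (1 + 2 * ln (real x)) * (1 + ln (real x)))"
  proof (rule sum_mono)
    fix r assume "r \<in> P"
    then have r: "prime r" "odd r" by (simp_all add: P_def)
    show "(\<Sum>q\<in>B r. ln (real q)) \<le> cr r * real x / (4 * (real r)\<^sup>2 - 1) + (1 + 2 * ln (real x)) * (1 + ln (real x))"
      using theta_square_progression[OF r x] unfolding theta_def B_def .
  qed
  also have "\<dots> = (\<Sum>r\<in>P. cr r / (4 * (real r)\<^sup>2 - 1)) * real x + real (card P) * ((1 + 2 * ln (real x)) * (1 + ln (real x)))"
    by (simp add: sum.distrib sum_distrib_right)
  also have "(\<Sum>r\<in>P. cr r / (4 * (real r)\<^sup>2 - 1)) * real x \<le> 0.463 * real x"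
    unfolding P_def by (intro mult_right_mono sum_cr_bound) simp
  also have "real (card P) * ((1 + 2 * ln (real x)) * (1 + ln (real x))) \<le> real R * ((1 + 2 * ln (real x)) * (1 + ln (real x)))"
  proof (rule mult_right_mono)
    have "card P \<le> card {1..R}" unfolding P_def using prime_gt_0_nat by (intro card_mono) (auto simp: Suc_le_eq)
    then show "real (card P) \<le> real R" by simp
    show "0 \<le> (1 + 2 * ln (real x)) * (1 + ln (real x))" using ln_nat_nonneg[of x] by simp
  qed
  also have "(\<Sum>q\<in>(\<Union>r\<in>{R<..x}. D r). ln (real q)) \<le> (\<Sum>r\<in>{R<..x}. \<Sum>q\<in>D r. ln (real q))"
    by (intro sum_UN_le fB ln_nat_nonneg) simp
  also have "\<dots> \<le> (\<Sum>r\<in>{R<..x}. real x * ln (real x) * (1 / (real r)\<^sup>2))"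
  proof (rule sum_mono)
    fix r assume "r \<in> {R<..x}"
    then show "(\<Sum>q\<in>D r. ln (real q)) \<le> real x * ln (real x) * (1 / (real r)\<^sup>2)"
      using theta_square_trivial[of r x] x unfolding theta_def D_def by simp
  qed
  also have "\<dots> = real x * ln (real x) * (\<Sum>r\<in>{R<..x}. 1 / (real r)\<^sup>2)" by (simp only: sum_distrib_left)
  also have "\<dots> \<le> real x * ln (real x) * (1 / real R)"
    by (intro mult_left_mono sum_inverse_squares_tail R mult_nonneg_nonneg ln_nat_nonneg) simp
  finally show ?thesis by simp
qed

lemma theta3_linear:
  assumes fin: "finite Lambda"
  shows "\<exists>K\<ge>0. \<forall>x\<ge>1. theta (\<lambda>q. q mod 4 = 3) x \<le> 0.47 * real x + K"
proof -
  define C0 where "C0 = (\<Sum>q\<in>Lambda. ln (real q))"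
  have "eventually (\<lambda>x::real. C0 + 0.463 * x + ((ln x)\<^sup>2 + 1) * ((1 + 2 * ln x) * (1 + ln x)) + x / ln x \<le> 0.47 * x) at_top"
    by real_asymp
  then obtain x0 where Xb: "\<And>x::real. x \<ge> x0 \<Longrightarrow> C0 + 0.463 * x + ((ln x)\<^sup>2 + 1) * ((1 + 2 * ln x) * (1 + ln x)) + x / ln x \<le> 0.47 * x"
    unfolding eventually_at_top_linorder by blast
  define M where "M = max 3 (nat \<lceil>x0\<rceil>)"
  have big: "theta (\<lambda>q. q mod 4 = 3) x \<le> 0.47 * real x" if "x \<ge> M" for x
  proof -
    have x3: "x \<ge> 3" and xX: "real x \<ge> x0" using that unfolding M_def by linarith+
    have "exp 1 \<le> real x" using e_less_272 x3 by simp
    then have l1: "1 \<le> ln (real x)" using x3 by (simp add: ln_ge_iff)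
    \<comment> \<open>Of order log^2 x: the progression errors stay polylogarithmic, and the trivial
      part shrinks to x / log x.\<close>
    define R where "R = nat \<lceil>(ln (real x))\<^sup>2\<rceil>"
    have sq1: "1 \<le> (ln (real x))\<^sup>2" using power_mono[of 1 "ln (real x)" 2] l1 by simp
    have R1: "(ln (real x))\<^sup>2 \<le> real R" "real R \<le> (ln (real x))\<^sup>2 + 1" unfolding R_def using sq1 by linarith+
    have R: "R \<ge> 1" using R1 sq1 by linarith
    have "theta (\<lambda>q. q mod 4 = 3) x \<le> C0 + 0.463 * real x
      + real R * ((1 + 2 * ln (real x)) * (1 + ln (real x))) + real x * ln (real x) / real R"
      unfolding C0_def using x3 by (intro theta3_bound[OF fin _ R]) simp
    also have "real R * ((1 + 2 * ln (real x)) * (1 + ln (real x))) \<le> ((ln (real x))\<^sup>2 + 1) * ((1 + 2 * ln (real x)) * (1 + ln (real x)))"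
      using R1 l1 by (intro mult_right_mono) auto
    also have "real x * ln (real x) / real R \<le> real x * ln (real x) / (ln (real x))\<^sup>2"
      using R1 sq1 l1 R by (intro divide_left_mono) (auto intro!: mult_pos_pos)
    also have "\<dots> = real x / ln (real x)" using l1 by (simp add: power2_eq_square)
    finally show ?thesis using Xb[OF xX] by linarith
  qed
  \<comment> \<open>Covers the finitely many x below the asymptotic range.\<close>
  define K where "K = (\<Sum>x\<le>M. theta (\<lambda>q. q mod 4 = 3) x)"
  have K0: "K \<ge> 0" unfolding K_def by (intro sum_nonneg theta_nonneg)
  have "theta (\<lambda>q. q mod 4 = 3) x \<le> 0.47 * real x + K" for x
  proof (cases "x \<ge> M")
    case True then show ?thesis using big[OF True] K0 by linarith
  next
    case False
    then have "theta (\<lambda>q. q mod 4 = 3) x \<le> K" unfolding K_def by (intro member_le_sum) (auto simp: theta_nonneg)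
    then show ?thesis by simp
  qed
  then show ?thesis using K0 by blast
qed

text \<open>Partial summation, which turns a linear bound on \<open>theta\<close> into a logarithmic
  bound on the Mertens sum with the same leading constant.\<close>

lemma theta_abel:
  "(\<Sum>q | prime q \<and> q \<le> n \<and> P q. ln (real q) / real q) =
    (\<Sum>k=1..n. theta P k / (real k * (real k + 1))) + theta P n / (real n + 1)"
proof (induction n)
  case 0
  have "{q::nat. prime q \<and> q \<le> 0 \<and> P q} = {}" by auto
  then show ?case unfolding theta_def by simp
next
  case (Suc n)
  define w where "w = (if prime (Suc n) \<and> P (Suc n) then ln (real (Suc n)) else 0)"
  have s: "{q. prime q \<and> q \<le> Suc n \<and> P q} = {q. prime q \<and> q \<le> n \<and> P q} \<union> (if prime (Suc n) \<and> P (Suc n) then {Suc n} else {})"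
    by (auto simp: le_Suc_eq)
  have t: "theta P (Suc n) = theta P n + w"
    unfolding theta_def s w_def by (auto simp: sum.union_disjoint)
  have "(\<Sum>q | prime q \<and> q \<le> Suc n \<and> P q. ln (real q) / real q) = (\<Sum>q | prime q \<and> q \<le> n \<and> P q. ln (real q) / real q) + w / real (Suc n)"
    unfolding s w_def by (auto simp: sum.union_disjoint)
  also have "\<dots> = (\<Sum>k=1..n. theta P k / (real k * (real k + 1))) + theta P (Suc n) / (real n + 1)"
    unfolding Suc.IH t by (simp add: add_divide_distrib add.commute)
  also have "theta P (Suc n) / (real n + 1) = theta P (Suc n) / ((real n + 1) * (real n + 2)) + theta P (Suc n) / (real n + 2)"
  proof -
    have e: "t / a = t / (a * (a + 1)) + t / (a + 1)" if "a > 0" for a t :: real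
    proof -
      have "t / (a * (a + 1)) + t * a / (a * (a + 1)) = t * (a + 1) / (a * (a + 1))"
        unfolding add_divide_distrib[symmetric] by (simp add: algebra_simps)
      then show ?thesis using that by simp
    qed
    have "real n + 1 + 1 = real n + 2" by simp
    then show ?thesis using e[of "real n + 1" "theta P (Suc n)"] by (simp only:)
  qed
  finally show ?case by (simp add: add_ac)
qed

theorem infinite_Lambda: "infinite Lambda"
proof
  assume fin: "finite Lambda"
  obtain K where K: "K \<ge> 0" "\<And>x. x \<ge> 1 \<Longrightarrow> theta (\<lambda>q. q mod 4 = 3) x \<le> 0.47 * real x + K"
    using theta3_linear[OF fin] by blast
  have le: "ln (real n) / 2 - 9 \<le> 0.47 * (1 + ln (real n)) + K + 0.47 + K" if n: "n \<ge> 1" for n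
  proof -
    define g where "g = (\<lambda>k. theta (\<lambda>q. q mod 4 = 3) k)"
    have "ln (real n) / 2 - 9 \<le> (\<Sum>k=1..n. g k / (real k * (real k + 1))) + g n / (real n + 1)"
      using mertens_3_mod_4[OF n] unfolding theta_abel g_def .
    also have "(\<Sum>k=1..n. g k / (real k * (real k + 1))) \<le> (\<Sum>k=1..n. 0.47 * (1 / real k) + K * (1 / real k - 1 / (real k + 1)))"
    proof (rule sum_mono)
      fix k assume k: "k \<in> {1..n}"
      have k0: "real k > 0" using k by simp
      have "g k / (real k * (real k + 1)) \<le> (0.47 * real k + K) / (real k * (real k + 1))"
      proof (rule divide_right_mono)
        have "k \<ge> 1" using k by simp
        then show "g k \<le> 0.47 * real k + K" unfolding g_def by (rule K(2))
      qed simp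
      also have "\<dots> = 0.47 * (real k / (real k * (real k + 1))) + K * (1 / (real k * (real k + 1)))"
        by (simp only: add_divide_distrib times_divide_eq_right mult_1_right)
      also have "1 / (real k * (real k + 1)) = 1 / real k - 1 / (real k + 1)" using k0 by (simp add: diff_frac_eq)
      also have "real k / (real k * (real k + 1)) = 1 / (real k + 1)" using k0 by simp
      also have "0.47 * (1 / (real k + 1)) \<le> 0.47 * (1 / real k)" using k0 by (intro mult_left_mono) (auto simp: frac_le)
      finally show "g k / (real k * (real k + 1)) \<le> 0.47 * (1 / real k) + K * (1 / real k - 1 / (real k + 1))" by simp
    qed
    also have "\<dots> = 0.47 * (\<Sum>k=1..n. 1 / real k) + K * (\<Sum>k=1..n. 1 / real k - 1 / (real k + 1))"
      by (simp only: sum.distrib sum_distrib_left)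
    also have "(\<Sum>k=1..n. 1 / real k - 1 / (real k + 1)) = 1 - 1 / (real n + 1)"
      by (induction n) (simp_all add: add.commute)
    also have "0.47 * (\<Sum>k=1..n. 1 / real k) \<le> 0.47 * (1 + ln (real n))"
      using n by (intro mult_left_mono sum_inverse_le) auto
    also have "K * (1 - 1 / (real n + 1)) \<le> K * 1" using K(1) by (intro mult_left_mono) auto
    also have "g n / (real n + 1) \<le> 0.47 + K"
    proof -
      have "g n \<le> 0.47 * real n + K" using K(2)[OF n] by (simp add: g_def)
      moreover have e: "(c + K) * (real n + 1) = c * real n + K + (c + K * real n)" for c :: real
        by (simp add: algebra_simps)
      have inc: "u \<le> a \<Longrightarrow> 0 \<le> d \<Longrightarrow> 0 \<le> c \<Longrightarrow> u \<le> a + (c + d)" for u a c d :: real by linarith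
      have "0 \<le> K * real n" using K(1) by simp
      moreover have "0 \<le> (0.47 :: real)" by simp
      ultimately have "g n \<le> (0.47 + K) * (real n + 1)" unfolding e by (rule inc)
      then show ?thesis by (simp add: divide_le_eq)
    qed
    finally show ?thesis by simp
  qed
  \<comment> \<open>The comparison of 1/2 with 0.47 leaves 0.03 log n <= 9.94 + 2 K, which fails
    from here on.\<close>
  define y where "y = (12 + 2 * K) / 0.03"
  define n where "n = nat \<lceil>exp y\<rceil>"
  have en: "exp y \<le> real n" unfolding n_def by linarith
  have "exp y > 0" by simp
  then have "n \<ge> 1" using en by linarith
  then have "y \<le> ln (real n)" using en by (simp add: ln_ge_iff)
  then have "12 + 2 * K \<le> 0.03 * ln (real n)" unfolding y_def by (simp add: field_simps)
  moreover have "(0.47 :: real) = 47 / 100" "(0.03 :: real) = 3 / 100" by simp_all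
  ultimately show False using le[OF \<open>n \<ge> 1\<close>] by (simp only:) argo
qed

theorem theorem3p3:
  fixes S :: "nat set"
  assumes "\<forall>p\<in>S. prime p"
  shows "(\<exists>L. realisation_over_Q L G_Lambda G_Lambda_topology \<and>
              (\<forall>p. prime p \<longrightarrow> unbounded_local_degrees L p)) \<and>
         (\<exists>L. realisation_over_Q L G_Lambda G_Lambda_topology \<and>
              (\<forall>p\<in>S. bounded_local_degrees L p))"
proof
  obtain \<psi> where c: "cyc_data (\<lambda>q. q) \<psi> (\<lambda>_. monom 1 1)" using cyc_data_roots_of_unity ..
  interpret cyc_data "\<lambda>q. q" \<psi> "\<lambda>_. monom 1 1" by (rule c)
  have "zeta q \<in> Lf" if q: "q \<in> Lambda" for q
  proof -
    have "A q 0 = zeta q"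
      using A_0[OF q] block.conj_psi[OF blk[OF q], of 1] unfolding A_def by simp
    then show ?thesis using A0_Lf[OF q] by simp
  qed
  then have "Lambda \<subseteq> {q. prime q \<and> zeta q \<in> Lf}" unfolding Lambda_def by blast
  then have "infinite {q. prime q \<and> zeta q \<in> Lf}" using infinite_Lambda infinite_super by blast
  then have "\<forall>p. prime p \<longrightarrow> unbounded_local_degrees Lf p" using unbounded_if_roots_of_unity[OF _ Lf] by blast
  then show "\<exists>L. realisation_over_Q L G_Lambda G_Lambda_topology \<and> (\<forall>p. prime p \<longrightarrow> unbounded_local_degrees L p)"
    using realisation by blast
next
  obtain N \<psi> f where c: "cyc_data N \<psi> f"
    and fin: "\<forall>p. prime p \<longrightarrow> finite {q \<in> Lambda. p dvd N q \<or> \<psi> q p \<noteq> 0}" using cyc_data_almost_split by blast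
  interpret cyc_data N \<psi> f by (rule c)
  have "\<forall>p\<in>S. bounded_local_degrees Lf p" using bounded_if_almost_split assms fin by blast
  then show "\<exists>L. realisation_over_Q L G_Lambda G_Lambda_topology \<and> (\<forall>p\<in>S. bounded_local_degrees L p)"
    using realisation by blast
qed


end
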